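(* Let $N\ge 1$ be an integer and let $(a_n)$ and $(b_n)$ be $N$-periodically modulated Jacobi parameters, with associated $N$-periodic sequences $(\alpha_n)$ and $(\beta_n)$. Suppose that there is an integer $r\ge1$ such that for every $i\in\{0,1,\ldots,N-1\}$, $$\Big(\frac{a_{kN+i-1}}{a_{kN+i}} : k\in\mathbb{N}\Big),\ \Big(\frac{b_{kN+i}}{a_{kN+i}} : k\in\mathbb{N}\Big),\ \Big(\frac{1}{a_{kN+i}} : k\in\mathbb{N}\Big) \in \mathcal{D}_r,$$ and that the Carleman condition $\sum_{n=0}^\infty \frac{1}{a_n}=\infty$ is satisfied. If $|\operatorname{tr}\mathfrak{X}_0(0)|<2$, then $$\frac{1}{\rho_n}K_n(x,x) = \frac{\omega'(0)}{\mu'(x)} + E_n(x), \qquad\text{where}\qquad \lim_{n\to\infty}|E_n(x)|=0$$ locally uniformly with respect to $x\in\mathbb{R}$, where $\omega$ is the equilibrium measure of $\{x\in\mathbb{R} : |\operatorname{tr}\mathfrak{X}_0(x)|\le 2\}$ and $\rho_n=\sum_{j=0}^n\frac{\alpha_j}{a_j}$.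
   Context: $(a_n)_{n\ge 0}$ is a sequence of positive numbers and $(b_n)_{n\ge0}$ a sequence of real numbers (Jacobi parameters). The polynomials $(p_n)_{n\ge 0}$ are defined by $p_0(x)=1$, $p_1(x)=(x-b_0)/a_0$, and $x p_n(x) = a_n p_{n+1}(x)+b_n p_n(x)+a_{n-1}p_{n-1}(x)$ for $n\ge1$. The Christoffel–Darboux kernel is $K_n(x,y)=\sum_{j=0}^np_j(x)p_j(y)$. Under the Carleman condition there is a unique probability measure $\mu$ on $\mathbb{R}$ for which $(p_n)$ is orthonormal in $L^2(\mathbb{R},\mu)$. It is a known fact that, under the hypotheses of the claim, $\mu$ is purely absolutely continuous on $\mathbb{R}$ with continuous positive density; $\mu'$ denotes this density. The sequences $(a_n),(b_n)$ are $N$-periodically modulated if there are $N$-periodic sequences $(\alpha_n:n\in\mathbb{Z})$ of positive numbers and $(\beta_n:n\in\mathbb{Z})$ of real numbers such that $\lim_{n\to\infty} a_n=\infty$, $\lim_{n\to\infty}\big|\frac{a_{n-1}}{a_n}-\frac{\alpha_{n-1}}{\alpha_n}\big|=0$ and $\lim_{n\to\infty}\big|\frac{b_n}{a_n}-\frac{\beta_n}{\alpha_n}\big|=0$. Set $\mathfrak{B}_j(x)=\begin{pmatrix}0&1\\ -\frac{\alpha_{j-1}}{\alpha_j}&\frac{x-\beta_j}{\alpha_j}\end{pmatrix}$ and $\mathfrak{X}_n(x)=\mathfrak{B}_{n+N-1}(x)\cdots\mathfrak{B}_n(x)$. Stolz class: a real sequence $(x_n)$ belongs to $\mathcal{D}_r$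 ($r$ a positive integer) if it is bounded and for each $j\in\{1,\ldots,r\}$, $\sum_{n}|\Delta^jx_n|^{r/j}<\infty$, where $\Delta^0x_n=x_n$, $\Delta^jx_n=\Delta^{j-1}x_{n+1}-\Delta^{j-1}x_n$. Equilibrium measure: for a compact set $F\subset\mathbb{R}$ with non-empty interior, its equilibrium measure is the unique probability measure minimizing $I(\nu)=-\iint\log|x-y|\,\nu(dx)\,\nu(dy)$ among probability measures $\nu$ supported on $F$. It is absolutely continuous with continuous density in the interior of $F$; $\omega'$ denotes the density of $\omega$. *)

theory Defs
  imports "HOL-Probability.Probability"
begin

text \<open>
  The recurrence \<open>x p\<^sub>n = a\<^sub>n p\<^sub>n\<^sub>+\<^sub>1 + b\<^sub>n p\<^sub>n + a\<^sub>n\<^sub>-\<^sub>1 p\<^sub>n\<^sub>-\<^sub>1\<close>, solved for the term of highest index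
  (\<open>a\<^sub>n > 0\<close> is assumed wherever it is used).
\<close>

fun jacobi_poly :: "(nat \<Rightarrow> real) \<Rightarrow> (nat \<Rightarrow> real) \<Rightarrow> nat \<Rightarrow> real \<Rightarrow> real" where
  "jacobi_poly a b 0 x = 1"
| "jacobi_poly a b (Suc 0) x = (x - b 0) / a 0"
| "jacobi_poly a b (Suc (Suc n)) x =
     ((x - b (Suc n)) * jacobi_poly a b (Suc n) x - a n * jacobi_poly a b n x) / a (Suc n)"

definition CD_kernel :: "(nat \<Rightarrow> real) \<Rightarrow> (nat \<Rightarrow> real) \<Rightarrow> nat \<Rightarrow> real \<Rightarrow> real \<Rightarrow> real" where
  "CD_kernel a b n x y = (\<Sum>j\<le>n. jacobi_poly a b j x * jacobi_poly a b j y)"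

definition real_prob_measure :: "real measure \<Rightarrow> bool" where
  "real_prob_measure M \<longleftrightarrow> prob_space M \<and> sets M = sets borel"

definition orthonormality_measure :: "(nat \<Rightarrow> real) \<Rightarrow> (nat \<Rightarrow> real) \<Rightarrow> real measure \<Rightarrow> bool" where
  "orthonormality_measure a b M \<longleftrightarrow>
     real_prob_measure M \<and>
     (\<forall>m n. integrable M (\<lambda>x. jacobi_poly a b m x * jacobi_poly a b n x) \<and>
            (\<integral>x. jacobi_poly a b m x * jacobi_poly a b n x \<partial>M) = (if m = n then 1 else 0))"

definition periodic_seq :: "nat \<Rightarrow> (int \<Rightarrow> real) \<Rightarrow> bool" where
  "periodic_seq N s \<longleftrightarrow> (\<forall>n. s (n + int N) = s n)"

text \<open>
  The index \<open>n - 1\<close> of \<open>a\<close> is truncated at \<open>n = 0\<close>; this does not affect the limit.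
\<close>

definition periodically_modulated ::
  "nat \<Rightarrow> (int \<Rightarrow> real) \<Rightarrow> (int \<Rightarrow> real) \<Rightarrow> (nat \<Rightarrow> real) \<Rightarrow> (nat \<Rightarrow> real) \<Rightarrow> bool" where
  "periodically_modulated N \<alpha> \<beta> a b \<longleftrightarrow>
     periodic_seq N \<alpha> \<and> periodic_seq N \<beta> \<and> (\<forall>n. \<alpha> n > 0) \<and>
     filterlim a at_top sequentially \<and>
     (\<lambda>n. \<bar>a (n - 1) / a n - \<alpha> (int n - 1) / \<alpha> (int n)\<bar>) \<longlonglongrightarrow> 0 \<and>
     (\<lambda>n. \<bar>b n / a n - \<beta> (int n) / \<alpha> (int n)\<bar>) \<longlonglongrightarrow> 0"

definition transfer_matrix :: "(int \<Rightarrow> real) \<Rightarrow> (int \<Rightarrow> real) \<Rightarrow> int \<Rightarrow> real \<Rightarrow> real^2^2" where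
  "transfer_matrix \<alpha> \<beta> j x =
     vector [vector [0, 1], vector [- \<alpha> (j - 1) / \<alpha> j, (x - \<beta> j) / \<alpha> j]]"

text \<open>
  \<open>transfer_prod \<alpha> \<beta> m n x\<close> is the product of the \<open>m\<close> matrices with indices
  \<open>n + m - 1, \<dots>, n\<close>, the highest index being leftmost.
\<close>

primrec transfer_prod ::
  "(int \<Rightarrow> real) \<Rightarrow> (int \<Rightarrow> real) \<Rightarrow> nat \<Rightarrow> int \<Rightarrow> real \<Rightarrow> real^2^2" where
  "transfer_prod \<alpha> \<beta> 0 n x = mat 1"
| "transfer_prod \<alpha> \<beta> (Suc m) n x = transfer_matrix \<alpha> \<beta> (n + int m) x ** transfer_prod \<alpha> \<beta> m n x"

definition fwd_diff :: "(nat \<Rightarrow> real) \<Rightarrow> nat \<Rightarrow> real" where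
  "fwd_diff s n = s (Suc n) - s n"

definition stolz_class :: "nat \<Rightarrow> (nat \<Rightarrow> real) set" where
  "stolz_class r = {s. bounded (range s) \<and>
     (\<forall>j\<in>{1..r}. summable (\<lambda>n. \<bar>(fwd_diff ^^ j) s n\<bar> powr (real r / real j)))}"

text \<open>
  Logarithmic energy \<open>-\<integral>\<integral> log \<bar>x - y\<bar> \<nu>(dx) \<nu>(dy)\<close>, split into the positive and the negative part of
  the kernel. The kernel is \<open>\<infinity>\<close> on the diagonal, which has to be said explicitly because
  \<open>ln 0 = 0\<close>. The subtracted integral is finite if \<open>\<nu>\<close> is finite with bounded support.
\<close>

definition log_energy :: "real measure \<Rightarrow> ereal" where
  "log_energy \<nu> =
     enn2ereal (\<integral>\<^sup>+x. (\<integral>\<^sup>+y. (if x = y then \<infinity> else ennreal (- ln \<bar>x - y\<bar>)) \<partial>\<nu>) \<partial>\<nu>) -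
     enn2ereal (\<integral>\<^sup>+x. (\<integral>\<^sup>+y. ennreal (ln \<bar>x - y\<bar>) \<partial>\<nu>) \<partial>\<nu>)"

definition prob_measure_on :: "real set \<Rightarrow> real measure \<Rightarrow> bool" where
  "prob_measure_on F \<nu> \<longleftrightarrow> real_prob_measure \<nu> \<and> emeasure \<nu> (- F) = 0"

definition equilibrium_measure :: "real set \<Rightarrow> real measure \<Rightarrow> bool" where
  "equilibrium_measure F \<omega> \<longleftrightarrow>
     prob_measure_on F \<omega> \<and> (\<forall>\<nu>. prob_measure_on F \<nu> \<longrightarrow> log_energy \<omega> \<le> log_energy \<nu>)"

definition has_continuous_density :: "real measure \<Rightarrow> real set \<Rightarrow> (real \<Rightarrow> real) \<Rightarrow> bool" where
  "has_continuous_density M S g \<longleftrightarrow>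
     continuous_on S g \<and> (\<forall>x\<in>S. 0 \<le> g x) \<and>
     (\<forall>A\<in>sets borel. A \<subseteq> S \<longrightarrow> emeasure M A = (\<integral>\<^sup>+x\<in>A. ennreal (g x) \<partial>lborel))"

text \<open>
  The value at \<open>x\<close> of the continuous density of \<open>M\<close> on \<open>S\<close>. It is unspecified if there is no such
  density; if there is one, it is unique on open \<open>S\<close>, as shown below. (\<open>RN_deriv\<close> is determined only almost
  everywhere, so it has no meaningful value at a point.)
\<close>

definition continuous_density :: "real measure \<Rightarrow> real set \<Rightarrow> real \<Rightarrow> real" where
  "continuous_density M S x = (THE d. \<exists>g. has_continuous_density M S g \<and> d = g x)"

lemma has_continuous_density_le:
  assumes g: "has_continuous_density M S g" and h: "has_continuous_density M S h"
    and S: "open S" "x \<in> S"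
  shows "g x \<le> h x"
proof (rule ccontr)
  assume "\<not> g x \<le> h x"
  define d where "d = (g x - h x) / 3"
  have d: "d > 0" using \<open>\<not> g x \<le> h x\<close> by (simp add: d_def)
  have cg: "isCont g x" and ch: "isCont h x"
    using g h S by (auto simp: has_continuous_density_def continuous_on_eq_continuous_at)
  obtain e1 where e1: "e1 > 0" "\<And>y. dist y x < e1 \<Longrightarrow> dist (g y) (g x) < d"
    using cg d unfolding continuous_at_eps_delta by metis
  obtain e2 where e2: "e2 > 0" "\<And>y. dist y x < e2 \<Longrightarrow> dist (h y) (h x) < d"
    using ch d unfolding continuous_at_eps_delta by metis
  obtain e3 where e3: "e3 > 0" "ball x e3 \<subseteq> S"
    using S by (meson openE)
  define e where "e = min e1 (min e2 e3)"
  have e: "e > 0" using e1 e2 e3 by (simp add: e_def)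
  define A where "A = ball x e"
  have AS: "A \<subseteq> S" using e3 by (auto simp: A_def e_def)
  have A: "A = {x - e<..<x + e}" by (auto simp: A_def dist_real_def)
  have vol: "emeasure lborel A = ennreal (2 * e)" using e by (simp add: A)
  have Ab: "A \<in> sets borel" by (simp add: A)
  have gl: "g x - d \<le> g y" and hu: "h y \<le> h x + d" if "y \<in> A" for y
  proof -
    have "dist y x < e1" "dist y x < e2"
      using that by (auto simp: A_def e_def dist_commute)
    then show "g x - d \<le> g y" "h y \<le> h x + d"
      using e1(2)[of y] e2(2)[of y] unfolding dist_real_def by linarith+
  qed
  have "ennreal ((g x - d) * (2 * e)) = (\<integral>\<^sup>+y\<in>A. ennreal (g x - d) \<partial>lborel)"
    using e d h S
    by (subst nn_integral_cmult_indicator)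
       (auto simp: Ab vol ennreal_mult'' has_continuous_density_def)
  also have "\<dots> \<le> (\<integral>\<^sup>+y\<in>A. ennreal (g y) \<partial>lborel)"
    by (intro nn_integral_mono) (auto simp: indicator_def gl ennreal_leI)
  also have "\<dots> = (\<integral>\<^sup>+y\<in>A. ennreal (h y) \<partial>lborel)"
    using g h Ab AS unfolding has_continuous_density_def by metis
  also have "\<dots> \<le> (\<integral>\<^sup>+y\<in>A. ennreal (h x + d) \<partial>lborel)"
    by (intro nn_integral_mono) (auto simp: indicator_def hu ennreal_leI)
  also have "\<dots> = ennreal ((h x + d) * (2 * e))"
    using e by (subst nn_integral_cmult_indicator) (auto simp: Ab vol ennreal_mult'')
  finally have "(g x - d) * (2 * e) \<le> (h x + d) * (2 * e)"
    using e d h S by (subst (asm) ennreal_le_iff) (auto simp: has_continuous_density_def)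
  then have "g x - d \<le> h x + d" using e by simp
  then show False using d by (simp add: d_def field_simps)
qed

lemma continuous_density_eq:
  assumes "has_continuous_density M S g" "open S" "x \<in> S"
  shows "continuous_density M S x = g x"
  unfolding continuous_density_def
  using has_continuous_density_le assms by (intro the_equality) (blast, metis order.antisym)

end

theory Submission
  imports Defs "HOL-Computational_Algebra.Computational_Algebra" "HOL-Complex_Analysis.Complex_Analysis" "HOL-Real_Asymp.Real_Asymp"
begin

text \<open>
  Over one period, \<open>(p\<^sub>n, p\<^sub>n\<^sub>+\<^sub>1)\<close> is multiplied by a matrix that tends to the monodromy matrix at \<open>0\<close>, which is elliptic. By the
  Stolz conditions, the moving fixed point of these matrices can be corrected \<open>r\<close> times so that it solves the Riccati
  equation up to a summable error. Hence \<open>a\<^sub>n \<bar>p\<^sub>n\<^sub>+\<^sub>1 - z p\<^sub>n\<bar>\<^sup>2\<close>, for the fixed point \<open>z\<close> of the monodromy matrix, tends along a period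
  to a positive limit \<open>G \<cdot> Im z\<close>, locally uniformly.

  This limit governs both sides of the claim. On one side, \<open>- Im w / (\<pi> a\<^sub>n \<bar>p\<^sub>n\<^sub>+\<^sub>1 - w p\<^sub>n\<bar>\<^sup>2)\<close> with \<open>Im w < 0\<close> is the density of the
  spectral measure of a dissipative truncation; by the Carleman condition these measures converge to \<open>\<mu>\<close>, and \<open>w\<close> conjugate to \<open>z\<close> gives
  \<open>\<mu>' = 1 / (\<pi> G)\<close>. On the other side, the monodromy acts as a rotation, so the oscillating part of \<open>p\<^sub>n\<^sup>2\<close> is a coboundary
  that averages out, and \<open>K\<^sub>n / \<rho>\<^sub>n\<close> tends to \<open>G\<close> times a constant, which is the derivative of the discriminant \<open>tr X\<^sub>0\<close> at \<open>0\<close> up to a factor.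

  Finally, the probability measure on the bands with density \<open>\<bar>discr'\<bar> / (\<pi> N sqrt (4 - discr\<^sup>2))\<close> is, in the coordinate \<open>discr = 2 cos p\<close>,
  uniform in \<open>p\<close> on each band. Its logarithmic potential is therefore constant on the bands, so it is the equilibrium measure.
\<close>

text \<open>The energy x enters a transfer matrix only through x / \<open>a n\<close>, which tends
  to 0. Hence all limiting matrices belong to energy 0, and x survives only in the limit function
  \<open>G\<close>. This function is never computed: it is a factor of the averages of the squares
  and, inverted, of the density, so that only a constant has to be identified. The obstacle to the
  convergence of the amplitude is that for r > 1 the successive differences of the transfer matrices
  lie in l^r but need not be summable, so following the exact fixed points leaves an error that
  cannot be summed; the differences of higher order pay for the corrections. The boundary condition
  of the truncation is taken nonreal because a real one gives a discrete measure, whereas a nonreal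
  one gives a density that can converge locally uniformly. The equilibrium measure is given only as
  a minimizer of the energy, so the explicit measure must be matched to it by a uniqueness argument.
  Its density must moreover be continuous on the whole interior of the bands, where closed gaps turn
  the explicit formula into 0 / 0.\<close>

section \<open>Difference symbols\<close>

text \<open>
  The differences up to order \<open>J\<close> of a symbol of order \<open>m\<close> gain one power of \<open>t\<close> each. For a scale \<open>t\<close> in
  \<open>\<ell>\<^sup>r\<close> built from its differences, a Stolz sequence is a symbol of order \<open>0\<close>, and symbols of order \<open>r\<close> are summable.
\<close>

fun symb :: "'p set \<Rightarrow> (nat \<Rightarrow> real) \<Rightarrow> nat \<Rightarrow> nat \<Rightarrow> (nat \<Rightarrow> 'p \<Rightarrow> complex) \<Rightarrow> bool" where
  "symb K t m 0 y = (\<exists>C\<ge>0. \<forall>k. \<forall>x\<in>K. norm (y k x) \<le> C * t k ^ m)"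
| "symb K t m (Suc J) y = ((\<exists>C\<ge>0. \<forall>k. \<forall>x\<in>K. norm (y k x) \<le> C * t k ^ m) \<and>
     symb K t (Suc m) J (\<lambda>k x. y (Suc k) x - y k x))"

lemma symb_bound:
  assumes "symb K t m J y"
  obtains C where "C \<ge> 0" "\<And>k x. x \<in> K \<Longrightarrow> norm (y k x) \<le> C * t k ^ m"
  using assms by (cases J) auto

lemma symb_0I:
  assumes "C \<ge> 0" "\<And>k x. x \<in> K \<Longrightarrow> norm (y k x) \<le> C * t k ^ m"
  shows "symb K t m 0 y"
  using assms by auto

lemma symb_0: "symb K t m J y \<Longrightarrow> symb K t m 0 y"
  by (cases J) auto

lemma symb_less_diff: "symb K t m (Suc J) y \<Longrightarrow> symb K t m J y"
proof (induction J arbitrary: m y)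
  case (Suc J)
  show ?case using Suc.IH[of "Suc m" "\<lambda>k x. y (Suc k) x - y k x"] Suc.prems by auto
qed auto

lemma symb_antimono: "symb K t m J y \<Longrightarrow> J' \<le> J \<Longrightarrow> symb K t m J' y"
  by (induction J) (use symb_less_diff le_Suc_eq in blast)+

lemma symb_cmult: "symb K t m J y \<Longrightarrow> symb K t m J (\<lambda>k x. c * y k x)"
proof (induction J arbitrary: m y)
  have base: "symb K t m 0 (\<lambda>k x. c * y k x)" if y: "symb K t m 0 y" for m y
  proof -
    obtain C where C: "C \<ge> 0" "\<And>k x. x \<in> K \<Longrightarrow> norm (y k x) \<le> C * t k ^ m" using symb_bound[OF y] by auto
    then show ?thesis by (intro symb_0I[of "norm c * C"]) (auto simp: norm_mult mult.assoc mult_left_mono)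
  qed
  {
    case 0 then show ?case using base by blast
  next
    case (Suc J)
    have "symb K t (Suc m) J (\<lambda>k x. c * (y (Suc k) x - y k x))"
      using Suc.prems by (intro Suc.IH) auto
    moreover have "symb K t m 0 (\<lambda>k x. c * y k x)"
      using Suc.prems symb_0 base by blast
    ultimately show ?case by (simp add: algebra_simps)
  }
qed

lemma symb_minus: "symb K t m J y \<Longrightarrow> symb K t m J (\<lambda>k x. - y k x)"
  using symb_cmult[of K t m J y "-1"] by simp

lemma symb_cong:
  assumes "symb K t m J y" and eq: "\<And>k x. x \<in> K \<Longrightarrow> z k x = y k x" shows "symb K t m J z"
  using assms
proof (induction J arbitrary: m y z)
  case 0
  then obtain C where C: "C \<ge> 0" "\<And>k x. x \<in> K \<Longrightarrow> norm (y k x) \<le> C * t k ^ m"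
    using symb_bound[OF 0(1)] by blast
  have "norm (z k x) \<le> C * t k ^ m" if "x \<in> K" for k x
    using C(2)[OF that] 0(2)[OF that] by simp
  with C(1) show ?case by auto
next
  case (Suc J)
  have y0: "symb K t m 0 y" by (rule symb_0[OF Suc.prems(1)])
  then obtain C where C: "C \<ge> 0" "\<And>k x. x \<in> K \<Longrightarrow> norm (y k x) \<le> C * t k ^ m"
    using symb_bound[OF y0] by blast
  have "norm (z k x) \<le> C * t k ^ m" if "x \<in> K" for k x
    using C(2)[OF that] Suc.prems(2)[OF that] by simp
  with C(1) have "symb K t m 0 z" by auto
  moreover have "symb K t (Suc m) J (\<lambda>k x. z (Suc k) x - z k x)"
  proof (rule Suc.IH)
    show "symb K t (Suc m) J (\<lambda>k x. y (Suc k) x - y k x)" using Suc.prems(1) by simp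
    show "z (Suc k) x - z k x = y (Suc k) x - y k x" if "x \<in> K" for k x
      using Suc.prems(2)[OF that] by simp
  qed
  ultimately show ?case by simp
qed

text \<open>\<open>t_Suc\<close> lets a symbol be shifted by one index, as the discrete Leibniz rule
  requires; \<open>t_le_1\<close> lets its order be lowered. A sequence of l^r need not satisfy
  \<open>t_Suc\<close>, so \<open>stolz_scale\<close> has to regularise the scale.\<close>

locale symb_scale =
  fixes K :: "'p set" and t :: "nat \<Rightarrow> real"
  assumes t_nonneg: "\<And>k. t k \<ge> 0" and t_le_1: "\<And>k. t k \<le> 1" and t_Suc: "\<And>k. t (Suc k) \<le> 2 * t k"
begin

lemma symb_zero: "symb K t m J (\<lambda>k x. 0)"
  using t_nonneg by (induction J arbitrary: m) (auto intro!: exI[of _ 0])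

lemma symb_const:
  assumes "bounded (f ` K)" shows "symb K t 0 J (\<lambda>k x. f x)"
proof -
  obtain C where C: "\<And>x. x \<in> K \<Longrightarrow> norm (f x) \<le> C"
    using assms by (auto simp: bounded_iff)
  have "symb K t 0 0 (\<lambda>k x. f x)" by (auto intro!: exI[of _ "max C 0"] simp: C le_max_iff_disj)
  then show ?thesis by (cases J) (use assms in \<open>auto simp: symb_zero\<close>)
qed

lemma symb_add: "symb K t m J y \<Longrightarrow> symb K t m J z \<Longrightarrow> symb K t m J (\<lambda>k x. y k x + z k x)"
proof (induction J arbitrary: m y z)
  have base: "symb K t m 0 (\<lambda>k x. y k x + z k x)" if y: "symb K t m 0 y" and z: "symb K t m 0 z" for m y z
  proof -
    obtain C where C: "C \<ge> 0" "\<And>k x. x \<in> K \<Longrightarrow> norm (y k x) \<le> C * t k ^ m" using symb_bound[OF y] by auto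
    obtain C' where C': "C' \<ge> 0" "\<And>k x. x \<in> K \<Longrightarrow> norm (z k x) \<le> C' * t k ^ m" using symb_bound[OF z] by auto
    have "norm (y k x + z k x) \<le> (C + C') * t k ^ m" if "x \<in> K" for k x
      using norm_triangle_le[OF add_mono[OF C(2)[OF that] C'(2)[OF that]]] by (simp add: algebra_simps)
    with C(1) C'(1) show ?thesis by (intro symb_0I[of "C + C'"]) auto
  qed
  {
    case 0
    then show ?case using base by blast
  next
    case (Suc J)
    have "symb K t (Suc m) J (\<lambda>k x. (y (Suc k) x - y k x) + (z (Suc k) x - z k x))"
      using Suc.prems by (intro Suc.IH) auto
    moreover have "symb K t m 0 (\<lambda>k x. y k x + z k x)"
      using Suc.prems symb_0 base by blast
    ultimately show ?case by (simp add: algebra_simps)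
  }
qed

lemma symb_diff:
  assumes "symb K t m J y" "symb K t m J z"
  shows "symb K t m J (\<lambda>k x. y k x - z k x)"
  using symb_add[OF assms(1) symb_minus[OF assms(2)]] by simp

lemma symb_weaken: "symb K t m J y \<Longrightarrow> m' \<le> m \<Longrightarrow> symb K t m' J y"
proof (induction J arbitrary: m m' y)
  have base: "symb K t m' 0 y" if y: "symb K t m 0 y" and m: "m' \<le> m" for m m' y
  proof -
    obtain C where C: "C \<ge> 0" "\<And>k x. x \<in> K \<Longrightarrow> norm (y k x) \<le> C * t k ^ m" using symb_bound[OF y] by auto
    have "t k ^ m \<le> t k ^ m'" for k using m t_nonneg t_le_1 by (simp add: power_decreasing)
    with C have "norm (y k x) \<le> C * t k ^ m'" if "x \<in> K" for k x
      by (meson mult_left_mono order_trans that)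
    then show ?thesis using C(1) by (intro symb_0I)
  qed
  {
    case 0 then show ?case using base by blast
  next
    case (Suc J)
    show ?case using base[OF symb_0[OF Suc.prems(1)] Suc.prems(2)] Suc.IH[of "Suc m" "\<lambda>k x. y (Suc k) x - y k x" "Suc m'"] Suc.prems by auto
  }
qed

lemma symb_shift: "symb K t m J y \<Longrightarrow> symb K t m J (\<lambda>k x. y (Suc k) x)"
proof (induction J arbitrary: m y)
  have base: "symb K t m 0 (\<lambda>k x. y (Suc k) x)" if y: "symb K t m 0 y" for m y
  proof -
    obtain C where C: "C \<ge> 0" "\<And>k x. x \<in> K \<Longrightarrow> norm (y k x) \<le> C * t k ^ m" using symb_bound[OF y] by auto
    have "norm (y (Suc k) x) \<le> (C * 2 ^ m) * t k ^ m" if "x \<in> K" for k x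
    proof -
      have "t (Suc k) ^ m \<le> 2 ^ m * t k ^ m"
        using power_mono[OF t_Suc t_nonneg] by (simp add: power_mult_distrib)
      then show ?thesis using C(2)[OF that, of "Suc k"] C(1)
        by (smt (verit) mult.assoc mult_left_mono)
    qed
    then show ?thesis using C(1) by (intro symb_0I[of "C * 2 ^ m"]) auto
  qed
  {
    case 0 then show ?case using base by blast
  next
    case (Suc J)
    show ?case using base[OF symb_0[OF Suc.prems]] Suc.IH[of "Suc m" "\<lambda>k x. y (Suc k) x - y k x"] Suc.prems by auto
  }
qed

text \<open>Induction over the Leibniz rule: the difference of y z is the difference of y times the
  shifted z, plus y times the difference of z. Each summand gains a power of \<open>t\<close> and
  needs one difference fewer.\<close>

lemma symb_mult: "symb K t m J y \<Longrightarrow> symb K t n J z \<Longrightarrow> symb K t (m + n) J (\<lambda>k x. y k x * z k x)"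
proof (induction J arbitrary: m n y z)
  have base: "symb K t (m + n) 0 (\<lambda>k x. y k x * z k x)" if y: "symb K t m 0 y" and z: "symb K t n 0 z" for m n y z
  proof -
    obtain C where C: "C \<ge> 0" "\<And>k x. x \<in> K \<Longrightarrow> norm (y k x) \<le> C * t k ^ m" using symb_bound[OF y] by auto
    obtain C' where C': "C' \<ge> 0" "\<And>k x. x \<in> K \<Longrightarrow> norm (z k x) \<le> C' * t k ^ n" using symb_bound[OF z] by auto
    have "norm (y k x * z k x) \<le> (C * C') * t k ^ (m + n)" if "x \<in> K" for k x
      using mult_mono[OF C(2)[OF that, of k] C'(2)[OF that, of k]] C(1) t_nonneg[of k]
      by (simp add: norm_mult power_add algebra_simps)
    then show ?thesis using symb_0I[of "C * C'" K "\<lambda>k x. y k x * z k x" t "m + n"] C(1) C'(1) by simp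
  qed
  {
    case 0 show ?case by (rule base[OF 0])
  next
    case (Suc J)
    have "symb K t (Suc m + n) J (\<lambda>k x. (y (Suc k) x - y k x) * z (Suc k) x)"
      by (rule Suc.IH[OF _ symb_shift[OF symb_less_diff[OF Suc.prems(2)]]]) (use Suc.prems(1) in simp)
    moreover have "symb K t (m + Suc n) J (\<lambda>k x. y k x * (z (Suc k) x - z k x))"
      by (rule Suc.IH[OF symb_less_diff[OF Suc.prems(1)]]) (use Suc.prems(2) in simp)
    ultimately have "symb K t (Suc (m + n)) J
        (\<lambda>k x. (y (Suc k) x - y k x) * z (Suc k) x + y k x * (z (Suc k) x - z k x))"
      using symb_add by simp
    moreover have "symb K t (m + n) 0 (\<lambda>k x. y k x * z k x)"
      by (rule base[OF symb_0[OF Suc.prems(1)] symb_0[OF Suc.prems(2)]])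
    ultimately show ?case by (simp add: algebra_simps)
  }
qed

lemma symb_mult0: "symb K t m J y \<Longrightarrow> symb K t 0 J z \<Longrightarrow> symb K t m J (\<lambda>k x. y k x * z k x)"
  using symb_mult[of m J y 0 z] by simp

text \<open>The difference of 1 / y is a difference of y times two inverses, which are symbols with
  one difference fewer by induction. In \<open>symb_sqrt\<close> the difference of d is divided by
  the sum of two neighbouring roots in the same way.\<close>

lemma symb_inverse:
  assumes "symb K t 0 J y" "c > 0" "\<And>k x. x \<in> K \<Longrightarrow> c \<le> norm (y k x)"
  shows "symb K t 0 J (\<lambda>k x. inverse (y k x))"
  using assms(1)
proof (induction J)
  have base: "symb K t 0 0 (\<lambda>k x. inverse (y k x))"
    using assms(2,3) by (auto intro!: exI[of _ "inverse c"] simp: norm_inverse le_imp_inverse_le)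
  {
    case 0 then show ?case using base by blast
  next
    case (Suc J)
    have IH: "symb K t 0 J (\<lambda>k x. inverse (y k x))" using Suc symb_less_diff by blast
    have "symb K t (Suc 0) J (\<lambda>k x. - ((y (Suc k) x - y k x) * (inverse (y (Suc k) x) * inverse (y k x))))"
      using Suc.prems IH by (intro symb_minus symb_mult0 symb_shift[OF IH]) auto
    then have "symb K t (Suc 0) J (\<lambda>k x. inverse (y (Suc k) x) - inverse (y k x))"
    proof (rule symb_cong)
      fix k x assume "x \<in> K"
      then have "y k x \<noteq> 0" "y (Suc k) x \<noteq> 0" using assms(2,3) by (metis norm_zero not_le)+
      then show "inverse (y (Suc k) x) - inverse (y k x)
        = - ((y (Suc k) x - y k x) * (inverse (y (Suc k) x) * inverse (y k x)))"
        by (simp add: field_simps)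
    qed
    then show ?case using base by auto
  }
qed

lemma symb_sqrt:
  assumes "symb K t 0 J (\<lambda>k x. complex_of_real (d k x))" "c > 0" "\<And>k x. x \<in> K \<Longrightarrow> c \<le> d k x"
  shows "symb K t 0 J (\<lambda>k x. complex_of_real (sqrt (d k x)))"
  using assms(1)
proof (induction J)
  have base: "symb K t 0 0 (\<lambda>k x. complex_of_real (sqrt (d k x)))" if d: "symb K t 0 0 (\<lambda>k x. complex_of_real (d k x))"
  proof -
    obtain C where C: "C \<ge> 0" "\<And>k x. x \<in> K \<Longrightarrow> norm (complex_of_real (d k x)) \<le> C * t k ^ 0" using symb_bound[OF d] by metis
    have "norm (complex_of_real (sqrt (d k x))) \<le> sqrt C" if "x \<in> K" for k x
    proof -
      have "d k x \<ge> 0" using assms(2) assms(3)[OF that, of k] by simp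
      then show ?thesis using C(2)[OF that, of k] by simp
    qed
    then show ?thesis using C(1) by (intro symb_0I[of "sqrt C"]) auto
  qed
  {
    case 0 then show ?case using base by blast
  next
    case (Suc J)
    let ?s = "\<lambda>k x. complex_of_real (sqrt (d k x))"
    have IH: "symb K t 0 J ?s" using Suc symb_less_diff by blast
    have "symb K t 0 J (\<lambda>k x. inverse (?s (Suc k) x + ?s k x))"
    proof (rule symb_inverse)
      show "symb K t 0 J (\<lambda>k x. ?s (Suc k) x + ?s k x)"
        by (rule symb_add[OF symb_shift[OF IH] IH])
      show "0 < sqrt c" using assms by simp
      fix k x assume x: "x \<in> K"
      have d: "c \<le> d k x" "0 \<le> d (Suc k) x" using assms(2) assms(3)[OF x, of k] assms(3)[OF x, of "Suc k"] by auto
      have "norm (?s (Suc k) x + ?s k x) = \<bar>sqrt (d (Suc k) x) + sqrt (d k x)\<bar>"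
        by (metis norm_of_real of_real_add)
      also have "\<dots> \<ge> sqrt (d (Suc k) x) + sqrt (d k x)" by simp
      finally have "sqrt (d (Suc k) x) + sqrt (d k x) \<le> norm (?s (Suc k) x + ?s k x)" .
      moreover have "sqrt c \<le> sqrt (d k x)" "0 \<le> sqrt (d (Suc k) x)" using d by auto
      ultimately show "sqrt c \<le> norm (?s (Suc k) x + ?s k x)" by linarith
    qed
    then have "symb K t (Suc 0) J (\<lambda>k x. (complex_of_real (d (Suc k) x) - complex_of_real (d k x)) * inverse (?s (Suc k) x + ?s k x))"
      using Suc.prems by (intro symb_mult0) auto
    then have "symb K t (Suc 0) J (\<lambda>k x. ?s (Suc k) x - ?s k x)"
    proof (rule symb_cong)
      fix k x assume x: "x \<in> K"
      have pos: "d k x > 0" "d (Suc k) x > 0" using assms(2) assms(3)[OF x, of k] assms(3)[OF x, of "Suc k"] by auto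
      then have s: "sqrt (d (Suc k) x) + sqrt (d k x) > 0" by (simp add: add_pos_pos)
      have "d (Suc k) x - d k x = (sqrt (d (Suc k) x) - sqrt (d k x)) * (sqrt (d (Suc k) x) + sqrt (d k x))"
        using pos by (simp add: algebra_simps)
      then have "sqrt (d (Suc k) x) - sqrt (d k x) = (d (Suc k) x - d k x) * inverse (sqrt (d (Suc k) x) + sqrt (d k x))"
        using s by (simp add: field_simps)
      then show "?s (Suc k) x - ?s k x = (complex_of_real (d (Suc k) x) - complex_of_real (d k x)) * inverse (?s (Suc k) x + ?s k x)"
        by (metis of_real_add of_real_diff of_real_inverse of_real_mult)
    qed
    then show ?case using base[OF symb_0[OF Suc.prems]] by auto
  }
qed

end

lemma symb_of_fwd_diff:
  assumes "\<And>j. j \<le> J \<Longrightarrow> \<exists>C\<ge>0. \<forall>k. \<bar>(fwd_diff ^^ j) s k\<bar> \<le> C * t k ^ (m + j)"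
  shows "symb K t m J (\<lambda>k x. complex_of_real (s k))"
  using assms
proof (induction J arbitrary: m s)
  case 0
  then show ?case using 0[of 0] by auto
next
  case (Suc J)
  have "symb K t (Suc m) J (\<lambda>k x. complex_of_real (fwd_diff s k))"
  proof (rule Suc.IH)
    fix j assume "j \<le> J"
    then show "\<exists>C\<ge>0. \<forall>k. \<bar>(fwd_diff ^^ j) (fwd_diff s) k\<bar> \<le> C * t k ^ (Suc m + j)"
      using Suc.prems[of "Suc j"] by (simp add: funpow_swap1)
  qed
  moreover obtain C where "C \<ge> 0" "\<forall>k. \<bar>s k\<bar> \<le> C * t k ^ m" using Suc.prems[of 0] by auto
  ultimately show ?case by (auto simp: fwd_diff_def)
qed

text \<open>If \<open>h\<close> collects all terms of the Stolz sums, the j-th differences are at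
  most \<open>h k\<close> to the power j / r, so the r-th root of \<open>h\<close> would be a scale
  but for the condition t (Suc k) <= 2 t k. Summing the later values of \<open>h\<close> with the
  weights 2^(-i) enforces this condition and keeps summability.\<close>

lemma stolz_scale:
  fixes S :: "(nat \<Rightarrow> real) set"
  assumes S: "finite S" "S \<subseteq> stolz_class r" and r: "r \<ge> 1"
  obtains t where "\<And>k. t k \<ge> 0" "\<And>k. t k \<le> 1" "\<And>k. t (Suc k) \<le> 2 * t k" "summable (\<lambda>k. t k ^ r)"
    "\<And>s K. s \<in> S \<Longrightarrow> symb (K :: 'p set) t 0 r (\<lambda>k x. complex_of_real (s k))"
proof -
  define h where "h k = (\<Sum>s\<in>S. \<Sum>j=1..r. \<bar>(fwd_diff ^^ j) s k\<bar> powr (real r / real j))" for k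
  have h0: "h k \<ge> 0" for k unfolding h_def by (intro sum_nonneg) auto
  have sh: "summable h"
    unfolding h_def[abs_def] using S by (intro summable_sum) (auto simp: stolz_class_def)
  have h_le: "h k \<le> suminf h" for k
    using sum_le_suminf[OF sh, of "{k}"] h0 by auto
  define H where "H k = (\<Sum>i. h (k + i) * (1/2) ^ i)" for k
  have sumH: "summable (\<lambda>i. h (k + i) * (1/2) ^ i)" for k
  proof (rule summable_comparison_test')
    show "summable (\<lambda>i. suminf h * (1/2::real) ^ i)" by (intro summable_mult summable_geometric) auto
    show "norm (h (k + n) * (1 / 2) ^ n) \<le> suminf h * (1 / 2) ^ n" for n
      using h_le h0 by (simp add: mult_right_mono abs_mult)
  qed
  have H0: "H k \<ge> 0" for k unfolding H_def using h0 by (intro suminf_nonneg sumH) auto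
  have Hrec: "H k = h k + H (Suc k) / 2" for k
  proof -
    have "H k = h k + (\<Sum>i. h (k + Suc i) * (1/2) ^ Suc i)"
      unfolding H_def using suminf_split_head[OF sumH[of k]] by simp
    also have "(\<Sum>i. h (k + Suc i) * (1/2) ^ Suc i) = (1/2) * H (Suc k)"
      unfolding H_def by (subst suminf_mult[OF sumH, symmetric]) (simp add: mult_ac)
    finally show ?thesis by simp
  qed
  have HS: "H (Suc k) \<le> 2 * H k" for k using Hrec[of k] h0[of k] by simp
  have hH: "h k \<le> H k" for k using Hrec[of k] H0[of "Suc k"] by simp
  \<comment> \<open>Sum the recursion \<open>Hrec\<close> and absorb the half of the sum of
    \<open>H\<close> into the left-hand side.\<close>
  have part: "(\<Sum>k<n. H k) \<le> 2 * (\<Sum>k<n. h k) + H n" for n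
  proof -
    have "(\<Sum>k<n. H k) = (\<Sum>k<n. h k) + (\<Sum>k<n. H (Suc k)) / 2"
      by (subst Hrec) (simp add: sum.distrib sum_divide_distrib)
    moreover have "(\<Sum>k<n. H (Suc k)) = (\<Sum>k<n. H k) + H n - H 0"
      by (induction n) auto
    ultimately show ?thesis using H0[of 0] by linarith
  qed
  have Hbd: "H k \<le> 2 * suminf h" for k
  proof -
    have "H k \<le> (\<Sum>i. suminf h * (1/2::real) ^ i)"
      unfolding H_def by (intro suminf_le sumH summable_mult summable_geometric) (auto simp: h_le mult_right_mono)
    also have "\<dots> = 2 * suminf h"
      by (subst suminf_mult) (auto simp: suminf_geometric)
    finally show ?thesis .
  qed
  have summH: "summable H"
  proof (rule summableI_nonneg_bounded[OF H0])
    show "(\<Sum>k<n. H k) \<le> 4 * suminf h" for n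
      using part[of n] Hbd[of n] sum_le_suminf[OF sh, of "{..<n}"] h0 by fastforce
  qed
  \<comment> \<open>The bound of \<open>H\<close> plus 1, so that M is positive even if all
    differences vanish, and H k / M is at most 1.\<close>
  define M where "M = 2 * suminf h + 1"
  have "suminf h \<ge> 0" using sh h0 by (intro suminf_nonneg)
  then have M: "M > 0" "\<And>k. H k \<le> M" using order_trans[OF Hbd] unfolding M_def by auto
  define t where "t k = (H k / M) powr (1 / real r)" for k
  have t0: "t k \<ge> 0" for k by (simp add: t_def)
  \<comment> \<open>For j = 0 the two sides differ where H k = 0: there \<open>0 ^ 0\<close> is 1
    but \<open>0 powr 0\<close> is 0.\<close>
  have tr: "t k ^ j = (H k / M) powr (real j / real r)" if "j \<ge> 1" for k j
  proof (cases "H k = 0")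
    case True then show ?thesis using that by (simp add: t_def)
  next
    case False
    then have "H k / M > 0" using H0[of k] M by simp
    then show ?thesis unfolding t_def
      using powr_realpow[of "(H k / M) powr (1 / real r)" j] False M by (simp add: powr_powr)
  qed
  show ?thesis
  proof (rule that[of t])
    show "t k \<ge> 0" for k by fact
    show "t k \<le> 1" for k unfolding t_def using H0[of k] M by (intro powr_le1) auto
    show "t (Suc k) \<le> 2 * t k" for k
    proof -
      have "t (Suc k) \<le> (2 * (H k / M)) powr (1 / real r)"
        unfolding t_def using HS[of k] H0[of "Suc k"] M by (intro powr_mono2) (auto simp: divide_right_mono)
      also have "\<dots> = 2 powr (1 / real r) * t k" unfolding t_def using H0[of k] M by (subst powr_mult) auto
      also have "\<dots> \<le> 2 powr 1 * t k" using r by (intro mult_right_mono powr_mono t0) auto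
      finally show ?thesis by simp
    qed
    have "t k ^ r = H k / M" for k using tr[OF r, of k] r H0[of k] M by simp
    then show "summable (\<lambda>k. t k ^ r)" using summH by (simp add: summable_divide)
    fix s and K :: "'p set" assume s: "s \<in> S"
    show "symb K t 0 r (\<lambda>k x. complex_of_real (s k))"
    proof (rule symb_of_fwd_diff)
      fix j assume j: "j \<le> r"
      show "\<exists>C\<ge>0. \<forall>k. \<bar>(fwd_diff ^^ j) s k\<bar> \<le> C * t k ^ (0 + j)"
      proof (cases "j = 0")
        case True
        have "bounded (range s)" using s S by (auto simp: stolz_class_def)
        then obtain C where C: "\<And>k. \<bar>s k\<bar> \<le> C" by (auto simp: bounded_iff)
        have "0 \<le> C" using C[of 0] by linarith
        then show ?thesis using True C by auto
      next
        case False
        have "\<bar>(fwd_diff ^^ j) s k\<bar> \<le> M powr (real j / real r) * t k ^ (0 + j)" for k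
        proof -
          let ?u = "\<bar>(fwd_diff ^^ j) s k\<bar>"
          have "?u powr (real r / real j) \<le> (\<Sum>j=1..r. \<bar>(fwd_diff ^^ j) s k\<bar> powr (real r / real j))"
            using False j by (intro member_le_sum) auto
          also have "\<dots> \<le> h k" unfolding h_def
            using s S by (intro member_le_sum[where f="\<lambda>s. \<Sum>j=1..r. \<bar>(fwd_diff ^^ j) s k\<bar> powr (real r / real j)"]) (auto intro: sum_nonneg)
          also have "\<dots> \<le> H k" by (rule hH)
          finally have "(?u powr (real r / real j)) powr (real j / real r) \<le> H k powr (real j / real r)"
            by (intro powr_mono2) auto
          moreover have "(?u powr (real r / real j)) powr (real j / real r) = ?u"
            using False j r by (simp add: powr_powr)
          moreover have "H k powr (real j / real r) = M powr (real j / real r) * (H k / M) powr (real j / real r)"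
            using M H0[of k] by (subst powr_mult[symmetric]) auto
          ultimately show ?thesis using tr[of j k] False by simp
        qed
        then show ?thesis by (intro exI[of _ "M powr (real j / real r)"]) auto
      qed
    qed
  qed
qed

section \<open>Approximate solutions of the Riccati equation\<close>

context symb_scale begin

text \<open>
  Each Newton step improves the error by one order and consumes one difference, whence \<open>m + J + 1 = r\<close>.
\<close>

lemma riccati_iteration:
  fixes A B C D z0 w :: "nat \<Rightarrow> 'p \<Rightarrow> complex"
  defines "e \<equiv> \<lambda>z k x. z k x * (D k x - z (Suc k) x * B k x) - z (Suc k) x * A k x + C k x"
  assumes A: "symb K t 0 r A" and B: "symb K t 0 r B" and C: "symb K t 0 r C" and D: "symb K t 0 r D"
    and z0: "symb K t 0 r z0" and iw: "symb K t 0 r (\<lambda>k x. inverse (w k x))"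
    and fp: "\<And>k x. x \<in> K \<Longrightarrow> z0 k x * (D k x - z0 k x * B k x) - z0 k x * A k x + C k x = 0"
    and w: "\<And>k x. x \<in> K \<Longrightarrow> w k x = 2 * B k x * z0 k x - (D k x - A k x)"
    and w0: "\<And>k x. x \<in> K \<Longrightarrow> w k x \<noteq> 0"
  shows "m + J + 1 = r \<Longrightarrow> \<exists>z. symb K t (Suc 0) J (\<lambda>k x. z (Suc k) x - z k x) \<and> symb K t 0 J z \<and>
    symb K t (Suc 0) J (\<lambda>k x. z k x - z0 k x) \<and> symb K t (Suc m) J (e z)"
proof (induction m arbitrary: J)
  case 0
  then have r: "r = Suc J" by simp
  have d: "symb K t (Suc 0) J (\<lambda>k x. z0 (Suc k) x - z0 k x)" using z0 r by simp
  have J: "symb K t 0 J A" "symb K t 0 J B" "symb K t 0 J z0"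
    using A B z0 r symb_less_diff by blast+
  have zBA: "symb K t 0 J (\<lambda>k x. z0 k x * B k x + A k x)"
    by (rule symb_add[OF symb_mult0[OF J(3,2)] J(1)])
  \<comment> \<open>With the exact fixed points the only error comes from the value at Suc k
    replacing the value at k, so it has order 1.\<close>
  have "symb K t (Suc 0) J (\<lambda>k x. - ((z0 (Suc k) x - z0 k x) * (z0 k x * B k x + A k x)))"
    by (rule symb_minus[OF symb_mult0[OF d zBA]])
  then have "symb K t (Suc 0) J (e z0)"
  proof (rule symb_cong)
    fix k x assume "x \<in> K"
    from fp[OF this, of k] show "e z0 k x = - ((z0 (Suc k) x - z0 k x) * (z0 k x * B k x + A k x))"
      unfolding e_def by algebra
  qed
  with d J show ?case by (intro exI[of _ z0]) (simp add: symb_zero)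
next
  case (Suc m)
  from Suc.prems have "m + Suc J + 1 = r" by simp
  from Suc.IH[OF this] obtain z where z: "symb K t (Suc 0) (Suc J) (\<lambda>k x. z (Suc k) x - z k x)"
    "symb K t 0 (Suc J) z" "symb K t (Suc 0) (Suc J) (\<lambda>k x. z k x - z0 k x)" "symb K t (Suc m) (Suc J) (e z)"
    by blast
  \<comment> \<open>A Newton step for the fixed-point polynomial z (D - z B) - z A + C, whose
    derivative at \<open>z0\<close> is minus \<open>w\<close>. Since the derivative is kept at
    \<open>z0\<close> throughout, only one inverse has to be a symbol.\<close>
  define d where "d k x = e z k x * inverse (w k x)" for k x
  have iwJ: "symb K t 0 (Suc J) (\<lambda>k x. inverse (w k x))" by (rule symb_antimono[OF iw]) (use Suc.prems in simp)
  have d: "symb K t (Suc m) (Suc J) d"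
    unfolding d_def[abs_def] by (rule symb_mult0[OF z(4) iwJ])
  have dd: "symb K t (Suc (Suc m)) J (\<lambda>k x. d (Suc k) x - d k x)" using d by simp
  have dJ: "symb K t (Suc m) J d" by (rule symb_less_diff[OF d])
  have zJ: "symb K t (Suc 0) J (\<lambda>k x. z (Suc k) x - z k x)" "symb K t 0 J z"
    "symb K t (Suc 0) J (\<lambda>k x. z k x - z0 k x)"
    using z symb_less_diff by blast+
  have "J \<le> r" using Suc.prems by simp
  then have cJ: "symb K t 0 J A" "symb K t 0 J B"
    by (rule symb_antimono[OF A], rule symb_antimono[OF B])
  define z' where "z' k x = z k x + d k x" for k x
  have 1: "symb K t (Suc 0) J (\<lambda>k x. z' (Suc k) x - z' k x)"
    by (rule symb_cong[OF symb_add[OF zJ(1) symb_weaken[OF dd]]]) (auto simp: z'_def)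
  have 2: "symb K t 0 J z'"
    by (rule symb_cong[OF symb_add[OF zJ(2) symb_weaken[OF dJ]]]) (auto simp: z'_def)
  have 3: "symb K t (Suc 0) J (\<lambda>k x. z' k x - z0 k x)"
    by (rule symb_cong[OF symb_add[OF zJ(3) symb_weaken[OF dJ]]]) (auto simp: z'_def)
  \<comment> \<open>The new error has four sources: the derivative taken at \<open>z0\<close>
    instead of z (\<open>t1\<close>), the drift of z (\<open>t2\<close>), the drift of the
    correction (\<open>t3\<close>) and the quadratic term (\<open>t4\<close>). Each is at least one
    order smaller than the error of z.\<close>
  have t1: "symb K t (Suc m + Suc 0) J (\<lambda>k x. d k x * (z k x - z0 k x) * (2 * B k x))"
    by (rule symb_mult0[OF symb_mult[OF dJ zJ(3)] symb_cmult[OF cJ(2)]])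
  have t2: "symb K t (Suc m + Suc 0) J (\<lambda>k x. d k x * (z (Suc k) x - z k x) * B k x)"
    by (rule symb_mult0[OF symb_mult[OF dJ zJ(1)] cJ(2)])
  have t3: "symb K t (Suc (Suc m)) J (\<lambda>k x. (d (Suc k) x - d k x) * (z k x * B k x + A k x))"
    by (rule symb_mult0[OF dd symb_add[OF symb_mult0[OF zJ(2) cJ(2)] cJ(1)]])
  have t4: "symb K t (Suc m + Suc m) J (\<lambda>k x. d k x * d (Suc k) x * B k x)"
    by (rule symb_mult0[OF symb_mult[OF dJ symb_shift[OF dJ]] cJ(2)])
  have t4': "symb K t (Suc (Suc m)) J (\<lambda>k x. d k x * d (Suc k) x * B k x)"
    by (rule symb_weaken[OF t4]) simp
  have "symb K t (Suc (Suc m)) J (\<lambda>k x. - (d k x * (z k x - z0 k x) * (2 * B k x) + d k x * (z (Suc k) x - z k x) * B k x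
     + (d (Suc k) x - d k x) * (z k x * B k x + A k x) + d k x * d (Suc k) x * B k x))"
    using t1 t2 t3 t4' by (intro symb_minus symb_add) auto
  then have 4: "symb K t (Suc (Suc m)) J (e z')"
  proof (rule symb_cong)
    fix k x assume x: "x \<in> K"
    have "d k x * w k x = e z k x" unfolding d_def using w0[OF x] by simp
    then have "d k x * (2 * B k x * z0 k x - (D k x - A k x)) = z k x * (D k x - z (Suc k) x * B k x) - z (Suc k) x * A k x + C k x"
      unfolding w[OF x] e_def .
    then show "e z' k x = - (d k x * (z k x - z0 k x) * (2 * B k x) + d k x * (z (Suc k) x - z k x) * B k x
     + (d (Suc k) x - d k x) * (z k x * B k x + A k x) + d k x * d (Suc k) x * B k x)"
      unfolding e_def z'_def by algebra
  qed
  show ?case using 1 2 3 4 by blast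
qed

text \<open>Supplies the starting point: the fixed point in the upper half-plane, selected by the
  sign \<sigma> of B. The lower bounds by c make 1 / B, the square root of the discriminant and 1 /
  \<open>w\<close> symbols. After r - 1 Newton steps no difference is left and the error has order
  r.\<close>

lemma riccati_approx:
  fixes A B C D :: "nat \<Rightarrow> 'p \<Rightarrow> real"
  assumes r: "r \<ge> 1" and \<sigma>: "\<sigma> = 1 \<or> \<sigma> = -1" and c: "c > 0"
    and A: "symb K t 0 r (\<lambda>k x. of_real (A k x))" and B: "symb K t 0 r (\<lambda>k x. of_real (B k x))"
    and C: "symb K t 0 r (\<lambda>k x. of_real (C k x))" and D: "symb K t 0 r (\<lambda>k x. of_real (D k x))"
    and Bc: "\<And>k x. x \<in> K \<Longrightarrow> c \<le> \<sigma> * B k x"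
    and disc: "\<And>k x. x \<in> K \<Longrightarrow> c \<le> 4 * (A k x * D k x - B k x * C k x) - (A k x + D k x)\<^sup>2"
  obtains z where
    "symb K t 1 0 (\<lambda>k x. z k x - Complex ((D k x - A k x) / (2 * B k x))
       (\<sigma> * sqrt (4 * (A k x * D k x - B k x * C k x) - (A k x + D k x)\<^sup>2) / (2 * B k x)))"
    "symb K t r 0 (\<lambda>k x. z k x * (of_real (D k x) - z (Suc k) x * of_real (B k x)) - z (Suc k) x * of_real (A k x) + of_real (C k x))"
proof -
  let ?d = "\<lambda>k x. 4 * (A k x * D k x - B k x * C k x) - (A k x + D k x)\<^sup>2"
  define w where "w k x = \<i> * of_real \<sigma> * complex_of_real (sqrt (?d k x))" for k x
  define z0 where "z0 k x = (of_real (D k x) - of_real (A k x) + w k x) * (inverse (of_real (B k x)) * (1/2))" for k x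
  have Bn: "c \<le> norm (complex_of_real (B k x))" if "x \<in> K" for k x
    using Bc[OF that, of k] \<sigma> by auto
  have B0: "B k x \<noteq> 0" if "x \<in> K" for k x using Bn[OF that, of k] c by auto
  have d0: "?d k x > 0" if "x \<in> K" for k x using disc[OF that, of k] c by linarith
  have sd: "symb K t 0 r (\<lambda>k x. of_real (?d k x))"
  proof (rule symb_cong)
    show "symb K t 0 r (\<lambda>k x. 4 * (complex_of_real (A k x) * of_real (D k x) - of_real (B k x) * of_real (C k x))
       - (of_real (A k x) + of_real (D k x)) * (of_real (A k x) + of_real (D k x)))"
      by (intro symb_diff symb_cmult symb_mult0 symb_add A B C D)
  qed (simp add: power2_eq_square)
  have sw: "symb K t 0 r w" unfolding w_def[abs_def]
    by (rule symb_cmult[OF symb_sqrt[OF sd c disc]])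
  have wn: "sqrt c \<le> norm (w k x)" if "x \<in> K" for k x
    using disc[OF that, of k] d0[OF that, of k] \<sigma> by (auto simp: w_def norm_mult)
  have siw: "symb K t 0 r (\<lambda>k x. inverse (w k x))"
    using c by (intro symb_inverse[OF sw _ wn]) auto
  have siB: "symb K t 0 r (\<lambda>k x. inverse (complex_of_real (B k x)) * (1/2))"
    using symb_cmult[OF symb_inverse[OF B c Bn], of "1/2"] by (simp add: mult.commute)
  have sz0: "symb K t 0 r z0" unfolding z0_def[abs_def]
    by (intro symb_mult0[OF _ siB] symb_add symb_diff A D sw)
  have w0: "w k x \<noteq> 0" if "x \<in> K" for k x using wn[OF that, of k] c by auto
  have weq: "w k x = 2 * of_real (B k x) * z0 k x - (of_real (D k x) - of_real (A k x))" if "x \<in> K" for k x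
    using B0[OF that, of k] by (simp add: z0_def field_simps)
  have w2: "w k x * w k x = - of_real (?d k x)" if "x \<in> K" for k x
  proof -
    have "(complex_of_real (sqrt (?d k x)))\<^sup>2 = of_real (?d k x)"
      using d0[OF that, of k] by (simp flip: of_real_power)
    moreover have "complex_of_real \<sigma> ^ 2 = 1" using \<sigma> by auto
    moreover have "w k x * w k x = \<i> ^ 2 * complex_of_real \<sigma> ^ 2 * (complex_of_real (sqrt (?d k x)))\<^sup>2"
      unfolding w_def by (simp only: power2_eq_square mult_ac)
    ultimately show ?thesis by (simp only: i_squared) simp
  qed
  have fixp: "z0 k x * (of_real (D k x) - z0 k x * of_real (B k x)) - z0 k x * of_real (A k x) + of_real (C k x) = 0"
    if x: "x \<in> K" for k x
  proof -
    have 1: "w k x * w k x = (of_real (A k x) + of_real (D k x))^2 - 4 * (complex_of_real (A k x) * of_real (D k x) - of_real (B k x) * of_real (C k x))"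
      using w2[OF x, of k] by simp
    have "4 * complex_of_real (B k x) * (z0 k x * (of_real (D k x) - z0 k x * of_real (B k x)) - z0 k x * of_real (A k x) + of_real (C k x)) = 0"
      using 1 unfolding weq[OF x] by algebra
    then show ?thesis using B0[OF x] by simp
  qed
  have "(r - 1) + 0 + 1 = r" using r by simp
  from riccati_iteration[OF A B C D sz0 siw fixp weq w0 this] r
  obtain z where z: "symb K t (Suc 0) 0 (\<lambda>k x. z k x - z0 k x)"
    "symb K t r 0 (\<lambda>k x. z k x * (of_real (D k x) - z (Suc k) x * of_real (B k x)) - z (Suc k) x * of_real (A k x) + of_real (C k x))"
    by (auto simp del: symb.simps)
  have "z0 k x = Complex ((D k x - A k x) / (2 * B k x)) (\<sigma> * sqrt (?d k x) / (2 * B k x))" if x: "x \<in> K" for k x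
    using B0[OF x, of k] by (simp add: z0_def w_def complex_eq_iff field_simps)
  then show ?thesis using z by (intro that[of z]) (auto intro: symb_cong simp del: symb.simps)
qed

end

section \<open>Uniform convergence and weighted averages\<close>

text \<open>Uniform convergence on \<open>K\<close> to a constant is ordinary convergence along this filter.\<close>

abbreviation ufilter :: "'p set \<Rightarrow> (nat \<times> 'p) filter" where
  "ufilter K \<equiv> sequentially \<times>\<^sub>F principal K"

lemma eventually_ufilter:
  "eventually P (ufilter K) \<longleftrightarrow> (\<exists>n0. \<forall>n\<ge>n0. \<forall>x\<in>K. P (n, x))"
  unfolding eventually_prod_filter eventually_principal
proof safe
  fix Pf Pg assume "eventually Pf sequentially" and "\<forall>x\<in>K. Pg x" and "\<forall>x y. Pf x \<longrightarrow> Pg y \<longrightarrow> P (x, y)"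
  then show "\<exists>n0. \<forall>n\<ge>n0. \<forall>x\<in>K. P (n, x)" unfolding eventually_sequentially by blast
next
  fix n0 assume "\<forall>n\<ge>n0. \<forall>x\<in>K. P (n, x)"
  then show "\<exists>Pf Pg. eventually Pf sequentially \<and> (\<forall>x\<in>K. Pg x) \<and> (\<forall>x y. Pf x \<longrightarrow> Pg y \<longrightarrow> P (x, y))"
    by (intro exI[of _ "\<lambda>n. n \<ge> n0"] exI[of _ "\<lambda>x. x \<in> K"]) (auto simp: eventually_ge_at_top)
qed

lemma uniform_limit_ufilter:
  fixes f :: "nat \<Rightarrow> 'p \<Rightarrow> 'b::real_normed_vector"
  shows "uniform_limit K f g sequentially \<longleftrightarrow> ((\<lambda>p. f (fst p) (snd p) - g (snd p)) \<longlongrightarrow> 0) (ufilter K)"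
  unfolding tendsto_iff eventually_ufilter uniform_limit_sequentially_iff by (simp add: dist_norm)

lemma uniform_limit_const_ufilter:
  fixes f :: "nat \<Rightarrow> 'p \<Rightarrow> 'b::real_normed_vector"
  shows "uniform_limit K f (\<lambda>x. c) sequentially \<longleftrightarrow> ((\<lambda>p. f (fst p) (snd p)) \<longlongrightarrow> c) (ufilter K)"
  unfolding uniform_limit_ufilter by (rule LIM_zero_iff)

lemma tendsto_ufilter_seq:
  assumes "s \<longlonglongrightarrow> c" shows "((\<lambda>p. s (fst p)) \<longlongrightarrow> c) (ufilter K)"
  using filterlim_compose[OF assms filterlim_fst] .

lemma tendsto_ufilter_Suc:
  assumes "((\<lambda>p. f (fst p) (snd p)) \<longlongrightarrow> c) (ufilter K)"
  shows "((\<lambda>p. f (Suc (fst p)) (snd p)) \<longlongrightarrow> c) (ufilter K)"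
  unfolding filterlim_iff
proof (intro allI impI)
  fix Q assume "eventually Q (nhds c)"
  with assms have "eventually (\<lambda>p. Q (f (fst p) (snd p))) (ufilter K)" unfolding filterlim_iff by blast
  then obtain n0 where "\<forall>n\<ge>n0. \<forall>x\<in>K. Q (f n x)" unfolding eventually_ufilter by auto
  then have "\<forall>n\<ge>n0. \<forall>x\<in>K. Q (f (Suc n) x)" by (meson le_SucI)
  then show "eventually (\<lambda>p. Q (f (Suc (fst p)) (snd p))) (ufilter K)" unfolding eventually_ufilter by auto
qed

lemma tendsto_ufilter_offset:
  assumes "((\<lambda>p. f (fst p) (snd p)) \<longlongrightarrow> c) (ufilter K)"
  shows "((\<lambda>p. f (fst p + m) (snd p)) \<longlongrightarrow> c) (ufilter K)"
  using assms
proof (induction m)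
  case (Suc m)
  from tendsto_ufilter_Suc[OF Suc.IH[OF Suc.prems]] show ?case by simp
qed simp

lemma uniform_limit_offset:
  assumes "uniform_limit K (\<lambda>k. f (k + m)) g sequentially"
  shows "uniform_limit K f g sequentially"
  unfolding uniform_limit_sequentially_iff
proof (intro allI impI)
  fix e :: real assume "e > 0"
  then obtain n0 where "\<forall>n\<ge>n0. \<forall>x\<in>K. dist (f (n + m) x) (g x) < e"
    using assms unfolding uniform_limit_sequentially_iff by blast
  then have "\<forall>n\<ge>n0 + m. \<forall>x\<in>K. dist (f n x) (g x) < e" by (metis add_leE le_add_diff_inverse2 add_le_imp_le_diff)
  then show "\<exists>n0. \<forall>n\<ge>n0. \<forall>x\<in>K. dist (f n x) (g x) < e" by blast
qed

lemma tendsto_zero_mult_bounded: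
  fixes f g :: "'q \<Rightarrow> real"
  assumes "(f \<longlongrightarrow> 0) F" "eventually (\<lambda>p. \<bar>g p\<bar> \<le> B) F"
  shows "((\<lambda>p. f p * g p) \<longlongrightarrow> 0) F"
proof (rule tendsto_0_le[OF assms(1)])
  show "\<forall>\<^sub>F p in F. norm (f p * g p) \<le> norm (f p) * B"
    using assms(2) by eventually_elim (auto simp: abs_mult intro!: mult_left_mono)
qed

text \<open>The quotient of consecutive values lies between 1 - e k and 1 + e k. The product of the
  upper factors is bounded, which makes the increments uniformly summable; the product of the lower
  ones stays away from 0, which makes the limit positive.\<close>

lemma uniform_limit_almost_multiplicative:
  fixes G :: "nat \<Rightarrow> 'p \<Rightarrow> real"
  assumes pos: "\<And>k x. x \<in> K \<Longrightarrow> G k x > 0"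
    and step: "\<And>k x. x \<in> K \<Longrightarrow> \<bar>G (Suc k) x - G k x\<bar> \<le> e k * G k x"
    and e: "summable e" and bdd: "\<And>x. x \<in> K \<Longrightarrow> G 0 x \<le> B"
  obtains g M where "uniform_limit K G g sequentially" "\<And>x. x \<in> K \<Longrightarrow> g x > 0" "\<And>k x. x \<in> K \<Longrightarrow> G k x \<le> M"
proof (cases "K = {}")
  case True then show ?thesis using that by simp
next
  case False
  then obtain x0 where x0: "x0 \<in> K" by blast
  have e0: "e k \<ge> 0" for k
  proof -
    have "0 \<le> e k * G k x0" using step[OF x0, of k] by linarith
    then show ?thesis using pos[OF x0, of k] by (simp add: zero_le_mult_iff)
  qed
  have B: "B \<ge> 0" using bdd[OF x0] pos[OF x0, of 0] by linarith
  define M where "M = B * exp (suminf e)"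
  have upper: "G k x \<le> B * exp (\<Sum>i<k. e i)" if x: "x \<in> K" for k x
  proof (induction k)
    case 0 then show ?case using bdd[OF x] by simp
  next
    case (Suc k)
    have "G (Suc k) x \<le> (1 + e k) * G k x" using step[OF x, of k] by (simp add: algebra_simps)
    also have "\<dots> \<le> exp (e k) * (B * exp (\<Sum>i<k. e i))"
      using Suc e0[of k] pos[OF x, of k] B by (intro mult_mono exp_ge_add_one_self) auto
    finally show ?case by (simp add: exp_add algebra_simps)
  qed
  have GM: "G k x \<le> M" if x: "x \<in> K" for k x
  proof -
    have "(\<Sum>i<k. e i) \<le> suminf e" by (rule sum_le_suminf[OF e]) (use e0 in auto)
    then have "B * exp (\<Sum>i<k. e i) \<le> M" unfolding M_def using B by (intro mult_left_mono) auto
    then show ?thesis using upper[OF x, of k] by linarith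
  qed
  have "uniform_limit K (\<lambda>n x. \<Sum>i<n. G (Suc i) x - G i x) (\<lambda>x. \<Sum>i. G (Suc i) x - G i x) sequentially"
  proof (rule Weierstrass_m_test)
    show "norm (G (Suc k) x - G k x) \<le> e k * M" if "x \<in> K" for k x
    proof -
      have "e k * G k x \<le> e k * M" by (intro mult_left_mono GM that e0)
      then show ?thesis using step[OF that, of k] by simp
    qed
    show "summable (\<lambda>k. e k * M)" using e by (rule summable_mult2)
  qed
  then have "uniform_limit K (\<lambda>n x. (\<Sum>i<n. G (Suc i) x - G i x) + G 0 x) (\<lambda>x. (\<Sum>i. G (Suc i) x - G i x) + G 0 x) sequentially"
    by (intro uniform_limit_add uniform_limit_const)
  moreover have "(\<Sum>i<n. G (Suc i) x - G i x) + G 0 x = G n x" for n x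
    by (induction n) auto
  ultimately have lim: "uniform_limit K G (\<lambda>x. (\<Sum>i. G (Suc i) x - G i x) + G 0 x) sequentially" by simp
  show ?thesis
  proof (rule that[OF lim _ GM])
    fix x assume x: "x \<in> K"
    let ?g = "(\<Sum>i. G (Suc i) x - G i x) + G 0 x"
    have l: "(\<lambda>k. G k x) \<longlonglongrightarrow> ?g" by (rule tendsto_uniform_limitI[OF lim x])
    have "e \<longlonglongrightarrow> 0" using e by (rule summable_LIMSEQ_zero)
    then have "eventually (\<lambda>k. e k < 1/2) sequentially" by (rule order_tendstoD) simp
    then obtain k0 where k0: "\<And>k. k \<ge> k0 \<Longrightarrow> e k < 1/2" unfolding eventually_sequentially by blast
    have lower: "G k0 x * exp (- (2 * (\<Sum>i<m. e (i + k0)))) \<le> G (m + k0) x" for m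
    proof (induction m)
      case (Suc m)
      have h: "e (m + k0) < 1/2" by (rule k0) simp
      \<comment> \<open>For e in [0, 1/2) one has (1 - e) (1 + 2 e) >= 1, and 1 + 2 e <= exp (2 e).
        The lower product is thus bounded by an exponential of a convergent sum.\<close>
      have "exp (- (2 * e (m + k0))) \<le> 1 - e (m + k0)"
      proof -
        have "1 + 2 * e (m + k0) \<le> exp (2 * e (m + k0))" by (rule exp_ge_add_one_self)
        moreover have "(1 - e (m + k0)) * (1 + 2 * e (m + k0)) \<ge> 1"
        proof -
          have "e (m + k0) * (1 - 2 * e (m + k0)) \<ge> 0" using h e0[of "m + k0"] by (intro mult_nonneg_nonneg) auto
          then show ?thesis by (simp add: algebra_simps)
        qed
        moreover have "0 \<le> 1 - e (m + k0)" using h by simp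
        ultimately have "1 \<le> (1 - e (m + k0)) * exp (2 * e (m + k0))"
          using mult_left_mono order_trans by blast
        then show ?thesis by (simp add: exp_minus field_simps)
      qed
      then have "exp (- (2 * e (m + k0))) * (G k0 x * exp (- (2 * (\<Sum>i<m. e (i + k0)))))
          \<le> (1 - e (m + k0)) * (G k0 x * exp (- (2 * (\<Sum>i<m. e (i + k0)))))"
        using pos[OF x, of k0] by (intro mult_right_mono) auto
      moreover have "exp (- (2 * (\<Sum>i<Suc m. e (i + k0)))) = exp (- (2 * e (m + k0))) * exp (- (2 * (\<Sum>i<m. e (i + k0))))"
        by (simp add: exp_add[symmetric])
      ultimately have "G k0 x * exp (- (2 * (\<Sum>i<Suc m. e (i + k0)))) \<le> (1 - e (m + k0)) * (G k0 x * exp (- (2 * (\<Sum>i<m. e (i + k0)))))"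
        by (simp only: mult.left_commute)
      also have "\<dots> \<le> (1 - e (m + k0)) * G (m + k0) x" using Suc h by (intro mult_left_mono) auto
      also have "\<dots> \<le> G (Suc m + k0) x" using step[OF x, of "m + k0"] by (simp add: algebra_simps)
      finally show ?case .
    qed simp
    have "G k0 x * exp (- (2 * (\<Sum>i. e (i + k0)))) \<le> ?g"
    proof (rule LIMSEQ_le_const[OF LIMSEQ_ignore_initial_segment[OF l, of k0]], intro exI[of _ 0] allI impI)
      fix m
      have "(\<Sum>i<m. e (i + k0)) \<le> (\<Sum>i. e (i + k0))"
        by (rule sum_le_suminf[OF summable_ignore_initial_segment[OF e]]) (use e0 in auto)
      then have "G k0 x * exp (- (2 * (\<Sum>i. e (i + k0)))) \<le> G k0 x * exp (- (2 * (\<Sum>i<m. e (i + k0))))"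
        using pos[OF x, of k0] by (intro mult_left_mono) auto
      then show "G k0 x * exp (- (2 * (\<Sum>i. e (i + k0)))) \<le> G (m + k0) x" using lower[of m] by linarith
    qed
    moreover have "G k0 x * exp (- (2 * (\<Sum>i. e (i + k0)))) > 0" using pos[OF x, of k0] by simp
    ultimately show "?g > 0" by linarith
  qed
qed

lemma uniform_cesaro:
  fixes h :: "nat \<Rightarrow> 'p \<Rightarrow> real" and w :: "nat \<Rightarrow> real"
  assumes w: "\<And>k. w k > 0" "\<not> summable w" and lim: "uniform_limit K h g sequentially"
    and bdd: "\<And>k. bounded ((\<lambda>x. h k x - g x) ` K)"
  shows "uniform_limit K (\<lambda>n x. (\<Sum>k<n. w k * h k x) / (\<Sum>k<n. w k)) g sequentially"
  unfolding uniform_limit_sequentially_iff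
proof (intro allI impI)
  fix e :: real assume e: "e > 0"
  then obtain n0 where n0: "\<And>n x. n \<ge> n0 \<Longrightarrow> x \<in> K \<Longrightarrow> dist (h n x) (g x) < e / 2"
    using lim unfolding uniform_limit_sequentially_iff by (meson half_gt_zero)
  have "\<forall>k. \<exists>C. \<forall>x\<in>K. \<bar>h k x - g x\<bar> \<le> C" using bdd by (auto simp: bounded_iff)
  then obtain C where C: "\<And>k x. x \<in> K \<Longrightarrow> \<bar>h k x - g x\<bar> \<le> C k" by metis
  define W where "W n = (\<Sum>k<n. w k)" for n
  \<comment> \<open>Bounds the terms before \<open>n0\<close> uniformly on K, which is the purpose
    of \<open>bdd\<close>. Once the total weight exceeds 2 (M + 1) / e, they cost less than e /
    2.\<close>
  define M where "M = (\<Sum>k<n0. w k * \<bar>C k\<bar>)"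
  have W_unb: "\<exists>n. W n > B" for B
  proof (rule ccontr)
    assume "\<not> (\<exists>n. W n > B)"
    then have "summable w" using w(1) by (intro summableI_nonneg_bounded[of w B]) (auto simp: W_def less_imp_le not_less)
    with w(2) show False by simp
  qed
  obtain n1 where n1: "W n1 > max 1 (2 * (M + 1) / e)" using W_unb by blast
  have "dist ((\<Sum>k<n. w k * h k x) / (\<Sum>k<n. w k)) (g x) < e" if n: "n \<ge> max n0 n1" and x: "x \<in> K" for n x
  proof -
    have "W n1 \<le> W n" unfolding W_def using n w(1) by (intro sum_mono2) (auto simp: less_imp_le)
    with n1 have W: "W n > 1" "W n > 2 * (M + 1) / e" by linarith+
    have "\<bar>\<Sum>k<n. w k * (h k x - g x)\<bar> \<le> (\<Sum>k<n. w k * \<bar>h k x - g x\<bar>)"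
      by (rule order_trans[OF sum_abs]) (simp add: abs_mult w(1) less_imp_le)
    also have "(\<Sum>k<n. w k * \<bar>h k x - g x\<bar>) = (\<Sum>k<n0. w k * \<bar>h k x - g x\<bar>) + (\<Sum>k=n0..<n. w k * \<bar>h k x - g x\<bar>)"
      using n by (simp add: lessThan_atLeast0 sum.atLeastLessThan_concat)
    also have "(\<Sum>k<n0. w k * \<bar>h k x - g x\<bar>) \<le> M"
      unfolding M_def using C[OF x] w(1) by (intro sum_mono mult_left_mono) (auto simp: less_imp_le intro: order_trans[OF _ abs_ge_self])
    also have "(\<Sum>k=n0..<n. w k * \<bar>h k x - g x\<bar>) \<le> (\<Sum>k=n0..<n. w k * (e / 2))"
      using n0[OF _ x] w(1) by (intro sum_mono mult_left_mono) (auto simp: less_imp_le dist_real_def)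
    also have "\<dots> \<le> (\<Sum>k<n. w k * (e / 2))" using w(1) e by (intro sum_mono2) (auto simp: less_imp_le)
    also have "\<dots> = W n * (e / 2)" unfolding W_def by (rule sum_distrib_right[symmetric])
    finally have "\<bar>\<Sum>k<n. w k * (h k x - g x)\<bar> \<le> M + W n * (e / 2)" by simp
    also have "\<dots> < W n * e"
    proof -
      have "2 * (M + 1) < W n * e" using W(2) e by (simp add: pos_divide_less_eq)
      then show ?thesis by (simp add: algebra_simps)
    qed
    finally have 1: "\<bar>\<Sum>k<n. w k * (h k x - g x)\<bar> < W n * e" .
    have "(\<Sum>k<n. w k * (h k x - g x)) = (\<Sum>k<n. w k * h k x) - W n * g x"
      unfolding W_def by (simp add: right_diff_distrib sum_subtractf sum_distrib_right)
    then have "(\<Sum>k<n. w k * h k x) / W n - g x = (\<Sum>k<n. w k * (h k x - g x)) / W n"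
      using W(1) by (simp add: diff_divide_distrib)
    then have "\<bar>(\<Sum>k<n. w k * h k x) / W n - g x\<bar> < e"
      using 1 W(1) by (simp add: pos_divide_less_eq mult.commute)
    then show ?thesis by (simp add: W_def dist_real_def)
  qed
  then show "\<exists>N. \<forall>n\<ge>N. \<forall>x\<in>K. dist ((\<Sum>k<n. w k * h k x) / (\<Sum>k<n. w k)) (g x) < e" by blast
qed

section \<open>Convergence of the amplitude\<close>

text \<open>For the matrix with rows (A, B) and (C, D), determinant 1 and trace in (-2, 2), this is
  the z in the upper half-plane for which (-z, 1) is a left eigenvector; the eigenvalue is D - z B.
  The determinant has been used to eliminate C.\<close>

definition fixed_point :: "real \<Rightarrow> real \<Rightarrow> real \<Rightarrow> complex" where
  "fixed_point A B D = Complex ((D - A) / (2 * B)) (sqrt (4 - (A + D)\<^sup>2) / (2 * \<bar>B\<bar>))"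

lemma abs_mult_le:
  fixes x y p q :: real
  assumes "\<bar>x\<bar> \<le> p" "\<bar>y\<bar> \<le> q" shows "\<bar>x * y\<bar> \<le> p * q"
  unfolding abs_mult by (rule mult_mono') (use assms in auto)

text \<open>A nonreal z makes the single complex number v2 - z v1 control the real number v1, and
  with it v2.\<close>

lemma abs_le_of_Im:
  assumes "Im z > 0"
  shows "\<bar>v1\<bar> \<le> norm (complex_of_real v2 - z * of_real v1) / Im z"
proof -
  have "Im z * \<bar>v1\<bar> = \<bar>Im (complex_of_real v2 - z * of_real v1)\<bar>" using assms by (simp add: abs_mult)
  also have "\<dots> \<le> norm (complex_of_real v2 - z * of_real v1)" by (rule abs_Im_le_cmod)
  finally show ?thesis using assms by (simp add: field_simps)
qed

text \<open>
  The factor \<open>lam\<close> is the one by which \<open>v2 - z v1\<close> gets multiplied in one step, up to the error \<open>e\<close>.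
\<close>

lemma Im_moebius:
  assumes "e = z * (of_real D - z' * of_real B) - z' * of_real A + of_real C"
    "lam = of_real D - z' * of_real B"
  shows "(norm lam)\<^sup>2 * Im z = (A * D - B * C) * Im z' + Im (cnj lam * e)"
proof -
  have "e = lam * z + (of_real C - z' * of_real A)" unfolding assms by (simp add: algebra_simps)
  then have "Im (cnj lam * e) = Im (lam * cnj lam * z) + Im (cnj lam * (of_real C - z' * of_real A))"
    by (simp only: distrib_left mult_ac plus_complex.simps)
  also have "Im (lam * cnj lam * z) = (norm lam)\<^sup>2 * Im z"
    by (simp only: cmod_power2) (simp add: power2_eq_square algebra_simps)
  also have "Im (cnj lam * (of_real C - z' * of_real A)) = - ((A * D - B * C) * Im z')"
    unfolding assms(2) by (simp add: algebra_simps)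
  finally show ?thesis by simp
qed

text \<open>If e = 0, the step multiplies v2 - z v1 by \<open>lam\<close>, and by
  \<open>Im_moebius\<close> the squared modulus of \<open>lam\<close> is d Im z' / Im z; since wt' =
  wt / d, the amplitude is then preserved exactly. In general its relative change is linear in
  e.\<close>

lemma amplitude_step:
  fixes z z' e lam :: complex and v1 v2 v1' v2' A B C D d wt wt' \<eta> L :: real
  defines "l \<equiv> complex_of_real v2 - z * of_real v1"
  assumes e: "e = z * (of_real D - z' * of_real B) - z' * of_real A + of_real C"
    and lam: "lam = of_real D - z' * of_real B" and d: "d = A * D - B * C" "d \<ge> 1/2"
    and wt: "wt > 0" "wt' = wt / d" and \<eta>: "\<eta> > 0" "Im z \<ge> \<eta>" "Im z' \<ge> \<eta>"
    and L: "norm lam \<le> L" "norm e \<le> 1"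
    and v: "v1' = A * v1 + B * v2" "v2' = C * v1 + D * v2"
  shows "\<bar>wt' * (norm (complex_of_real v2' - z' * of_real v1'))\<^sup>2 / Im z' - wt * (norm l)\<^sup>2 / Im z\<bar>
    \<le> ((3 * L + 1 / \<eta>) * (2 / \<eta>)) * norm e * (wt * (norm l)\<^sup>2 / Im z)"
proof -
  define y where "y = Im z"
  define y' where "y' = Im z'"
  have pos: "y > 0" "y' > 0" "d > 0" using \<eta> d by (auto simp: y_def y'_def)
  define n where "n = norm l"
  define R where "R = (norm (lam * l + e * of_real v1))\<^sup>2 - (norm lam * n)\<^sup>2"
  have l': "complex_of_real v2' - z' * of_real v1' = lam * l + e * of_real v1"
    unfolding v l_def e lam by (simp add: algebra_simps)
  have Imrel: "(norm lam)\<^sup>2 * y = d * y' + Im (cnj lam * e)"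
    unfolding d(1) y_def y'_def by (rule Im_moebius[OF e lam])
  have v1: "\<bar>v1\<bar> \<le> n / y" unfolding n_def l_def y_def by (rule abs_le_of_Im) (use pos y_def in simp)
  have n0: "n \<ge> 0" by (simp add: n_def)
  \<comment> \<open>Here \<open>lam l\<close> is perturbed by e v1, and |v1| is at most |l| / y. The
    difference of the squares is the difference of the moduli times their sum.\<close>
  have R: "\<bar>R\<bar> \<le> norm e * n\<^sup>2 * (2 * L + 1 / \<eta>) / y"
  proof -
    let ?a = "norm (lam * l + e * of_real v1)" and ?b = "norm lam * n"
    have "\<bar>?a - norm (lam * l)\<bar> \<le> norm (e * complex_of_real v1)"
      using norm_triangle_ineq3[of "lam * l + e * of_real v1" "lam * l"] by simp
    then have ab: "\<bar>?a - ?b\<bar> \<le> norm e * \<bar>v1\<bar>" by (simp add: norm_mult n_def)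
    also have "\<dots> \<le> norm e * (n / y)" by (intro mult_left_mono v1) auto
    finally have 1: "\<bar>?a - ?b\<bar> \<le> norm e * (n / y)" .
    have "1 / y \<le> 1 / \<eta>" using \<eta> pos by (simp add: y_def frac_le)
    then have "n * (1 / y) \<le> n * (1 / \<eta>)" by (intro mult_left_mono n0)
    then have "norm e * (n / y) \<le> 1 * (n * (1 / \<eta>))" using L(2) n0 pos by (intro mult_mono) auto
    moreover have "?b \<le> L * n" using L(1) n0 by (intro mult_right_mono)
    ultimately have 2: "?a + ?b \<le> n * (2 * L + 1 / \<eta>)" using 1 by (simp add: algebra_simps)
    have "R = (?a - ?b) * (?a + ?b)" by (simp add: R_def power2_eq_square algebra_simps)
    then have "\<bar>R\<bar> = \<bar>?a - ?b\<bar> * (?a + ?b)" using n0 by (simp add: abs_mult)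
    also have "\<dots> \<le> (norm e * (n / y)) * (n * (2 * L + 1 / \<eta>))"
      using 1 2 n0 pos by (intro mult_mono) auto
    also have "\<dots> = norm e * n\<^sup>2 * (2 * L + 1 / \<eta>) / y"
      by (simp only: power2_eq_square times_divide_eq_right times_divide_eq_left mult_ac)
    finally show ?thesis .
  qed
  have I: "\<bar>Im (cnj lam * e)\<bar> \<le> L * norm e"
  proof -
    have "\<bar>Im (cnj lam * e)\<bar> \<le> norm (cnj lam * e)" by (rule abs_Im_le_cmod)
    also have "\<dots> = norm lam * norm e" by (simp add: norm_mult)
    also have "\<dots> \<le> L * norm e" using L(1) by (intro mult_right_mono) auto
    finally show ?thesis .
  qed
  have "wt' * (norm (complex_of_real v2' - z' * of_real v1'))\<^sup>2 / Im z' - wt * (norm l)\<^sup>2 / Im z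
     = wt / d * ((norm lam)\<^sup>2 * n\<^sup>2 + R) / y' - wt * n\<^sup>2 / y"
    unfolding l' R_def wt(2) y_def y'_def n_def by (simp add: power_mult_distrib)
  also have "\<dots> = wt / (d * y' * y) * (n\<^sup>2 * ((norm lam)\<^sup>2 * y) + R * y - n\<^sup>2 * (d * y'))"
    using pos by (simp add: field_simps)
  also have "\<dots> = wt / (d * y' * y) * (n\<^sup>2 * Im (cnj lam * e) + R * y)"
    unfolding Imrel by (simp add: algebra_simps)
  finally have eq: "\<bar>wt' * (norm (complex_of_real v2' - z' * of_real v1'))\<^sup>2 / Im z' - wt * (norm l)\<^sup>2 / Im z\<bar>
     = wt / (d * y' * y) * \<bar>n\<^sup>2 * Im (cnj lam * e) + R * y\<bar>"
    using pos wt by (simp add: abs_mult)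
  have "\<bar>n\<^sup>2 * Im (cnj lam * e) + R * y\<bar> \<le> n\<^sup>2 * \<bar>Im (cnj lam * e)\<bar> + \<bar>R\<bar> * y"
    using abs_triangle_ineq[of "n\<^sup>2 * Im (cnj lam * e)" "R * y"] pos by (simp add: abs_mult)
  also have "\<dots> \<le> n\<^sup>2 * (L * norm e) + (norm e * n\<^sup>2 * (2 * L + 1 / \<eta>) / y) * y"
    using I R pos by (intro add_mono mult_left_mono mult_right_mono) auto
  also have "\<dots> = n\<^sup>2 * (L * norm e) + norm e * n\<^sup>2 * (2 * L + 1 / \<eta>)" using pos by simp
  also have "\<dots> = norm e * n\<^sup>2 * (3 * L + 1 / \<eta>)" by (simp add: algebra_simps)
  finally have bd: "\<bar>n\<^sup>2 * Im (cnj lam * e) + R * y\<bar> \<le> norm e * n\<^sup>2 * (3 * L + 1 / \<eta>)" .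
  have L0: "L \<ge> 0" using L(1) norm_ge_zero[of lam] by linarith
  \<comment> \<open>The factor 2 comes from d >= 1/2.\<close>
  have "wt / (d * y' * y) \<le> (2 / \<eta>) * (wt / y)"
  proof -
    have "(1/2) * \<eta> \<le> d * y'" using d \<eta> by (intro mult_mono) (auto simp: y'_def)
    then have "1 / (d * y') \<le> 1 / ((1/2) * \<eta>)" using \<eta> pos by (intro divide_left_mono) auto
    then have "1 / (d * y') \<le> 2 / \<eta>" by simp
    from mult_right_mono[OF this, of "wt / y"] show ?thesis using pos wt by simp
  qed
  then have "wt / (d * y' * y) * \<bar>n\<^sup>2 * Im (cnj lam * e) + R * y\<bar> \<le> ((2 / \<eta>) * (wt / y)) * (norm e * n\<^sup>2 * (3 * L + 1 / \<eta>))"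
    using bd pos wt \<eta> by (intro mult_mono) auto
  also have "\<dots> = ((3 * L + 1 / \<eta>) * (2 / \<eta>)) * norm e * (wt * (norm l)\<^sup>2 / Im z)"
    by (simp add: n_def y_def)
  finally show ?thesis using eq by simp
qed

context symb_scale begin

lemma symb_offset: "symb K t m J y \<Longrightarrow> symb K t m J (\<lambda>k x. y (k + i) x)"
proof (induction i)
  case (Suc i)
  from symb_shift[OF Suc.IH[OF Suc.prems]] show ?case by simp
qed simp

text \<open>Formed with the corrected fixed points, the amplitude has relative increments of order
  \<open>t k ^ r\<close>, which are summable, so it has a positive limit. The corrected fixed points
  tend to the fixed point of the limit matrix, so exchanging them for it multiplies the amplitude by
  a factor tending to 1.\<close>

lemma amplitude_limit:
  fixes A B C D v1 v2 :: "nat \<Rightarrow> 'p \<Rightarrow> real" and wt :: "nat \<Rightarrow> real"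
  assumes r: "r \<ge> 1" and sum: "summable (\<lambda>k. t k ^ r)"
    and A: "symb K t 0 r (\<lambda>k x. of_real (A k x))" and B: "symb K t 0 r (\<lambda>k x. of_real (B k x))"
    and C: "symb K t 0 r (\<lambda>k x. of_real (C k x))" and D: "symb K t 0 r (\<lambda>k x. of_real (D k x))"
    and limA: "((\<lambda>p. A (fst p) (snd p)) \<longlongrightarrow> A0) (ufilter K)" and limB: "((\<lambda>p. B (fst p) (snd p)) \<longlongrightarrow> B0) (ufilter K)"
    and limC: "((\<lambda>p. C (fst p) (snd p)) \<longlongrightarrow> C0) (ufilter K)" and limD: "((\<lambda>p. D (fst p) (snd p)) \<longlongrightarrow> D0) (ufilter K)"
    and det0: "A0 * D0 - B0 * C0 = 1" and tr0: "\<bar>A0 + D0\<bar> < 2"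
    and det: "\<And>k x. x \<in> K \<Longrightarrow> A k x * D k x - B k x * C k x = wt k / wt (Suc k)"
    and wt: "\<And>k. wt k > 0"
    and v: "\<And>k x. x \<in> K \<Longrightarrow> v1 (Suc k) x = A k x * v1 k x + B k x * v2 k x"
      "\<And>k x. x \<in> K \<Longrightarrow> v2 (Suc k) x = C k x * v1 k x + D k x * v2 k x"
    and nz: "\<And>k x. x \<in> K \<Longrightarrow> v1 k x \<noteq> 0 \<or> v2 k x \<noteq> 0"
    and bdd: "\<And>k. bounded (v1 k ` K)" "\<And>k. bounded (v2 k ` K)"
  obtains g where
    "uniform_limit K (\<lambda>k x. wt k * (norm (complex_of_real (v2 k x) - fixed_point A0 B0 D0 * of_real (v1 k x)))\<^sup>2 / Im (fixed_point A0 B0 D0)) g sequentially"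
    "\<And>x. x \<in> K \<Longrightarrow> g x > 0" "bounded (g ` K)"
proof -
  define z0 where "z0 = fixed_point A0 B0 D0"
  define s0 where "s0 = 4 - (A0 + D0)\<^sup>2"
  have "(A0 + D0)\<^sup>2 < 2\<^sup>2" using power_strict_mono[of "\<bar>A0 + D0\<bar>" 2 2] tr0 by simp
  then have s0: "s0 > 0" by (simp add: s0_def)
  have B0: "B0 \<noteq> 0"
  proof
    assume "B0 = 0"
    then have "s0 = - (A0 - D0)\<^sup>2" using det0 by (simp add: s0_def power2_eq_square algebra_simps)
    then show False using s0 zero_le_power2[of "A0 - D0"] by linarith
  qed
  define \<sigma> where "\<sigma> = sgn B0"
  have \<sigma>: "\<sigma> = 1 \<or> \<sigma> = -1" "\<sigma> * B0 = \<bar>B0\<bar>" using B0 by (auto simp: \<sigma>_def sgn_if)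
  have Im0: "Im z0 > 0" using s0 B0 by (simp add: z0_def fixed_point_def s0_def)
  define dk where "dk k x = 4 * (A k x * D k x - B k x * C k x) - (A k x + D k x)\<^sup>2" for k x
  have limd: "((\<lambda>p. dk (fst p) (snd p)) \<longlongrightarrow> s0) (ufilter K)"
  proof -
    have "((\<lambda>p. dk (fst p) (snd p)) \<longlongrightarrow> 4 * (A0 * D0 - B0 * C0) - (A0 + D0)\<^sup>2) (ufilter K)"
      unfolding dk_def by (intro tendsto_intros limA limB limC limD)
    then show ?thesis by (simp add: det0 s0_def)
  qed
  have lims: "((\<lambda>p. \<sigma> * B (fst p) (snd p)) \<longlongrightarrow> \<bar>B0\<bar>) (ufilter K)"
    using tendsto_mult[OF tendsto_const[of \<sigma>] limB] \<sigma>(2) by simp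
  \<comment> \<open>A bound below both limits, so that the discriminant and \<sigma> B exceed it
    from some index \<open>k0\<close> on. Before \<open>k0\<close> the matrices need not be
    elliptic, so everything is shifted by \<open>k0\<close>.\<close>
  define c where "c = min (s0 / 2) (\<bar>B0\<bar> / 2)"
  have c: "c > 0" "c < s0" "c < \<bar>B0\<bar>" using s0 B0 by (auto simp: c_def min_def)
  have "eventually (\<lambda>p. c < dk (fst p) (snd p) \<and> c < \<sigma> * B (fst p) (snd p)) (ufilter K)"
    using order_tendstoD(1)[OF limd c(2)] order_tendstoD(1)[OF lims c(3)] by eventually_elim simp
  then obtain k0 where k0: "\<And>k x. k \<ge> k0 \<Longrightarrow> x \<in> K \<Longrightarrow> c < dk k x \<and> c < \<sigma> * B k x"
    unfolding eventually_ufilter by auto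
  have Bc: "c \<le> \<sigma> * B (k + k0) x" and dc: "c \<le> 4 * (A (k + k0) x * D (k + k0) x - B (k + k0) x * C (k + k0) x) - (A (k + k0) x + D (k + k0) x)\<^sup>2"
    if "x \<in> K" for k x
    using k0[of "k + k0" x] that by (auto simp: dk_def)
  from riccati_approx[OF r \<sigma>(1) c(1) symb_offset[OF A] symb_offset[OF B] symb_offset[OF C] symb_offset[OF D] Bc dc]
  obtain z where z1: "symb K t 1 0 (\<lambda>k x. z k x - Complex ((D (k + k0) x - A (k + k0) x) / (2 * B (k + k0) x))
       (\<sigma> * sqrt (4 * (A (k + k0) x * D (k + k0) x - B (k + k0) x * C (k + k0) x) - (A (k + k0) x + D (k + k0) x)\<^sup>2) / (2 * B (k + k0) x)))"
    and z2: "symb K t r 0 (\<lambda>k x. z k x * (of_real (D (k + k0) x) - z (Suc k) x * of_real (B (k + k0) x)) - z (Suc k) x * of_real (A (k + k0) x) + of_real (C (k + k0) x))"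
    by blast
  define z0k where "z0k k x = Complex ((D (k + k0) x - A (k + k0) x) / (2 * B (k + k0) x))
       (\<sigma> * sqrt (dk (k + k0) x) / (2 * B (k + k0) x))" for k x
  define e where "e k x = z k x * (of_real (D (k + k0) x) - z (Suc k) x * of_real (B (k + k0) x)) - z (Suc k) x * of_real (A (k + k0) x) + of_real (C (k + k0) x)" for k x
  have limt: "t \<longlonglongrightarrow> 0"
  proof -
    have "(\<lambda>k. t k ^ r) \<longlonglongrightarrow> 0" using sum by (rule summable_LIMSEQ_zero)
    then have "(\<lambda>k. root r (t k ^ r)) \<longlonglongrightarrow> root r 0" by (rule tendsto_real_root)
    then show ?thesis using r t_nonneg by (simp add: real_root_power_cancel)
  qed
  have limz0k: "((\<lambda>p. z0k (fst p) (snd p)) \<longlongrightarrow> z0) (ufilter K)"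
  proof -
    have "((\<lambda>p. z0k (fst p) (snd p)) \<longlongrightarrow> Complex ((D0 - A0) / (2 * B0)) (\<sigma> * sqrt s0 / (2 * B0))) (ufilter K)"
      unfolding z0k_def
      by (intro tendsto_Complex tendsto_divide tendsto_mult tendsto_diff tendsto_const tendsto_real_sqrt
          tendsto_ufilter_offset[OF limA] tendsto_ufilter_offset[OF limB] tendsto_ufilter_offset[OF limD] tendsto_ufilter_offset[OF limd])
        (use B0 in auto)
    moreover have "\<sigma> * sqrt s0 / (2 * B0) = sqrt s0 / (2 * \<bar>B0\<bar>)"
      using B0 by (auto simp: \<sigma>_def sgn_if)
    ultimately show ?thesis by (simp add: z0_def fixed_point_def s0_def)
  qed
  have limz: "((\<lambda>p. z (fst p) (snd p)) \<longlongrightarrow> z0) (ufilter K)"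
  proof -
    obtain C1 where C1: "C1 \<ge> 0" "\<And>k x. x \<in> K \<Longrightarrow> norm (z k x - z0k k x) \<le> C1 * t k ^ 1"
      using symb_bound[OF z1] unfolding z0k_def dk_def by blast
    have "((\<lambda>p. z (fst p) (snd p) - z0k (fst p) (snd p)) \<longlongrightarrow> 0) (ufilter K)"
    proof (rule Lim_null_comparison)
      show "((\<lambda>p. C1 * t (fst p)) \<longlongrightarrow> 0) (ufilter K)"
        using tendsto_mult[OF tendsto_const[of C1] tendsto_ufilter_seq[OF limt]] by simp
      show "\<forall>\<^sub>F p in ufilter K. norm (z (fst p) (snd p) - z0k (fst p) (snd p)) \<le> C1 * t (fst p)"
        unfolding eventually_ufilter using C1(2) by auto
    qed
    from tendsto_add[OF this limz0k] show ?thesis by simp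
  qed
  obtain Ce where Ce: "Ce \<ge> 0" "\<And>k x. x \<in> K \<Longrightarrow> norm (e k x) \<le> Ce * t k ^ r"
    using symb_bound[OF z2] unfolding e_def by blast
  define lam where "lam k x = of_real (D (k + k0) x) - z (Suc k) x * of_real (B (k + k0) x)" for k x
  define lam0 where "lam0 = of_real D0 - z0 * of_real B0"
  have limlam: "((\<lambda>p. lam (fst p) (snd p)) \<longlongrightarrow> lam0) (ufilter K)"
    unfolding lam_def lam0_def
    by (intro tendsto_intros tendsto_ufilter_offset[OF limB] tendsto_ufilter_offset[OF limD] tendsto_ufilter_Suc[OF limz])
  have lime: "((\<lambda>p. e (fst p) (snd p)) \<longlongrightarrow> 0) (ufilter K)"
  proof (rule Lim_null_comparison)
    show "((\<lambda>p. Ce * t (fst p) ^ r) \<longlongrightarrow> 0) (ufilter K)"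
      using tendsto_ufilter_seq[OF tendsto_mult[OF tendsto_const[of Ce] summable_LIMSEQ_zero[OF sum]]] by simp
    show "\<forall>\<^sub>F p in ufilter K. norm (e (fst p) (snd p)) \<le> Ce * t (fst p) ^ r"
      unfolding eventually_ufilter using Ce(2) by auto
  qed
  define dd where "dd k x = A (k + k0) x * D (k + k0) x - B (k + k0) x * C (k + k0) x" for k x
  have limdd: "((\<lambda>p. dd (fst p) (snd p)) \<longlongrightarrow> 1) (ufilter K)"
    unfolding dd_def det0[symmetric]
    by (intro tendsto_intros tendsto_ufilter_offset[OF limB] tendsto_ufilter_offset[OF limD] tendsto_ufilter_offset[OF limA] tendsto_ufilter_offset[OF limC])
  \<comment> \<open>Half of the limit of the imaginary parts. From \<open>k1\<close> on, the
    imaginary parts exceed it and the other bounds of \<open>amplitude_step\<close> hold as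
    well.\<close>
  define \<eta> where "\<eta> = Im z0 / 2"
  define L where "L = norm lam0 + 1"
  have \<eta>: "\<eta> > 0" "\<eta> < Im z0" using Im0 by (auto simp: \<eta>_def)
  have "eventually (\<lambda>p. \<eta> < Im (z (fst p) (snd p)) \<and> norm (lam (fst p) (snd p)) < L \<and> norm (e (fst p) (snd p)) < 1 \<and> 1/2 < dd (fst p) (snd p)) (ufilter K)"
    using order_tendstoD(1)[OF tendsto_Im[OF limz] \<eta>(2)] order_tendstoD(2)[OF tendsto_norm[OF limlam], of L]
      order_tendstoD(2)[OF tendsto_norm[OF lime], of 1] order_tendstoD(1)[OF limdd, of "1/2"]
    by (simp add: L_def eventually_conj_iff)
  then obtain k1 where k1: "\<And>k x. k \<ge> k1 \<Longrightarrow> x \<in> K \<Longrightarrow>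
      \<eta> < Im (z k x) \<and> norm (lam k x) < L \<and> norm (e k x) < 1 \<and> 1/2 < dd k x"
    unfolding eventually_ufilter by auto
  define l where "l k x = complex_of_real (v2 (k + k0) x) - z k x * of_real (v1 (k + k0) x)" for k x
  define G where "G k x = wt (k + k0) * (norm (l k x))\<^sup>2 / Im (z k x)" for k x
  have v1_le: "\<bar>v1 (k + k0) x\<bar> \<le> norm (l k x) / \<eta>" if "k \<ge> k1" "x \<in> K" for k x
  proof -
    have y: "Im (z k x) > \<eta>" using k1[OF that] by simp
    have "\<bar>v1 (k + k0) x\<bar> \<le> norm (l k x) / Im (z k x)"
      unfolding l_def using y \<eta> by (intro abs_le_of_Im) auto
    also have "\<dots> \<le> norm (l k x) / \<eta>" using y \<eta> by (intro divide_left_mono) auto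
    finally show ?thesis .
  qed
  have l_nz: "l k x \<noteq> 0" if "k \<ge> k1" "x \<in> K" for k x
  proof
    assume 0: "l k x = 0"
    then have "v1 (k + k0) x = 0" using v1_le[OF that] by simp
    moreover then have "v2 (k + k0) x = 0" using 0 by (simp add: l_def)
    ultimately show False using nz[OF that(2), of "k + k0"] by simp
  qed
  have G_pos: "G k x > 0" if "k \<ge> k1" "x \<in> K" for k x
    unfolding G_def using l_nz[OF that] k1[OF that] \<eta> wt[of "k + k0"] by (intro divide_pos_pos mult_pos_pos) auto
  define Cc where "Cc = (3 * L + 1 / \<eta>) * (2 / \<eta>)"
  have Cc: "Cc \<ge> 0" unfolding Cc_def L_def using \<eta> by (intro mult_nonneg_nonneg add_nonneg_nonneg) auto
  have G_step: "\<bar>G (Suc k) x - G k x\<bar> \<le> (Cc * Ce * t k ^ r) * G k x" if k: "k \<ge> k1" and x: "x \<in> K" for k x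
  proof -
    have w': "wt (Suc k + k0) = wt (k + k0) / dd k x"
    proof -
      have "dd k x = wt (k + k0) / wt (Suc (k + k0))" unfolding dd_def by (rule det[OF x])
      then have w: "wt (k + k0) = dd k x * wt (Suc k + k0)" using wt[of "Suc (k + k0)"] by simp
      have "dd k x \<noteq> 0"
      proof
        assume "dd k x = 0"
        then show False using w wt[of "k + k0"] by simp
      qed
      then show ?thesis unfolding w by simp
    qed
    have "\<bar>G (Suc k) x - G k x\<bar> \<le> Cc * norm (e k x) * G k x"
      unfolding G_def l_def Cc_def
    proof (rule amplitude_step[where A = "A (k + k0) x" and B = "B (k + k0) x" and C = "C (k + k0) x" and D = "D (k + k0) x" and lam = "lam k x" and d = "dd k x"])
      show "v1 (Suc k + k0) x = A (k + k0) x * v1 (k + k0) x + B (k + k0) x * v2 (k + k0) x" using v(1)[OF x, of "k + k0"] by simp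
      show "v2 (Suc k + k0) x = C (k + k0) x * v1 (k + k0) x + D (k + k0) x * v2 (k + k0) x" using v(2)[OF x, of "k + k0"] by simp
    qed (use k1[OF k x] k1[of "Suc k" x] k x w' wt \<eta> in \<open>simp_all add: e_def lam_def dd_def\<close>)
    also have "\<dots> \<le> Cc * (Ce * t k ^ r) * G k x"
      using Ce(2)[OF x, of k] Cc G_pos[OF k x] by (intro mult_right_mono mult_left_mono) auto
    finally show ?thesis by (simp add: mult.assoc)
  qed
  obtain b1 where b1: "\<And>x. x \<in> K \<Longrightarrow> \<bar>v1 (k1 + k0) x\<bar> \<le> b1" using bdd(1)[of "k1 + k0"] by (auto simp: bounded_iff)
  obtain b2 where b2: "\<And>x. x \<in> K \<Longrightarrow> \<bar>v2 (k1 + k0) x\<bar> \<le> b2" using bdd(2)[of "k1 + k0"] by (auto simp: bounded_iff)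
  \<comment> \<open>The amplitude must be bounded on K at its first index \<open>k1\<close>, which
    needs a bound of z there. It is read off from the explicit uncorrected fixed point.\<close>
  obtain Cz where Cz: "\<And>x. x \<in> K \<Longrightarrow> norm (z k1 x) \<le> Cz"
  proof -
    obtain C1 where C1: "\<And>k x. x \<in> K \<Longrightarrow> norm (z k x - z0k k x) \<le> C1 * t k ^ 1"
      using symb_bound[OF z1] unfolding z0k_def dk_def by blast
    obtain CA CB CD CC where "\<And>x. x \<in> K \<Longrightarrow> norm (complex_of_real (A (k1 + k0) x)) \<le> CA" "\<And>x. x \<in> K \<Longrightarrow> norm (complex_of_real (B (k1 + k0) x)) \<le> CB"
      "\<And>x. x \<in> K \<Longrightarrow> norm (complex_of_real (D (k1 + k0) x)) \<le> CD" "\<And>x. x \<in> K \<Longrightarrow> norm (complex_of_real (C (k1 + k0) x)) \<le> CC"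
      using symb_bound[OF A] symb_bound[OF B] symb_bound[OF D] symb_bound[OF C] by metis
    then have bds: "\<bar>A (k1 + k0) x\<bar> \<le> CA" "\<bar>B (k1 + k0) x\<bar> \<le> CB" "\<bar>D (k1 + k0) x\<bar> \<le> CD" "\<bar>C (k1 + k0) x\<bar> \<le> CC" if "x \<in> K" for x using that by auto
    have z0kb: "norm (z0k k1 x) \<le> (\<bar>CD\<bar> + \<bar>CA\<bar>) / (2 * c) + sqrt (4 * (CA * CD + CB * CC)) / (2 * c)" if x: "x \<in> K" for x
    proof -
      have Bx: "c \<le> \<bar>B (k1 + k0) x\<bar>" using Bc[OF x, of k1] \<sigma>(1) by auto
      have "\<bar>Re (z0k k1 x)\<bar> = \<bar>D (k1 + k0) x - A (k1 + k0) x\<bar> / (2 * \<bar>B (k1 + k0) x\<bar>)"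
        by (simp add: z0k_def abs_mult)
      also have "\<dots> \<le> (\<bar>CD\<bar> + \<bar>CA\<bar>) / (2 * c)"
        using bds[OF x] Bx c by (intro frac_le) auto
      finally have 1: "\<bar>Re (z0k k1 x)\<bar> \<le> (\<bar>CD\<bar> + \<bar>CA\<bar>) / (2 * c)" .
      have dk0: "dk (k1 + k0) x > 0" using k0[of "k1 + k0" x] x c by auto
      have "A (k1 + k0) x * D (k1 + k0) x \<le> CA * CD"
        using abs_mult_le[OF bds(1)[OF x] bds(3)[OF x]] by linarith
      moreover have "- (B (k1 + k0) x * C (k1 + k0) x) \<le> CB * CC"
        using abs_mult_le[OF bds(2)[OF x] bds(4)[OF x]] by linarith
      ultimately have "dk (k1 + k0) x \<le> 4 * (CA * CD + CB * CC)"
      proof -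
        assume 1: "A (k1 + k0) x * D (k1 + k0) x \<le> CA * CD" and 2: "- (B (k1 + k0) x * C (k1 + k0) x) \<le> CB * CC"
        have gen: "4 * (p - q) - s \<le> 4 * (P + Q)" if "p \<le> P" "- q \<le> Q" "0 \<le> s" for p q s P Q :: real
          using that unfolding distrib_left right_diff_distrib by linarith
        show ?thesis unfolding dk_def by (rule gen[OF 1 2 zero_le_power2])
      qed
      then have s: "sqrt (dk (k1 + k0) x) \<le> sqrt (4 * (CA * CD + CB * CC))" by (rule real_sqrt_le_mono)
      have "\<bar>Im (z0k k1 x)\<bar> = sqrt (dk (k1 + k0) x) / (2 * \<bar>B (k1 + k0) x\<bar>)"
        using \<sigma>(1) dk0 by (auto simp: z0k_def abs_mult)
      also have "\<dots> \<le> sqrt (4 * (CA * CD + CB * CC)) / (2 * c)"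
        using s Bx c dk0 by (intro frac_le) (auto intro: order_trans[OF _ s])
      finally show ?thesis using 1 cmod_le[of "z0k k1 x"] by linarith
    qed
    show ?thesis
    proof (rule that)
      fix x assume x: "x \<in> K"
      show "norm (z k1 x) \<le> C1 * t k1 ^ 1 + ((\<bar>CD\<bar> + \<bar>CA\<bar>) / (2 * c) + sqrt (4 * (CA * CD + CB * CC)) / (2 * c))"
        using norm_triangle_sub[of "z k1 x" "z0k k1 x"] C1[OF x, of k1] z0kb[OF x] by linarith
    qed
  qed
  obtain g M where g: "uniform_limit K (\<lambda>k x. G (k + k1) x) g sequentially" "\<And>x. x \<in> K \<Longrightarrow> g x > 0" "\<And>k x. x \<in> K \<Longrightarrow> G (k + k1) x \<le> M"
  proof (rule uniform_limit_almost_multiplicative[of K "\<lambda>k x. G (k + k1) x" "\<lambda>k. Cc * Ce * t (k + k1) ^ r" "wt (k1 + k0) * (b2 + Cz * b1)\<^sup>2 / \<eta>"])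
    show "summable (\<lambda>k. Cc * Ce * t (k + k1) ^ r)" using summable_ignore_initial_segment[OF sum, of k1] by (rule summable_mult)
    show "\<bar>G (Suc k + k1) x - G (k + k1) x\<bar> \<le> Cc * Ce * t (k + k1) ^ r * G (k + k1) x" if "x \<in> K" for k x
      using G_step[of "k + k1" x] that by simp
    show "G (0 + k1) x \<le> wt (k1 + k0) * (b2 + Cz * b1)\<^sup>2 / \<eta>" if x: "x \<in> K" for x
    proof -
      have "norm (l k1 x) \<le> \<bar>v2 (k1 + k0) x\<bar> + norm (z k1 x) * \<bar>v1 (k1 + k0) x\<bar>"
        unfolding l_def by (rule order_trans[OF norm_triangle_ineq4]) (simp add: norm_mult)
      also have "\<dots> \<le> b2 + Cz * b1"
      proof (rule add_mono[OF b2[OF x]], rule mult_mono[OF Cz[OF x] b1[OF x]])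
        show "0 \<le> Cz" using Cz[OF x] norm_ge_zero[of "z k1 x"] by linarith
      qed simp
      finally have "(norm (l k1 x))\<^sup>2 \<le> (b2 + Cz * b1)\<^sup>2" by (intro power_mono) auto
      then show ?thesis unfolding G_def using k1[of k1 x] x \<eta> wt[of "k1 + k0"]
        by (simp, intro frac_le mult_left_mono mult_nonneg_nonneg) auto
    qed
  qed (use G_pos in auto)
  \<comment> \<open>Exchanging z for the limit gives v2 - z0 v1 = l (1 + (z - z0) q), and |q| is at
    most 1 / \<eta> by \<open>v1_le\<close>. So the quotient \<open>\<rho>\<close> of the two
    amplitudes tends to 1.\<close>
  define q where "q k x = complex_of_real (v1 (k + k0) x) / l k x" for k x
  define \<rho> where "\<rho> k x = (norm (1 + (z k x - z0) * q k x))\<^sup>2 * (Im (z k x) / Im z0)" for k x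
  have lim\<rho>: "((\<lambda>p. \<rho> (fst p) (snd p) - 1) \<longlongrightarrow> 0) (ufilter K)"
  proof -
    have "((\<lambda>p. (z (fst p) (snd p) - z0) * q (fst p) (snd p)) \<longlongrightarrow> 0) (ufilter K)"
    proof (rule tendsto_0_le[where K = "1 / \<eta>"])
      show "((\<lambda>p. z (fst p) (snd p) - z0) \<longlongrightarrow> 0) (ufilter K)" using limz by (rule LIM_zero)
      have "norm ((z k x - z0) * q k x) \<le> norm (z k x - z0) * (1 / \<eta>)" if "k \<ge> k1" "x \<in> K" for k x
      proof -
        have "norm (q k x) \<le> 1 / \<eta>" unfolding q_def norm_divide
          using v1_le[OF that] l_nz[OF that] \<eta> by (simp add: field_simps)
        then show ?thesis unfolding norm_mult by (intro mult_left_mono) auto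
      qed
      then show "\<forall>\<^sub>F p in ufilter K. norm ((z (fst p) (snd p) - z0) * q (fst p) (snd p)) \<le> norm (z (fst p) (snd p) - z0) * (1 / \<eta>)"
        unfolding eventually_ufilter by (intro exI[of _ k1]) auto
    qed
    then have "((\<lambda>p. \<rho> (fst p) (snd p)) \<longlongrightarrow> (norm (1 + 0 :: complex))\<^sup>2 * (Im z0 / Im z0)) (ufilter K)"
      unfolding \<rho>_def using Im0 by (intro tendsto_mult tendsto_power tendsto_norm tendsto_add tendsto_const tendsto_divide tendsto_Im limz) auto
    then show ?thesis using Im0 by (simp add: LIM_zero)
  qed
  define F where "F k x = wt k * (norm (complex_of_real (v2 k x) - z0 * of_real (v1 k x)))\<^sup>2 / Im z0" for k x
  have F: "F (k + k0) x = G k x * \<rho> k x" if "k \<ge> k1" "x \<in> K" for k x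
  proof -
    have "complex_of_real (v2 (k + k0) x) - z0 * of_real (v1 (k + k0) x) = l k x * (1 + (z k x - z0) * q k x)"
      using l_nz[OF that] by (simp add: q_def l_def field_simps)
    then show ?thesis unfolding F_def G_def \<rho>_def using Im0 k1[OF that] \<eta> by (simp add: norm_mult power_mult_distrib)
  qed
  have limFG: "((\<lambda>p. F (fst p + k1 + k0) (snd p) - g (snd p)) \<longlongrightarrow> 0) (ufilter K)"
  proof -
    have "((\<lambda>p. (\<rho> (fst p + k1) (snd p) - 1) * G (fst p + k1) (snd p)) \<longlongrightarrow> 0) (ufilter K)"
    proof (rule tendsto_zero_mult_bounded)
      show "((\<lambda>p. \<rho> (fst p + k1) (snd p) - 1) \<longlongrightarrow> 0) (ufilter K)"
        using tendsto_ufilter_offset[of "\<lambda>k x. \<rho> k x - 1" 0 K k1] lim\<rho> by simp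
      show "\<forall>\<^sub>F p in ufilter K. \<bar>G (fst p + k1) (snd p)\<bar> \<le> M"
        unfolding eventually_ufilter
      proof (intro exI[of _ 0] allI ballI impI)
        fix n x assume "x \<in> K"
        then show "\<bar>G (fst (n, x) + k1) (snd (n, x))\<bar> \<le> M" using g(3)[of x n] G_pos[of "n + k1" x] by simp
      qed
    qed
    moreover have "((\<lambda>p. G (fst p + k1) (snd p) - g (snd p)) \<longlongrightarrow> 0) (ufilter K)"
      using g(1) unfolding uniform_limit_ufilter .
    ultimately have "((\<lambda>p. (\<rho> (fst p + k1) (snd p) - 1) * G (fst p + k1) (snd p) + (G (fst p + k1) (snd p) - g (snd p))) \<longlongrightarrow> 0 + 0) (ufilter K)"
      by (rule tendsto_add)
    moreover have "\<forall>\<^sub>F p in ufilter K. (\<rho> (fst p + k1) (snd p) - 1) * G (fst p + k1) (snd p) + (G (fst p + k1) (snd p) - g (snd p)) = F (fst p + k1 + k0) (snd p) - g (snd p)"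
      unfolding eventually_ufilter
    proof (intro exI[of _ 0] allI ballI impI)
      fix n x assume "x \<in> K"
      then show "(\<rho> (fst (n, x) + k1) (snd (n, x)) - 1) * G (fst (n, x) + k1) (snd (n, x)) + (G (fst (n, x) + k1) (snd (n, x)) - g (snd (n, x))) = F (fst (n, x) + k1 + k0) (snd (n, x)) - g (snd (n, x))"
        using F[of "n + k1" x] by (simp add: algebra_simps)
    qed
    ultimately have "((\<lambda>p. F (fst p + k1 + k0) (snd p) - g (snd p)) \<longlongrightarrow> 0 + 0) (ufilter K)"
      by (rule Lim_transform_eventually)
    then show ?thesis by simp
  qed
  have "uniform_limit K (\<lambda>k. F (k + (k1 + k0))) g sequentially"
    unfolding uniform_limit_ufilter using limFG by (simp add: add.assoc)
  then have "uniform_limit K F g sequentially" by (rule uniform_limit_offset)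
  moreover have "bounded (g ` K)"
  proof -
    have "\<bar>g x\<bar> \<le> M" if x: "x \<in> K" for x
    proof -
      have "g x \<le> M"
        by (rule LIMSEQ_le_const2[OF tendsto_uniform_limitI[OF g(1) x]]) (use g(3)[OF x] in auto)
      then show ?thesis using g(2)[OF x] by simp
    qed
    then show ?thesis unfolding bounded_iff by (intro exI[of _ M]) auto
  qed
  ultimately show ?thesis using that g(2) unfolding F_def z0_def by blast
qed

end

section \<open>Averages of quadratic forms along an orbit\<close>

lemma fixed_point_props:
  fixes A B C D :: real
  assumes det: "A * D - B * C = 1" and tr: "\<bar>A + D\<bar> < 2"
  defines "z \<equiv> fixed_point A B D"
  shows "B \<noteq> 0" "4 - (A + D)\<^sup>2 > 0" "Im z > 0" "z * (of_real D - z * of_real B) - z * of_real A + of_real C = 0"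
proof -
  have "(A + D)\<^sup>2 < 2\<^sup>2" using power_strict_mono[of "\<bar>A + D\<bar>" 2 2] tr by simp
  then show s: "4 - (A + D)\<^sup>2 > 0" by simp
  show B: "B \<noteq> 0"
  proof
    assume "B = 0"
    then have "4 - (A + D)\<^sup>2 = - (A - D)\<^sup>2" using det by (simp add: power2_eq_square algebra_simps)
    then show False using s zero_le_power2[of "A - D"] by linarith
  qed
  show "Im z > 0" using s B by (simp add: z_def fixed_point_def)
  define x where "x = Re z"
  define y where "y = Im z"
  have x: "2 * B * x = D - A" using B by (simp add: x_def z_def fixed_point_def)
  have "4 * B\<^sup>2 * y\<^sup>2 = 4 - (A + D)\<^sup>2"
    using B s by (simp add: y_def z_def fixed_point_def power_divide power_mult_distrib)
  then have "4 * B\<^sup>2 * y\<^sup>2 = 4 * (A * D - B * C) - (A + D)\<^sup>2" using det by simp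
  then have "4 * B * (x * D - B * (x\<^sup>2 - y\<^sup>2) - x * A + C) = 0" using x by algebra
  then have 1: "x * D - B * (x\<^sup>2 - y\<^sup>2) - x * A + C = 0" using B by simp
  have 2: "y * D - 2 * x * y * B - y * A = 0" using x by algebra
  show "z * (of_real D - z * of_real B) - z * of_real A + of_real C = 0"
    using 1 2 by (simp add: complex_eq_iff x_def y_def power2_eq_square algebra_simps)
qed

text \<open>
  In the coordinate \<open>v2 - z v1\<close> the matrix acts as a rotation, so the square of a linear form is the sum
  of an invariant form and of a coboundary.
\<close>

lemma quadratic_average:
  fixes A B C D l1 l2 :: real
  assumes det: "A * D - B * C = 1" and tr: "\<bar>A + D\<bar> < 2"
  defines "z \<equiv> fixed_point A B D"
  obtains s1 s2 s3 :: real where "\<And>v1 v2.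
    (l1 * v1 + l2 * v2)\<^sup>2 - ((s1 * (A * v1 + B * v2)\<^sup>2 + s2 * (A * v1 + B * v2) * (C * v1 + D * v2) + s3 * (C * v1 + D * v2)\<^sup>2)
       - (s1 * v1\<^sup>2 + s2 * v1 * v2 + s3 * v2\<^sup>2))
    = (l1\<^sup>2 + 2 * l1 * l2 * Re z + l2\<^sup>2 * (norm z)\<^sup>2) / (2 * Im z) * ((norm (complex_of_real v2 - z * of_real v1))\<^sup>2 / Im z)"
proof -
  note fp = fixed_point_props[OF det tr, folded z_def]
  define lam where "lam = of_real D - z * of_real B"
  define y where "y = Im z"
  have y: "y > 0" using fp(3) by (simp add: y_def)
  have "(norm lam)\<^sup>2 * Im z = (A * D - B * C) * Im z + Im (cnj lam * 0)"
    by (rule Im_moebius) (use fp(4) in \<open>simp_all add: lam_def\<close>)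
  \<comment> \<open>The eigenvalue is not real, so its square is not 1 and the coboundary equation
    defining \<open>\<beta>\<close> is solvable.\<close>
  have "Im lam \<noteq> 0" using fp(1,3) by (simp add: lam_def)
  have lam2: "lam\<^sup>2 - 1 \<noteq> 0"
  proof
    assume "lam\<^sup>2 - 1 = 0"
    then have "lam = 1 \<or> lam = -1" by (simp add: power2_eq_1_iff)
    then show False using \<open>Im lam \<noteq> 0\<close> by auto
  qed
  \<comment> \<open>Chosen so that l1 v1 + l2 v2 is the real part of \<gamma> \<zeta> with \<zeta> =
    v2 - z v1. The square of a real part is half the squared modulus plus half the real part of the
    square; \<open>\<beta>\<close> turns the latter into the increment of Re (\<beta>
    \<zeta>^2).\<close>
  define \<gamma> where "\<gamma> = Complex l2 ((l1 + l2 * Re z) / y)"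
  define \<beta> where "\<beta> = \<gamma>\<^sup>2 / (2 * (lam\<^sup>2 - 1))"
  define S where "S v1 v2 = Re (\<beta> * (complex_of_real v2 - z * of_real v1)\<^sup>2)" for v1 v2
  define s1 where "s1 = Re (\<beta> * z\<^sup>2)"
  define s2 where "s2 = - 2 * Re (\<beta> * z)"
  define s3 where "s3 = Re \<beta>"
  have S: "S v1 v2 = s1 * v1\<^sup>2 + s2 * v1 * v2 + s3 * v2\<^sup>2" for v1 v2
  proof -
    have "\<beta> * (complex_of_real v2 - z * of_real v1)\<^sup>2
       = (\<beta> * z\<^sup>2) * of_real (v1\<^sup>2) - (\<beta> * z) * of_real (2 * v1 * v2) + \<beta> * of_real (v2\<^sup>2)"
      by (simp add: power2_eq_square algebra_simps)
    then have "S v1 v2 = Re ((\<beta> * z\<^sup>2) * of_real (v1\<^sup>2)) - Re ((\<beta> * z) * of_real (2 * v1 * v2)) + Re (\<beta> * of_real (v2\<^sup>2))"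
      unfolding S_def by (simp only: plus_complex.simps minus_complex.simps)
    moreover have "Re (w * of_real r) = Re w * r" for w r by simp
    ultimately show ?thesis by (simp only: s1_def s2_def s3_def)
  qed
  have main: "(l1 * v1 + l2 * v2)\<^sup>2 - (S (A * v1 + B * v2) (C * v1 + D * v2) - S v1 v2)
    = (norm \<gamma>)\<^sup>2 / 2 * (norm (complex_of_real v2 - z * of_real v1))\<^sup>2" for v1 v2
  proof -
    define \<zeta> where "\<zeta> = complex_of_real v2 - z * of_real v1"
    have \<zeta>': "complex_of_real (C * v1 + D * v2) - z * of_real (A * v1 + B * v2) = lam * \<zeta>"
    proof -
      show ?thesis unfolding \<zeta>_def lam_def of_real_add of_real_mult using fp(4) by algebra
    qed
    have l: "l1 * v1 + l2 * v2 = Re (\<gamma> * \<zeta>)"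
      using y by (simp add: \<gamma>_def \<zeta>_def y_def field_simps)
    have sq: "(Re w)\<^sup>2 = (norm w)\<^sup>2 / 2 + Re (w\<^sup>2) / 2" for w :: complex
      by (simp only: cmod_power2) (simp add: power2_eq_square add_divide_distrib diff_divide_distrib)
    have "S (A * v1 + B * v2) (C * v1 + D * v2) - S v1 v2 = Re (\<beta> * (lam * \<zeta>)\<^sup>2 - \<beta> * \<zeta>\<^sup>2)"
      unfolding S_def \<zeta>' by (simp add: \<zeta>_def)
    also have "\<beta> * (lam * \<zeta>)\<^sup>2 - \<beta> * \<zeta>\<^sup>2 = (\<beta> * (lam\<^sup>2 - 1)) * \<zeta>\<^sup>2" by (simp add: power_mult_distrib algebra_simps)
    also have "\<beta> * (lam\<^sup>2 - 1) = \<gamma>\<^sup>2 / 2"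
    proof -
      have gen: "p / (2 * w) * w = p / 2" if "w \<noteq> 0" for p w :: complex using that by simp
      show ?thesis unfolding \<beta>_def by (rule gen[OF lam2])
    qed
    also have "\<gamma>\<^sup>2 / 2 * \<zeta>\<^sup>2 = of_real (1/2) * (\<gamma> * \<zeta>)\<^sup>2" by (simp add: power_mult_distrib)
    also have "Re \<dots> = Re ((\<gamma> * \<zeta>)\<^sup>2) / 2" by simp
    finally have "S (A * v1 + B * v2) (C * v1 + D * v2) - S v1 v2 = Re ((\<gamma> * \<zeta>)\<^sup>2) / 2" .
    moreover have "(Re (\<gamma> * \<zeta>))\<^sup>2 = (norm (\<gamma> * \<zeta>))\<^sup>2 / 2 + Re ((\<gamma> * \<zeta>)\<^sup>2) / 2" by (rule sq)
    ultimately have "(l1 * v1 + l2 * v2)\<^sup>2 - (S (A * v1 + B * v2) (C * v1 + D * v2) - S v1 v2) = (norm (\<gamma> * \<zeta>))\<^sup>2 / 2"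
      unfolding l by linarith
    then show ?thesis by (simp add: \<zeta>_def norm_mult power_mult_distrib)
  qed
  have c: "(norm \<gamma>)\<^sup>2 / 2 = (l1\<^sup>2 + 2 * l1 * l2 * Re z + l2\<^sup>2 * (norm z)\<^sup>2) / (2 * Im z) / Im z"
  proof -
    have "(norm \<gamma>)\<^sup>2 = l2\<^sup>2 + (l1 + l2 * Re z)\<^sup>2 / y\<^sup>2" by (simp add: \<gamma>_def cmod_power2 power_divide)
    moreover have "(norm z)\<^sup>2 = (Re z)\<^sup>2 + y\<^sup>2" by (simp add: cmod_power2 y_def)
    ultimately show ?thesis using y unfolding y_def[symmetric]
      by (simp add: field_simps power2_eq_square)
  qed
  show ?thesis
  proof (rule that[of s1 s2 s3])
    fix v1 v2
    show "(l1 * v1 + l2 * v2)\<^sup>2 - ((s1 * (A * v1 + B * v2)\<^sup>2 + s2 * (A * v1 + B * v2) * (C * v1 + D * v2) + s3 * (C * v1 + D * v2)\<^sup>2)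
       - (s1 * v1\<^sup>2 + s2 * v1 * v2 + s3 * v2\<^sup>2))
    = (l1\<^sup>2 + 2 * l1 * l2 * Re z + l2\<^sup>2 * (norm z)\<^sup>2) / (2 * Im z) * ((norm (complex_of_real v2 - z * of_real v1))\<^sup>2 / Im z)"
      using main[of v1 v2] unfolding S c by simp
  qed
qed

text \<open>Compares the moving matrix with its limit. Each coefficient on the right combines
  differences between products of moving entries and their limits, so it tends to 0 in
  \<open>average_limit\<close>, while the weighted monomials in v1 and v2 stay bounded
  there.\<close>

lemma form_identity:
  fixes w m1 m2 l1 l2 s1 s2 s3 A B C D A0 B0 C0 D0 v1 v2 :: real
  shows "w * ((m1 * v1 + m2 * v2)\<^sup>2 - (s1 * (A * v1 + B * v2)\<^sup>2 + s2 * (A * v1 + B * v2) * (C * v1 + D * v2) + s3 * (C * v1 + D * v2)\<^sup>2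
       - (s1 * v1\<^sup>2 + s2 * v1 * v2 + s3 * v2\<^sup>2)))
     - w * ((l1 * v1 + l2 * v2)\<^sup>2 - (s1 * (A0 * v1 + B0 * v2)\<^sup>2 + s2 * (A0 * v1 + B0 * v2) * (C0 * v1 + D0 * v2) + s3 * (C0 * v1 + D0 * v2)\<^sup>2
       - (s1 * v1\<^sup>2 + s2 * v1 * v2 + s3 * v2\<^sup>2)))
   = (m1\<^sup>2 - l1\<^sup>2 - s1 * (A\<^sup>2 - A0\<^sup>2) - s2 * (A * C - A0 * C0) - s3 * (C\<^sup>2 - C0\<^sup>2)) * (w * v1\<^sup>2)
   + (2 * (m1 * m2 - l1 * l2) - 2 * s1 * (A * B - A0 * B0) - s2 * (A * D + B * C - A0 * D0 - B0 * C0) - 2 * s3 * (C * D - C0 * D0)) * (w * (v1 * v2))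
   + (m2\<^sup>2 - l2\<^sup>2 - s1 * (B\<^sup>2 - B0\<^sup>2) - s2 * (B * D - B0 * D0) - s3 * (D\<^sup>2 - D0\<^sup>2)) * (w * v2\<^sup>2)"
  by (simp add: power2_eq_square algebra_simps)

text \<open>By \<open>quadratic_average\<close>, wt times the square minus a coboundary converges to
  a multiple of g, also with moving coefficients. Averaging this with the weights 1 / wt leaves the
  telescoped coboundary S n - S 0, which is bounded and gets divided by a divergent sum.\<close>

lemma average_limit:
  fixes A B C D v1 v2 m1 m2 :: "nat \<Rightarrow> 'p \<Rightarrow> real" and wt :: "nat \<Rightarrow> real" and l1 l2 A0 B0 C0 D0 :: real
  assumes limA: "((\<lambda>p. A (fst p) (snd p)) \<longlongrightarrow> A0) (ufilter K)" and limB: "((\<lambda>p. B (fst p) (snd p)) \<longlongrightarrow> B0) (ufilter K)"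
    and limC: "((\<lambda>p. C (fst p) (snd p)) \<longlongrightarrow> C0) (ufilter K)" and limD: "((\<lambda>p. D (fst p) (snd p)) \<longlongrightarrow> D0) (ufilter K)"
    and lim1: "((\<lambda>p. m1 (fst p) (snd p)) \<longlongrightarrow> l1) (ufilter K)" and lim2: "((\<lambda>p. m2 (fst p) (snd p)) \<longlongrightarrow> l2) (ufilter K)"
    and det0: "A0 * D0 - B0 * C0 = 1" and tr0: "\<bar>A0 + D0\<bar> < 2"
    and wt: "\<And>k. wt k > 0" "filterlim wt at_top sequentially" "\<not> summable (\<lambda>k. 1 / wt k)"
    and v: "\<And>k x. x \<in> K \<Longrightarrow> v1 (Suc k) x = A k x * v1 k x + B k x * v2 k x"
      "\<And>k x. x \<in> K \<Longrightarrow> v2 (Suc k) x = C k x * v1 k x + D k x * v2 k x"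
    and bdd: "\<And>k. bounded (v1 k ` K)" "\<And>k. bounded (v2 k ` K)" "\<And>k. bounded ((\<lambda>x. m1 k x * v1 k x + m2 k x * v2 k x) ` K)"
    and lim: "uniform_limit K (\<lambda>k x. wt k * (norm (complex_of_real (v2 k x) - fixed_point A0 B0 D0 * of_real (v1 k x)))\<^sup>2 / Im (fixed_point A0 B0 D0)) g sequentially"
    and g: "bounded (g ` K)"
  shows "uniform_limit K (\<lambda>n x. (\<Sum>k<n. (m1 k x * v1 k x + m2 k x * v2 k x)\<^sup>2) / (\<Sum>k<n. 1 / wt k))
    (\<lambda>x. (l1\<^sup>2 + 2 * l1 * l2 * Re (fixed_point A0 B0 D0) + l2\<^sup>2 * (norm (fixed_point A0 B0 D0))\<^sup>2) / (2 * Im (fixed_point A0 B0 D0)) * g x) sequentially"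
proof -
  define z where "z = fixed_point A0 B0 D0"
  define y where "y = Im z"
  define c where "c = (l1\<^sup>2 + 2 * l1 * l2 * Re z + l2\<^sup>2 * (norm z)\<^sup>2) / (2 * Im z)"
  have y: "y > 0" using fixed_point_props(3)[OF det0 tr0] by (simp add: y_def z_def)
  define F where "F k x = wt k * (norm (complex_of_real (v2 k x) - z * of_real (v1 k x)))\<^sup>2 / y" for k x
  have F0: "F k x \<ge> 0" for k x unfolding F_def using wt(1)[of k] y by (intro divide_nonneg_pos mult_nonneg_nonneg) auto
  have limF: "uniform_limit K F g sequentially" using lim unfolding F_def z_def y_def .
  obtain Mg where Mg: "\<And>x. x \<in> K \<Longrightarrow> \<bar>g x\<bar> \<le> Mg" using g by (auto simp: bounded_iff)
  obtain n1 where n1: "\<And>k x. k \<ge> n1 \<Longrightarrow> x \<in> K \<Longrightarrow> F k x \<le> Mg + 1"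
  proof -
    obtain n1 where n1: "\<forall>k\<ge>n1. \<forall>x\<in>K. dist (F k x) (g x) < 1"
      using limF unfolding uniform_limit_sequentially_iff by (meson zero_less_one)
    show ?thesis
    proof (rule that)
      fix k x assume "k \<ge> n1" "x \<in> K"
      then have "dist (F k x) (g x) < 1" "\<bar>g x\<bar> \<le> Mg" using n1 Mg by auto
      then show "F k x \<le> Mg + 1" by (auto simp: dist_real_def)
    qed
  qed
  define M1 where "M1 = \<bar>(Mg + 1) / y\<bar> + \<bar>(Mg + 1) * y * (1 + norm z / y)\<^sup>2\<bar>"
  have M1: "M1 \<ge> 0" by (simp add: M1_def)
  have wv1: "wt k * (v1 k x)\<^sup>2 \<le> M1" and wv2: "wt k * (v2 k x)\<^sup>2 \<le> M1" if k: "k \<ge> n1" and x: "x \<in> K" for k x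
  proof -
    let ?n = "norm (complex_of_real (v2 k x) - z * of_real (v1 k x))"
    have a1: "\<bar>v1 k x\<bar> \<le> ?n / y" unfolding y_def by (rule abs_le_of_Im) (use y y_def in simp)
    have "(v1 k x)\<^sup>2 \<le> (?n / y)\<^sup>2" using a1 by (metis abs_ge_zero power2_abs power_mono)
    then have "wt k * (v1 k x)\<^sup>2 \<le> wt k * (?n / y)\<^sup>2" using wt(1)[of k] by (intro mult_left_mono) auto
    also have "\<dots> = F k x / y" by (simp add: F_def power_divide power2_eq_square)
    also have "\<dots> \<le> (Mg + 1) / y" using n1[OF k x] y by (intro divide_right_mono) auto
    finally show "wt k * (v1 k x)\<^sup>2 \<le> M1" unfolding M1_def
      using abs_ge_self[of "(Mg + 1) / y"] abs_ge_zero[of "(Mg + 1) * y * (1 + norm z / y)\<^sup>2"] by linarith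
    have "complex_of_real (v2 k x) = (complex_of_real (v2 k x) - z * of_real (v1 k x)) + z * of_real (v1 k x)" by simp
    then have "\<bar>v2 k x\<bar> \<le> ?n + norm z * \<bar>v1 k x\<bar>" by (metis norm_mult norm_of_real norm_triangle_ineq)
    also have "\<dots> \<le> ?n + norm z * (?n / y)" using a1 by (intro add_left_mono mult_left_mono) auto
    also have "\<dots> = ?n * (1 + norm z / y)" by (simp add: algebra_simps)
    finally have "(v2 k x)\<^sup>2 \<le> (?n * (1 + norm z / y))\<^sup>2" by (metis abs_ge_zero power2_abs power_mono)
    then have "wt k * (v2 k x)\<^sup>2 \<le> wt k * (?n * (1 + norm z / y))\<^sup>2" using wt(1)[of k] by (intro mult_left_mono) auto
    also have "\<dots> = F k x * (y * (1 + norm z / y)\<^sup>2)" using y by (simp add: F_def power_mult_distrib)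
    also have "\<dots> \<le> (Mg + 1) * (y * (1 + norm z / y)\<^sup>2)" using n1[OF k x] y by (intro mult_right_mono) auto
    finally have "wt k * (v2 k x)\<^sup>2 \<le> (Mg + 1) * y * (1 + norm z / y)\<^sup>2" by (simp only: mult.assoc)
    then show "wt k * (v2 k x)\<^sup>2 \<le> M1" unfolding M1_def using abs_ge_zero[of "(Mg + 1) / y"] abs_ge_self[of "(Mg + 1) * y * (1 + norm z / y)\<^sup>2"] by linarith
  qed
  have wv12: "\<bar>wt k * (v1 k x * v2 k x)\<bar> \<le> M1" if k: "k \<ge> n1" and x: "x \<in> K" for k x
  proof -
    have "2 * (\<bar>v1 k x\<bar> * \<bar>v2 k x\<bar>) \<le> (v1 k x)\<^sup>2 + (v2 k x)\<^sup>2"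
      using sum_squares_bound[of "\<bar>v1 k x\<bar>" "\<bar>v2 k x\<bar>"] by (simp add: mult.assoc)
    then have "wt k * (2 * (\<bar>v1 k x\<bar> * \<bar>v2 k x\<bar>)) \<le> wt k * ((v1 k x)\<^sup>2 + (v2 k x)\<^sup>2)" using wt(1)[of k] by (intro mult_left_mono) auto
    then have "2 * \<bar>wt k * (v1 k x * v2 k x)\<bar> \<le> wt k * (v1 k x)\<^sup>2 + wt k * (v2 k x)\<^sup>2"
      using wt(1)[of k] by (simp add: abs_mult distrib_left)
    then show ?thesis using wv1[OF k x] wv2[OF k x] by linarith
  qed
  obtain s1 s2 s3 where s: "\<And>v1 v2.
    (l1 * v1 + l2 * v2)\<^sup>2 - ((s1 * (A0 * v1 + B0 * v2)\<^sup>2 + s2 * (A0 * v1 + B0 * v2) * (C0 * v1 + D0 * v2) + s3 * (C0 * v1 + D0 * v2)\<^sup>2)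
       - (s1 * v1\<^sup>2 + s2 * v1 * v2 + s3 * v2\<^sup>2)) = c * ((norm (complex_of_real v2 - z * of_real v1))\<^sup>2 / Im z)"
    using quadratic_average[OF det0 tr0, of l1 l2] unfolding c_def z_def by blast
  define S where "S k x = s1 * (v1 k x)\<^sup>2 + s2 * v1 k x * v2 k x + s3 * (v2 k x)\<^sup>2" for k x
  define f where "f k x = (m1 k x * v1 k x + m2 k x * v2 k x)\<^sup>2" for k x
  define h where "h k x = wt k * (f k x - (S (Suc k) x - S k x))" for k x
  define p1 where "p1 k x = ((m1 k x)\<^sup>2 - l1\<^sup>2) - s1 * ((A k x)\<^sup>2 - A0\<^sup>2) - s2 * (A k x * C k x - A0 * C0) - s3 * ((C k x)\<^sup>2 - C0\<^sup>2)" for k x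
  define p2 where "p2 k x = 2 * (m1 k x * m2 k x - l1 * l2) - 2 * s1 * (A k x * B k x - A0 * B0) - s2 * (A k x * D k x + B k x * C k x - A0 * D0 - B0 * C0) - 2 * s3 * (C k x * D k x - C0 * D0)" for k x
  define p3 where "p3 k x = ((m2 k x)\<^sup>2 - l2\<^sup>2) - s1 * ((B k x)\<^sup>2 - B0\<^sup>2) - s2 * (B k x * D k x - B0 * D0) - s3 * ((D k x)\<^sup>2 - D0\<^sup>2)" for k x
  have hF: "h k x - c * F k x = p1 k x * (wt k * (v1 k x)\<^sup>2) + p2 k x * (wt k * (v1 k x * v2 k x)) + p3 k x * (wt k * (v2 k x)\<^sup>2)"
    if x: "x \<in> K" for k x
  proof -
    have "c * F k x = wt k * (c * ((norm (complex_of_real (v2 k x) - z * of_real (v1 k x)))\<^sup>2 / Im z))"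
      by (simp add: F_def y_def)
    also note s[of "v1 k x" "v2 k x", symmetric]
    finally show ?thesis
      unfolding h_def f_def S_def v(1)[OF x, of k] v(2)[OF x, of k] p1_def p2_def p3_def
      by (simp only: form_identity)
  qed
  have "((\<lambda>p. p1 (fst p) (snd p)) \<longlongrightarrow> (l1\<^sup>2 - l1\<^sup>2) - s1 * (A0\<^sup>2 - A0\<^sup>2) - s2 * (A0 * C0 - A0 * C0) - s3 * (C0\<^sup>2 - C0\<^sup>2)) (ufilter K)"
    unfolding p1_def by (intro tendsto_intros limA limB limC limD lim1 lim2)
  then have lp1: "((\<lambda>p. p1 (fst p) (snd p)) \<longlongrightarrow> 0) (ufilter K)" by simp
  have "((\<lambda>p. p2 (fst p) (snd p)) \<longlongrightarrow> 2 * (l1 * l2 - l1 * l2) - 2 * s1 * (A0 * B0 - A0 * B0) - s2 * (A0 * D0 + B0 * C0 - A0 * D0 - B0 * C0) - 2 * s3 * (C0 * D0 - C0 * D0)) (ufilter K)"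
    unfolding p2_def by (intro tendsto_intros limA limB limC limD lim1 lim2)
  then have lp2: "((\<lambda>p. p2 (fst p) (snd p)) \<longlongrightarrow> 0) (ufilter K)" by simp
  have "((\<lambda>p. p3 (fst p) (snd p)) \<longlongrightarrow> (l2\<^sup>2 - l2\<^sup>2) - s1 * (B0\<^sup>2 - B0\<^sup>2) - s2 * (B0 * D0 - B0 * D0) - s3 * (D0\<^sup>2 - D0\<^sup>2)) (ufilter K)"
    unfolding p3_def by (intro tendsto_intros limA limB limC limD lim1 lim2)
  then have lp3: "((\<lambda>p. p3 (fst p) (snd p)) \<longlongrightarrow> 0) (ufilter K)" by simp
  have b1: "eventually (\<lambda>p. \<bar>wt (fst p) * (v1 (fst p) (snd p))\<^sup>2\<bar> \<le> M1) (ufilter K)"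
    unfolding eventually_ufilter using wv1 wt(1) by (intro exI[of _ n1]) (auto simp: abs_mult less_imp_le)
  have b2: "eventually (\<lambda>p. \<bar>wt (fst p) * (v1 (fst p) (snd p) * v2 (fst p) (snd p))\<bar> \<le> M1) (ufilter K)"
    unfolding eventually_ufilter using wv12 by (intro exI[of _ n1]) auto
  have b3: "eventually (\<lambda>p. \<bar>wt (fst p) * (v2 (fst p) (snd p))\<^sup>2\<bar> \<le> M1) (ufilter K)"
    unfolding eventually_ufilter using wv2 wt(1) by (intro exI[of _ n1]) (auto simp: abs_mult less_imp_le)
  have "((\<lambda>p. p1 (fst p) (snd p) * (wt (fst p) * (v1 (fst p) (snd p))\<^sup>2) + p2 (fst p) (snd p) * (wt (fst p) * (v1 (fst p) (snd p) * v2 (fst p) (snd p)))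
      + p3 (fst p) (snd p) * (wt (fst p) * (v2 (fst p) (snd p))\<^sup>2)) \<longlongrightarrow> 0 + 0 + 0) (ufilter K)"
    by (intro tendsto_add tendsto_zero_mult_bounded[OF lp1 b1] tendsto_zero_mult_bounded[OF lp2 b2] tendsto_zero_mult_bounded[OF lp3 b3])
  then have hcF: "((\<lambda>p. h (fst p) (snd p) - c * F (fst p) (snd p)) \<longlongrightarrow> 0 + 0 + 0) (ufilter K)"
    by (rule Lim_transform_eventually) (auto simp: eventually_ufilter hF)
  have "((\<lambda>p. (h (fst p) (snd p) - c * F (fst p) (snd p)) + c * (F (fst p) (snd p) - g (snd p))) \<longlongrightarrow> (0 + 0 + 0) + c * 0) (ufilter K)"
    using limF unfolding uniform_limit_ufilter by (intro tendsto_add hcF tendsto_mult tendsto_const)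
  then have limh: "uniform_limit K h (\<lambda>x. c * g x) sequentially"
    unfolding uniform_limit_ufilter by (simp add: algebra_simps)
  have S_bdd: "bounded (S k ` K)" for k
  proof -
    obtain b1 where b1: "\<And>x. x \<in> K \<Longrightarrow> \<bar>v1 k x\<bar> \<le> b1" using bdd(1)[of k] by (auto simp: bounded_iff)
    obtain b2 where b2: "\<And>x. x \<in> K \<Longrightarrow> \<bar>v2 k x\<bar> \<le> b2" using bdd(2)[of k] by (auto simp: bounded_iff)
    have "\<bar>S k x\<bar> \<le> \<bar>s1\<bar> * (b1 * b1) + \<bar>s2\<bar> * (b1 * b2) + \<bar>s3\<bar> * (b2 * b2)" if x: "x \<in> K" for x
    proof -
      have "\<bar>s1 * (v1 k x * v1 k x)\<bar> \<le> \<bar>s1\<bar> * (b1 * b1)" by (rule abs_mult_le[OF _ abs_mult_le[OF b1[OF x] b1[OF x]]]) simp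
      moreover have "\<bar>s2 * (v1 k x * v2 k x)\<bar> \<le> \<bar>s2\<bar> * (b1 * b2)" by (rule abs_mult_le[OF _ abs_mult_le[OF b1[OF x] b2[OF x]]]) simp
      moreover have "\<bar>s3 * (v2 k x * v2 k x)\<bar> \<le> \<bar>s3\<bar> * (b2 * b2)" by (rule abs_mult_le[OF _ abs_mult_le[OF b2[OF x] b2[OF x]]]) simp
      ultimately show ?thesis unfolding S_def power2_eq_square mult.assoc by linarith
    qed
    then show ?thesis unfolding bounded_iff by auto
  qed
  have hbdd: "bounded ((\<lambda>x. h k x - c * g x) ` K)" for k
  proof -
    obtain bf where bf: "\<And>x. x \<in> K \<Longrightarrow> \<bar>m1 k x * v1 k x + m2 k x * v2 k x\<bar> \<le> bf" using bdd(3)[of k] by (auto simp: bounded_iff)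
    obtain bs where bs: "\<And>x. x \<in> K \<Longrightarrow> \<bar>S k x\<bar> \<le> bs" using S_bdd[of k] by (auto simp: bounded_iff)
    obtain bs' where bs': "\<And>x. x \<in> K \<Longrightarrow> \<bar>S (Suc k) x\<bar> \<le> bs'" using S_bdd[of "Suc k"] by (auto simp: bounded_iff)
    have "\<bar>h k x - c * g x\<bar> \<le> wt k * (bf * bf + bs' + bs) + \<bar>c\<bar> * Mg" if x: "x \<in> K" for x
    proof -
      have "\<bar>f k x\<bar> \<le> bf * bf" unfolding f_def power2_eq_square by (rule abs_mult_le[OF bf[OF x] bf[OF x]])
      then have "\<bar>f k x - (S (Suc k) x - S k x)\<bar> \<le> bf * bf + bs' + bs" using bs[OF x] bs'[OF x] by linarith
      then have "\<bar>h k x\<bar> \<le> wt k * (bf * bf + bs' + bs)" unfolding h_def using wt(1)[of k] by (intro abs_mult_le) auto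
      moreover have "\<bar>c * g x\<bar> \<le> \<bar>c\<bar> * Mg" by (rule abs_mult_le) (use Mg[OF x] in auto)
      ultimately show ?thesis by linarith
    qed
    then show ?thesis unfolding bounded_iff by auto
  qed
  have W: "1 / wt k > 0" for k using wt(1)[of k] by simp
  have ces: "uniform_limit K (\<lambda>n x. (\<Sum>k<n. 1 / wt k * h k x) / (\<Sum>k<n. 1 / wt k)) (\<lambda>x. c * g x) sequentially"
    by (rule uniform_cesaro[OF W wt(3) limh hbdd])
  have sum_eq: "(\<Sum>k<n. 1 / wt k * h k x) = (\<Sum>k<n. f k x) - S n x + S 0 x" for n x
  proof -
    have "1 / wt k * h k x = f k x - (S (Suc k) x - S k x)" for k using wt(1)[of k] by (simp add: h_def)
    then show ?thesis by (induction n) auto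
  qed
  have W_lim: "filterlim (\<lambda>n. \<Sum>k<n. 1 / wt k) at_top sequentially"
    unfolding filterlim_at_top
  proof
    fix Z
    have "\<exists>n. (\<Sum>k<n. 1 / wt k) > Z"
    proof (rule ccontr)
      assume "\<not> (\<exists>n. (\<Sum>k<n. 1 / wt k) > Z)"
      then have "summable (\<lambda>k. 1 / wt k)" by (intro summableI_nonneg_bounded[of _ Z]) (auto simp: less_imp_le wt(1) not_less)
      with wt(3) show False by simp
    qed
    then obtain n where n: "(\<Sum>k<n. 1 / wt k) > Z" by blast
    have "Z \<le> (\<Sum>k<m. 1 / wt k)" if "m \<ge> n" for m
    proof -
      have "(\<Sum>k<n. 1 / wt k) \<le> (\<Sum>k<m. 1 / wt k)" using that by (intro sum_mono2) (auto simp: less_imp_le wt(1))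
      then show ?thesis using n by linarith
    qed
    then show "eventually (\<lambda>n. Z \<le> (\<Sum>k<n. 1 / wt k)) sequentially" unfolding eventually_sequentially by blast
  qed
  have tail: "((\<lambda>p. inverse (\<Sum>k<fst p. 1 / wt k) * (S (fst p) (snd p) - S 0 (snd p))) \<longlongrightarrow> 0) (ufilter K)"
  proof -
    obtain n2 where n2: "\<And>k. k \<ge> n2 \<Longrightarrow> wt k \<ge> 1" using wt(2) unfolding filterlim_at_top eventually_sequentially by blast
    obtain bs where bs: "\<And>x. x \<in> K \<Longrightarrow> \<bar>S 0 x\<bar> \<le> bs" using S_bdd[of 0] by (auto simp: bounded_iff)
    \<comment> \<open>The monomials multiplied by wt are at most \<open>M1\<close>, and wt is
      eventually at least 1.\<close>
    have Sb: "\<bar>S k x\<bar> \<le> (\<bar>s1\<bar> + \<bar>s2\<bar> + \<bar>s3\<bar>) * M1" if k: "k \<ge> max n1 n2" and x: "x \<in> K" for k x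
    proof -
      have w1: "wt k \<ge> 1" "k \<ge> n1" using n2 k by auto
      have le: "\<bar>u\<bar> \<le> M1" if "\<bar>wt k * u\<bar> \<le> M1" for u
      proof -
        have "1 * \<bar>u\<bar> \<le> wt k * \<bar>u\<bar>" using w1 by (intro mult_right_mono) auto
        then show ?thesis using that w1 by (simp add: abs_mult)
      qed
      have "\<bar>(v1 k x)\<^sup>2\<bar> \<le> M1" by (rule le) (use wv1[OF w1(2) x] wt(1)[of k] in \<open>simp add: abs_mult\<close>)
      then have 1: "\<bar>s1 * (v1 k x)\<^sup>2\<bar> \<le> \<bar>s1\<bar> * M1" by (intro abs_mult_le) auto
      have "\<bar>v1 k x * v2 k x\<bar> \<le> M1" by (rule le) (use wv12[OF w1(2) x] in simp)
      then have 2: "\<bar>s2 * (v1 k x * v2 k x)\<bar> \<le> \<bar>s2\<bar> * M1" by (intro abs_mult_le[of s2]) auto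
      have "\<bar>(v2 k x)\<^sup>2\<bar> \<le> M1" by (rule le) (use wv2[OF w1(2) x] wt(1)[of k] in \<open>simp add: abs_mult\<close>)
      then have 3: "\<bar>s3 * (v2 k x)\<^sup>2\<bar> \<le> \<bar>s3\<bar> * M1" by (intro abs_mult_le) auto
      show ?thesis unfolding S_def mult.assoc distrib_right using 1 2 3 by linarith
    qed
    show ?thesis
    proof (rule tendsto_zero_mult_bounded)
      show "((\<lambda>p. inverse (\<Sum>k<fst p. 1 / wt k)) \<longlongrightarrow> 0) (ufilter K)"
        by (rule tendsto_ufilter_seq[OF tendsto_inverse_0_at_top[OF W_lim]])
      have "\<bar>S k x - S 0 x\<bar> \<le> (\<bar>s1\<bar> + \<bar>s2\<bar> + \<bar>s3\<bar>) * M1 + bs" if k: "k \<ge> max n1 n2" and x: "x \<in> K" for k x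
        using Sb[OF k x] bs[OF x] by linarith
      then show "\<forall>\<^sub>F p in ufilter K. \<bar>S (fst p) (snd p) - S 0 (snd p)\<bar> \<le> (\<bar>s1\<bar> + \<bar>s2\<bar> + \<bar>s3\<bar>) * M1 + bs"
        unfolding eventually_ufilter by (intro exI[of _ "max n1 n2"]) auto
    qed
  qed
  have "((\<lambda>p. ((\<Sum>k<fst p. 1 / wt k * h k (snd p)) / (\<Sum>k<fst p. 1 / wt k) - c * g (snd p)) + inverse (\<Sum>k<fst p. 1 / wt k) * (S (fst p) (snd p) - S 0 (snd p))) \<longlongrightarrow> 0 + 0) (ufilter K)"
    using ces unfolding uniform_limit_ufilter by (intro tendsto_add tail)
  then have "uniform_limit K (\<lambda>n x. (\<Sum>k<n. f k x) / (\<Sum>k<n. 1 / wt k)) (\<lambda>x. c * g x) sequentially"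
    unfolding uniform_limit_ufilter sum_eq by (simp add: divide_inverse algebra_simps)
  then show ?thesis unfolding f_def c_def z_def .
qed

section \<open>Periodic Jacobi parameters\<close>

text \<open>Stated over a commutative ring because it serves real energies, complex energies and, in
  \<open>psol\<close>, polynomials in the energy.\<close>

fun sol :: "(nat \<Rightarrow> 'a::comm_ring_1) \<Rightarrow> (nat \<Rightarrow> 'a) \<Rightarrow> 'a \<Rightarrow> 'a \<Rightarrow> nat \<Rightarrow> 'a" where
  "sol c d u v 0 = u"
| "sol c d u v (Suc 0) = v"
| "sol c d u v (Suc (Suc i)) = d i * sol c d u v (Suc i) - c i * sol c d u v i"

lemma sol_linear: "sol c d u v i = u * sol c d 1 0 i + v * sol c d 0 1 i"
  by (induction i rule: induct_nat_012) (auto simp: algebra_simps)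

lemma sol_add:
  "sol c d u v (i + n) = sol (\<lambda>i. c (i + n)) (\<lambda>i. d (i + n)) (sol c d u v n) (sol c d u v (Suc n)) i"
  by (induction i rule: induct_nat_012) auto

lemma sol_wronskian:
  "sol c d 1 0 i * sol c d 0 1 (Suc i) - sol c d 1 0 (Suc i) * sol c d 0 1 i = (\<Prod>j<i. c j)"
proof (induction i)
  case (Suc i)
  have "sol c d 1 0 (Suc i) * sol c d 0 1 (Suc (Suc i)) - sol c d 1 0 (Suc (Suc i)) * sol c d 0 1 (Suc i)
    = c i * (sol c d 1 0 i * sol c d 0 1 (Suc i) - sol c d 1 0 (Suc i) * sol c d 0 1 i)"
    by (simp add: algebra_simps)
  then show ?case by (simp only: Suc.IH) simp
qed simp

text \<open>The discrete Green identity: along a solution the current p Im (u2 cnj u1) grows by Im z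
  |u1|^2. It yields the reality of the zeros of the discriminant and the estimates for the Weyl
  functions.\<close>

lemma energy_step:
  assumes "complex_of_real p * u2 = (z - of_real q) * u1 - of_real p' * u0"
  shows "p * Im (u2 * cnj u1) = p' * Im (u1 * cnj u0) + Im z * (norm u1)\<^sup>2"
proof -
  have "p * Im (u2 * cnj u1) = Im ((complex_of_real p * u2) * cnj u1)" by (simp add: mult.assoc)
  also have "\<dots> = Im (z * (u1 * cnj u1)) - q * Im (u1 * cnj u1) - p' * Im (u0 * cnj u1)"
    unfolding assms by (simp add: algebra_simps)
  also have "\<dots> = Im z * (norm u1)\<^sup>2 + p' * Im (u1 * cnj u0)"
    by (simp add: complex_mult_cnj cmod_power2) (simp add: algebra_simps)
  finally show ?thesis by simp
qed

locale periodic_jacobi =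
  fixes N :: nat and \<alpha> \<beta> :: "int \<Rightarrow> real"
  assumes N: "N \<ge> 1" and per_\<alpha>: "periodic_seq N \<alpha>" and per_\<beta>: "periodic_seq N \<beta>"
    and \<alpha>_pos: "\<And>n. \<alpha> n > 0"
begin

text \<open>Index i of \<open>sol pc (pd z)\<close> is position i - 1 of the Jacobi recurrence. The
  initial values sit at positions -1 and 0, whence \<alpha> (-1) in the Wronskian.\<close>

definition pc :: "nat \<Rightarrow> 'a::real_field" where "pc i = of_real (\<alpha> (int i - 1) / \<alpha> (int i))"
definition pd :: "'a::real_field \<Rightarrow> nat \<Rightarrow> 'a" where "pd z i = (z - of_real (\<beta> (int i))) / of_real (\<alpha> (int i))"

abbreviation \<phi> :: "'a::real_field \<Rightarrow> nat \<Rightarrow> 'a" where "\<phi> z \<equiv> sol pc (pd z) 1 0"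
abbreviation \<psi> :: "'a::real_field \<Rightarrow> nat \<Rightarrow> 'a" where "\<psi> z \<equiv> sol pc (pd z) 0 1"

definition discr :: "'a::real_field \<Rightarrow> 'a" where "discr z = \<phi> z N + \<psi> z (Suc N)"

lemma \<alpha>_shift: "\<alpha> (n + int N) = \<alpha> n" and \<beta>_shift: "\<beta> (n + int N) = \<beta> n"
  using per_\<alpha> per_\<beta> by (auto simp: periodic_seq_def)

lemma pc_shift: "pc (i + N) = (pc i :: 'a::real_field)" and pd_shift: "pd z (i + N) = pd z i"
  using \<alpha>_shift[of "int i"] \<alpha>_shift[of "int i - 1"] \<beta>_shift[of "int i"]
  by (simp_all add: pc_def pd_def algebra_simps)

lemma prod_pc: "(\<Prod>j<i. pc j) = (of_real (\<alpha> (-1) / \<alpha> (int i - 1)) :: 'a::real_field)"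
proof (induction i)
  case (Suc i)
  have "\<alpha> (int i - 1) \<noteq> 0" using \<alpha>_pos[of "int i - 1"] by simp
  then show ?case using Suc by (simp add: pc_def)
qed (use \<alpha>_pos[of "-1"] in simp)

lemma wronskian: "\<phi> z i * \<psi> z (Suc i) - \<phi> z (Suc i) * \<psi> z i = of_real (\<alpha> (-1) / \<alpha> (int i - 1))"
  by (simp only: sol_wronskian prod_pc)

lemma det_monodromy: "\<phi> z N * \<psi> z (Suc N) - \<phi> z (Suc N) * \<psi> z N = 1"
proof -
  have "\<alpha> (int N - 1) = \<alpha> (-1)" using \<alpha>_shift[of "-1"] by (simp add: algebra_simps)
  then show ?thesis using wronskian[of z N] \<alpha>_pos[of "-1"] by simp
qed

lemma sol_of_real:
  "sol pc (pd (of_real x :: 'a::real_field)) (of_real u) (of_real v) i = of_real (sol pc (pd x) u v i)"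
  by (induction i rule: induct_nat_012) (auto simp: pc_def pd_def)

lemma discr_of_real: "discr (of_real x :: 'a::real_field) = of_real (discr x)"
  using sol_of_real[of x 1 0 N, where 'a='a] sol_of_real[of x 0 1 "Suc N", where 'a='a] by (simp add: discr_def del: sol.simps)

text \<open>Variation of constants: differentiating the recurrence in z gives the same recurrence
  with the solution itself, divided by \<alpha>, as its source. The kernel is built from
  \<open>\<phi>\<close> and \<open>\<psi>\<close>, normalised by their Wronskian.\<close>

lemma sol_has_derivative:
  fixes z u v :: "'a::real_normed_field"
  shows "((\<lambda>z. sol pc (pd z) u v n) has_field_derivative
    (\<Sum>i<n. sol pc (pd z) u v (Suc i) * (\<phi> z (Suc i) * \<psi> z n - \<psi> z (Suc i) * \<phi> z n)) / of_real (\<alpha> (-1))) (at z)"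
proof (induction n rule: induct_nat_012)
  case (ge2 n)
  define s where "s = sol pc (pd z) u v"
  define G where "G i n = s (Suc i) * (\<phi> z (Suc i) * \<psi> z n - \<psi> z (Suc i) * \<phi> z n)" for i n
  define a where "a = (of_real (\<alpha> (-1)) :: 'a)"
  define an where "an = (of_real (\<alpha> (int n)) :: 'a)"
  have a: "a \<noteq> 0" "an \<noteq> 0" unfolding a_def an_def using \<alpha>_pos[of "-1"] \<alpha>_pos[of "int n"] by auto
  have pd: "((\<lambda>z. pd z n) has_field_derivative inverse an) (at z)"
    unfolding pd_def an_def using \<alpha>_pos[of "int n"] by (auto intro!: derivative_eq_intros simp: divide_inverse)
  have D: "((\<lambda>z. sol pc (pd z) u v (Suc (Suc n))) has_field_derivative
     (inverse an * s (Suc n) + (\<Sum>i<Suc n. G i (Suc n)) / a * pd z n) - pc n * ((\<Sum>i<n. G i n) / a)) (at z)"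
    unfolding sol.simps s_def G_def a_def
    by (rule DERIV_diff[OF DERIV_mult[OF pd] DERIV_cmult]; fact ge2)
  have rec: "G i (Suc (Suc n)) = pd z n * G i (Suc n) - pc n * G i n" for i
    by (simp add: G_def algebra_simps)
  have Gn: "G n (Suc n) = 0" "G (Suc n) (Suc (Suc n)) = 0" by (simp_all add: G_def del: sol.simps)
  have W: "\<phi> z (Suc n) * \<psi> z (Suc (Suc n)) - \<phi> z (Suc (Suc n)) * \<psi> z (Suc n) = a / an"
    using wronskian[of z "Suc n"] by (simp add: a_def an_def del: sol.simps)
  have "G n (Suc (Suc n)) = s (Suc n) * (a / an)"
    unfolding G_def using W by (simp add: algebra_simps del: sol.simps)
  then have "(\<Sum>i<Suc (Suc n). G i (Suc (Suc n))) = (\<Sum>i<n. pd z n * G i (Suc n) - pc n * G i n) + s (Suc n) * (a / an)"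
    using Gn by (simp add: rec)
  also have "\<dots> = pd z n * (\<Sum>i<Suc n. G i (Suc n)) - pc n * (\<Sum>i<n. G i n) + s (Suc n) * (a / an)"
    using Gn by (simp add: sum_subtractf sum_distrib_left)
  finally have e: "(\<Sum>i<Suc (Suc n). G i (Suc (Suc n))) = pd z n * (\<Sum>i<Suc n. G i (Suc n)) - pc n * (\<Sum>i<n. G i n) + s (Suc n) * (a / an)" .
  have "(\<Sum>i<Suc (Suc n). G i (Suc (Suc n))) / a
     = (inverse an * s (Suc n) + (\<Sum>i<Suc n. G i (Suc n)) / a * pd z n) - pc n * ((\<Sum>i<n. G i n) / a)"
    unfolding e using a by (simp add: field_simps del: sum.lessThan_Suc)
  with D show ?case by (simp only: G_def s_def a_def)
qed auto

text \<open>With A, B, C, D for the entries of the monodromy matrix, the summand is the value at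
  (\<open>\<phi>\<close>, \<open>\<psi>\<close>) of the form with coefficients B, D - A, -C. The
  same form governs the averages of the squares; this links the two in
  \<open>\<kappa>_sum\<close>.\<close>

lemma discr_has_derivative:
  fixes z :: "'a::real_normed_field"
  shows "(discr has_field_derivative
    (\<Sum>i<N. \<psi> z N * (\<phi> z (Suc i))\<^sup>2 + (\<psi> z (Suc N) - \<phi> z N) * \<phi> z (Suc i) * \<psi> z (Suc i) - \<phi> z (Suc N) * (\<psi> z (Suc i))\<^sup>2)
      / of_real (\<alpha> (-1))) (at z)"
proof -
  have eq: "discr = (\<lambda>z::'a. \<phi> z N + \<psi> z (Suc N))" by (rule ext) (simp add: discr_def)
  have *: "(\<Sum>i<Suc N. \<psi> z (Suc i) * (\<phi> z (Suc i) * \<psi> z (Suc N) - \<psi> z (Suc i) * \<phi> z (Suc N)))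
     = (\<Sum>i<N. \<psi> z (Suc i) * (\<phi> z (Suc i) * \<psi> z (Suc N) - \<psi> z (Suc i) * \<phi> z (Suc N)))"
    by (simp del: sol.simps)
  show ?thesis unfolding eq
    by (rule DERIV_cong[OF DERIV_add[OF sol_has_derivative sol_has_derivative]])
      (simp add: * add_divide_distrib[symmetric] sum.distrib[symmetric] algebra_simps power2_eq_square del: sol.simps)
qed

text \<open>By Cayley-Hamilton, a monodromy matrix of trace 0 and determinant 1 has square
  -1.\<close>

lemma sol_antiperiodic:
  assumes "discr z = 0" shows "sol pc (pd z) u v (i + 2 * N) = - sol pc (pd z) u v i"
proof -
  let ?s = "sol pc (pd z) u v"
  have step: "?s (i + N) = ?s N * \<phi> z i + ?s (Suc N) * \<psi> z i" for i
    using sol_add[of pc "pd z" u v i N] sol_linear[of pc "pd z" "?s N" "?s (Suc N)" i]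
    by (simp add: pc_shift pd_shift del: sol.simps)
  have sN: "?s n = u * \<phi> z n + v * \<psi> z n" for n by (rule sol_linear)
  have tr: "\<psi> z (Suc N) = - \<phi> z N" using assms by (simp add: discr_def eq_neg_iff_add_eq_0 add.commute)
  have det: "\<phi> z N * \<psi> z (Suc N) - \<phi> z (Suc N) * \<psi> z N = 1" by (rule det_monodromy)
  have 1: "?s (N + N) = - u" using det unfolding step[of N] sN[of N] sN[of "Suc N"] tr by algebra
  have 2: "?s (Suc N + N) = - v" using det unfolding step[of "Suc N"] sN[of N] sN[of "Suc N"] tr by algebra
  have "?s (i + (N + N)) = ?s (N + N) * \<phi> z i + ?s (Suc (N + N)) * \<psi> z i"
    using sol_add[of pc "pd z" u v i "N + N"] sol_linear[of pc "pd z" "?s (N + N)" "?s (Suc (N + N))" i]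
    by (simp add: pc_shift pd_shift add.assoc[symmetric] del: sol.simps)
  moreover have "i + 2 * N = i + (N + N)" "Suc (N + N) = Suc N + N" by simp_all
  ultimately show ?thesis using 1 2 sN[of i] by (simp only:) (simp del: sol.simps)
qed

text \<open>The current is quadratic, so a change of sign after 2 N steps leaves it unchanged. Its
  growth over these steps, Im z times a positive sum, is therefore 0.\<close>

lemma discr_zero_real:
  fixes z :: complex assumes "discr z = 0" shows "Im z = 0"
proof -
  let ?u = "\<psi> z"
  define E where "E i = \<alpha> (int i - 1) * Im (?u (Suc i) * cnj (?u i))" for i
  have "E (Suc i) = E i + Im z * (norm (?u (Suc i)))\<^sup>2" for i
  proof -
    have "\<alpha> (int i) \<noteq> 0" using \<alpha>_pos[of "int i"] by simp
    then show ?thesis unfolding E_def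
      using energy_step[of "\<alpha> (int i)" "?u (Suc (Suc i))" z "\<beta> (int i)" "?u (Suc i)" "\<alpha> (int i - 1)" "?u i"]
      by (simp add: pc_def pd_def field_simps)
  qed
  then have sum: "E n = E 0 + Im z * (\<Sum>i<n. (norm (?u (Suc i)))\<^sup>2)" for n
    by (induction n) (auto simp: algebra_simps simp del: sol.simps)
  have "E (2 * N) = E 0"
  proof -
    have "\<alpha> (int (2 * N) - 1) = \<alpha> (-1)" using \<alpha>_shift[of "-1"] \<alpha>_shift[of "-1 + int N"] by (simp add: algebra_simps)
    then show ?thesis unfolding E_def
      using sol_antiperiodic[OF assms, of 0 1 0] sol_antiperiodic[OF assms, of 0 1 1] by simp
  qed
  then have "Im z * (\<Sum>i<2*N. (norm (?u (Suc i)))\<^sup>2) = 0" using sum[of "2 * N"] by simp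
  moreover have "(\<Sum>i<2*N. (norm (?u (Suc i)))\<^sup>2) > 0"
    using N by (intro sum_pos2[of _ 0]) auto
  ultimately show ?thesis by simp
qed

lemma trace_transfer_prod: "trace (transfer_prod \<alpha> \<beta> N 0 x) = discr x"
proof -
  have "transfer_prod \<alpha> \<beta> m 0 x $ 1 $ 1 = \<phi> x m \<and> transfer_prod \<alpha> \<beta> m 0 x $ 1 $ 2 = \<psi> x m \<and>
    transfer_prod \<alpha> \<beta> m 0 x $ 2 $ 1 = \<phi> x (Suc m) \<and> transfer_prod \<alpha> \<beta> m 0 x $ 2 $ 2 = \<psi> x (Suc m)" for m
  proof (induction m)
    case 0 then show ?case by (simp add: mat_def)
  next
    case (Suc m)
    then show ?case
      by (auto simp: transfer_matrix_def matrix_matrix_mult_def sum_2 pc_def pd_def algebra_simps)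
  qed
  then show ?thesis by (simp add: trace_def sum_2 discr_def)
qed

section \<open>The discriminant as a polynomial with simple real zeros\<close>

definition psol :: "'a::real_field \<Rightarrow> 'a \<Rightarrow> nat \<Rightarrow> 'a poly" where
  "psol u v = sol (\<lambda>i. [:pc i:]) (\<lambda>i. [:- (of_real (\<beta> (int i) / \<alpha> (int i))), of_real (1 / \<alpha> (int i)):]) [:u:] [:v:]"

lemma poly_psol: "poly (psol u v n) z = sol pc (pd z) u v n"
proof (induction n rule: induct_nat_012)
  case (ge2 n)
  have "poly (psol u v (Suc (Suc n))) z = (- (of_real (\<beta> (int n) / \<alpha> (int n))) + z * of_real (1 / \<alpha> (int n))) * poly (psol u v (Suc n)) z
      - pc n * poly (psol u v n) z" unfolding psol_def sol.simps poly_diff poly_mult by simp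
  then show ?case using ge2 \<alpha>_pos[of "int n"] by (simp add: pd_def field_simps)
qed (auto simp: psol_def)

lemma degree_psol: "degree (psol u v n) \<le> n - 1" and coeff_psol: "coeff (psol u v (Suc n)) n = v * of_real (\<Prod>j<n. 1 / \<alpha> (int j))"
proof -
  have *: "degree (psol u v n) \<le> n - 1 \<and> degree (psol u v (Suc n)) \<le> n \<and> coeff (psol u v (Suc n)) n = v * of_real (\<Prod>j<n. 1 / \<alpha> (int j))" for n
  proof (induction n)
    case 0 then show ?case by (simp add: psol_def)
  next
    case (Suc n)
    define d where "d = [:- (of_real (\<beta> (int n) / \<alpha> (int n)) :: 'a), of_real (1 / \<alpha> (int n)):]"
    have eq: "psol u v (Suc (Suc n)) = d * psol u v (Suc n) - smult (pc n) (psol u v n)"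
      by (simp add: psol_def d_def)
    have dd: "degree d \<le> 1" by (simp add: d_def)
    have "degree (d * psol u v (Suc n)) \<le> Suc n"
      using degree_mult_le[of d "psol u v (Suc n)"] dd Suc by linarith
    moreover have "degree (smult (pc n) (psol u v n)) \<le> Suc n"
      using degree_smult_le[of "pc n" "psol u v n"] Suc by linarith
    ultimately have 1: "degree (psol u v (Suc (Suc n))) \<le> Suc n"
      unfolding eq by (rule degree_diff_le)
    have "coeff (psol u v n) (Suc n) = 0" "coeff (psol u v (Suc n)) (Suc n) = 0"
      using Suc by (auto intro!: coeff_eq_0)
    then have "coeff (psol u v (Suc (Suc n))) (Suc n) = of_real (1 / \<alpha> (int n)) * coeff (psol u v (Suc n)) n"
      unfolding eq d_def by (simp add: coeff_pCons)
    then show ?case using 1 Suc by simp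
  qed
  show "degree (psol u v n) \<le> n - 1" "coeff (psol u v (Suc n)) n = v * of_real (\<Prod>j<n. 1 / \<alpha> (int j))"
    using * by auto
qed

definition discr_poly :: "'a::real_field poly" where "discr_poly = psol 1 0 N + psol 0 1 (Suc N)"

lemma poly_discr_poly: "poly discr_poly z = discr z"
  by (simp add: discr_poly_def poly_psol discr_def)

lemma degree_discr_poly: "degree (discr_poly :: 'a::real_field poly) = N"
proof -
  have 1: "degree (psol 1 0 N :: 'a poly) < N" using degree_psol[of "1::'a" 0 N] N by simp
  have "coeff (psol (0::'a) 1 (Suc N)) N \<noteq> 0"
    unfolding coeff_psol using \<alpha>_pos by (simp add: prod_pos less_imp_neq) (metis less_irrefl)
  then have 2: "degree (psol 0 1 (Suc N) :: 'a poly) = N"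
    using degree_psol[of "0::'a" 1 "Suc N"] le_degree by (metis diff_Suc_1 le_antisym)
  then show ?thesis unfolding discr_poly_def using 1 by (simp add: degree_add_eq_right)
qed

text \<open>The form has discriminant (D - A)^2 + 4 B C = discr^2 - 4 < 0, so it is definite and its
  values cannot cancel. Completing the square after multiplication by 4 B shows this.\<close>

lemma discr_deriv_nonzero:
  fixes x :: real assumes "\<bar>discr x\<bar> < 2"
  shows "(\<Sum>i<N. \<psi> x N * (\<phi> x (Suc i))\<^sup>2 + (\<psi> x (Suc N) - \<phi> x N) * \<phi> x (Suc i) * \<psi> x (Suc i) - \<phi> x (Suc N) * (\<psi> x (Suc i))\<^sup>2) \<noteq> 0"
proof -
  let ?A = "\<phi> x N" and ?B = "\<psi> x N" and ?C = "\<phi> x (Suc N)" and ?D = "\<psi> x (Suc N)"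
  let ?q = "\<lambda>i. ?B * (\<phi> x (Suc i))\<^sup>2 + (?D - ?A) * \<phi> x (Suc i) * \<psi> x (Suc i) - ?C * (\<psi> x (Suc i))\<^sup>2"
  have "\<bar>?A + ?D\<bar> < 2" using assms by (simp add: discr_def)
  then have "(?A + ?D)\<^sup>2 < 4" using power_strict_mono[of "\<bar>?A + ?D\<bar>" 2 2] by simp
  moreover have "?A * ?D - ?C * ?B = 1" by (rule det_monodromy)
  moreover have "(?D - ?A)\<^sup>2 + 4 * ?B * ?C = (?A + ?D)\<^sup>2 - 4 * (?A * ?D - ?C * ?B)"
    by (simp add: power2_eq_square algebra_simps del: sol.simps)
  ultimately have disc: "(?D - ?A)\<^sup>2 + 4 * ?B * ?C < 0" by simp
  have B: "?B \<noteq> 0"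
  proof
    assume B: "?B = 0"
    show False using disc zero_le_power2[of "?D - ?A"] unfolding B by simp
  qed
  have q: "4 * ?B * ?q i = (2 * ?B * \<phi> x (Suc i) + (?D - ?A) * \<psi> x (Suc i))\<^sup>2 - ((?D - ?A)\<^sup>2 + 4 * ?B * ?C) * (\<psi> x (Suc i))\<^sup>2" for i
    by (simp add: power2_eq_square algebra_simps del: sol.simps)
  have nn: "4 * ?B * ?q i \<ge> 0" for i
    unfolding q using mult_nonpos_nonneg[OF less_imp_le[OF disc] zero_le_power2[of "\<psi> x (Suc i)"]]
      zero_le_power2[of "2 * ?B * \<phi> x (Suc i) + (?D - ?A) * \<psi> x (Suc i)"] by linarith
  have "4 * (?B * ?C) < 0" using disc zero_le_power2[of "?D - ?A"] by (simp only: mult.assoc)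
  \<comment> \<open>At i = 0 one has \<open>\<phi>\<close> = 0 and \<open>\<psi>\<close> = 1, so
    this term is strictly positive.\<close>
  then have "4 * ?B * ?q 0 > 0" unfolding q by simp
  then have "(\<Sum>i<N. 4 * ?B * ?q i) > 0"
    using N nn by (intro sum_pos2[of _ 0]) auto
  then have "4 * ?B * (\<Sum>i<N. ?q i) > 0" by (simp only: sum_distrib_left)
  then show ?thesis by (metis less_irrefl mult_zero_right)
qed

text \<open>The polynomial has degree N; its complex roots are real by
  \<open>discr_zero_real\<close> and simple by \<open>discr_deriv_nonzero\<close>. They will label
  the bands.\<close>

lemma card_discr_zeros: "card {x::real. discr x = 0} = N"
proof -
  let ?p = "discr_poly :: complex poly"
  have p0: "?p \<noteq> 0" using degree_discr_poly[where 'a=complex] N by auto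
  have "rsquarefree ?p"
    unfolding rsquarefree_roots
  proof safe
    fix z assume z: "poly ?p z = 0" "poly (pderiv ?p) z = 0"
    then have "Im z = 0" using discr_zero_real by (simp add: poly_discr_poly)
    then obtain x where x: "z = of_real x" by (metis complex_is_Real_iff Reals_cases)
    have "discr x = 0" using z(1) unfolding x poly_discr_poly discr_of_real by simp
    then have nz: "(\<Sum>i<N. \<psi> x N * (\<phi> x (Suc i))\<^sup>2 + (\<psi> x (Suc N) - \<phi> x N) * \<phi> x (Suc i) * \<psi> x (Suc i) - \<phi> x (Suc N) * (\<psi> x (Suc i))\<^sup>2) \<noteq> 0"
      by (intro discr_deriv_nonzero) simp
    have D: "(discr has_field_derivative poly (pderiv ?p) z) (at z)"
      using poly_DERIV[of ?p z] by (simp add: poly_discr_poly)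
    have \<phi>: "\<phi> (complex_of_real x) i = of_real (\<phi> x i)" and \<psi>: "\<psi> (complex_of_real x) i = of_real (\<psi> x i)" for i
      using sol_of_real[of x 1 0 i, where 'a=complex] sol_of_real[of x 0 1 i, where 'a=complex] by simp_all
    show False using DERIV_unique[OF D discr_has_derivative] z(2) nz \<alpha>_pos[of "-1"]
      unfolding x \<phi> \<psi> by (simp flip: of_real_power of_real_mult of_real_diff of_real_add of_real_sum del: sol.simps)
  qed
  then have "smult (lead_coeff ?p) (\<Prod>z|poly ?p z = 0. [:-z, 1:]) = ?p"
    by (rule complex_poly_decompose_rsquarefree)
  then have "degree (smult (lead_coeff ?p) (\<Prod>z|poly ?p z = 0. [:-z, 1:])) = N"
    using degree_discr_poly by metis
  then have "card {z. poly ?p z = 0} = N"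
    using p0 by (simp add: degree_prod_eq_sum_degree)
  moreover have "{z. poly ?p z = 0} = complex_of_real ` {x. discr x = 0}"
  proof (intro equalityI subsetI)
    fix z assume "z \<in> {z. poly ?p z = 0}"
    then have z: "discr z = 0" by (simp add: poly_discr_poly)
    then obtain x where x: "z = of_real x" using discr_zero_real by (metis complex_is_Real_iff Reals_cases)
    with z show "z \<in> complex_of_real ` {x. discr x = 0}" by (auto simp: discr_of_real)
  qed (auto simp: poly_discr_poly discr_of_real)
  ultimately show ?thesis by (simp add: card_image inj_on_def)
qed

end

section \<open>Poisson integrals\<close>

definition poisson :: "real \<Rightarrow> real \<Rightarrow> real" where "poisson y u = y / (pi * (u\<^sup>2 + y\<^sup>2))"

lemma poisson_nonneg: "y \<ge> 0 \<Longrightarrow> poisson y u \<ge> 0"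
  by (simp add: poisson_def)

lemma poisson_measurable [measurable]: "poisson y \<in> borel_measurable borel"
  unfolding poisson_def[abs_def] by measurable

lemma poisson_uminus: "poisson y (- u) = poisson y u"
  by (simp add: poisson_def)

lemma poisson_minus_commute: "poisson y (x - a) = poisson y (a - x)"
  using poisson_uminus[of y "a - x"] by simp

lemma poisson_le:
  assumes "y > 0" shows "poisson y u \<le> 1 / (pi * y)"
proof -
  have "y / (u\<^sup>2 + y\<^sup>2) \<le> y / y\<^sup>2" using assms by (intro divide_left_mono mult_pos_pos add_nonneg_pos) auto
  then have "y / (u\<^sup>2 + y\<^sup>2) / pi \<le> y / y\<^sup>2 / pi" by (rule divide_right_mono) simp
  then show ?thesis using assms by (simp add: poisson_def power2_eq_square field_simps)
qed

lemma has_bochner_integral_poisson: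
  assumes y: "y > 0" shows "has_bochner_integral lborel (\<lambda>x. poisson y (x - a)) 1"
proof -
  have "(\<integral>\<^sup>+x. ennreal (poisson 1 x) * indicator {0 ..} x \<partial>lborel) = 1/2 - arctan 0 / pi"
  proof (rule nn_integral_FTC_atLeast)
    show "((\<lambda>x. arctan x / pi) has_real_derivative poisson 1 x) (at x)" for x
      by (rule DERIV_cong[OF DERIV_cdivide[OF DERIV_arctan]]) (simp add: poisson_def inverse_eq_divide add.commute mult.commute)
    show "((\<lambda>x. arctan x / pi) \<longlongrightarrow> 1/2) at_top"
      using tendsto_divide[OF tendsto_arctan_at_top tendsto_const[of pi]] by simp
  qed (auto simp: poisson_nonneg)
  then have "has_bochner_integral lborel (\<lambda>x. indicator {0..} x *\<^sub>R poisson 1 x) (1/2)"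
    by (intro has_bochner_integral_nn_integral)
      (auto simp: poisson_nonneg ennreal_mult' ennreal_indicator mult.commute cong: nn_integral_cong)
  from has_bochner_integral_even_function[OF this poisson_uminus]
  have "has_bochner_integral lborel (poisson 1) 1" by simp
  then have "has_bochner_integral lborel (\<lambda>x. poisson 1 (- a / y + 1 / y * x)) (1 /\<^sub>R \<bar>1 / y\<bar>)"
    using y by (subst lborel_has_bochner_integral_real_affine_iff[symmetric]) auto
  then have "has_bochner_integral lborel (\<lambda>x. (1 / y) * poisson 1 (- a / y + 1 / y * x)) ((1 / y) * (1 /\<^sub>R \<bar>1 / y\<bar>))"
    by (rule has_bochner_integral_mult_right)
  moreover have "(1 / y) * poisson 1 (- a / y + 1 / y * x) = poisson y (x - a)" for x
  proof -
    have "(- a / y + 1 / y * x)\<^sup>2 + 1\<^sup>2 = ((x - a)\<^sup>2 + y\<^sup>2) / y\<^sup>2"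
      using y by (simp add: field_simps power2_eq_square)
    then show ?thesis using y unfolding poisson_def by (simp add: power2_eq_square)
  qed
  ultimately show ?thesis using y by simp
qed

lemma integrable_poisson [simp]: "y > 0 \<Longrightarrow> integrable lborel (\<lambda>x. poisson y (x - a))"
  and integral_poisson: "y > 0 \<Longrightarrow> (\<integral>x. poisson y (x - a) \<partial>lborel) = 1"
  using has_bochner_integral_poisson[of y a] by (auto simp: has_bochner_integral_iff)

lemma integral_symmetric_limit:
  fixes F :: "real \<Rightarrow> complex" assumes intF: "integrable lborel F"
  shows "(\<lambda>n. integral\<^sup>L lborel (\<lambda>x. indicat_real {- real n..real n} x *\<^sub>R F x)) \<longlonglongrightarrow> integral\<^sup>L lborel F"
proof (rule integral_dominated_convergence[where w = "\<lambda>x. norm (F x)" and f = F and s = "\<lambda>n x. indicat_real {- real n..real n} x *\<^sub>R F x"])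
    show F: "F \<in> borel_measurable lborel" using intF by (rule borel_measurable_integrable)
    show "(\<lambda>x. indicat_real {- real n..real n} x *\<^sub>R F x) \<in> borel_measurable lborel" for n
      using F by measurable
    show "integrable lborel (\<lambda>x. norm (F x))" using intF by (rule integrable_norm)
    show "AE x in lborel. norm (indicat_real {- real n..real n} x *\<^sub>R F x) \<le> norm (F x)" for n
      by (rule AE_I2) (simp add: indicator_def)
    show "AE x in lborel. (\<lambda>n. indicat_real {- real n..real n} x *\<^sub>R F x) \<longlonglongrightarrow> F x"
    proof (rule AE_I2)
      fix x :: real
      obtain n0 :: nat where n0: "\<bar>x\<bar> \<le> n0" using real_arch_simple[of "\<bar>x\<bar>"] by (elim exE)
      have "indicat_real {- real n..real n} x *\<^sub>R F x = F x" if "n \<ge> n0" for n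
      proof -
        have "real n0 \<le> real n" using that by simp
        then have "x \<in> {- real n..real n}" using n0 unfolding atLeastAtMost_iff by linarith
        then show ?thesis by simp
      qed
      then have "eventually (\<lambda>n. indicat_real {- real n..real n} x *\<^sub>R F x = F x) sequentially"
        unfolding eventually_sequentially by blast
      then show "(\<lambda>n. indicat_real {- real n..real n} x *\<^sub>R F x) \<longlonglongrightarrow> F x"
        by (rule tendsto_eventually)
    qed
qed

lemma closed_half_plane_props:
  shows "convex {z. Im z \<ge> 0}" "interior {z. Im z \<ge> 0} = {z. Im z > 0}"
  using convex_halfspace_Im_ge[of 0] interior_halfspace_ge[of \<i> 0] by (auto simp: inner_complex_def)

text \<open>Cauchy's theorem on a large half-disc for h = (M z - M z0) / ((z - z0) (z - cnj z0)):
  the subtraction removes the pole at z0, and the other pole lies in the lower half-plane. As h is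
  O(R^-2) on the arc, its integral over the real line vanishes. There the denominator is |x - z0|^2,
  which gives the Poisson kernel, and this kernel has mass 1.\<close>

lemma poisson_formula_half_plane:
  fixes M :: "complex \<Rightarrow> complex"
  assumes cont: "continuous_on {z. Im z \<ge> 0} M" and holo: "M holomorphic_on {z. Im z > 0}"
    and bdd: "\<And>z. Im z \<ge> 0 \<Longrightarrow> norm (M z) \<le> C" and z0: "Im z0 > 0"
  shows "has_bochner_integral lborel (\<lambda>x. of_real (poisson (Im z0) (x - Re z0)) * M (of_real x)) (M z0)"
proof -
  let ?H = "{z. Im z \<ge> 0}"
  have C: "C \<ge> 0" using order_trans[OF norm_ge_zero bdd[of 0]] by simp
  define q where "q z = (if z = z0 then deriv M z0 else (M z - M z0) / (z - z0))" for z
  define h where "h z = q z / (z - cnj z0)" for z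
  have ne: "z - cnj z0 \<noteq> 0" if "Im z \<ge> 0" for z using that z0 by (auto simp: complex_eq_iff)
  have opn: "open {z. Im z > 0}" using open_halfspace_Im_gt[of 0] by simp
  have Md: "M field_differentiable (at z)" if "Im z > 0" for z
    using holo opn that holomorphic_on_imp_differentiable_at by blast
  have qd: "q field_differentiable (at z)" if "Im z > 0" "z \<noteq> z0" for z
  proof -
    have "(\<lambda>z. (M z - M z0) / (z - z0)) field_differentiable (at z)"
      using that Md[OF that(1)] by (intro derivative_intros) auto
    then obtain D where "((\<lambda>z. (M z - M z0) / (z - z0)) has_field_derivative D) (at z)"
      unfolding field_differentiable_def by blast
    moreover have "eventually (\<lambda>w. w \<in> - {z0}) (nhds z)"
      using that(2) by (intro eventually_nhds_in_open) auto
    then have "eventually (\<lambda>w. (M w - M z0) / (w - z0) = q w) (nhds z)"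
      by eventually_elim (auto simp: q_def)
    ultimately have "(q has_field_derivative D) (at z)"
      using DERIV_cong_ev[of z z "\<lambda>z. (M z - M z0) / (z - z0)" q D D] by blast
    then show ?thesis unfolding field_differentiable_def by blast
  qed
  have qc0: "continuous (at z0) q"
  proof -
    have "(M has_field_derivative deriv M z0) (at z0)"
      using Md[OF z0] by (simp add: DERIV_deriv_iff_field_differentiable)
    then have "((\<lambda>z. (M z - M z0) / (z - z0)) \<longlongrightarrow> deriv M z0) (at z0)"
      by (simp add: has_field_derivative_iff)
    moreover have "eventually (\<lambda>z. (M z - M z0) / (z - z0) = q z) (at z0)"
      by (auto simp: eventually_at_filter q_def)
    ultimately have "(q \<longlongrightarrow> deriv M z0) (at z0)"
      by (rule Lim_transform_eventually)
    then show ?thesis by (simp add: continuous_at q_def)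
  qed
  have qc: "continuous_on ?H q"
    unfolding continuous_on_eq_continuous_within
  proof
    fix z assume z: "z \<in> ?H"
    show "continuous (at z within ?H) q"
    proof (cases "z = z0")
      case True then show ?thesis using qc0 continuous_at_imp_continuous_within by blast
    next
      case False
      have "continuous (at z within ?H) (\<lambda>z. (M z - M z0) / (z - z0))"
        using cont z False by (intro continuous_intros) (auto simp: continuous_on_eq_continuous_within)
      moreover have "eventually (\<lambda>w. w \<in> - {z0}) (nhds z)"
        using False by (intro eventually_nhds_in_open) auto
      then have "eventually (\<lambda>w. (M w - M z0) / (w - z0) = q w) (at z within ?H)"
        unfolding eventually_at_filter by eventually_elim (auto simp: q_def)
      ultimately have "(q \<longlongrightarrow> (M z - M z0) / (z - z0)) (at z within ?H)"
        unfolding continuous_within by (rule Lim_transform_eventually)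
      then show ?thesis using False by (simp add: continuous_within q_def)
    qed
  qed
  have hc: "continuous_on ?H h" unfolding h_def[abs_def]
    by (intro continuous_intros qc) (use ne in auto)
  have hd: "h field_differentiable (at z)" if "Im z > 0" "z \<noteq> z0" for z
    unfolding h_def[abs_def] using qd[OF that] ne[of z] that by (intro derivative_intros) auto
  have arc: "norm (integral {-R..R} (\<lambda>x. h (of_real x))) \<le> 2 * C / (R - norm z0)\<^sup>2 * R * pi"
    if R: "R > norm z0" for R
  proof -
    have R0: "R > 0" using R norm_ge_zero[of z0] by linarith
    let ?g1 = "linepath (complex_of_real (-R)) (complex_of_real R)" and ?g2 = "part_circlepath 0 R 0 pi"
    have im1: "path_image ?g1 \<subseteq> ?H" by (auto simp: in_segment path_image_linepath)
    have im2: "path_image ?g2 \<subseteq> ?H"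
      using R0 by (auto simp: path_image_part_circlepath Im_exp intro!: mult_nonneg_nonneg sin_ge_zero)
    have ends: "pathfinish ?g1 = pathstart ?g2" "pathfinish ?g2 = pathstart ?g1"
      using R0 by (auto simp: )
    have "(h has_contour_integral 0) (?g1 +++ ?g2)"
    \<comment> \<open>The exceptional set asks only for continuity at z0, where \<open>h\<close> has
      been filled in by the derivative of M.\<close>
    proof (rule Cauchy_theorem_convex[where S = ?H and K = "{z0}"])
      show "path_image (?g1 +++ ?g2) \<subseteq> ?H" using im1 im2 ends by (simp add: path_image_join)
      show "valid_path (?g1 +++ ?g2)" using ends by (intro valid_path_join) auto
    qed (use hc hd closed_half_plane_props ends in auto)
    moreover have i1: "h contour_integrable_on ?g1"
      by (rule contour_integrable_continuous_linepath) (use hc im1 continuous_on_subset in auto)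
    moreover have i2: "h contour_integrable_on ?g2"
      by (rule contour_integrable_continuous_part_circlepath) (use hc im2 continuous_on_subset in auto)
    ultimately have "contour_integral ?g1 h + contour_integral ?g2 h = 0"
      using ends by (metis contour_integral_join contour_integral_unique valid_path_linepath valid_path_part_circlepath)
    then have "contour_integral ?g1 h = - contour_integral ?g2 h" by (simp add: eq_neg_iff_add_eq_0)
    moreover have "contour_integral ?g1 h = integral {-R..R} (\<lambda>x. h (of_real x))"
      using R0 by (subst contour_integral_linepath_Reals_eq) auto
    moreover have "norm (contour_integral ?g2 h) \<le> 2 * C / (R - norm z0)\<^sup>2 * R * \<bar>pi - 0\<bar>"
    proof (rule contour_integral_bound_part_circlepath[OF i2])
      fix z assume z: "z \<in> path_image ?g2"
      then have zH: "Im z \<ge> 0" using im2 by auto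
      have nz: "norm z = R" using z R0 path_image_part_circlepath_subset'[of R 0 0 pi] by auto
      have zz0: "z \<noteq> z0" using nz R by auto
      have a: "R - norm z0 \<le> norm (z - z0)" "R - norm z0 \<le> norm (z - cnj z0)"
        using norm_triangle_ineq2[of z z0] norm_triangle_ineq2[of z "cnj z0"] nz by auto
      have "norm (h z) = norm (M z - M z0) / (norm (z - z0) * norm (z - cnj z0))"
        using zz0 by (simp add: h_def q_def norm_divide norm_mult)
      also have "\<dots> \<le> (2 * C) / ((R - norm z0) * (R - norm z0))"
      proof (rule frac_le)
        show "norm (M z - M z0) \<le> 2 * C"
          using norm_triangle_ineq4[of "M z" "M z0"] bdd[OF zH] bdd[of z0] z0 by simp
        show "(R - norm z0) * (R - norm z0) \<le> norm (z - z0) * norm (z - cnj z0)"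
          using a R by (intro mult_mono) auto
      qed (use R C in auto)
      finally show "norm (h z) \<le> 2 * C / (R - norm z0)\<^sup>2" by (simp add: power2_eq_square)
    qed (use C R0 in auto)
    ultimately show ?thesis by (metis diff_0_right abs_of_nonneg pi_ge_zero norm_minus_cancel)
  qed
  define P where "P x = poisson (Im z0) (x - Re z0)" for x
  have P0: "P x \<ge> 0" for x unfolding P_def using z0 by (intro poisson_nonneg) auto
  have intP: "integrable lborel P" "integral\<^sup>L lborel P = 1"
    unfolding P_def[abs_def] using z0 integral_poisson by auto
  have Mm: "(\<lambda>x. M (of_real x)) \<in> borel_measurable borel"
    by (intro borel_measurable_continuous_onI continuous_on_compose2[OF cont]) (auto intro!: continuous_intros)
  have intPM: "integrable lborel (\<lambda>x. of_real (P x) * M (of_real x))"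
  proof (rule Bochner_Integration.integrable_bound)
    show "integrable lborel (\<lambda>x. C * P x)" using intP by simp
    show "AE x in lborel. norm (of_real (P x) * M (of_real x)) \<le> norm (C * P x)"
    proof (rule AE_I2)
      fix x
      have "norm (of_real (P x) * M (of_real x)) = P x * norm (M (of_real x))" using P0 by (simp add: norm_mult)
      also have "\<dots> \<le> P x * C" using bdd[of "of_real x"] P0 by (intro mult_left_mono) auto
      finally show "norm (of_real (P x) * M (of_real x)) \<le> norm (C * P x)" using P0[of x] C by (simp add: mult.commute)
    qed
  qed (use Mm intP in measurable)
  have hP: "h (of_real x) = of_real (pi / Im z0) * (of_real (P x) * M (of_real x) - of_real (P x) * M z0)" for x
  proof -
    let ?r = "(x - Re z0)\<^sup>2 + (Im z0)\<^sup>2"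
    have xz: "of_real x \<noteq> z0" using z0 by auto
    have r: "(of_real x - z0) * (of_real x - cnj z0) = of_real ?r"
      by (simp add: complex_eq_iff power2_eq_square algebra_simps)
    have "P x * (pi / Im z0) = 1 / ?r"
      unfolding P_def poisson_def using z0 by simp
    then have P: "of_real (P x) * of_real (pi / Im z0) = 1 / complex_of_real ?r"
      by (metis of_real_1 of_real_divide of_real_mult)
    have "h (of_real x) = (M (of_real x) - M z0) / ((of_real x - z0) * (of_real x - cnj z0))"
      using xz by (simp add: h_def q_def)
    also have "\<dots> = (M (of_real x) - M z0) * (of_real (P x) * of_real (pi / Im z0))"
      unfolding r P by simp
    also have "\<dots> = of_real (pi / Im z0) * (of_real (P x) * M (of_real x) - of_real (P x) * M z0)"
      by (simp only: algebra_simps)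
    finally show ?thesis .
  qed
  define F where "F x = of_real (P x) * M (of_real x) - of_real (P x) * M z0" for x
  have intPz: "integrable lborel (\<lambda>x. complex_of_real (P x) * M z0)"
    using integrable_of_real[OF intP(1), where 'a=complex] by (rule integrable_mult_left)
  have intF: "integrable lborel F" unfolding F_def[abs_def]
    by (rule Bochner_Integration.integrable_diff[OF intPM intPz])
  have "(\<lambda>n. LINT x:{- real n..real n}|lborel. F x) \<longlonglongrightarrow> (LINT x|lborel. F x)"
    unfolding set_lebesgue_integral_def by (rule integral_symmetric_limit[OF intF])
  moreover have "(\<lambda>n. LINT x:{- real n..real n}|lborel. F x) \<longlonglongrightarrow> 0"
  proof (rule Lim_null_comparison)
    have "((\<lambda>n::nat. Im z0 / pi * (2 * C / (real n - norm z0)\<^sup>2 * real n * pi)) \<longlonglongrightarrow> 0)"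
      by real_asymp
    then show "((\<lambda>n::nat. Im z0 / pi * (2 * C / (real n - norm z0)\<^sup>2 * real n * pi)) \<longlonglongrightarrow> 0)" .
    show "\<forall>\<^sub>F n in sequentially. norm (LINT x:{- real n..real n}|lborel. F x)
       \<le> Im z0 / pi * (2 * C / (real n - norm z0)\<^sup>2 * real n * pi)"
    proof -
      obtain n0 :: nat where n0: "norm z0 < n0" using reals_Archimedean2[of "norm z0"] by (elim exE)
      show ?thesis using eventually_ge_at_top[of n0]
      proof eventually_elim
        case (elim n)
        have "set_integrable lborel {- real n..real n} F"
          using intF unfolding set_integrable_def by (intro integrable_mult_indicator) auto
        then have 1: "(LINT x:{- real n..real n}|lborel. F x) = integral {- real n..real n} F"
          by (rule set_borel_integral_eq_integral)
        have 2: "F = (\<lambda>x. of_real (Im z0 / pi) * h (of_real x))"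
          unfolding hP F_def[abs_def] using z0 by simp
        have "integral {- real n..real n} F = of_real (Im z0 / pi) * integral {- real n..real n} (\<lambda>x. h (of_real x))"
          unfolding 2 by (rule integral_mult_right)
        then have "norm (LINT x:{- real n..real n}|lborel. F x) = (Im z0 / pi) * norm (integral {- real n..real n} (\<lambda>x. h (of_real x)))"
          unfolding 1 using z0 by (simp add: norm_mult norm_divide)
        moreover have "real n > norm z0" using elim n0 by simp
        then have "(Im z0 / pi) * norm (integral {- real n..real n} (\<lambda>x. h (of_real x)))
            \<le> (Im z0 / pi) * (2 * C / (real n - norm z0)\<^sup>2 * real n * pi)"
          using arc[of "real n"] z0 by (intro mult_left_mono) auto
        ultimately show ?case by (simp only:)
      qed
    qed
  qed
  ultimately have "(LINT x|lborel. F x) = 0" using LIMSEQ_unique by blast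
  moreover have "(LINT x|lborel. F x) = (LINT x|lborel. of_real (P x) * M (of_real x)) - M z0"
  proof -
    have "(LINT x|lborel. complex_of_real (P x) * M z0) = M z0"
      using intP(2) by (simp add: integral_mult_left_zero)
    then show ?thesis
      unfolding F_def[abs_def] Bochner_Integration.integral_diff[OF intPM intPz] by simp
  qed
  ultimately show ?thesis using intPM by (simp add: has_bochner_integral_iff P_def)
qed

text \<open>Away from 0 the kernel is of order y times a fixed integrable kernel.\<close>

lemma poisson_tail:
  assumes "0 < y" "y \<le> 1" "0 < d" "d \<le> 1" "d \<le> \<bar>u\<bar>"
  shows "poisson y u \<le> (2 * y / d\<^sup>2) * poisson 1 u"
proof -
  have "d\<^sup>2 \<le> u\<^sup>2" using assms by (simp add: abs_le_square_iff[symmetric])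
  moreover have "d\<^sup>2 * u\<^sup>2 \<le> 1 * u\<^sup>2" using assms by (intro mult_right_mono) (auto simp: power_le_one)
  ultimately have "d\<^sup>2 * (u\<^sup>2 + 1) \<le> 2 * (u\<^sup>2 + y\<^sup>2)" using zero_le_power2[of y] unfolding distrib_left by linarith
  moreover have "u\<^sup>2 + y\<^sup>2 > 0" using assms by (simp add: add_nonneg_pos)
  moreover have "u\<^sup>2 + 1 > 0" by (simp add: add_nonneg_pos)
  ultimately have "(2 * y) / (2 * (u\<^sup>2 + y\<^sup>2)) \<le> (2 * y) / (d\<^sup>2 * (u\<^sup>2 + 1))"
    using assms by (intro divide_left_mono mult_pos_pos) auto
  then have "y / (u\<^sup>2 + y\<^sup>2) \<le> 2 * y / d\<^sup>2 * (1 / (u\<^sup>2 + 1))"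
    by (simp only: mult_divide_mult_cancel_left[of 2] times_divide_times_eq mult_1_right)
  from divide_right_mono[OF this, of pi] show ?thesis
    by (simp add: poisson_def field_simps)
qed

text \<open>By Fubini, the subtracted integral is the M-integral of the Poisson smoothing of g. The
  smoothing differs from g by \<eta> through the nearby points and, by \<open>poisson_tail\<close>,
  by twice 2 y / d^2 through the others. The bound does not depend on M, so it serves all
  approximating measures at once.\<close>

lemma poisson_smoothing:
  fixes g :: "real \<Rightarrow> real" and M :: "real measure"
  assumes g: "continuous_on UNIV g" "\<And>x. \<bar>g x\<bar> \<le> 1" "integrable lborel g"
    and uc: "\<And>x a. \<bar>x - a\<bar> < d \<Longrightarrow> \<bar>g x - g a\<bar> \<le> \<eta>" and d: "0 < d" "d \<le> 1" and \<eta>: "\<eta> \<ge> 0"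
    and y: "0 < y" "y \<le> 1"
    and M: "finite_measure M" "sets M = sets borel" "measure M UNIV \<le> 1"
  shows "\<bar>(\<integral>x. g x \<partial>M) - (\<integral>a. g a * (\<integral>x. poisson y (x - a) \<partial>M) \<partial>lborel)\<bar> \<le> \<eta> + 4 * y / d\<^sup>2"
proof -
  interpret M: finite_measure M by fact
  interpret pair_sigma_finite M lborel ..
  have [measurable]: "g \<in> borel_measurable borel" using g(1) by (rule borel_measurable_continuous_onI)
  note [measurable_cong] = M(2)
  have spM: "space M = UNIV" using sets_eq_imp_space_eq[OF M(2)] by simp
  have intg: "integrable lborel (\<lambda>a. g a * poisson y (x - a))" for x
  proof (rule Bochner_Integration.integrable_bound)
    show "integrable lborel (\<lambda>a. poisson y (a - x))" using y by simp
    show "AE a in lborel. norm (g a * poisson y (x - a)) \<le> norm (poisson y (a - x))"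
      using g(2) y poisson_minus_commute[of y x] by (auto simp: abs_mult mult_left_le_one_le)
  qed measurable
  have bnd: "\<bar>(\<integral>a. g a * poisson y (x - a) \<partial>lborel) - g x\<bar> \<le> \<eta> + 4 * y / d\<^sup>2" for x
  proof -
    have "(\<integral>a. g a * poisson y (x - a) \<partial>lborel) - g x = (\<integral>a. g a * poisson y (x - a) \<partial>lborel) - (\<integral>a. g x * poisson y (a - x) \<partial>lborel)"
      using y by (simp add: integral_poisson)
    also have "\<dots> = (\<integral>a. (g a - g x) * poisson y (a - x) \<partial>lborel)"
      using intg[of x] y by (subst Bochner_Integration.integral_diff[symmetric])
        (auto simp: poisson_minus_commute[of y x] algebra_simps)
    also have "\<bar>\<dots>\<bar> \<le> (\<integral>a. \<eta> * poisson y (a - x) + 4 * y / d\<^sup>2 * poisson 1 (a - x) \<partial>lborel)"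
    proof (rule integral_abs_bound[THEN order_trans], rule integral_mono)
      show "integrable lborel (\<lambda>a. \<bar>(g a - g x) * poisson y (a - x)\<bar>)"
        using intg[of x] y poisson_minus_commute[of y x] by (simp add: left_diff_distrib)
      show "integrable lborel (\<lambda>a. \<eta> * poisson y (a - x) + 4 * y / d\<^sup>2 * poisson 1 (a - x))"
        using y by simp
      fix a
      have p: "poisson y (a - x) \<ge> 0" "poisson 1 (a - x) \<ge> 0" using y by (auto intro: poisson_nonneg)
      show "\<bar>(g a - g x) * poisson y (a - x)\<bar> \<le> \<eta> * poisson y (a - x) + 4 * y / d\<^sup>2 * poisson 1 (a - x)"
      proof (cases "\<bar>a - x\<bar> < d")
        case True
        have "\<bar>(g a - g x) * poisson y (a - x)\<bar> \<le> \<eta> * poisson y (a - x)"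
          using uc[OF True] p by (simp add: abs_mult mult_right_mono)
        also have "\<dots> \<le> \<eta> * poisson y (a - x) + 4 * y / d\<^sup>2 * poisson 1 (a - x)" using p y by simp
        finally show ?thesis .
      next
        case False
        have "\<bar>g a - g x\<bar> \<le> 2" using g(2)[of a] g(2)[of x] by linarith
        then have "\<bar>(g a - g x) * poisson y (a - x)\<bar> \<le> 2 * poisson y (a - x)"
          using p by (simp add: abs_mult mult_right_mono)
        also have "\<dots> \<le> 2 * ((2 * y / d\<^sup>2) * poisson 1 (a - x))"
          using False y d by (intro mult_left_mono poisson_tail) auto
        also have "\<dots> = 4 * y / d\<^sup>2 * poisson 1 (a - x)" by simp
        also have "\<dots> \<le> \<eta> * poisson y (a - x) + 4 * y / d\<^sup>2 * poisson 1 (a - x)"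
          using mult_nonneg_nonneg[OF \<eta> p(1)] by linarith
        finally show ?thesis .
      qed
    qed
    also have "\<dots> = \<eta> + 4 * y / d\<^sup>2" using y by (simp add: integral_poisson)
    finally show ?thesis .
  qed
  have bnd1: "\<bar>\<integral>a. g a * poisson y (x - a) \<partial>lborel\<bar> \<le> 1 + (\<eta> + 4 * y / d\<^sup>2)" for x
    using bnd[of x] g(2)[of x] by linarith
  have int1: "integrable M (\<lambda>x. \<integral>a. g a * poisson y (x - a) \<partial>lborel)"
    by (rule M.integrable_const_bound[where B = "1 + (\<eta> + 4 * y / d\<^sup>2)"]) (use bnd1 in auto)
  have int2: "integrable M g" by (rule M.integrable_const_bound[where B = 1]) (use g in auto)
  have prod: "integrable (M \<Otimes>\<^sub>M lborel) (\<lambda>(x, a). g a * poisson y (x - a))"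
  proof (rule Fubini_integrable)
    show "integrable M (\<lambda>x. \<integral>a. norm (case (x, a) of (x, a) \<Rightarrow> g a * poisson y (x - a)) \<partial>lborel)"
    proof (rule M.integrable_const_bound[where B = 1])
      show "AE x in M. norm (\<integral>a. norm (case (x, a) of (x, a) \<Rightarrow> g a * poisson y (x - a)) \<partial>lborel) \<le> 1"
      proof (rule AE_I2)
        fix x
        have "(\<integral>a. norm (g a * poisson y (x - a)) \<partial>lborel) \<le> (\<integral>a. poisson y (a - x) \<partial>lborel)"
          using y g(2) poisson_minus_commute[of y x]
          by (intro integral_mono integrable_norm[OF intg]) (auto simp: abs_mult poisson_nonneg mult_left_le_one_le)
        then show "norm (\<integral>a. norm (case (x, a) of (x, a) \<Rightarrow> g a * poisson y (x - a)) \<partial>lborel) \<le> 1"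
          using y by (simp add: integral_poisson)
      qed
    qed measurable
  qed (use intg in auto)
  have "(\<integral>a. g a * (\<integral>x. poisson y (x - a) \<partial>M) \<partial>lborel) = (\<integral>a. (\<integral>x. g a * poisson y (x - a) \<partial>M) \<partial>lborel)" by simp
  also have "\<dots> = (\<integral>x. (\<integral>a. g a * poisson y (x - a) \<partial>lborel) \<partial>M)"
    by (rule Fubini_integral[OF prod])
  finally have "(\<integral>x. g x \<partial>M) - (\<integral>a. g a * (\<integral>x. poisson y (x - a) \<partial>M) \<partial>lborel)
     = (\<integral>x. g x - (\<integral>a. g a * poisson y (x - a) \<partial>lborel) \<partial>M)"
    using int1 int2 by simp
  also have "\<bar>\<dots>\<bar> \<le> (\<integral>x. \<eta> + 4 * y / d\<^sup>2 \<partial>M)"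
    using int1 int2 bnd by (intro integral_abs_bound[THEN order_trans] integral_mono) (auto simp: abs_minus_commute)
  also have "\<dots> = (\<eta> + 4 * y / d\<^sup>2) * measure M UNIV" using spM by simp
  also have "\<dots> \<le> (\<eta> + 4 * y / d\<^sup>2) * 1" using M(3) \<eta> y by (intro mult_left_mono) auto
  finally show ?thesis by simp
qed

text \<open>Smoothing with a small fixed y turns the convergence of Poisson integrals into
  convergence of the integrals of Lipschitz functions. Against compactly supported ones, the locally
  uniform convergence of the densities identifies the limit as an integral against g. Open intervals
  are then exhausted by such functions.\<close>

lemma continuous_density_from_poisson:
  fixes f :: "nat \<Rightarrow> real \<Rightarrow> real" and g :: "real \<Rightarrow> real" and \<mu> :: "real measure"
  assumes \<mu>: "real_prob_measure \<mu>"
    and f: "\<And>n. continuous_on UNIV (f n)" "\<And>n x. 0 \<le> f n x" "\<And>n. integrable lborel (f n)"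
      "\<And>n. (\<integral>x. f n x \<partial>lborel) \<le> 1"
    and conv: "\<And>y a. y > 0 \<Longrightarrow>
      (\<lambda>n. \<integral>x. f n x * poisson y (x - a) \<partial>lborel) \<longlonglongrightarrow> (\<integral>x. poisson y (x - a) \<partial>\<mu>)"
    and lim: "\<And>R. uniform_limit {-R..R} f g sequentially"
  shows "has_continuous_density \<mu> UNIV g"
proof -
  interpret prob_space \<mu> using \<mu> by (simp add: real_prob_measure_def)
  have sets: "sets \<mu> = sets borel" using \<mu> by (simp add: real_prob_measure_def)
  note [measurable_cong] = sets
  have [measurable]: "f n \<in> borel_measurable borel" for n using f(1) by (rule borel_measurable_continuous_onI)
  have g_cont_at: "isCont g x" for x
  proof -
    have "continuous_on {-(\<bar>x\<bar>+1)..\<bar>x\<bar>+1} g"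
      by (rule uniform_limit_theorem[OF _ lim]) (auto intro!: always_eventually continuous_on_subset[OF f(1)])
    then have "continuous_on {-(\<bar>x\<bar>+1)<..<\<bar>x\<bar>+1} g"
      by (rule continuous_on_subset) auto
    moreover have "- (\<bar>x\<bar> + 1) < x" "x < \<bar>x\<bar> + 1" by linarith+
    then have "x \<in> {-(\<bar>x\<bar>+1)<..<\<bar>x\<bar>+1}" by simp
    ultimately show ?thesis
      using continuous_on_eq_continuous_at[OF open_greaterThanLessThan] by blast
  qed
  have g_cont: "continuous_on UNIV g"
    using g_cont_at by (simp add: continuous_at_imp_continuous_on)
  have [measurable]: "g \<in> borel_measurable borel" using g_cont by (rule borel_measurable_continuous_onI)
  have g_nonneg: "g x \<ge> 0" for x
  proof (rule LIMSEQ_le_const)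
    have "- \<bar>x\<bar> \<le> x" "x \<le> \<bar>x\<bar>" by linarith+
    then show "(\<lambda>n. f n x) \<longlonglongrightarrow> g x"
      using tendsto_uniform_limitI[OF lim[of "\<bar>x\<bar>"], of x] by simp
  qed (use f(2) in auto)
  define \<nu> where "\<nu> n = density lborel (\<lambda>x. ennreal (f n x))" for n
  have \<nu>_sets: "sets (\<nu> n) = sets borel" for n by (simp add: \<nu>_def)
  have \<nu>_em: "emeasure (\<nu> n) UNIV = ennreal (\<integral>x. f n x \<partial>lborel)" for n
    unfolding \<nu>_def using f by (simp add: emeasure_density nn_integral_eq_integral)
  have \<nu>_fin: "finite_measure (\<nu> n)" for n
    by (rule finite_measureI) (use \<nu>_em in \<open>simp add: \<nu>_def\<close>)
  have \<nu>_le: "measure (\<nu> n) UNIV \<le> 1" for n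
    using \<nu>_em[of n] f(2,4) by (simp add: measure_def integral_nonneg_AE)
  have \<nu>_int: "(\<integral>x. h x \<partial>\<nu> n) = (\<integral>x. f n x * h x \<partial>lborel)" if "h \<in> borel_measurable borel" for n and h :: "real \<Rightarrow> real"
    unfolding \<nu>_def using that f(2) by (subst integral_density) auto
  have conv_test: "(\<lambda>n. \<integral>x. h x \<partial>\<nu> n) \<longlonglongrightarrow> (\<integral>x. h x \<partial>\<mu>)"
    if h: "continuous_on UNIV h" "\<And>x. \<bar>h x\<bar> \<le> 1" "integrable lborel h"
      and L: "L > 0" "\<And>x a. \<bar>h x - h a\<bar> \<le> L * \<bar>x - a\<bar>" for h :: "real \<Rightarrow> real" and L :: real
  proof (rule LIMSEQ_I)
    fix e :: real assume e: "e > 0"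
    have [measurable]: "h \<in> borel_measurable borel" using h(1) by (rule borel_measurable_continuous_onI)
    \<comment> \<open>With d and y the smoothing error is at most e / 8 + e / 8 for each of the two
      measures. The convergence of the smoothed integrals costs another e / 4, and the total stays
      below e.\<close>
    define d where "d = min 1 (e / (8 * L))"
    have d: "0 < d" "d \<le> 1" "L * d \<le> e / 8" using e L by (auto simp: d_def min_def field_simps)
    define y where "y = min 1 (e * d\<^sup>2 / 32)"
    have y: "0 < y" "y \<le> 1" "4 * y / d\<^sup>2 \<le> e / 8" using e d by (auto simp: y_def min_def field_simps)
    have uc: "\<bar>h x - h a\<bar> \<le> e / 8" if "\<bar>x - a\<bar> < d" for x a
    proof -
      have "L * \<bar>x - a\<bar> \<le> L * d" using that L by (intro mult_left_mono) auto
      then show ?thesis using L(2)[of x a] d(3) by linarith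
    qed
    have sm: "\<bar>(\<integral>x. h x \<partial>M) - (\<integral>a. h a * (\<integral>x. poisson y (x - a) \<partial>M) \<partial>lborel)\<bar> \<le> e / 4"
      if "finite_measure M" "sets M = sets borel" "measure M UNIV \<le> 1" for M :: "real measure"
      using poisson_smoothing[OF h uc d(1,2) _ y(1,2) that] e y(3) by simp
    have "(\<lambda>n. \<integral>a. h a * (\<integral>x. poisson y (x - a) \<partial>\<nu> n) \<partial>lborel) \<longlonglongrightarrow> (\<integral>a. h a * (\<integral>x. poisson y (x - a) \<partial>\<mu>) \<partial>lborel)"
    proof (rule integral_dominated_convergence[where w = "\<lambda>a. 1 / (pi * y) * \<bar>h a\<bar>"])
      show "integrable lborel (\<lambda>a. 1 / (pi * y) * \<bar>h a\<bar>)" using h(3) by simp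
      show "AE a in lborel. (\<lambda>n. h a * (\<integral>x. poisson y (x - a) \<partial>\<nu> n)) \<longlonglongrightarrow> h a * (\<integral>x. poisson y (x - a) \<partial>\<mu>)"
        using conv[OF y(1)] by (intro AE_I2 tendsto_mult tendsto_const) (simp add: \<nu>_int)
      show "AE a in lborel. norm (h a * (\<integral>x. poisson y (x - a) \<partial>\<nu> n)) \<le> 1 / (pi * y) * \<bar>h a\<bar>" for n
      proof (rule AE_I2)
        fix a :: real
        interpret \<nu>: finite_measure "\<nu> n" by (rule \<nu>_fin)
        have "(\<integral>x. poisson y (x - a) \<partial>\<nu> n) \<le> (\<integral>x. 1 / (pi * y) \<partial>\<nu> n)"
        proof (rule integral_mono)
          show "integrable (\<nu> n) (\<lambda>x. poisson y (x - a))"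
            by (rule \<nu>.integrable_const_bound[where B = "1 / (pi * y)"])
              (use y poisson_le poisson_nonneg[of y] in \<open>auto simp: \<nu>_def\<close>)
        qed (use y poisson_le in auto)
        also have "\<dots> = 1 / (pi * y) * measure (\<nu> n) UNIV" by (simp add: \<nu>_def)
        also have "\<dots> \<le> 1 / (pi * y) * 1" using \<nu>_le[of n] y by (intro mult_left_mono) auto
        finally have "(\<integral>x. poisson y (x - a) \<partial>\<nu> n) \<le> 1 / (pi * y)" by simp
        moreover have "(\<integral>x. poisson y (x - a) \<partial>\<nu> n) \<ge> 0"
          using y by (intro integral_nonneg_AE AE_I2 poisson_nonneg) auto
        ultimately have "norm (h a * (\<integral>x. poisson y (x - a) \<partial>\<nu> n)) \<le> \<bar>h a\<bar> * (1 / (pi * y))"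
          unfolding real_norm_def abs_mult by (intro mult_left_mono) auto
        then show "norm (h a * (\<integral>x. poisson y (x - a) \<partial>\<nu> n)) \<le> 1 / (pi * y) * \<bar>h a\<bar>" by (simp add: mult.commute)
      qed
      have "(\<lambda>a. \<integral>x. f n x * poisson y (x - a) \<partial>lborel) \<in> borel_measurable borel" for n by measurable
      then show "(\<lambda>a. h a * (\<integral>x. poisson y (x - a) \<partial>\<nu> n)) \<in> borel_measurable lborel" for n
        by (simp add: \<nu>_int)
    qed measurable
    from LIMSEQ_D[OF this, of "e / 4"] e obtain n0 where n0: "\<And>n. n \<ge> n0 \<Longrightarrow>
      norm ((\<integral>a. h a * (\<integral>x. poisson y (x - a) \<partial>\<nu> n) \<partial>lborel) - (\<integral>a. h a * (\<integral>x. poisson y (x - a) \<partial>\<mu>) \<partial>lborel)) < e / 4"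
      by auto
    have "norm ((\<integral>x. h x \<partial>\<nu> n) - (\<integral>x. h x \<partial>\<mu>)) < e" if "n \<ge> n0" for n
    proof -
      have m: "\<bar>(\<integral>x. h x \<partial>\<mu>) - (\<integral>a. h a * (\<integral>x. poisson y (x - a) \<partial>\<mu>) \<partial>lborel)\<bar> \<le> e / 4"
        by (rule sm[OF finite_measure_axioms sets prob_le_1])
      show ?thesis
        using n0[OF that] sm[OF \<nu>_fin \<nu>_sets \<nu>_le, of n] m e unfolding real_norm_def by linarith
    qed
    then show "\<exists>n0. \<forall>n\<ge>n0. norm ((\<integral>x. h x \<partial>\<nu> n) - (\<integral>x. h x \<partial>\<mu>)) < e" by blast
  qed
  have test: "(\<integral>x. h x \<partial>\<mu>) = (\<integral>x. g x * h x \<partial>lborel)"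
    if h: "continuous_on UNIV h" "\<And>x. \<bar>h x\<bar> \<le> 1" and supp: "\<And>x. x \<notin> {-R..R} \<Longrightarrow> h x = 0" and R: "R > 0"
      and L: "L > 0" "\<And>x a. \<bar>h x - h a\<bar> \<le> L * \<bar>x - a\<bar>" for h :: "real \<Rightarrow> real" and L R :: real
  proof -
    have [measurable]: "h \<in> borel_measurable borel" using h(1) by (rule borel_measurable_continuous_onI)
    have bint: "integrable lborel (\<lambda>x. k x * h x)" if k: "continuous_on UNIV k" for k :: "real \<Rightarrow> real"
    proof -
      have "integrable lborel (\<lambda>x. indicator {-R..R} x *\<^sub>R (k x * h x))"
        using borel_integrable_compact[of "{-R..R}" "\<lambda>x. k x * h x"]
          continuous_on_subset[OF continuous_on_mult[OF k h(1)]] by auto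
      moreover have "(\<lambda>x. indicator {-R..R} x *\<^sub>R (k x * h x)) = (\<lambda>x. k x * h x)"
      proof
        fix x show "indicator {-R..R} x *\<^sub>R (k x * h x) = k x * h x"
          using supp[of x] by (cases "x \<in> {-R..R}") auto
      qed
      ultimately show ?thesis by (simp only:)
    qed
    have hint: "integrable lborel h" using bint[of "\<lambda>_. 1"] by simp
    have "(\<lambda>n. \<integral>x. f n x * h x \<partial>lborel) \<longlonglongrightarrow> (\<integral>x. g x * h x \<partial>lborel)"
    proof (rule LIMSEQ_I)
      fix e :: real assume e: "e > 0"
      define e' where "e' = e / (4 * R)"
      have e': "e' > 0" using e R by (simp add: e'_def)
      from uniform_limitD[OF lim this, of R] obtain n0 where n0: "\<And>n x. n \<ge> n0 \<Longrightarrow> x \<in> {-R..R} \<Longrightarrow> dist (f n x) (g x) < e'"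
        unfolding eventually_sequentially by blast
      have "norm ((\<integral>x. f n x * h x \<partial>lborel) - (\<integral>x. g x * h x \<partial>lborel)) < e" if n: "n \<ge> n0" for n
      proof -
        have "(\<integral>x. f n x * h x \<partial>lborel) - (\<integral>x. g x * h x \<partial>lborel) = (\<integral>x. f n x * h x - g x * h x \<partial>lborel)"
          using bint[OF f(1)[of n]] bint[OF g_cont] by simp
        also have "norm \<dots> \<le> (\<integral>x. e' * indicator {-R..R} x \<partial>lborel)"
        proof (rule integral_norm_bound[THEN order_trans], rule integral_mono)
          show "integrable lborel (\<lambda>x. norm (f n x * h x - g x * h x))"
            using bint[OF f(1)[of n]] bint[OF g_cont] by simp
          show "norm (f n x * h x - g x * h x) \<le> e' * indicator {-R..R} x" for x :: real
          proof (cases "x \<in> {-R..R}")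
            case True
            have "norm (f n x * h x - g x * h x) = \<bar>f n x - g x\<bar> * \<bar>h x\<bar>"
              by (simp add: left_diff_distrib[symmetric] abs_mult)
            also have "\<dots> \<le> e' * 1" using n0[OF n True] h(2)[of x] e' by (intro mult_mono) (auto simp: dist_real_def)
            finally show ?thesis using True by simp
          qed (use supp in simp)
          show "integrable lborel (\<lambda>x. e' * indicator {-R..R} x)"
            by (intro integrable_mult_right integrable_real_indicator) (simp_all add: emeasure_lborel_Icc_eq)
        qed
        also have "\<dots> = e / 2" using R e by (simp add: e'_def)
        finally show ?thesis using e by simp
      qed
      then show "\<exists>n0. \<forall>n\<ge>n0. norm ((\<integral>x. f n x * h x \<partial>lborel) - (\<integral>x. g x * h x \<partial>lborel)) < e" by blast
    qed
    then have "(\<lambda>n. \<integral>x. h x \<partial>\<nu> n) \<longlonglongrightarrow> (\<integral>x. g x * h x \<partial>lborel)"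
      by (simp add: \<nu>_int)
    with conv_test[OF h hint L] show ?thesis using LIMSEQ_unique by blast
  qed
  have ivl: "emeasure \<mu> {a<..<b} = emeasure (density lborel (\<lambda>x. ennreal (g x))) {a<..<b}" for a b :: real
  proof -
    define A where "A = - {a<..<b}"
    have A: "closed A" "A \<noteq> {}"
    proof -
      show "closed A" by (simp add: A_def closed_Compl)
      have "b \<in> A" by (simp add: A_def)
      then show "A \<noteq> {}" by blast
    qed
    \<comment> \<open>Lipschitz functions increasing to the indicator of the open interval, each
      point of which has a positive distance from the closed complement A.\<close>
    define h where "h m x = min 1 (real m * infdist x A)" for m :: nat and x :: real
    define R where "R = \<bar>a\<bar> + \<bar>b\<bar> + 1"
    have R: "R > 0" "x \<notin> {-R..R} \<Longrightarrow> x \<in> A" for x by (auto simp: R_def A_def)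
    have h_lim: "(\<lambda>m. h m x) \<longlonglongrightarrow> indicator {a<..<b} x" for x :: real
    proof (cases "x \<in> A")
      case True then show ?thesis by (simp add: h_def A_def)
    next
      case False
      then have pos: "infdist x A > 0"
        using in_closed_iff_infdist_zero[OF A] infdist_nonneg[of x A] by fastforce
      obtain m0 :: nat where m0: "1 < real m0 * infdist x A" using reals_Archimedean3[OF pos] by blast
      have "h m x = 1" if "m \<ge> m0" for m
      proof -
        have "real m0 * infdist x A \<le> real m * infdist x A" using that pos by (intro mult_right_mono) auto
        then show ?thesis using m0 by (simp add: h_def)
      qed
      then have "eventually (\<lambda>m. h m x = indicator {a<..<b} x) sequentially"
        using False unfolding eventually_sequentially by (auto simp: A_def)
      then show ?thesis by (rule tendsto_eventually)
    qed
    have h01: "0 \<le> h m x" "h m x \<le> 1" for m x by (auto simp: h_def infdist_nonneg)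
    have h_cont: "continuous_on UNIV (h m)" for m
      unfolding h_def[abs_def] by (intro continuous_intros)
    have h_lip: "\<bar>h m x - h m y\<bar> \<le> (real m + 1) * \<bar>x - y\<bar>" for m x y
    proof -
      have "\<bar>infdist x A - infdist y A\<bar> \<le> \<bar>x - y\<bar>"
        using infdist_triangle_abs[of x A y] by (simp add: dist_real_def)
      then have "real m * \<bar>infdist x A - infdist y A\<bar> \<le> (real m + 1) * \<bar>x - y\<bar>"
        by (intro mult_mono) auto
      moreover have "\<bar>h m x - h m y\<bar> \<le> \<bar>real m * infdist x A - real m * infdist y A\<bar>"
        unfolding h_def by linarith
      ultimately show ?thesis by (simp add: right_diff_distrib[symmetric] abs_mult)
    qed
    have h_supp: "h m x = 0" if "x \<notin> {-R..R}" for m x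
      using R(2)[OF that] by (simp add: h_def)
    have [measurable]: "h m \<in> borel_measurable borel" for m using h_cont by (rule borel_measurable_continuous_onI)
    have eq: "(\<integral>x. h m x \<partial>\<mu>) = (\<integral>x. g x * h m x \<partial>lborel)" for m
      by (rule test[OF h_cont _ h_supp R(1) _ h_lip]) (use h01[of m] in \<open>auto simp: abs_le_iff intro: order_trans[of _ 0]\<close>)
    have 1: "(\<lambda>m. \<integral>x. h m x \<partial>\<mu>) \<longlonglongrightarrow> (\<integral>x. indicator {a<..<b} x \<partial>\<mu>)"
      by (rule integral_dominated_convergence[where w = "\<lambda>_. 1"]) (use h_lim h01 in auto)
    have gb: "integrable lborel (\<lambda>x. indicator {-R..R} x *\<^sub>R g x)"
      using borel_integrable_compact[of "{-R..R}" g] continuous_on_subset[OF g_cont] by auto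
    have 2: "(\<lambda>m. \<integral>x. g x * h m x \<partial>lborel) \<longlonglongrightarrow> (\<integral>x. g x * indicator {a<..<b} x \<partial>lborel)"
    proof (rule integral_dominated_convergence[where w = "\<lambda>x. indicator {-R..R} x *\<^sub>R g x"])
      show "AE x in lborel. (\<lambda>m. g x * h m x) \<longlonglongrightarrow> g x * indicator {a<..<b} x"
        by (intro AE_I2 tendsto_mult tendsto_const h_lim)
      show "AE x in lborel. norm (g x * h m x) \<le> indicator {-R..R} x *\<^sub>R g x" for m
      proof (rule AE_I2)
        fix x :: real
        show "norm (g x * h m x) \<le> indicator {-R..R} x *\<^sub>R g x"
          using h_supp[of x m] h01[of m x] g_nonneg[of x] by (cases "x \<in> {-R..R}") (auto simp: abs_mult mult_left_le)
      qed
    qed (use gb in auto)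
    have gi: "integrable lborel (\<lambda>x. g x * indicator {a<..<b} x)"
    proof (rule Bochner_Integration.integrable_bound[OF gb])
      show "AE x in lborel. norm (g x * indicator {a<..<b} x) \<le> norm (indicator {-R..R} x *\<^sub>R g x)"
        using g_nonneg by (intro AE_I2) (auto simp: indicator_def R_def)
    qed measurable
    have "measure \<mu> {a<..<b} = (\<integral>x. g x * indicator {a<..<b} x \<partial>lborel)"
      using LIMSEQ_unique[OF 1] 2 unfolding eq by simp
    then have "emeasure \<mu> {a<..<b} = ennreal (\<integral>x. g x * indicator {a<..<b} x \<partial>lborel)"
      by (simp add: emeasure_eq_measure)
    also have "\<dots> = (\<integral>\<^sup>+x. ennreal (g x * indicator {a<..<b} x) \<partial>lborel)"
      using gi g_nonneg by (intro nn_integral_eq_integral[symmetric]) (auto intro!: AE_I2 mult_nonneg_nonneg)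
    also have "\<dots> = emeasure (density lborel (\<lambda>x. ennreal (g x))) {a<..<b}"
      using g_nonneg by (subst emeasure_density) (auto intro!: nn_integral_cong simp: indicator_def)
    finally show ?thesis .
  qed
  have E: "borel = sigma UNIV (range (\<lambda>(a, b). {a<..<b::real}))"
    using borel_eq_box[where 'a=real] by (simp only: box_real)
  have "\<mu> = density lborel (\<lambda>x. ennreal (g x))"
  proof (rule measure_eqI_generator_eq[where E = "range (\<lambda>(a, b). {a<..<b::real})" and \<Omega> = UNIV and A = "\<lambda>i. {- real i<..<real i}"])
    show "Int_stable (range (\<lambda>(a, b). {a<..<b::real}))"
    proof (rule Int_stableI)
      fix X Y :: "real set"
      assume "X \<in> range (\<lambda>(a, b). {a<..<b})" "Y \<in> range (\<lambda>(a, b). {a<..<b})"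
      then obtain a b c d where XY: "X = {a<..<b}" "Y = {c<..<d}" by auto
      have "X \<inter> Y = (\<lambda>(a, b). {a<..<b}) (max a c, min b d)" unfolding XY by auto
      then show "X \<inter> Y \<in> range (\<lambda>(a, b). {a<..<b})" by blast
    qed
    show "sets \<mu> = sigma_sets UNIV (range (\<lambda>(a, b). {a<..<b::real}))"
      unfolding sets by (subst E) simp
    show "sets (density lborel (\<lambda>x. ennreal (g x))) = sigma_sets UNIV (range (\<lambda>(a, b). {a<..<b::real}))"
      unfolding sets_density sets_lborel by (subst E) simp
    show "(\<Union>i. {- real i<..<real i}) = UNIV"
    proof -
      have "\<exists>i. x \<in> {- real i<..<real i}" for x :: real
      proof -
        obtain n where "\<bar>x\<bar> < real n" using reals_Archimedean2[of "\<bar>x\<bar>"] by (elim exE)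
        then have "- real n < x \<and> x < real n" by linarith
        then show ?thesis by auto
      qed
      then show ?thesis by blast
    qed
    show "emeasure \<mu> {- real i<..<real i} \<noteq> \<infinity>" for i by simp
  qed (auto simp: ivl)
  then have "emeasure \<mu> A = (\<integral>\<^sup>+x\<in>A. ennreal (g x) \<partial>lborel)" if "A \<in> sets borel" for A
    using that by (simp add: emeasure_density)
  then show ?thesis
    using g_cont g_nonneg by (simp add: has_continuous_density_def)
qed

section \<open>Weyl functions and the orthonormality measure\<close>

lemma sol_eqI:
  assumes "s 0 = u" "s (Suc 0) = v" "\<And>i. s (Suc (Suc i)) = d i * s (Suc i) - c i * s i"
  shows "s i = sol c d u v i"
  by (induction i rule: induct_nat_012) (auto simp: assms)

lemma tendsto_cong_limit:
  assumes "(f \<longlongrightarrow> l) F" "eventually (\<lambda>x. f x = g x) F" "l = l'"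
  shows "(g \<longlongrightarrow> l') F"
  using Lim_transform_eventually[OF assms(1,2)] assms(3) by simp

locale jacobi =
  fixes a b :: "nat \<Rightarrow> real"
  assumes a_pos: "\<And>n. a n > 0"
begin

text \<open>In contrast to \<open>pc\<close>, index n is position n here: the initial values sit at
  0 and 1. \<open>P\<close> and \<open>Y\<close> will be the polynomials of the first and of the
  second kind.\<close>

definition jc :: "nat \<Rightarrow> 'a::real_field" where "jc i = of_real (a i / a (Suc i))"
definition jd :: "'a::real_field \<Rightarrow> nat \<Rightarrow> 'a" where "jd z i = (z - of_real (b (Suc i))) / of_real (a (Suc i))"

definition jsol :: "'a::real_field \<Rightarrow> 'a \<Rightarrow> 'a \<Rightarrow> nat \<Rightarrow> 'a" where "jsol z = sol jc (jd z)"
definition P :: "'a::real_field \<Rightarrow> nat \<Rightarrow> 'a" where "P z = jsol z 1 ((z - of_real (b 0)) / of_real (a 0))"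
definition Y :: "'a::real_field \<Rightarrow> nat \<Rightarrow> 'a" where "Y z = jsol z 0 (1 / of_real (a 0))"

lemma a_nz [simp]: "a n \<noteq> 0" using a_pos[of n] by simp

lemma jsol_rec:
  "of_real (a (Suc i)) * jsol z u v (Suc (Suc i)) = (z - of_real (b (Suc i))) * jsol z u v (Suc i) - of_real (a i) * jsol z u v i"
  by (simp add: jsol_def jc_def jd_def field_simps)

lemma jacobi_poly_eq: "jacobi_poly a b n x = P x n"
proof (induction n rule: induct_nat_012)
  case (ge2 n)
  then show ?case by (simp add: P_def jsol_def jc_def jd_def diff_divide_distrib left_diff_distrib)
qed (auto simp: P_def jsol_def)

lemma P_of_real: "P (of_real x :: 'a::real_field) n = of_real (P x n)"
  by (induction n rule: induct_nat_012) (auto simp: P_def jsol_def jc_def jd_def)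

lemma P_0 [simp]: "P z 0 = 1" and Y_0 [simp]: "Y z 0 = 0"
  by (simp_all add: P_def Y_def jsol_def)

lemma P_Y_wronskian: "of_real (a n) * (P z n * Y z (Suc n) - P z (Suc n) * Y z n) = 1"
proof (induction n)
  case 0 then show ?case by (simp add: P_def Y_def jsol_def)
next
  case (Suc n)
  have "of_real (a (Suc n)) * (P z (Suc n) * Y z (Suc (Suc n)) - P z (Suc (Suc n)) * Y z (Suc n))
     = P z (Suc n) * (of_real (a (Suc n)) * Y z (Suc (Suc n))) - (of_real (a (Suc n)) * P z (Suc (Suc n))) * Y z (Suc n)"
    by (simp only: algebra_simps)
  also have "\<dots> = of_real (a n) * (P z n * Y z (Suc n) - P z (Suc n) * Y z n)"
    unfolding P_def Y_def jsol_rec by (simp only: algebra_simps)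
  finally show ?case using Suc by simp
qed

lemma jsol_energy:
  fixes z :: complex
  shows "a n * Im (jsol z u v (Suc n) * cnj (jsol z u v n)) = a 0 * Im (v * cnj u) + Im z * (\<Sum>j<n. (norm (jsol z u v (Suc j)))\<^sup>2)"
proof (induction n)
  case 0 then show ?case by (simp add: jsol_def)
next
  case (Suc n)
  from energy_step[OF jsol_rec[of n z u v]] Suc show ?case by (simp add: algebra_simps)
qed

text \<open>The Christoffel-Darboux formula at the pair z, cnj z.\<close>

lemma P_energy:
  fixes z :: complex
  shows "a n * Im (P z (Suc n) * cnj (P z n)) = Im z * (\<Sum>j\<le>n. (norm (P z j))\<^sup>2)"
proof -
  have "a 0 * Im ((z - of_real (b 0)) / of_real (a 0) * cnj 1) = Im z" by (simp add: Im_divide_of_real)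
  then have "a n * Im (P z (Suc n) * cnj (P z n)) = Im z + Im z * (\<Sum>j<n. (norm (P z (Suc j)))\<^sup>2)"
    unfolding P_def jsol_energy by simp
  also have "\<dots> = Im z * (\<Sum>j<Suc n. (norm (P z j))\<^sup>2)"
    unfolding sum.lessThan_Suc_shift by (simp add: algebra_simps)
  finally show ?thesis by (simp only: lessThan_Suc_atMost)
qed

text \<open>
  \<open>mfun w n\<close> is the Weyl function of the recurrence cut off at \<open>n\<close> with the boundary condition \<open>u\<^sub>n\<^sub>+\<^sub>1 = w u\<^sub>n\<close>. For
  \<open>Im w < 0\<close> it maps the upper half-plane to itself and extends continuously to the real line.
\<close>

definition den :: "complex \<Rightarrow> nat \<Rightarrow> complex \<Rightarrow> complex" where "den w n z = P z (Suc n) - w * P z n"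
definition num :: "complex \<Rightarrow> nat \<Rightarrow> complex \<Rightarrow> complex" where "num w n z = Y z (Suc n) - w * Y z n"
definition mfun :: "complex \<Rightarrow> nat \<Rightarrow> complex \<Rightarrow> complex" where "mfun w n z = - num w n z / den w n z"

text \<open>At a zero, the current of \<open>P\<close> at n would have the sign of Im w unless P z n
  = 0, but it is nonnegative by \<open>P_energy\<close>. Two consecutive zeros of \<open>P\<close>
  contradict the Wronskian.\<close>

lemma den_nonzero:
  assumes w: "Im w < 0" and z: "Im z \<ge> 0" shows "den w n z \<noteq> 0"
proof
  assume "den w n z = 0"
  then have eq: "P z (Suc n) = w * P z n" by (simp add: den_def)
  have "Im (P z (Suc n) * cnj (P z n)) = Im w * (norm (P z n))\<^sup>2"
    unfolding eq by (simp add: mult.assoc complex_mult_cnj cmod_power2)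
  then have "a n * (Im w * (norm (P z n))\<^sup>2) = Im z * (\<Sum>j\<le>n. (norm (P z j))\<^sup>2)"
    using P_energy[of n z] by simp
  moreover have "Im z * (\<Sum>j\<le>n. (norm (P z j))\<^sup>2) \<ge> 0" using z by (intro mult_nonneg_nonneg sum_nonneg) auto
  ultimately have "Im w * (norm (P z n))\<^sup>2 \<ge> 0" using a_pos[of n] by (metis zero_le_mult_iff not_less)
  then have "(norm (P z n))\<^sup>2 \<le> 0" using w by (simp add: zero_le_mult_iff)
  then have "P z n = 0" by simp
  then show False using P_Y_wronskian[of n z] eq by simp
qed

text \<open>The first column of the resolvent of the truncated Jacobi matrix J: it solves (J - z) u
  = e_0 with u_(n+1) = w u_n, and its entry 0 is \<open>mfun\<close>.\<close>

definition usol :: "complex \<Rightarrow> nat \<Rightarrow> complex \<Rightarrow> nat \<Rightarrow> complex" where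
  "usol w n z j = Y z j + mfun w n z * P z j"

lemma usol_jsol: "Y z j + m * P z j = jsol z m (1 / of_real (a 0) + m * ((z - of_real (b 0)) / of_real (a 0))) j"
  unfolding Y_def P_def jsol_def
  by (rule sol_eqI) (simp_all add: algebra_simps)

text \<open>Green's identity from 0 to n. The last term is the loss at the dissipative end; on the
  real axis it is all of the imaginary part.\<close>

lemma mfun_energy:
  assumes w: "Im w < 0" and z: "Im z \<ge> 0"
  shows "Im (mfun w n z) = Im z * (\<Sum>j\<le>n. (norm (usol w n z j))\<^sup>2) - a n * Im w * (norm (usol w n z n))\<^sup>2"
proof -
  define m where "m = mfun w n z"
  let ?v = "1 / of_real (a 0) + m * ((z - of_real (b 0)) / of_real (a 0))"
  have u: "usol w n z j = jsol z m ?v j" for j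
    unfolding usol_def m_def[symmetric] by (rule usol_jsol)
  have last: "usol w n z (Suc n) = w * usol w n z n"
  proof -
    have "m * den w n z = - num w n z" using den_nonzero[OF assms, of n] by (simp add: m_def mfun_def)
    then show ?thesis unfolding usol_def m_def[symmetric] den_def num_def by (simp add: algebra_simps)
  qed
  have v: "a 0 * Im (?v * cnj m) = Im z * (norm m)\<^sup>2 - Im m"
  proof -
    have "a 0 * Im (?v * cnj m) = Im (of_real (a 0) * ?v * cnj m)" by (simp add: mult.assoc)
    also have "of_real (a 0) * ?v = 1 + m * (z - of_real (b 0))" by (simp add: field_simps)
    also have "Im ((1 + m * (z - of_real (b 0))) * cnj m) = - Im m + Im ((z - of_real (b 0)) * (m * cnj m))"
      by (simp add: algebra_simps)
    also have "\<dots> = Im z * (norm m)\<^sup>2 - Im m" by (simp add: complex_mult_cnj cmod_power2)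
    finally show ?thesis .
  qed
  have "a n * Im (usol w n z (Suc n) * cnj (usol w n z n)) = Im z * (norm m)\<^sup>2 - Im m + Im z * (\<Sum>j<n. (norm (usol w n z (Suc j)))\<^sup>2)"
    unfolding u jsol_energy v by simp
  also have "\<dots> = Im z * (\<Sum>j<Suc n. (norm (usol w n z j))\<^sup>2) - Im m"
    unfolding sum.lessThan_Suc_shift by (simp add: usol_def m_def algebra_simps)
  also have "Im (usol w n z (Suc n) * cnj (usol w n z n)) = Im w * (norm (usol w n z n))\<^sup>2"
    unfolding last by (simp add: mult.assoc complex_mult_cnj cmod_power2)
  finally show ?thesis by (simp add: m_def lessThan_Suc_atMost algebra_simps)
qed

lemma mfun_energy_le:
  assumes w: "Im w < 0" and z: "Im z \<ge> 0"
  shows "Im z * (\<Sum>j\<le>n. (norm (usol w n z j))\<^sup>2) \<le> Im (mfun w n z)"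
proof -
  have "a n * Im w * (norm (usol w n z n))\<^sup>2 \<le> 0"
    using a_pos[of n] w by (intro mult_nonpos_nonneg mult_nonneg_nonpos) auto
  then show ?thesis using mfun_energy[OF assms, of n] by linarith
qed

text \<open>Entry 0 of \<open>usol\<close> is the Weyl function m itself, so the energy inequality
  contains Im z |m|^2 <= Im m <= |m|.\<close>

lemma mfun_bound:
  assumes w: "Im w < 0" and z: "Im z > 0"
  shows "norm (mfun w n z) \<le> 1 / Im z"
proof (cases "mfun w n z = 0")
  case False
  have "(norm (mfun w n z))\<^sup>2 = (norm (usol w n z 0))\<^sup>2" by (simp add: usol_def)
  also have "\<dots> \<le> (\<Sum>j\<le>n. (norm (usol w n z j))\<^sup>2)" by (rule member_le_sum) auto
  finally have "Im z * (norm (mfun w n z))\<^sup>2 \<le> Im z * (\<Sum>j\<le>n. (norm (usol w n z j))\<^sup>2)"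
    using z by (intro mult_left_mono) auto
  also have "\<dots> \<le> norm (mfun w n z)"
    using mfun_energy_le[OF w less_imp_le[OF z], of n] abs_Im_le_cmod[of "mfun w n z"] by linarith
  finally have "(Im z * norm (mfun w n z)) * norm (mfun w n z) \<le> 1 * norm (mfun w n z)"
    by (simp add: power2_eq_square mult.assoc)
  then have "Im z * norm (mfun w n z) \<le> 1" using False by (simp del: mult_1)
  then show ?thesis using z by (simp add: field_simps)
qed (use z in simp)

text \<open>The last entry of \<open>usol\<close> times \<open>den\<close> is a Wronskian, which
  expresses the loss term of \<open>mfun_energy\<close> through \<open>den\<close> alone.\<close>

lemma Im_mfun_real:
  assumes w: "Im w < 0"
  shows "Im (mfun w n (of_real x)) = - Im w / (a n * (norm (den w n (of_real x)))\<^sup>2)"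
proof -
  let ?z = "complex_of_real x"
  have d: "den w n ?z \<noteq> 0" using den_nonzero[OF w, of ?z n] by simp
  have "usol w n ?z n * den w n ?z = Y ?z n * den w n ?z - num w n ?z * P ?z n"
    using d by (simp add: usol_def mfun_def field_simps)
  also have "\<dots> = - (P ?z n * Y ?z (Suc n) - P ?z (Suc n) * Y ?z n)"
    by (simp add: den_def num_def algebra_simps)
  finally have "of_real (a n) * (usol w n ?z n * den w n ?z) = - (of_real (a n) * (P ?z n * Y ?z (Suc n) - P ?z (Suc n) * Y ?z n))"
    by (simp only: mult_minus_right)
  then have "of_real (a n) * (usol w n ?z n * den w n ?z) = -1" unfolding P_Y_wronskian .
  then have "norm (of_real (a n) * (usol w n ?z n * den w n ?z)) = 1" by simp
  then have "a n * norm (usol w n ?z n) * norm (den w n ?z) = 1" using a_pos[of n] by (simp add: norm_mult)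
  then have u: "norm (usol w n ?z n) = 1 / (a n * norm (den w n ?z))" using d by (simp add: field_simps)
  have "Im (mfun w n ?z) = - (a n * Im w * (norm (usol w n ?z n))\<^sup>2)" using mfun_energy[OF w, of ?z n] by simp
  also have "\<dots> = - Im w / (a n * (norm (den w n ?z))\<^sup>2)"
    unfolding u by (simp add: power2_eq_square field_simps)
  finally show ?thesis .
qed

section \<open>Regularity and boundedness of the Weyl functions, and the densities of the
  truncations\<close>

lemma P_holomorphic: "(\<lambda>z. P z n) holomorphic_on S" and Y_holomorphic: "(\<lambda>z. Y z n) holomorphic_on S"
proof -
  show "(\<lambda>z. P z n) holomorphic_on S"
    by (induction n rule: induct_nat_012) (auto simp: P_def jsol_def jd_def intro!: holomorphic_intros)
  show "(\<lambda>z. Y z n) holomorphic_on S"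
    by (induction n rule: induct_nat_012) (auto simp: Y_def jsol_def jd_def intro!: holomorphic_intros)
qed

lemma mfun_holomorphic:
  assumes "Im w < 0" "S \<subseteq> {z. Im z \<ge> 0}" shows "mfun w n holomorphic_on S"
proof -
  have "(\<lambda>z. - num w n z / den w n z) holomorphic_on S"
    unfolding num_def by (intro holomorphic_intros Y_holomorphic)
      (use assms den_nonzero in \<open>auto simp: den_def intro!: holomorphic_intros P_holomorphic\<close>)
  then show ?thesis by (simp add: mfun_def[abs_def])
qed

lemma P_asymptotic: "((\<lambda>z::complex. P z n / z ^ n) \<longlongrightarrow> of_real (\<Prod>j<n. 1 / a j)) at_infinity"
proof (induction n rule: induct_nat_012)
  case 0 then show ?case by simp
next
  case 1
  have "((\<lambda>z::complex. (1 - of_real (b 0) * inverse z) * of_real (1 / a 0)) \<longlongrightarrow> (1 - of_real (b 0) * 0) * of_real (1 / a 0)) at_infinity"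
    by (intro tendsto_intros tendsto_inverse_0)
  moreover have "eventually (\<lambda>z::complex. (1 - of_real (b 0) * inverse z) * of_real (1 / a 0) = P z (Suc 0) / z ^ Suc 0) at_infinity"
    using eventually_not_equal_at_infinity[of "0::complex"] by eventually_elim (simp add: P_def jsol_def field_simps)
  ultimately show ?case by (rule tendsto_cong_limit) simp
next
  case (ge2 n)
  have "((\<lambda>z::complex. (1 - of_real (b (Suc n)) * inverse z) * of_real (1 / a (Suc n)) * (P z (Suc n) / z ^ Suc n)
       - jc n * (inverse z * inverse z) * (P z n / z ^ n))
      \<longlongrightarrow> (1 - of_real (b (Suc n)) * 0) * of_real (1 / a (Suc n)) * of_real (\<Prod>j<Suc n. 1 / a j) - jc n * (0 * 0) * of_real (\<Prod>j<n. 1 / a j)) at_infinity"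
    by (intro tendsto_intros tendsto_inverse_0 ge2)
  moreover have "eventually (\<lambda>z::complex. (1 - of_real (b (Suc n)) * inverse z) * of_real (1 / a (Suc n)) * (P z (Suc n) / z ^ Suc n)
       - jc n * (inverse z * inverse z) * (P z n / z ^ n) = P z (Suc (Suc n)) / z ^ Suc (Suc n)) at_infinity"
    using eventually_not_equal_at_infinity[of "0::complex"]
    by eventually_elim (simp add: P_def jsol_def jd_def field_simps)
  ultimately show ?case by (rule tendsto_cong_limit) simp
qed

lemma Y_asymptotic: "((\<lambda>z::complex. Y z n / z ^ n) \<longlongrightarrow> 0) at_infinity"
proof (induction n rule: induct_nat_012)
  case 0 then show ?case by simp
next
  case 1
  have "((\<lambda>z::complex. of_real (1 / a 0) * inverse z) \<longlongrightarrow> of_real (1 / a 0) * 0) at_infinity"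
    by (intro tendsto_intros tendsto_inverse_0)
  then show ?case by (simp add: Y_def jsol_def divide_inverse)
next
  case (ge2 n)
  have "((\<lambda>z::complex. (1 - of_real (b (Suc n)) * inverse z) * of_real (1 / a (Suc n)) * (Y z (Suc n) / z ^ Suc n)
       - jc n * (inverse z * inverse z) * (Y z n / z ^ n))
      \<longlongrightarrow> (1 - of_real (b (Suc n)) * 0) * of_real (1 / a (Suc n)) * 0 - jc n * (0 * 0) * 0) at_infinity"
    by (intro tendsto_intros tendsto_inverse_0 ge2)
  moreover have "eventually (\<lambda>z::complex. (1 - of_real (b (Suc n)) * inverse z) * of_real (1 / a (Suc n)) * (Y z (Suc n) / z ^ Suc n)
       - jc n * (inverse z * inverse z) * (Y z n / z ^ n) = Y z (Suc (Suc n)) / z ^ Suc (Suc n)) at_infinity"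
    using eventually_not_equal_at_infinity[of "0::complex"]
    by eventually_elim (simp add: Y_def jsol_def jd_def field_simps)
  ultimately show ?case by (rule tendsto_cong_limit) simp
qed

text \<open>\<open>P z (Suc n)\<close> has exact degree n + 1 and dominates the denominator, while
  the numerator has smaller degree.\<close>

lemma mfun_at_infinity: "(mfun w n \<longlongrightarrow> 0) at_infinity"
proof -
  define \<kappa> where "\<kappa> = (of_real (\<Prod>j<Suc n. 1 / a j) :: complex)"
  have \<kappa>: "\<kappa> - w * (0 * of_real (\<Prod>j<n. 1 / a j)) \<noteq> 0" unfolding \<kappa>_def by simp
  have "((\<lambda>z::complex. - (Y z (Suc n) / z ^ Suc n - w * (inverse z * (Y z n / z ^ n))) /
      (P z (Suc n) / z ^ Suc n - w * (inverse z * (P z n / z ^ n)))) \<longlongrightarrow>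
     - (0 - w * (0 * 0)) / (\<kappa> - w * (0 * of_real (\<Prod>j<n. 1 / a j)))) at_infinity"
    unfolding \<kappa>_def
    by (intro tendsto_intros tendsto_inverse_0 P_asymptotic Y_asymptotic \<kappa>[unfolded \<kappa>_def])
  moreover have "eventually (\<lambda>z::complex. - (Y z (Suc n) / z ^ Suc n - w * (inverse z * (Y z n / z ^ n))) /
      (P z (Suc n) / z ^ Suc n - w * (inverse z * (P z n / z ^ n))) = mfun w n z) at_infinity"
    using eventually_not_equal_at_infinity[of "0::complex"]
  proof eventually_elim
    case (elim z)
    have "Y z (Suc n) / z ^ Suc n - w * (inverse z * (Y z n / z ^ n)) = num w n z / z ^ Suc n"
      "P z (Suc n) / z ^ Suc n - w * (inverse z * (P z n / z ^ n)) = den w n z / z ^ Suc n"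
      using elim by (simp_all add: num_def den_def field_simps)
    then show ?case using elim by (simp add: mfun_def)
  qed
  ultimately show ?thesis by (rule tendsto_cong_limit) simp
qed

text \<open>\<open>mfun_bound\<close> degenerates at the real axis. The uniform bound that
  \<open>poisson_formula_half_plane\<close> asks for comes from the decay at infinity and from
  continuity on a compact part of the closed half-plane.\<close>

lemma mfun_bounded:
  assumes w: "Im w < 0"
  obtains C where "\<And>z. Im z \<ge> 0 \<Longrightarrow> norm (mfun w n z) \<le> C"
proof -
  have "eventually (\<lambda>z. norm (mfun w n z) < 1) at_infinity"
    using tendstoD[OF mfun_at_infinity, of 1] by simp
  then obtain R where R: "\<And>z. norm z \<ge> R \<Longrightarrow> norm (mfun w n z) < 1"
    unfolding eventually_at_infinity by blast
  have cl: "closed {z. Im z \<ge> 0}" using closed_halfspace_Im_ge[of 0] by simp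
  have "compact (mfun w n ` ({z. Im z \<ge> 0} \<inter> cball 0 R))"
    by (intro compact_continuous_image holomorphic_on_imp_continuous_on mfun_holomorphic[OF w] closed_Int_compact cl) auto
  then obtain C where "\<forall>z\<in>mfun w n ` ({z. Im z \<ge> 0} \<inter> cball 0 R). norm z \<le> C"
    using compact_imp_bounded bounded_iff by blast
  then have C: "norm (mfun w n z) \<le> C" if "Im z \<ge> 0" "norm z \<le> R" for z
    using that by auto
  have "norm (mfun w n z) \<le> max C 1" if "Im z \<ge> 0" for z
    using C[OF that] R[of z] by (cases "norm z \<le> R") (auto simp: le_max_iff_disj)
  then show ?thesis using that by blast
qed

definition approx :: "complex \<Rightarrow> nat \<Rightarrow> real \<Rightarrow> real" where
  "approx w n x = - Im w / (pi * a n * (norm (den w n (of_real x)))\<^sup>2)"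

lemma approx_eq: "Im w < 0 \<Longrightarrow> approx w n x = Im (mfun w n (of_real x)) / pi"
  by (simp add: approx_def Im_mfun_real)

lemma approx_nonneg: "Im w < 0 \<Longrightarrow> approx w n x \<ge> 0"
  using a_pos[of n] unfolding approx_def by (intro divide_nonneg_nonneg) auto

lemma approx_continuous: "Im w < 0 \<Longrightarrow> continuous_on UNIV (approx w n)"
proof -
  assume w: "Im w < 0"
  have "continuous_on {z. Im z \<ge> 0} (mfun w n)"
    by (rule holomorphic_on_imp_continuous_on[OF mfun_holomorphic[OF w]]) simp
  then have "continuous_on UNIV (\<lambda>x. mfun w n (complex_of_real x))"
    by (rule continuous_on_compose2) (auto intro!: continuous_intros)
  then have "continuous_on UNIV (\<lambda>x. Im (mfun w n (of_real x)) / pi)" by (intro continuous_intros) auto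
  moreover have "approx w n = (\<lambda>x. Im (mfun w n (of_real x)) / pi)"
    using approx_eq[OF w] by (rule ext)
  ultimately show ?thesis by (simp only:)
qed

lemma approx_poisson:
  assumes w: "Im w < 0" and z: "Im z > 0"
  shows "has_bochner_integral lborel (\<lambda>x. approx w n x * poisson (Im z) (x - Re z)) (Im (mfun w n z) / pi)"
proof -
  obtain C where C: "\<And>z. Im z \<ge> 0 \<Longrightarrow> norm (mfun w n z) \<le> C" using mfun_bounded[OF w] by blast
  have "has_bochner_integral lborel (\<lambda>x. of_real (poisson (Im z) (x - Re z)) * mfun w n (of_real x)) (mfun w n z)"
    by (rule poisson_formula_half_plane[OF _ _ C z])
      (auto intro!: holomorphic_on_imp_continuous_on mfun_holomorphic[OF w])
  then have "has_bochner_integral lborel (\<lambda>x. Im (of_real (poisson (Im z) (x - Re z)) * mfun w n (of_real x))) (Im (mfun w n z))"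
    by (rule has_bochner_integral_bounded_linear[OF bounded_linear_Im])
  then have "has_bochner_integral lborel (\<lambda>x. (1 / pi) * Im (of_real (poisson (Im z) (x - Re z)) * mfun w n (of_real x))) ((1 / pi) * Im (mfun w n z))"
    by (rule has_bochner_integral_mult_right)
  moreover have "(1 / pi) * Im (of_real (poisson (Im z) (x - Re z)) * mfun w n (of_real x)) = approx w n x * poisson (Im z) (x - Re z)" for x
    unfolding approx_eq[OF w] by simp
  ultimately show ?thesis by simp
qed

text \<open>As y grows, pi y times the Poisson kernel at height y tends to 1. The corresponding
  integrals are y times the imaginary part of \<open>mfun\<close> at the point i y, at most 1 by
  \<open>mfun_bound\<close>, and Fatou's lemma gives the mass.\<close>

lemma approx_mass:
  assumes w: "Im w < 0"
  shows "integrable lborel (approx w n)" "(\<integral>x. approx w n x \<partial>lborel) \<le> 1"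
proof -
  let ?f = "approx w n"
  have [measurable]: "?f \<in> borel_measurable borel"
    using approx_continuous[OF w] by (rule borel_measurable_continuous_onI)
  define k where "k m x = pi * real (Suc m) * (?f x * poisson (real (Suc m)) x)" for m x
  have k0: "k m x \<ge> 0" for m x unfolding k_def using approx_nonneg[OF w] poisson_nonneg by (intro mult_nonneg_nonneg) auto
  have int: "(\<integral>\<^sup>+x. ennreal (k m x) \<partial>lborel) \<le> 1" for m
  proof -
    define z where "z = Complex 0 (real (Suc m))"
    have z: "Im z > 0" by (simp add: z_def)
    have "has_bochner_integral lborel (k m) (pi * real (Suc m) * (Im (mfun w n z) / pi))"
      unfolding k_def[abs_def] using has_bochner_integral_mult_right[OF approx_poisson[OF w z, of n], of "pi * real (Suc m)"]
      by (simp add: z_def)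
    then have "(\<integral>\<^sup>+x. ennreal (k m x) \<partial>lborel) = ennreal (pi * real (Suc m) * (Im (mfun w n z) / pi))"
      using k0 by (subst nn_integral_eq_integral) (auto simp: has_bochner_integral_iff)
    moreover have "Im (mfun w n z) \<le> 1 / real (Suc m)"
      using mfun_bound[OF w z, of n] abs_Im_le_cmod[of "mfun w n z"] by (simp add: z_def)
    then have "real (Suc m) * Im (mfun w n z) \<le> 1" by (simp add: field_simps)
    ultimately show ?thesis by (simp add: ennreal_le_1)
  qed
  have klim: "(\<lambda>m. k m x) \<longlonglongrightarrow> ?f x" for x
  proof -
    have "(\<lambda>m. ((real (Suc m))\<^sup>2 / (x\<^sup>2 + (real (Suc m))\<^sup>2))) \<longlonglongrightarrow> 1" by real_asymp
    then have "(\<lambda>m. ?f x * ((real (Suc m))\<^sup>2 / (x\<^sup>2 + (real (Suc m))\<^sup>2))) \<longlonglongrightarrow> ?f x * 1"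
      by (intro tendsto_mult tendsto_const)
    moreover have "?f x * ((real (Suc m))\<^sup>2 / (x\<^sup>2 + (real (Suc m))\<^sup>2)) = k m x" for m
      by (simp add: k_def poisson_def power2_eq_square)
    ultimately show ?thesis by simp
  qed
  have "(\<integral>\<^sup>+x. ennreal (?f x) \<partial>lborel) = (\<integral>\<^sup>+x. liminf (\<lambda>m. ennreal (k m x)) \<partial>lborel)"
    by (intro nn_integral_cong) (metis klim lim_imp_Liminf sequentially_bot tendsto_ennrealI)
  also have "\<dots> \<le> liminf (\<lambda>m. \<integral>\<^sup>+x. ennreal (k m x) \<partial>lborel)"
    by (rule nn_integral_liminf) (simp add: k_def)
  also have "\<dots> \<le> liminf (\<lambda>m. 1)" by (intro Liminf_mono always_eventually allI int)
  also have "\<dots> = (1::ennreal)" by (simp add: Liminf_const)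
  finally have le: "(\<integral>\<^sup>+x. ennreal (?f x) \<partial>lborel) \<le> 1" .
  then have "(\<integral>\<^sup>+x. ennreal (?f x) \<partial>lborel) < \<infinity>" using order.strict_trans1 by fastforce
  then show int: "integrable lborel ?f"
    by (intro integrableI_nonneg) (auto simp: approx_nonneg[OF w])
  show "(\<integral>x. ?f x \<partial>lborel) \<le> 1"
    using le nn_integral_eq_integral[OF int] approx_nonneg[OF w] by (simp add: ennreal_le_1)
qed

end

section \<open>The Stieltjes transform of the orthonormality measure as limit of the Weyl
  functions\<close>

context jacobi
begin

text \<open>The functions of the second kind: the coefficients of 1 / (x - z) in the orthonormal
  system. Entry 0 is the Stieltjes transform of \<mu>.\<close>

definition ssol :: "real measure \<Rightarrow> complex \<Rightarrow> nat \<Rightarrow> complex" where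
  "ssol \<mu> z j = (\<integral>x. of_real (P x j) / (of_real x - z) \<partial>\<mu>)"

context
  fixes \<mu> :: "real measure" and z :: complex
  assumes orth: "orthonormality_measure a b \<mu>" and z: "Im z > 0"
begin

lemma prob_\<mu>: "prob_space \<mu>" and sets_\<mu>: "sets \<mu> = sets borel"
  using orth by (auto simp: orthonormality_measure_def real_prob_measure_def)

lemma orthP: "integrable \<mu> (\<lambda>x. P x m * P x n)" "(\<integral>x. P x m * P x n \<partial>\<mu>) = (if m = n then 1 else 0)"
  using orth by (simp_all add: orthonormality_measure_def jacobi_poly_eq)

lemma resolvent_bound: "norm (1 / (complex_of_real x - z)) \<le> 1 / Im z" and resolvent_nz: "complex_of_real x - z \<noteq> 0"
proof -
  have "Im z \<le> norm (complex_of_real x - z)" using abs_Im_le_cmod[of "complex_of_real x - z"] z by simp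
  then show "norm (1 / (complex_of_real x - z)) \<le> 1 / Im z" using z by (simp add: norm_divide frac_le)
  show "complex_of_real x - z \<noteq> 0" using z by (auto simp: complex_eq_iff)
qed

lemma integrable_resolvent:
  fixes f :: "real \<Rightarrow> complex"
  assumes f: "integrable \<mu> f"
  shows "integrable \<mu> (\<lambda>x. f x / (of_real x - z))"
proof (rule Bochner_Integration.integrable_bound)
  note [measurable_cong] = sets_\<mu>
  have [measurable]: "f \<in> borel_measurable \<mu>" using f by (rule borel_measurable_integrable)
  show "integrable \<mu> (\<lambda>x. of_real (1 / Im z) * f x)" using f by simp
  show "(\<lambda>x. f x / (of_real x - z)) \<in> borel_measurable \<mu>" by measurable
  show "AE x in \<mu>. norm (f x / (of_real x - z)) \<le> norm (of_real (1 / Im z) * f x)"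
  proof (rule AE_I2)
    fix x
    have "norm (f x / (of_real x - z)) = norm (f x) * norm (1 / (complex_of_real x - z))"
      by (simp add: norm_mult[symmetric] del: norm_mult)
    also have "\<dots> \<le> norm (f x) * (1 / Im z)" by (intro mult_left_mono resolvent_bound) auto
    finally show "norm (f x / (of_real x - z)) \<le> norm (of_real (1 / Im z) * f x)" using z by (simp add: norm_mult norm_divide mult.commute)
  qed
qed

lemma integrable_P: "integrable \<mu> (\<lambda>x. complex_of_real (P x n))" "(\<integral>x. complex_of_real (P x n) \<partial>\<mu>) = (if n = 0 then 1 else 0)"
  using integrable_of_real[OF orthP(1)[of n 0], where 'a=complex] orthP(2)[of n 0] by simp_all

text \<open>Write x / (x - z) as 1 + z / (x - z) in the recurrence for P x j: the integral of P x j
  vanishes unless j = 0. So \<open>ssol\<close> solves the same inhomogeneous recurrence as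
  \<open>usol\<close>, with the source at 0 only.\<close>

lemma ssol_eq: "ssol \<mu> z j = Y z j + ssol \<mu> z 0 * P z j"
proof -
  define h where "h j x = complex_of_real (P x j) / (of_real x - z)" for j x
  have hi: "integrable \<mu> (h j)" for j unfolding h_def[abs_def] by (rule integrable_resolvent[OF integrable_P(1)])
  have hs: "ssol \<mu> z j = (\<integral>x. h j x \<partial>\<mu>)" for j by (simp add: ssol_def h_def)
  have split: "of_real x * h j x = complex_of_real (P x j) + z * h j x" for x j
    using resolvent_nz[of x] by (simp add: h_def field_simps)
  have 1: "of_real (a 0) * h 1 x = (complex_of_real (P x 0) + z * h 0 x) - of_real (b 0) * h 0 x" for x
  proof -
    have "a 0 * P x 1 = (x - b 0) * P x 0" by (simp add: P_def jsol_def)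
    then have "complex_of_real (a 0) * of_real (P x 1) = (of_real x - of_real (b 0)) * of_real (P x 0)"
      by (metis of_real_diff of_real_mult)
    then have "of_real (a 0) * h 1 x = (of_real x - of_real (b 0)) * h 0 x"
      by (simp add: h_def mult.assoc[symmetric])
    then show ?thesis by (simp add: split left_diff_distrib)
  qed
  have 2: "of_real (a (Suc i)) * h (Suc (Suc i)) x = (complex_of_real (P x (Suc i)) + z * h (Suc i) x) - of_real (b (Suc i)) * h (Suc i) x - of_real (a i) * h i x" for x i
  proof -
    have "a (Suc i) * P x (Suc (Suc i)) = (x - b (Suc i)) * P x (Suc i) - a i * P x i"
      using jsol_rec[of i x] by (simp add: P_def)
    then have "complex_of_real (a (Suc i)) * of_real (P x (Suc (Suc i))) = (of_real x - of_real (b (Suc i))) * of_real (P x (Suc i)) - of_real (a i) * of_real (P x i)"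
      by (metis of_real_diff of_real_mult)
    then have "of_real (a (Suc i)) * h (Suc (Suc i)) x = (of_real x - of_real (b (Suc i))) * h (Suc i) x - of_real (a i) * h i x"
      by (simp add: h_def diff_divide_distrib)
    then show ?thesis by (simp add: split left_diff_distrib)
  qed
  have s1: "of_real (a 0) * ssol \<mu> z 1 = 1 + z * ssol \<mu> z 0 - of_real (b 0) * ssol \<mu> z 0"
  proof -
    have "of_real (a 0) * ssol \<mu> z 1 = (\<integral>x. of_real (a 0) * h 1 x \<partial>\<mu>)" unfolding hs by (simp only: integral_mult_right_zero)
    also have "\<dots> = (\<integral>x. (complex_of_real (P x 0) + z * h 0 x) - of_real (b 0) * h 0 x \<partial>\<mu>)" unfolding 1 ..
    also have "\<dots> = (\<integral>x. complex_of_real (P x 0) + z * h 0 x \<partial>\<mu>) - (\<integral>x. of_real (b 0) * h 0 x \<partial>\<mu>)"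
      by (intro Bochner_Integration.integral_diff Bochner_Integration.integrable_add integrable_mult_right integrable_P hi)
    also have "(\<integral>x. complex_of_real (P x 0) + z * h 0 x \<partial>\<mu>) = (\<integral>x. complex_of_real (P x 0) \<partial>\<mu>) + (\<integral>x. z * h 0 x \<partial>\<mu>)"
      by (intro Bochner_Integration.integral_add integrable_mult_right integrable_P hi)
    finally show ?thesis unfolding integrable_P(2) hs by (simp add: integral_mult_right_zero)
  qed
  have s2: "of_real (a (Suc i)) * ssol \<mu> z (Suc (Suc i)) = z * ssol \<mu> z (Suc i) - of_real (b (Suc i)) * ssol \<mu> z (Suc i) - of_real (a i) * ssol \<mu> z i" for i
  proof -
    have "of_real (a (Suc i)) * ssol \<mu> z (Suc (Suc i)) = (\<integral>x. of_real (a (Suc i)) * h (Suc (Suc i)) x \<partial>\<mu>)" unfolding hs by (simp only: integral_mult_right_zero)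
    also have "\<dots> = (\<integral>x. (complex_of_real (P x (Suc i)) + z * h (Suc i) x) - of_real (b (Suc i)) * h (Suc i) x - of_real (a i) * h i x \<partial>\<mu>)" unfolding 2 ..
    also have "\<dots> = (\<integral>x. (complex_of_real (P x (Suc i)) + z * h (Suc i) x) - of_real (b (Suc i)) * h (Suc i) x \<partial>\<mu>) - (\<integral>x. of_real (a i) * h i x \<partial>\<mu>)"
      by (intro Bochner_Integration.integral_diff Bochner_Integration.integrable_diff Bochner_Integration.integrable_add integrable_mult_right integrable_P hi)
    also have "(\<integral>x. (complex_of_real (P x (Suc i)) + z * h (Suc i) x) - of_real (b (Suc i)) * h (Suc i) x \<partial>\<mu>) = (\<integral>x. complex_of_real (P x (Suc i)) + z * h (Suc i) x \<partial>\<mu>) - (\<integral>x. of_real (b (Suc i)) * h (Suc i) x \<partial>\<mu>)"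
      by (intro Bochner_Integration.integral_diff Bochner_Integration.integrable_add integrable_mult_right integrable_P hi)
    also have "(\<integral>x. complex_of_real (P x (Suc i)) + z * h (Suc i) x \<partial>\<mu>) = (\<integral>x. complex_of_real (P x (Suc i)) \<partial>\<mu>) + (\<integral>x. z * h (Suc i) x \<partial>\<mu>)"
      by (intro Bochner_Integration.integral_add integrable_mult_right integrable_P hi)
    finally show ?thesis unfolding integrable_P(2) hs by (simp add: integral_mult_right_zero)
  qed
  let ?m = "ssol \<mu> z 0"
  have "ssol \<mu> z j = sol jc (jd z) ?m (1 / of_real (a 0) + ?m * ((z - of_real (b 0)) / of_real (a 0))) j"
  proof (rule sol_eqI)
    have "ssol \<mu> z (Suc 0) = (1 + z * ?m - of_real (b 0) * ?m) / of_real (a 0)"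
      using s1 by (simp add: eq_divide_eq mult.commute)
    then show "ssol \<mu> z (Suc 0) = 1 / of_real (a 0) + ?m * ((z - of_real (b 0)) / of_real (a 0))"
      by (simp add: field_simps)
    fix i
    have S: "ssol \<mu> z (Suc (Suc i)) = (z * ssol \<mu> z (Suc i) - of_real (b (Suc i)) * ssol \<mu> z (Suc i) - of_real (a i) * ssol \<mu> z i) / of_real (a (Suc i))"
      using s2[of i] by (simp add: eq_divide_eq mult.commute)
    show "ssol \<mu> z (Suc (Suc i)) = jd z i * ssol \<mu> z (Suc i) - jc i * ssol \<mu> z i"
      unfolding S by (simp only: jd_def jc_def of_real_divide diff_divide_distrib left_diff_distrib times_divide_eq_left)
  qed simp
  then show ?thesis unfolding usol_jsol jsol_def .
qed

text \<open>Bessel's inequality for the function 1 / (x - z), whose modulus is at most 1 / Im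
  z.\<close>

lemma ssol_bessel: "(\<Sum>j\<le>n. (norm (ssol \<mu> z j))\<^sup>2) \<le> 1 / (Im z)\<^sup>2"
proof -
  interpret prob_space \<mu> by (rule prob_\<mu>)
  note [measurable_cong] = sets_\<mu>
  define c where "c j = ssol \<mu> z j" for j
  define r where "r x = 1 / (complex_of_real x - z)" for x
  define S where "S x = (\<Sum>j\<le>n. c j * complex_of_real (P x j))" for x
  have [measurable]: "r \<in> borel_measurable borel" unfolding r_def[abs_def] by measurable
  have r2: "integrable \<mu> (\<lambda>x. (norm (r x))\<^sup>2)"
    by (rule integrable_const_bound[where B = "(1 / Im z)\<^sup>2"])
      (use resolvent_bound z in \<open>auto intro!: AE_I2 power_mono simp: r_def\<close>)
  have rP: "integrable \<mu> (\<lambda>x. cnj (c j) * (complex_of_real (P x j) * r x))"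
    "(\<integral>x. cnj (c j) * (complex_of_real (P x j) * r x) \<partial>\<mu>) = of_real ((norm (c j))\<^sup>2)" for j
  proof -
    have eq: "complex_of_real (P x j) * r x = complex_of_real (P x j) / (of_real x - z)" for x by (simp add: r_def)
    show "integrable \<mu> (\<lambda>x. cnj (c j) * (complex_of_real (P x j) * r x))"
      unfolding eq by (intro integrable_mult_right integrable_resolvent integrable_P)
    have "(\<integral>x. cnj (c j) * (complex_of_real (P x j) * r x) \<partial>\<mu>) = cnj (c j) * c j"
      unfolding eq by (simp only: integral_mult_right_zero c_def ssol_def)
    also have "\<dots> = of_real ((norm (c j))\<^sup>2)" unfolding complex_norm_square by (rule mult.commute)
    finally show "(\<integral>x. cnj (c j) * (complex_of_real (P x j) * r x) \<partial>\<mu>) = of_real ((norm (c j))\<^sup>2)" .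
  qed
  have rS_eq: "r x * cnj (S x) = (\<Sum>j\<le>n. cnj (c j) * (complex_of_real (P x j) * r x))" for x
    by (simp add: S_def sum_distrib_left mult_ac)
  have rS: "integrable \<mu> (\<lambda>x. r x * cnj (S x))" "(\<integral>x. r x * cnj (S x) \<partial>\<mu>) = of_real (\<Sum>j\<le>n. (norm (c j))\<^sup>2)"
    unfolding rS_eq using rP by (simp_all add: Bochner_Integration.integral_sum)
  have SS_eq: "S x * cnj (S x) = (\<Sum>i\<le>n. \<Sum>j\<le>n. c i * cnj (c j) * of_real (P x i * P x j))" for x
    by (simp add: S_def sum_product mult_ac)
  have PP: "integrable \<mu> (\<lambda>x. c i * cnj (c j) * complex_of_real (P x i * P x j))"
    "(\<integral>x. c i * cnj (c j) * complex_of_real (P x i * P x j) \<partial>\<mu>) = (if i = j then of_real ((norm (c j))\<^sup>2) else 0)" for i j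
  proof -
    show "integrable \<mu> (\<lambda>x. c i * cnj (c j) * complex_of_real (P x i * P x j))"
      by (intro integrable_mult_right integrable_of_real orthP)
    show "(\<integral>x. c i * cnj (c j) * complex_of_real (P x i * P x j) \<partial>\<mu>) = (if i = j then of_real ((norm (c j))\<^sup>2) else 0)"
      by (simp only: integral_mult_right_zero integral_complex_of_real orthP(2)) (simp add: complex_norm_square mult.commute del: of_real_power)
  qed
  have SS: "integrable \<mu> (\<lambda>x. S x * cnj (S x))" "(\<integral>x. S x * cnj (S x) \<partial>\<mu>) = of_real (\<Sum>j\<le>n. (norm (c j))\<^sup>2)"
  proof -
    show "integrable \<mu> (\<lambda>x. S x * cnj (S x))" unfolding SS_eq by (intro Bochner_Integration.integrable_sum PP)
    have "(\<integral>x. S x * cnj (S x) \<partial>\<mu>) = (\<Sum>i\<le>n. \<integral>x. (\<Sum>j\<le>n. c i * cnj (c j) * complex_of_real (P x i * P x j)) \<partial>\<mu>)"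
      unfolding SS_eq by (rule Bochner_Integration.integral_sum) (intro Bochner_Integration.integrable_sum PP)
    also have "\<dots> = (\<Sum>i\<le>n. \<Sum>j\<le>n. \<integral>x. c i * cnj (c j) * complex_of_real (P x i * P x j) \<partial>\<mu>)"
      by (intro sum.cong refl Bochner_Integration.integral_sum PP)
    finally have "(\<integral>x. S x * cnj (S x) \<partial>\<mu>) = (\<Sum>i\<le>n. \<Sum>j\<le>n. (if i = j then of_real ((norm (c j))\<^sup>2) else 0))"
      unfolding PP(2) .
    then show "(\<integral>x. S x * cnj (S x) \<partial>\<mu>) = of_real (\<Sum>j\<le>n. (norm (c j))\<^sup>2)" by simp
  qed
  have expand: "(norm (r x - S x))\<^sup>2 = (norm (r x))\<^sup>2 - 2 * Re (r x * cnj (S x)) + Re (S x * cnj (S x))" for x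
    by (simp only: cmod_power2) (simp add: power2_eq_square algebra_simps)
  have i1: "integrable \<mu> (\<lambda>x. Re (r x * cnj (S x)))" "integrable \<mu> (\<lambda>x. Re (S x * cnj (S x)))"
    by (rule integrable_Re[OF rS(1)], rule integrable_Re[OF SS(1)])
  have "0 \<le> (\<integral>x. (norm (r x - S x))\<^sup>2 \<partial>\<mu>)" by (intro integral_nonneg_AE AE_I2) simp
  also have "\<dots> = (\<integral>x. (norm (r x))\<^sup>2 - 2 * Re (r x * cnj (S x)) \<partial>\<mu>) + (\<integral>x. Re (S x * cnj (S x)) \<partial>\<mu>)"
    unfolding expand
    by (rule Bochner_Integration.integral_add[OF Bochner_Integration.integrable_diff[OF r2 integrable_mult_right[OF i1(1)]] i1(2)])
  also have "(\<integral>x. (norm (r x))\<^sup>2 - 2 * Re (r x * cnj (S x)) \<partial>\<mu>) = (\<integral>x. (norm (r x))\<^sup>2 \<partial>\<mu>) - (\<integral>x. 2 * Re (r x * cnj (S x)) \<partial>\<mu>)"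
    by (rule Bochner_Integration.integral_diff[OF r2 integrable_mult_right[OF i1(1)]])
  also have "(\<integral>x. 2 * Re (r x * cnj (S x)) \<partial>\<mu>) = 2 * (\<Sum>j\<le>n. (norm (c j))\<^sup>2)"
    unfolding integral_mult_right_zero integral_Re[OF rS(1)] rS(2) by simp
  also have "(\<integral>x. Re (S x * cnj (S x)) \<partial>\<mu>) = (\<Sum>j\<le>n. (norm (c j))\<^sup>2)"
    unfolding integral_Re[OF SS(1)] SS(2) by simp
  finally have "(\<Sum>j\<le>n. (norm (c j))\<^sup>2) \<le> (\<integral>x. (norm (r x))\<^sup>2 \<partial>\<mu>)" by linarith
  also have "\<dots> \<le> (\<integral>x. (1 / Im z)\<^sup>2 \<partial>\<mu>)"
    by (rule integral_mono[OF r2]) (use resolvent_bound in \<open>auto simp: r_def intro!: power_mono\<close>)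
  also have "\<dots> = 1 / (Im z)\<^sup>2" by (simp add: prob_space power_divide)
  finally show ?thesis by (simp add: c_def)
qed

lemma Im_ssol: "Im (ssol \<mu> z 0) = pi * (\<integral>x. poisson (Im z) (x - Re z) \<partial>\<mu>)"
proof -
  interpret prob_space \<mu> by (rule prob_\<mu>)
  have i: "integrable \<mu> (\<lambda>x. 1 / (complex_of_real x - z))"
    using integrable_resolvent[of "\<lambda>_. 1"] by simp
  have eq: "Im (1 / (complex_of_real x - z)) = pi * poisson (Im z) (x - Re z)" for x
    by (simp add: poisson_def Im_divide)
  have "Im (ssol \<mu> z 0) = (\<integral>x. Im (1 / (complex_of_real x - z)) \<partial>\<mu>)"
    unfolding ssol_def using integral_Im[OF i] by simp
  then show ?thesis unfolding eq by simp
qed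

end

text \<open>The limit point case. As \<open>P z 0\<close> is 1, \<open>P_energy\<close> gives 1 / a
  n <= |P z n| |P z (Suc n)| / Im z, so square summability of P would contradict the Carleman
  condition.\<close>

lemma P_norm_unbounded:
  assumes z: "Im z > 0" and carleman: "\<not> summable (\<lambda>n. 1 / a n)"
  shows "filterlim (\<lambda>n. \<Sum>j\<le>n. (norm (P z j))\<^sup>2) at_top sequentially"
proof (rule ccontr)
  let ?K = "\<lambda>n. \<Sum>j\<le>n. (norm (P z j))\<^sup>2"
  assume "\<not> filterlim ?K at_top sequentially"
  then obtain B where nB: "\<not> eventually (\<lambda>n. B \<le> ?K n) sequentially"
    unfolding filterlim_at_top by blast
  have B: "?K n \<le> B" for n
  proof (rule ccontr)
    assume n: "\<not> ?K n \<le> B"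
    have "B \<le> ?K k" if "k \<ge> n" for k
    proof -
      have "?K n \<le> ?K k" using that by (intro sum_mono2) auto
      then show ?thesis using n by linarith
    qed
    then show False using nB unfolding eventually_sequentially by blast
  qed
  have "summable (\<lambda>j. (norm (P z j))\<^sup>2)"
  proof (rule summableI_nonneg_bounded)
    show "(\<Sum>j<n. (norm (P z j))\<^sup>2) \<le> B" for n
    proof -
      have "(\<Sum>j<n. (norm (P z j))\<^sup>2) \<le> ?K n" by (intro sum_mono2) auto
      then show ?thesis using B[of n] by linarith
    qed
  qed simp
  then have s: "summable (\<lambda>j. ((norm (P z (Suc j)))\<^sup>2 + (norm (P z j))\<^sup>2) / (2 * Im z))"
    using summable_Suc_iff[of "\<lambda>j. (norm (P z j))\<^sup>2"] by (intro summable_divide summable_add) simp_all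
  have "summable (\<lambda>n. 1 / a n)"
  proof (rule summable_comparison_test'[OF s])
    fix n
    have "1 = (norm (P z 0))\<^sup>2" by simp
    also have "\<dots> \<le> ?K n" by (rule member_le_sum) auto
    finally have "Im z * 1 \<le> Im z * ?K n" using z by (intro mult_left_mono) auto
    also have "\<dots> = a n * Im (P z (Suc n) * cnj (P z n))" by (rule P_energy[symmetric])
    also have "\<dots> \<le> a n * (norm (P z (Suc n)) * norm (P z n))"
      using abs_Im_le_cmod[of "P z (Suc n) * cnj (P z n)"] a_pos[of n] by (intro mult_left_mono) (auto simp: norm_mult)
    also have "\<dots> \<le> a n * (((norm (P z (Suc n)))\<^sup>2 + (norm (P z n))\<^sup>2) / 2)"
      using sum_squares_bound[of "norm (P z (Suc n))" "norm (P z n)"] a_pos[of n] by (intro mult_left_mono) auto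
    finally have "1 / a n \<le> ((norm (P z (Suc n)))\<^sup>2 + (norm (P z n))\<^sup>2) / (2 * Im z)"
      using a_pos[of n] z by (simp add: field_simps)
    then show "norm (1 / a n) \<le> ((norm (P z (Suc n)))\<^sup>2 + (norm (P z n))\<^sup>2) / (2 * Im z)"
      using a_pos[of n] by simp
  qed
  with carleman show False by simp
qed

text \<open>\<open>usol\<close> and \<open>ssol\<close> have the form Y + m P, with square sums up
  to n at most 1 / (Im z)^2. Their difference is the difference of the two m times P, and the square
  sums of P are unbounded, so the m must approach each other.\<close>

lemma mfun_tendsto:
  assumes orth: "orthonormality_measure a b \<mu>" and z: "Im z > 0" and w: "Im w < 0"
    and carleman: "\<not> summable (\<lambda>n. 1 / a n)"
  shows "(\<lambda>n. mfun w n z) \<longlonglongrightarrow> ssol \<mu> z 0"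
proof -
  let ?K = "\<lambda>n. \<Sum>j\<le>n. (norm (P z j))\<^sup>2"
  define D where "D n = mfun w n z - ssol \<mu> z 0" for n
  have K1: "?K n \<ge> 1" for n
  proof -
    have "1 = (norm (P z 0))\<^sup>2" by simp
    also have "\<dots> \<le> ?K n" by (rule member_le_sum) auto
    finally show ?thesis .
  qed
  have bound: "(norm (D n))\<^sup>2 * ?K n \<le> 4 / (Im z)\<^sup>2" for n
  proof -
    have "(norm (D n))\<^sup>2 * ?K n = (\<Sum>j\<le>n. (norm (D n * P z j))\<^sup>2)"
      by (simp add: sum_distrib_left norm_mult power_mult_distrib)
    also have "\<dots> = (\<Sum>j\<le>n. (norm (usol w n z j - ssol \<mu> z j))\<^sup>2)"
    proof -
      have "D n * P z j = usol w n z j - ssol \<mu> z j" for j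
        using ssol_eq[OF orth z, of j] by (simp add: usol_def D_def algebra_simps)
      then show ?thesis by (simp only:)
    qed
    also have "\<dots> \<le> (\<Sum>j\<le>n. 2 * (norm (usol w n z j))\<^sup>2 + 2 * (norm (ssol \<mu> z j))\<^sup>2)"
    proof (rule sum_mono)
      fix j
      let ?x = "norm (usol w n z j)" and ?y = "norm (ssol \<mu> z j)"
      have "(norm (usol w n z j - ssol \<mu> z j))\<^sup>2 \<le> (?x + ?y)\<^sup>2"
        by (intro power_mono norm_triangle_ineq4) auto
      also have "\<dots> \<le> 2 * ?x\<^sup>2 + 2 * ?y\<^sup>2"
        using sum_squares_bound[of ?x ?y] by (simp add: power2_sum)
      finally show "(norm (usol w n z j - ssol \<mu> z j))\<^sup>2 \<le> 2 * ?x\<^sup>2 + 2 * ?y\<^sup>2" .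
    qed
    also have "\<dots> = 2 * (\<Sum>j\<le>n. (norm (usol w n z j))\<^sup>2) + 2 * (\<Sum>j\<le>n. (norm (ssol \<mu> z j))\<^sup>2)"
      by (simp add: sum.distrib sum_distrib_left)
    also have "\<dots> \<le> 2 * (1 / (Im z)\<^sup>2) + 2 * (1 / (Im z)\<^sup>2)"
    proof -
      have "Im z * (\<Sum>j\<le>n. (norm (usol w n z j))\<^sup>2) \<le> 1 / Im z"
        using mfun_energy_le[OF w less_imp_le[OF z], of n] mfun_bound[OF w z, of n] abs_Im_le_cmod[of "mfun w n z"] by linarith
      then have "(\<Sum>j\<le>n. (norm (usol w n z j))\<^sup>2) \<le> 1 / (Im z)\<^sup>2"
        using z by (simp add: field_simps power2_eq_square)
      then show ?thesis using ssol_bessel[OF orth z, of n] by linarith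
    qed
    finally show ?thesis by simp
  qed
  have "(\<lambda>n. (norm (D n))\<^sup>2) \<longlonglongrightarrow> 0"
  proof (rule Lim_null_comparison)
    show "(\<lambda>n. 4 / (Im z)\<^sup>2 / ?K n) \<longlonglongrightarrow> 0"
      by (rule real_tendsto_divide_at_top[OF tendsto_const P_norm_unbounded[OF z carleman]])
    show "\<forall>\<^sub>F n in sequentially. norm ((norm (D n))\<^sup>2) \<le> 4 / (Im z)\<^sup>2 / ?K n"
    proof (intro always_eventually allI)
      fix n
      have "?K n > 0" using K1[of n] by linarith
      then have "(norm (D n))\<^sup>2 \<le> 4 / (Im z)\<^sup>2 / ?K n" using bound[of n] by (simp only: pos_le_divide_eq)
      then show "norm ((norm (D n))\<^sup>2) \<le> 4 / (Im z)\<^sup>2 / ?K n" by (simp only: real_norm_def abs_power2)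
    qed
  qed
  then have "(\<lambda>n. sqrt ((norm (D n))\<^sup>2)) \<longlonglongrightarrow> sqrt 0" by (rule tendsto_real_sqrt)
  then have "D \<longlonglongrightarrow> 0" by (simp add: tendsto_norm_zero_iff)
  then show ?thesis unfolding D_def[abs_def] by (simp add: LIM_zero_iff)
qed

text \<open>Allows a subsequence \<open>s\<close>, because the amplitude is shown to converge only
  along the last indices of the periods.\<close>

theorem orthonormality_measure_density:
  assumes orth: "orthonormality_measure a b \<mu>" and carleman: "\<not> summable (\<lambda>n. 1 / a n)"
    and w: "Im w < 0" and s: "filterlim s at_top sequentially"
    and lim: "\<And>R. uniform_limit {-R..R} (\<lambda>k. approx w (s k)) g sequentially"
  shows "has_continuous_density \<mu> UNIV g"
proof (rule continuous_density_from_poisson[where f = "\<lambda>k. approx w (s k)"])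
  show "real_prob_measure \<mu>" using orth by (simp add: orthonormality_measure_def)
  fix y c :: real assume y: "y > 0"
  define z where "z = Complex c y"
  have z: "Im z > 0" using y by (simp add: z_def)
  have "(\<lambda>k. mfun w (s k) z) \<longlonglongrightarrow> ssol \<mu> z 0"
    by (rule filterlim_compose[OF mfun_tendsto[OF orth z w carleman] s])
  then have "(\<lambda>k. Im (mfun w (s k) z) / pi) \<longlonglongrightarrow> Im (ssol \<mu> z 0) / pi"
    by (intro tendsto_divide tendsto_Im) auto
  moreover have "(\<integral>x. approx w n x * poisson y (x - c) \<partial>lborel) = Im (mfun w n z) / pi" for n
    using approx_poisson[OF w z, of n] by (simp add: has_bochner_integral_iff z_def)
  moreover have "Im (ssol \<mu> z 0) / pi = (\<integral>x. poisson y (x - c) \<partial>\<mu>)"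
    unfolding Im_ssol[OF orth z] by (simp add: z_def)
  ultimately show "(\<lambda>k. \<integral>x. approx w (s k) x * poisson y (x - c) \<partial>lborel) \<longlonglongrightarrow> (\<integral>x. poisson y (x - c) \<partial>\<mu>)"
    by simp
qed (use w lim approx_continuous approx_nonneg approx_mass in auto)

end

section \<open>Uniqueness of the energy minimizer\<close>

text \<open>
  \<open>ln D - ln \<bar>x - y\<bar>\<close> is a mixture over the lengths \<open>u\<close> of the kernels \<open>max 0 (u - \<bar>x - y\<bar>)\<close>. Each of them is the overlap of
  two intervals of length \<open>u\<close>, hence positive definite, and this makes the minimizer of the energy unique.
\<close>

definition win :: "real measure \<Rightarrow> real \<Rightarrow> real \<Rightarrow> real" where
  "win \<nu> u t = measure \<nu> {t - u/2..t + u/2}"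

text \<open>By \<open>pairing_eq\<close> this is the mutual energy for the kernel max 0 (u - |x -
  y|). As an L^2 product of window functions it shows the positivity.\<close>

definition pairing :: "real \<Rightarrow> real measure \<Rightarrow> real measure \<Rightarrow> ennreal" where
  "pairing u \<nu>1 \<nu>2 = (\<integral>\<^sup>+t. ennreal (win \<nu>1 u t * win \<nu>2 u t) \<partial>lborel)"

abbreviation wind :: "real \<Rightarrow> real \<Rightarrow> real \<Rightarrow> ennreal" where
  "wind u t x \<equiv> (if \<bar>x - t\<bar> \<le> u/2 then 1 else 0)"

lemma overlap_length:
  fixes x y u :: real
  shows "(\<integral>\<^sup>+t. wind u t x * wind u t y \<partial>lborel) = ennreal (u - \<bar>x - y\<bar>)"
proof -
  have "wind u t x * wind u t y = indicator {max x y - u/2..min x y + u/2} t" for t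
  proof (cases "t \<in> {max x y - u/2..min x y + u/2}")
    case True
    then have "\<bar>x - t\<bar> \<le> u/2" "\<bar>y - t\<bar> \<le> u/2" unfolding atLeastAtMost_iff by linarith+
    then show ?thesis using True by simp
  next
    case False
    then have "\<not> (\<bar>x - t\<bar> \<le> u/2 \<and> \<bar>y - t\<bar> \<le> u/2)" unfolding atLeastAtMost_iff by linarith
    then show ?thesis using False by auto
  qed
  then have "(\<integral>\<^sup>+t. wind u t x * wind u t y \<partial>lborel) = emeasure lborel {max x y - u/2..min x y + u/2}" by (simp only: nn_integral_indicator sets_lborel atLeastAtMost_borel)
  also have "\<dots> = ennreal (u - \<bar>x - y\<bar>)"
  proof (cases "max x y - u/2 \<le> min x y + u/2")
    case True
    then have "emeasure lborel {max x y - u/2..min x y + u/2} = ennreal ((min x y + u/2) - (max x y - u/2))" by (rule emeasure_lborel_Icc)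
    moreover have "(min x y + u/2) - (max x y - u/2) = u - \<bar>x - y\<bar>" by linarith
    ultimately show ?thesis by simp
  next
    case False
    then have "u - \<bar>x - y\<bar> \<le> 0" by linarith
    then show ?thesis using False by (simp add: ennreal_neg)
  qed
  finally show ?thesis .
qed

lemma win_measurable:
  assumes "prob_space \<nu>" "sets \<nu> = sets borel"
  shows "(\<lambda>t. win \<nu> u t) \<in> borel_measurable borel"
    and "ennreal (win \<nu> u t) = (\<integral>\<^sup>+x. wind u t x \<partial>\<nu>)"
proof -
  interpret prob_space \<nu> by fact
  note [measurable_cong] = assms(2)
  show eq: "ennreal (win \<nu> u t) = (\<integral>\<^sup>+x. wind u t x \<partial>\<nu>)" for t
  proof -
    have "wind u t x = indicator {t - u/2..t + u/2} x" for x
    proof (cases "x \<in> {t - u/2..t + u/2}")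
      case True
      then have "\<bar>x - t\<bar> \<le> u/2" unfolding atLeastAtMost_iff by linarith
      then show ?thesis using True by simp
    next
      case False
      then have "\<not> \<bar>x - t\<bar> \<le> u/2" unfolding atLeastAtMost_iff by linarith
      then show ?thesis using False by simp
    qed
    then show ?thesis by (simp add: win_def emeasure_eq_measure assms(2))
  qed
  have "(\<lambda>t. \<integral>\<^sup>+x. wind u t x \<partial>\<nu>) \<in> borel_measurable borel"
    by measurable
  then have "(\<lambda>t. ennreal (win \<nu> u t)) \<in> borel_measurable borel" by (simp only: eq)
  then have "(\<lambda>t. enn2real (ennreal (win \<nu> u t))) \<in> borel_measurable borel" by measurable
  then show "(\<lambda>t. win \<nu> u t) \<in> borel_measurable borel" by (simp add: win_def)
qed

lemma win_nonneg [simp]: "0 \<le> win \<nu> u t"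
  by (simp add: win_def)

lemma pairing_eq:
  assumes 1: "prob_space \<nu>1" "sets \<nu>1 = sets borel" and 2: "prob_space \<nu>2" "sets \<nu>2 = sets borel"
  shows "(\<integral>\<^sup>+x. \<integral>\<^sup>+y. ennreal (u - \<bar>x - y\<bar>) \<partial>\<nu>2 \<partial>\<nu>1) = pairing u \<nu>1 \<nu>2"
proof -
  interpret p1: prob_space \<nu>1 by fact
  interpret p2: prob_space \<nu>2 by fact
  interpret a: pair_sigma_finite \<nu>2 lborel ..
  interpret b: pair_sigma_finite \<nu>1 lborel ..
  note [measurable_cong] = 1(2) 2(2)
  let ?i = "\<lambda>t x. wind u t x"
  have [measurable]: "(\<lambda>t. win \<nu>2 u t) \<in> borel_measurable borel" by (rule win_measurable(1)[OF 2])
  have "(\<integral>\<^sup>+x. \<integral>\<^sup>+y. ennreal (u - \<bar>x - y\<bar>) \<partial>\<nu>2 \<partial>\<nu>1) = (\<integral>\<^sup>+x. \<integral>\<^sup>+y. \<integral>\<^sup>+t. ?i t x * ?i t y \<partial>lborel \<partial>\<nu>2 \<partial>\<nu>1)"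
    by (simp only: overlap_length)
  also have "\<dots> = (\<integral>\<^sup>+x. \<integral>\<^sup>+t. \<integral>\<^sup>+y. ?i t x * ?i t y \<partial>\<nu>2 \<partial>lborel \<partial>\<nu>1)"
    by (intro nn_integral_cong a.Fubini'[symmetric]) measurable
  also have "\<dots> = (\<integral>\<^sup>+x. \<integral>\<^sup>+t. ?i t x * ennreal (win \<nu>2 u t) \<partial>lborel \<partial>\<nu>1)"
    by (intro nn_integral_cong) (simp add: nn_integral_cmult win_measurable(2)[OF 2])
  also have "\<dots> = (\<integral>\<^sup>+t. \<integral>\<^sup>+x. ?i t x * ennreal (win \<nu>2 u t) \<partial>\<nu>1 \<partial>lborel)"
    by (intro b.Fubini'[symmetric]) measurable
  also have "\<dots> = pairing u \<nu>1 \<nu>2"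
    unfolding pairing_def
    by (intro nn_integral_cong) (simp add: nn_integral_multc win_measurable(2)[OF 1] ennreal_mult)
  finally show ?thesis .
qed

text \<open>The two sides differ by the integral of the squared difference of the window functions.
  Sums are compared because subtraction is truncated in \<open>ennreal\<close>.\<close>

lemma pairing_le:
  assumes 1: "prob_space \<nu>1" "sets \<nu>1 = sets borel" and 2: "prob_space \<nu>2" "sets \<nu>2 = sets borel"
  shows "2 * pairing u \<nu>1 \<nu>2 \<le> pairing u \<nu>1 \<nu>1 + pairing u \<nu>2 \<nu>2"
    and "pairing u \<nu>1 \<nu>1 + pairing u \<nu>2 \<nu>2 \<le> 2 * pairing u \<nu>1 \<nu>2 \<Longrightarrow> pairing u \<nu>1 \<nu>2 < \<infinity> \<Longrightarrow> AE t in lborel. win \<nu>1 u t = win \<nu>2 u t"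
proof -
  have [measurable]: "(\<lambda>t. win \<nu>1 u t) \<in> borel_measurable borel" "(\<lambda>t. win \<nu>2 u t) \<in> borel_measurable borel"
    by (rule win_measurable(1)[OF 1], rule win_measurable(1)[OF 2])
  let ?p = "win \<nu>1 u" and ?q = "win \<nu>2 u"
  have eq: "pairing u \<nu>1 \<nu>1 + pairing u \<nu>2 \<nu>2 = (\<integral>\<^sup>+t. ennreal ((?p t - ?q t)\<^sup>2) \<partial>lborel) + 2 * pairing u \<nu>1 \<nu>2"
  proof -
    have "pairing u \<nu>1 \<nu>1 + pairing u \<nu>2 \<nu>2 = (\<integral>\<^sup>+t. ennreal (?p t * ?p t) + ennreal (?q t * ?q t) \<partial>lborel)"
      unfolding pairing_def by (rule nn_integral_add[symmetric]) measurable
    also have "\<dots> = (\<integral>\<^sup>+t. ennreal ((?p t - ?q t)\<^sup>2) + 2 * ennreal (?p t * ?q t) \<partial>lborel)"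
    proof (rule nn_integral_cong)
      fix t
      have "ennreal (?p t * ?p t) + ennreal (?q t * ?q t) = ennreal (?p t * ?p t + ?q t * ?q t)" by (simp add: ennreal_plus)
      also have "?p t * ?p t + ?q t * ?q t = (?p t - ?q t)\<^sup>2 + 2 * (?p t * ?q t)" by (simp add: power2_eq_square algebra_simps)
      also have "ennreal \<dots> = ennreal ((?p t - ?q t)\<^sup>2) + ennreal (2 * (?p t * ?q t))" by (simp add: ennreal_plus)
      also have "ennreal (2 * (?p t * ?q t)) = 2 * ennreal (?p t * ?q t)" by (simp add: ennreal_mult)
      finally show "ennreal (?p t * ?p t) + ennreal (?q t * ?q t) = ennreal ((?p t - ?q t)\<^sup>2) + 2 * ennreal (?p t * ?q t)" .
    qed
    also have "\<dots> = (\<integral>\<^sup>+t. ennreal ((?p t - ?q t)\<^sup>2) \<partial>lborel) + (\<integral>\<^sup>+t. 2 * ennreal (?p t * ?q t) \<partial>lborel)"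
      by (rule nn_integral_add) measurable
    also have "(\<integral>\<^sup>+t. 2 * ennreal (?p t * ?q t) \<partial>lborel) = 2 * pairing u \<nu>1 \<nu>2"
      unfolding pairing_def by (rule nn_integral_cmult) measurable
    finally show ?thesis .
  qed
  show "2 * pairing u \<nu>1 \<nu>2 \<le> pairing u \<nu>1 \<nu>1 + pairing u \<nu>2 \<nu>2" unfolding eq by simp
  assume le: "pairing u \<nu>1 \<nu>1 + pairing u \<nu>2 \<nu>2 \<le> 2 * pairing u \<nu>1 \<nu>2" and fin: "pairing u \<nu>1 \<nu>2 < \<infinity>"
  have fin2: "2 * pairing u \<nu>1 \<nu>2 \<noteq> \<infinity>" using fin by (simp add: ennreal_mult_eq_top_iff)
  have "(\<integral>\<^sup>+t. ennreal ((?p t - ?q t)\<^sup>2) \<partial>lborel) + 2 * pairing u \<nu>1 \<nu>2 \<le> 0 + 2 * pairing u \<nu>1 \<nu>2" using le unfolding eq by simp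
  then have "2 * pairing u \<nu>1 \<nu>2 + (\<integral>\<^sup>+t. ennreal ((?p t - ?q t)\<^sup>2) \<partial>lborel) \<le> 2 * pairing u \<nu>1 \<nu>2 + 0" by (simp only: add.commute)
  then have "(\<integral>\<^sup>+t. ennreal ((?p t - ?q t)\<^sup>2) \<partial>lborel) = 0"
    using fin2 by (simp only: ennreal_add_left_cancel_le le_zero_eq simp_thms)
  then have "AE t in lborel. ennreal ((?p t - ?q t)\<^sup>2) = 0"
    by (subst (asm) nn_integral_0_iff_AE) auto
  then show "AE t in lborel. win \<nu>1 u t = win \<nu>2 u t"
    by eventually_elim (simp add: ennreal_eq_0_iff)
qed

text \<open>The shift by ln D makes the logarithmic kernel nonnegative on a set of diameter at most
  D, so energies become integrals in \<open>ennreal\<close>.\<close>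

definition kern :: "real \<Rightarrow> real \<Rightarrow> real \<Rightarrow> ennreal" where
  "kern D x y = (if x = y then \<infinity> else ennreal (ln D - ln \<bar>x - y\<bar>))"

lemma kern_measurable [measurable]: "(\<lambda>(x, y). kern D x y) \<in> borel_measurable (borel \<Otimes>\<^sub>M borel)"
  unfolding kern_def[abs_def] by measurable

lemma ennreal_unbounded_eq_top:
  fixes X :: ennreal
  assumes "\<And>B :: real. ennreal B \<le> X" shows "X = \<infinity>"
proof (cases X)
  case (real r)
  have "ennreal (r + 1) \<le> ennreal r" using assms[of "r + 1"] real by simp
  then show ?thesis using real by (simp add: ennreal_le_iff2)
qed simp

text \<open>With r = |x - y| > 0, the integral of (u - r) / u^2 from r to D is ln D - ln r + r / D -
  1, and the term at u = D adds 1 - r / D. On the diagonal the integrand is 1 / u, which is not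
  integrable at 0.\<close>

lemma kern_decomposition:
  fixes x y D :: real
  assumes D: "D > 0" and le: "\<bar>x - y\<bar> \<le> D"
  shows "kern D x y = (\<integral>\<^sup>+u. ennreal (1 / u\<^sup>2) * ennreal (u - \<bar>x - y\<bar>) * indicator {0<..D} u \<partial>lborel) + ennreal (1 / D) * ennreal (D - \<bar>x - y\<bar>)"
proof (cases "x = y")
  case True
  have "(\<integral>\<^sup>+u. ennreal (1 / u\<^sup>2) * ennreal (u - \<bar>x - y\<bar>) * indicator {0<..D} u \<partial>lborel) \<ge> ennreal B" for B :: real
  proof (cases "B \<ge> 0")
    case B: True
    \<comment> \<open>Chosen so that the integral of 1 / u from a to D is B.\<close>
    define a where "a = D * exp (- B)"
    have a: "0 < a" "a \<le> D" using D B by (auto simp: a_def mult_le_cancel_left2)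
    have "ennreal B = ennreal (ln D - ln a)" using D by (simp add: a_def ln_mult)
    also have "\<dots> = (\<integral>\<^sup>+u. ennreal (1 / u) * indicator {a..D} u \<partial>lborel)"
      by (rule nn_integral_FTC_Icc[symmetric]) (use a in \<open>auto intro!: derivative_eq_intros simp: divide_inverse\<close>)
    also have "\<dots> \<le> (\<integral>\<^sup>+u. ennreal (1 / u\<^sup>2) * ennreal (u - \<bar>x - y\<bar>) * indicator {0<..D} u \<partial>lborel)"
    proof (rule nn_integral_mono)
      fix u :: real
      show "ennreal (1 / u) * indicator {a..D} u \<le> ennreal (1 / u\<^sup>2) * ennreal (u - \<bar>x - y\<bar>) * indicator {0<..D} u"
        using True a by (auto simp: indicator_def ennreal_mult[symmetric] power2_eq_square)
    qed
    finally show ?thesis .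
  qed (simp add: ennreal_neg)
  then have "(\<integral>\<^sup>+u. ennreal (1 / u\<^sup>2) * ennreal (u - \<bar>x - y\<bar>) * indicator {0<..D} u \<partial>lborel) = \<infinity>"
    by (rule ennreal_unbounded_eq_top)
  then show ?thesis using True by (simp add: kern_def)
next
  case False
  define r where "r = \<bar>x - y\<bar>"
  have r: "r > 0" "r \<le> D" using False le by (auto simp: r_def)
  have "(\<integral>\<^sup>+u. ennreal (1 / u\<^sup>2) * ennreal (u - r) * indicator {0<..D} u \<partial>lborel) = (\<integral>\<^sup>+u. ennreal ((u - r) / u\<^sup>2) * indicator {r..D} u \<partial>lborel)"
  proof (rule nn_integral_cong)
    fix u :: real
    show "ennreal (1 / u\<^sup>2) * ennreal (u - r) * indicator {0<..D} u = ennreal ((u - r) / u\<^sup>2) * indicator {r..D} u"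
      using r by (cases "u \<ge> r") (auto simp: indicator_def ennreal_mult[symmetric] ennreal_neg)
  qed
  also have "\<dots> = ennreal ((ln D + r / D) - (ln r + r / r))"
  proof (rule nn_integral_FTC_Icc)
    fix u assume "u \<in> {r..D}"
    then have u: "r \<le> u" "u \<le> D" by auto
    have "((\<lambda>u. ln u + r / u) has_real_derivative (1 / u + (- r) / (u * u))) (at u)"
      using u r by (auto intro!: derivative_eq_intros simp: divide_inverse)
    then show "((\<lambda>u. ln u + r / u) has_real_derivative (u - r) / u\<^sup>2) (at u)"
      using u r by (simp add: diff_divide_distrib power2_eq_square)
    show "0 \<le> (u - r) / u\<^sup>2" using u r by simp
  qed (use r in auto)
  finally have 1: "(\<integral>\<^sup>+u. ennreal (1 / u\<^sup>2) * ennreal (u - r) * indicator {0<..D} u \<partial>lborel) = ennreal (ln D + r / D - ln r - 1)"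
    using r by (simp add: algebra_simps)
  have "ln (D / r) \<ge> 1 - 1 / (D / r)" using r D ln_le_minus_one[of "r / D"] by (simp add: ln_div)
  then have nn: "0 \<le> ln D + r / D - ln r - 1" using r D by (simp add: ln_div)
  have "ennreal (1 / D) * ennreal (D - r) = ennreal (1 - r / D)"
    using r D by (simp add: ennreal_mult[symmetric] field_simps)
  then have "ennreal (ln D + r / D - ln r - 1) + ennreal (1 / D) * ennreal (D - r) = ennreal ((ln D + r / D - ln r - 1) + (1 - r / D))"
    using nn r D by (simp add: ennreal_plus[symmetric] del: ennreal_plus)
  then show ?thesis using False unfolding r_def[symmetric] 1 by (simp add: kern_def r_def)
qed

definition energy :: "real \<Rightarrow> real measure \<Rightarrow> real measure \<Rightarrow> ennreal" where
  "energy D \<nu>1 \<nu>2 = (\<integral>\<^sup>+x. \<integral>\<^sup>+y. kern D x y \<partial>\<nu>2 \<partial>\<nu>1)"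

lemma energy_decomposition:
  assumes 1: "prob_space \<nu>1" "sets \<nu>1 = sets borel" and 2: "prob_space \<nu>2" "sets \<nu>2 = sets borel"
    and F: "AE x in \<nu>1. x \<in> F" "AE x in \<nu>2. x \<in> F" and D: "D > 0" "\<And>x y. x \<in> F \<Longrightarrow> y \<in> F \<Longrightarrow> \<bar>x - y\<bar> \<le> D"
  shows "energy D \<nu>1 \<nu>2 = (\<integral>\<^sup>+u. ennreal (1 / u\<^sup>2) * indicator {0<..D} u * pairing u \<nu>1 \<nu>2 \<partial>lborel) + ennreal (1 / D) * pairing D \<nu>1 \<nu>2"
proof -
  interpret p1: prob_space \<nu>1 by fact
  interpret p2: prob_space \<nu>2 by fact
  interpret a: pair_sigma_finite \<nu>2 lborel ..
  interpret b: pair_sigma_finite \<nu>1 lborel ..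
  note [measurable_cong] = 1(2) 2(2)
  let ?k = "\<lambda>x y u. ennreal (1 / u\<^sup>2) * ennreal (u - \<bar>x - y\<bar>) * indicator {0<..D} u"
  have "energy D \<nu>1 \<nu>2 = (\<integral>\<^sup>+x. \<integral>\<^sup>+y. (\<integral>\<^sup>+u. ?k x y u \<partial>lborel) + ennreal (1 / D) * ennreal (D - \<bar>x - y\<bar>) \<partial>\<nu>2 \<partial>\<nu>1)"
    unfolding energy_def
  proof (rule nn_integral_cong_AE)
    show "AE x in \<nu>1. (\<integral>\<^sup>+y. kern D x y \<partial>\<nu>2) = (\<integral>\<^sup>+y. (\<integral>\<^sup>+u. ?k x y u \<partial>lborel) + ennreal (1 / D) * ennreal (D - \<bar>x - y\<bar>) \<partial>\<nu>2)"
      using F(1)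
    proof eventually_elim
      case (elim x)
      show ?case
      proof (rule nn_integral_cong_AE)
        show "AE y in \<nu>2. kern D x y = (\<integral>\<^sup>+u. ?k x y u \<partial>lborel) + ennreal (1 / D) * ennreal (D - \<bar>x - y\<bar>)"
          using F(2) by eventually_elim (rule kern_decomposition[OF D(1) D(2)[OF elim]])
      qed
    qed
  qed
  also have "\<dots> = (\<integral>\<^sup>+x. (\<integral>\<^sup>+y. \<integral>\<^sup>+u. ?k x y u \<partial>lborel \<partial>\<nu>2) + ennreal (1 / D) * (\<integral>\<^sup>+y. ennreal (D - \<bar>x - y\<bar>) \<partial>\<nu>2) \<partial>\<nu>1)"
    by (simp add: nn_integral_add nn_integral_cmult)
  also have "\<dots> = (\<integral>\<^sup>+x. \<integral>\<^sup>+y. \<integral>\<^sup>+u. ?k x y u \<partial>lborel \<partial>\<nu>2 \<partial>\<nu>1) + ennreal (1 / D) * pairing D \<nu>1 \<nu>2"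
    by (simp add: nn_integral_add nn_integral_cmult pairing_eq[OF 1 2, symmetric])
  also have "(\<integral>\<^sup>+x. \<integral>\<^sup>+y. \<integral>\<^sup>+u. ?k x y u \<partial>lborel \<partial>\<nu>2 \<partial>\<nu>1) = (\<integral>\<^sup>+x. \<integral>\<^sup>+u. \<integral>\<^sup>+y. ?k x y u \<partial>\<nu>2 \<partial>lborel \<partial>\<nu>1)"
    by (intro nn_integral_cong a.Fubini'[symmetric]) measurable
  also have "\<dots> = (\<integral>\<^sup>+u. \<integral>\<^sup>+x. \<integral>\<^sup>+y. ?k x y u \<partial>\<nu>2 \<partial>\<nu>1 \<partial>lborel)"
    by (intro b.Fubini'[symmetric]) measurable
  also have "\<dots> = (\<integral>\<^sup>+u. ennreal (1 / u\<^sup>2) * indicator {0<..D} u * pairing u \<nu>1 \<nu>2 \<partial>lborel)"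
  proof (rule nn_integral_cong)
    fix u :: real
    have eq: "?k x y u = (ennreal (1 / u\<^sup>2) * indicator {0<..D} u) * ennreal (u - \<bar>x - y\<bar>)" for x y by (simp only: mult_ac)
    show "(\<integral>\<^sup>+x. \<integral>\<^sup>+y. ?k x y u \<partial>\<nu>2 \<partial>\<nu>1) = ennreal (1 / u\<^sup>2) * indicator {0<..D} u * pairing u \<nu>1 \<nu>2"
      unfolding eq by (simp add: nn_integral_cmult pairing_eq[OF 1 2, symmetric])
  qed
  finally show ?thesis .
qed

lemma pairing_measurable:
  assumes 1: "prob_space \<nu>1" "sets \<nu>1 = sets borel" and 2: "prob_space \<nu>2" "sets \<nu>2 = sets borel"
  shows "(\<lambda>u. pairing u \<nu>1 \<nu>2) \<in> borel_measurable borel"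
proof -
  interpret p1: prob_space \<nu>1 by fact
  interpret p2: prob_space \<nu>2 by fact
  note [measurable_cong] = 1(2) 2(2)
  have "(\<lambda>u. \<integral>\<^sup>+x. \<integral>\<^sup>+y. ennreal (u - \<bar>x - y\<bar>) \<partial>\<nu>2 \<partial>\<nu>1) \<in> borel_measurable borel" by measurable
  then show ?thesis by (simp only: pairing_eq[OF 1 2])
qed

text \<open>\<open>pairing_le\<close> holds at every length u, so the reverse inequality for the
  energies forces it for each summand of the decomposition. The separate boundary term gives it at u
  = D itself rather than for almost every u, and windows longer than the support determine the
  distribution function.\<close>

lemma energy_le_imp_eq:
  fixes m M :: real
  assumes 1: "prob_space \<nu>1" "sets \<nu>1 = sets borel" and 2: "prob_space \<nu>2" "sets \<nu>2 = sets borel"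
    and F: "AE x in \<nu>1. x \<in> {m..M}" "AE x in \<nu>2. x \<in> {m..M}" and D: "D > 0" "M - m < D"
    and le: "energy D \<nu>1 \<nu>1 + energy D \<nu>2 \<nu>2 \<le> 2 * energy D \<nu>1 \<nu>2" and fin: "energy D \<nu>1 \<nu>2 < \<infinity>"
  shows "\<nu>1 = \<nu>2"
proof -
  interpret p1: real_distribution \<nu>1
    using 1 by (simp add: real_distribution_def real_distribution_axioms_def)
  interpret p2: real_distribution \<nu>2
    using 2 by (simp add: real_distribution_def real_distribution_axioms_def)
  have [measurable]: "(\<lambda>u. pairing u \<nu>1 \<nu>1) \<in> borel_measurable borel" "(\<lambda>u. pairing u \<nu>2 \<nu>2) \<in> borel_measurable borel" "(\<lambda>u. pairing u \<nu>1 \<nu>2) \<in> borel_measurable borel"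
    by (intro pairing_measurable 1 2)+
  have D': "\<bar>x - y\<bar> \<le> D" if "x \<in> {m..M}" "y \<in> {m..M}" for x y using that D by auto
  let ?w = "\<lambda>u. ennreal (1 / u\<^sup>2) * indicator {0<..D} u"
  note dec = energy_decomposition[where F = "{m..M}", OF _ _ _ _ _ _ D(1)]
  have e11: "energy D \<nu>1 \<nu>1 = (\<integral>\<^sup>+u. ?w u * pairing u \<nu>1 \<nu>1 \<partial>lborel) + ennreal (1 / D) * pairing D \<nu>1 \<nu>1"
    by (rule dec[OF 1 1 F(1) F(1)]) (rule D')
  have e22: "energy D \<nu>2 \<nu>2 = (\<integral>\<^sup>+u. ?w u * pairing u \<nu>2 \<nu>2 \<partial>lborel) + ennreal (1 / D) * pairing D \<nu>2 \<nu>2"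
    by (rule dec[OF 2 2 F(2) F(2)]) (rule D')
  have e12: "energy D \<nu>1 \<nu>2 = (\<integral>\<^sup>+u. ?w u * pairing u \<nu>1 \<nu>2 \<partial>lborel) + ennreal (1 / D) * pairing D \<nu>1 \<nu>2"
    by (rule dec[OF 1 2 F(1) F(2)]) (rule D')
  define X where "X = (\<integral>\<^sup>+u. ?w u * pairing u \<nu>1 \<nu>1 \<partial>lborel) + (\<integral>\<^sup>+u. ?w u * pairing u \<nu>2 \<nu>2 \<partial>lborel)"
  define X' where "X' = 2 * (\<integral>\<^sup>+u. ?w u * pairing u \<nu>1 \<nu>2 \<partial>lborel)"
  define Y where "Y = ennreal (1 / D) * (pairing D \<nu>1 \<nu>1 + pairing D \<nu>2 \<nu>2)"
  define Y' where "Y' = ennreal (1 / D) * (2 * pairing D \<nu>1 \<nu>2)"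
  have XY: "energy D \<nu>1 \<nu>1 + energy D \<nu>2 \<nu>2 = X + Y"
    unfolding e11 e22 X_def Y_def
    by (simp add: distrib_left add_ac)
  have XY': "2 * energy D \<nu>1 \<nu>2 = X' + Y'"
    unfolding e12 X'_def Y'_def
    by (simp add: distrib_left mult_ac)
  have "X' = (\<integral>\<^sup>+u. ?w u * (2 * pairing u \<nu>1 \<nu>2) \<partial>lborel)"
    unfolding X'_def by (subst nn_integral_cmult[symmetric]) (auto simp: mult_ac)
  also have "\<dots> \<le> (\<integral>\<^sup>+u. ?w u * (pairing u \<nu>1 \<nu>1 + pairing u \<nu>2 \<nu>2) \<partial>lborel)"
    by (intro nn_integral_mono mult_left_mono pairing_le(1)[OF 1 2]) simp
  also have "\<dots> = X" unfolding X_def distrib_left by (rule nn_integral_add) measurable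
  finally have X: "X' \<le> X" .
  have fin': "X' + Y' < \<infinity>" using fin unfolding XY'[symmetric] by (simp add: ennreal_mult_less_top)
  then have X'_fin: "X' \<noteq> \<infinity>" "Y' \<noteq> \<infinity>" by auto
  have "X' + Y \<le> X + Y" using X by (rule add_right_mono)
  also have "\<dots> \<le> X' + Y'" using le unfolding XY XY' .
  finally have "Y \<le> Y'" using X'_fin(1) by (simp only: ennreal_add_left_cancel_le simp_thms)
  then have Y: "pairing D \<nu>1 \<nu>1 + pairing D \<nu>2 \<nu>2 \<le> 2 * pairing D \<nu>1 \<nu>2"
    unfolding Y_def Y'_def using D(1) by (subst (asm) ennreal_mult_le_mult_iff) auto
  have "pairing D \<nu>1 \<nu>2 \<noteq> \<infinity>"
  proof
    assume "pairing D \<nu>1 \<nu>2 = \<infinity>"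
    then have "Y' = \<infinity>" unfolding Y'_def using D(1) by (simp add: ennreal_mult_eq_top_iff)
    then show False using X'_fin(2) by simp
  qed
  then have "pairing D \<nu>1 \<nu>2 < \<infinity>" by (simp add: less_top)
  from pairing_le(2)[OF 1 2 Y this] have ae: "AE t in lborel. win \<nu>1 D t = win \<nu>2 D t" .
  \<comment> \<open>As D exceeds M - m, a window that ends at or before M begins to the left of m,
    so it contains all the mass up to its right end.\<close>
  have win_cdf: "win \<nu> D t = cdf \<nu> (t + D/2)"
    if \<nu>: "real_distribution \<nu>" "AE x in \<nu>. x \<in> {m..M}" and t: "t + D/2 \<le> M" for \<nu> t
  proof -
    interpret real_distribution \<nu> by fact
    have "measure \<nu> {t - D/2..t + D/2} = measure \<nu> {..t + D/2}"
    proof (rule finite_measure_eq_AE)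
      show "AE x in \<nu>. (x \<in> {t - D/2..t + D/2}) = (x \<in> {..t + D/2})"
        using \<nu>(2)
      proof eventually_elim
        case (elim x)
        have "t - D/2 \<le> x" using elim t D(2) unfolding atLeastAtMost_iff by linarith
        then show ?case by simp
      qed
    qed auto
    then show ?thesis by (simp add: win_def cdf_def)
  qed
  have r1: "real_distribution \<nu>1" and r2: "real_distribution \<nu>2" by unfold_locales
  have top: "cdf \<nu> s = 1" if \<nu>: "real_distribution \<nu>" "AE x in \<nu>. x \<in> {m..M}" and s: "s \<ge> M" for \<nu> s
  proof -
    interpret real_distribution \<nu> by fact
    have "measure \<nu> {..s} = measure \<nu> (space \<nu>)"
    proof (rule finite_measure_eq_AE)
      show "AE x in \<nu>. (x \<in> {..s}) = (x \<in> space \<nu>)"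
        using \<nu>(2) by eventually_elim (use s in auto)
    qed auto
    then show ?thesis unfolding cdf_def by (simp only: prob_space)
  qed
  have "cdf \<nu>1 s = cdf \<nu>2 s" for s
  proof (cases "s \<ge> M")
    case True then show ?thesis using top[OF r1 F(1) True] top[OF r2 F(2) True] by simp
  next
    case False
    \<comment> \<open>The windows agree only almost everywhere, so the distribution functions agree
      at points arbitrarily close to s from the right. Right continuity does the rest.\<close>
    have ex: "\<exists>s'. s < s' \<and> s' < s + e \<and> cdf \<nu>1 s' = cdf \<nu>2 s'" if e: "e > 0" "s + e \<le> M" for e
    proof (rule ccontr)
      assume neg: "\<not> (\<exists>s'. s < s' \<and> s' < s + e \<and> cdf \<nu>1 s' = cdf \<nu>2 s')"
      have "AE t in lborel. t \<notin> {s - D/2<..<s + e - D/2}"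
        using ae
      proof eventually_elim
        case (elim t)
        show ?case
        proof
          assume "t \<in> {s - D/2<..<s + e - D/2}"
          then have t: "s < t + D/2" "t + D/2 < s + e" by auto
          then have "t + D/2 \<le> M" using e by simp
          then have "cdf \<nu>1 (t + D/2) = cdf \<nu>2 (t + D/2)"
            using elim win_cdf[OF r1 F(1)] win_cdf[OF r2 F(2)] by simp
          then show False using neg t by blast
        qed
      qed
      then have "{s - D/2<..<s + e - D/2} \<in> null_sets lborel"
        by (subst AE_iff_null_sets) auto
      then have "emeasure lborel {s - D/2<..<s + e - D/2} = 0" by (rule null_setsD1)
      then show False using e by simp
    qed
    define e where "e = M - s"
    have e: "e > 0" using False by (simp add: e_def)
    have "\<exists>s'. s < s' \<and> s' < s + e / real (Suc n) \<and> cdf \<nu>1 s' = cdf \<nu>2 s'" for n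
    proof (rule ex)
      show "e / real (Suc n) > 0" using e by simp
      have "e / real (Suc n) \<le> e / 1" using e by (intro divide_left_mono) auto
      then show "s + e / real (Suc n) \<le> M" by (simp add: e_def)
    qed
    then obtain q where q: "\<And>n. s < q n" "\<And>n. q n < s + e / real (Suc n)" "\<And>n. cdf \<nu>1 (q n) = cdf \<nu>2 (q n)" by metis
    have "q \<longlonglongrightarrow> s"
    proof (rule tendsto_sandwich[of "\<lambda>_. s"])
      show "(\<lambda>n. s + e / real (Suc n)) \<longlonglongrightarrow> s" by real_asymp
    qed (use q in \<open>auto intro!: always_eventually less_imp_le\<close>)
    then have qr: "filterlim q (at_right s) sequentially"
      using q(1) by (auto simp: filterlim_at intro!: always_eventually)
    have "(\<lambda>n. cdf \<nu>1 (q n)) \<longlonglongrightarrow> cdf \<nu>1 s"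
      using p1.cdf_is_right_cont[of s] by (intro filterlim_compose[OF _ qr]) (simp add: continuous_within)
    moreover have "(\<lambda>n. cdf \<nu>2 (q n)) \<longlonglongrightarrow> cdf \<nu>2 s"
      using p2.cdf_is_right_cont[of s] by (intro filterlim_compose[OF _ qr]) (simp add: continuous_within)
    ultimately show ?thesis using q(3) LIMSEQ_unique by simp
  qed
  then show ?thesis by (intro cdf_unique r1 r2 ext)
qed

text \<open>The subtracted integral \<open>Q\<close> is at most ln D, hence finite, so the
  subtraction in \<open>ereal\<close> can be carried out even if the energy is infinite.\<close>

lemma log_energy_eq:
  assumes 1: "prob_space \<nu>" "sets \<nu> = sets borel" and F: "AE x in \<nu>. x \<in> {m..M}" and D: "D \<ge> 1" "M - m \<le> D"
  shows "log_energy \<nu> = enn2ereal (energy D \<nu> \<nu>) - ereal (ln D)"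
proof -
  interpret prob_space \<nu> by fact
  note [measurable_cong] = 1(2)
  define P where "P = (\<integral>\<^sup>+x. (\<integral>\<^sup>+y. (if x = y then \<infinity> else ennreal (- ln \<bar>x - y\<bar>)) \<partial>\<nu>) \<partial>\<nu>)"
  define Q where "Q = (\<integral>\<^sup>+x. (\<integral>\<^sup>+y. ennreal (ln \<bar>x - y\<bar>) \<partial>\<nu>) \<partial>\<nu>)"
  have lnD: "ln D \<ge> 0" using D by simp
  have pt: "(if x = y then \<infinity> else ennreal (- ln \<bar>x - y\<bar>)) + ennreal (ln D) = kern D x y + ennreal (ln \<bar>x - y\<bar>)"
    and pl: "ennreal (ln \<bar>x - y\<bar>) \<le> ennreal (ln D)"
    if xy: "x \<in> {m..M}" "y \<in> {m..M}" for x y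
  proof -
    have le: "ln \<bar>x - y\<bar> \<le> ln D"
    proof (cases "x = y")
      case False
      then show ?thesis using xy D by auto
    qed (use lnD in simp)
    then show "ennreal (ln \<bar>x - y\<bar>) \<le> ennreal (ln D)" by (rule ennreal_leI)
    show "(if x = y then \<infinity> else ennreal (- ln \<bar>x - y\<bar>)) + ennreal (ln D) = kern D x y + ennreal (ln \<bar>x - y\<bar>)"
    proof (cases "x = y")
      case True then show ?thesis by (simp add: kern_def)
    next
      case False
      show ?thesis
      proof (cases "ln \<bar>x - y\<bar> \<ge> 0")
        case True
        then have "ennreal (ln D) = ennreal (ln D - ln \<bar>x - y\<bar>) + ennreal (ln \<bar>x - y\<bar>)"
          using le by (simp add: ennreal_plus[symmetric] del: ennreal_plus)
        then show ?thesis using False True by (simp add: kern_def ennreal_neg)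
      next
        case neg: False
        then have "ennreal (- ln \<bar>x - y\<bar>) + ennreal (ln D) = ennreal (ln D - ln \<bar>x - y\<bar>)"
          using lnD by (simp add: ennreal_plus[symmetric] del: ennreal_plus)
        then show ?thesis using False neg by (simp add: kern_def ennreal_neg)
      qed
    qed
  qed
  have const: "(\<integral>\<^sup>+x. (\<integral>\<^sup>+y. c \<partial>\<nu>) \<partial>\<nu>) = c" for c :: ennreal by (simp add: emeasure_space_1)
  have "P + ennreal (ln D) = (\<integral>\<^sup>+x. (\<integral>\<^sup>+y. (if x = y then \<infinity> else ennreal (- ln \<bar>x - y\<bar>)) + ennreal (ln D) \<partial>\<nu>) \<partial>\<nu>)"
    unfolding P_def by (simp add: nn_integral_add emeasure_space_1)
  also have "\<dots> = (\<integral>\<^sup>+x. (\<integral>\<^sup>+y. kern D x y + ennreal (ln \<bar>x - y\<bar>) \<partial>\<nu>) \<partial>\<nu>)"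
  proof (rule nn_integral_cong_AE)
    show "AE x in \<nu>. (\<integral>\<^sup>+y. (if x = y then \<infinity> else ennreal (- ln \<bar>x - y\<bar>)) + ennreal (ln D) \<partial>\<nu>) = (\<integral>\<^sup>+y. kern D x y + ennreal (ln \<bar>x - y\<bar>) \<partial>\<nu>)"
      using F
    proof eventually_elim
      case (elim x)
      show ?case
        by (rule nn_integral_cong_AE) (use F in eventually_elim, rule pt[OF elim])
    qed
  qed
  also have "\<dots> = energy D \<nu> \<nu> + Q"
    unfolding energy_def Q_def by (simp add: nn_integral_add)
  finally have PQ: "P + ennreal (ln D) = energy D \<nu> \<nu> + Q" .
  have "Q \<le> (\<integral>\<^sup>+x. (\<integral>\<^sup>+y. ennreal (ln D) \<partial>\<nu>) \<partial>\<nu>)"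
    unfolding Q_def
  proof (rule nn_integral_mono_AE)
    show "AE x in \<nu>. (\<integral>\<^sup>+y. ennreal (ln \<bar>x - y\<bar>) \<partial>\<nu>) \<le> (\<integral>\<^sup>+y. ennreal (ln D) \<partial>\<nu>)"
      using F
    proof eventually_elim
      case (elim x)
      show ?case by (rule nn_integral_mono_AE) (use F in eventually_elim, rule pl[OF elim])
    qed
  qed
  then have "Q \<le> ennreal (ln D)" unfolding const .
  then obtain q where q: "Q = ennreal q" "q \<ge> 0" by (cases Q) (auto simp: top_unique)
  have "log_energy \<nu> = enn2ereal P - enn2ereal Q" by (simp add: log_energy_def P_def Q_def)
  also have "\<dots> = enn2ereal (energy D \<nu> \<nu>) - ereal (ln D)"
  proof (cases "energy D \<nu> \<nu>")
    case (real e)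
    have "P \<noteq> \<infinity>"
    proof
      assume "P = \<infinity>"
      then show False using PQ real q by (simp add: ennreal_plus[symmetric] del: ennreal_plus)
    qed
    then obtain p where p: "P = ennreal p" "p \<ge> 0" by (cases P) auto
    have "ennreal (p + ln D) = ennreal (e + q)" using PQ p real q lnD by (simp add: ennreal_plus)
    then have "p + ln D = e + q" using p real q lnD by (subst (asm) ennreal_inj) auto
    then show ?thesis using p real q by (simp add: enn2ereal_ennreal)
  next
    case top
    then have "P + ennreal (ln D) = \<infinity>" using PQ by simp
    then have "P = \<infinity>" by (simp add: add_top)
    then show ?thesis using top q by (simp add: enn2ereal_ennreal)
  qed
  finally show ?thesis .
qed

text \<open>A constant potential c of \<nu> makes its mutual energy with every probability measure
  on F equal to c, in particular its own energy. Minimality bounds the energy of \<omega> by c, so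
  the two self-energies together are at most twice the mutual one.\<close>

theorem energy_minimizer_unique:
  assumes F: "F \<subseteq> {m..M}" "F \<in> sets borel" and D: "D \<ge> 1" "M - m < D"
    and \<omega>: "prob_measure_on F \<omega>" and \<nu>: "prob_measure_on F \<nu>" and min: "log_energy \<omega> \<le> log_energy \<nu>"
    and pot: "\<And>x. x \<in> F \<Longrightarrow> (\<integral>\<^sup>+y. kern D x y \<partial>\<nu>) = c" and c: "c < \<infinity>"
  shows "\<omega> = \<nu>"
proof -
  have AE: "AE x in \<nu>. x \<in> F" if "prob_measure_on F \<nu>" for \<nu>
  proof (rule AE_I[where N = "- F"])
    show "emeasure \<nu> (- F) = 0" "- F \<in> sets \<nu>" using that F by (auto simp: prob_measure_on_def real_prob_measure_def)
  qed auto
  have p: "prob_space \<nu>" "sets \<nu> = sets borel" if "prob_measure_on F \<nu>" for \<nu>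
    using that by (auto simp: prob_measure_on_def real_prob_measure_def)
  have AE': "AE x in \<nu>. x \<in> {m..M}" if "prob_measure_on F \<nu>" for \<nu>
    using AE[OF that] by eventually_elim (use F in auto)
  have pot': "energy D \<nu>' \<nu> = c" if \<nu>': "prob_measure_on F \<nu>'" for \<nu>'
  proof -
    have "energy D \<nu>' \<nu> = (\<integral>\<^sup>+x. c \<partial>\<nu>')" unfolding energy_def
      by (rule nn_integral_cong_AE) (use AE[OF \<nu>'] in eventually_elim, rule pot)
    then show ?thesis using p(1)[OF \<nu>'] by (simp add: prob_space.emeasure_space_1)
  qed
  have le: "energy D \<omega> \<omega> \<le> c"
  proof -
    have M: "M - m \<le> D" using D by simp
    have "enn2ereal (energy D \<omega> \<omega>) - ereal (ln D) \<le> enn2ereal (energy D \<nu> \<nu>) - ereal (ln D)"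
      using min unfolding log_energy_eq[OF p[OF \<omega>] AE'[OF \<omega>] D(1) M] log_energy_eq[OF p[OF \<nu>] AE'[OF \<nu>] D(1) M] .
    then have "enn2ereal (energy D \<omega> \<omega>) - ereal (ln D) + ereal (ln D) \<le> enn2ereal (energy D \<nu> \<nu>) - ereal (ln D) + ereal (ln D)"
      by (rule add_right_mono)
    then have "enn2ereal (energy D \<omega> \<omega>) \<le> enn2ereal (energy D \<nu> \<nu>)"
      by (cases "enn2ereal (energy D \<omega> \<omega>)"; cases "enn2ereal (energy D \<nu> \<nu>)") simp_all
    then show ?thesis using pot'[OF \<nu>] by (simp add: less_eq_ennreal.rep_eq)
  qed
  show ?thesis
  proof (rule energy_le_imp_eq[OF p[OF \<omega>] p[OF \<nu>] AE'[OF \<omega>] AE'[OF \<nu>] _ D(2)])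
    show "energy D \<omega> \<omega> + energy D \<nu> \<nu> \<le> 2 * energy D \<omega> \<nu>"
      unfolding pot'[OF \<omega>] pot'[OF \<nu>] mult_2 by (rule add_right_mono[OF le])
    show "energy D \<omega> \<nu> < \<infinity>" using pot'[OF \<omega>] c by simp
  qed (use D in simp)
qed

section \<open>Spectral bands and their equilibrium measure\<close>

lemma poly_eq_prod_roots:
  fixes p :: "real poly" and y :: "'i \<Rightarrow> real"
  assumes Z: "finite Z" "inj_on y Z" "\<And>i. i \<in> Z \<Longrightarrow> poly p (y i) = 0" and p: "degree p = card Z"
  shows "poly p x = lead_coeff p * (\<Prod>i\<in>Z. x - y i)"
proof -
  define q where "q = smult (lead_coeff p) (\<Prod>i\<in>Z. [:- y i, 1:])"
  have dq: "degree (\<Prod>i\<in>Z. [:- y i, 1:]) = card Z" by (subst degree_prod_eq_sum_degree) auto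
  have lq: "lead_coeff (\<Prod>i\<in>Z. [:- y i, 1:]) = 1" by (simp add: lead_coeff_prod)
  have "p = q"
  proof (rule poly_eqI_degree_lead_coeff[where n = "card Z" and A = "y ` Z"])
    show "degree p \<le> card Z" using p by simp
    show "degree q \<le> card Z" unfolding q_def using degree_smult_le[of "lead_coeff p" "\<Prod>i\<in>Z. [:- y i, 1:]"] dq by simp
    show "coeff p (card Z) = coeff q (card Z)" using lq dq p by (simp add: q_def)
    show "card Z \<le> card (y ` Z)" using Z by (simp add: card_image)
    show "poly p z = poly q z" if "z \<in> y ` Z" for z
      using that Z by (auto simp: q_def poly_prod)
  qed
  then have "poly p x = poly q x" by simp
  also have "\<dots> = lead_coeff p * (\<Prod>i\<in>Z. x - y i)" by (simp add: q_def poly_prod)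
  finally show ?thesis .
qed

text \<open>The image of |w| dx under \<theta> is Lebesgue measure on (0, b). On Borel sets this is
  the change of variables for the constant 1; the function h may then be any nonnegative one, such
  as the potential kernel with its infinite values.\<close>

lemma nn_integral_change_of_variables_interval:
  fixes \<theta> w :: "real \<Rightarrow> real" and Y :: "real \<Rightarrow> real" and h :: "real \<Rightarrow> ennreal"
  assumes der: "\<And>x. x \<in> {l<..<r} \<Longrightarrow> (\<theta> has_real_derivative w x) (at x)"
    and inj: "inj_on \<theta> {l<..<r}" and img: "\<theta> ` {l<..<r} = {0<..<b}"
    and Y: "\<And>x. x \<in> {l<..<r} \<Longrightarrow> Y (\<theta> x) = x" "continuous_on {0<..<b} Y"
    and w: "continuous_on {l<..<r} w" and b: "b > 0" and h: "h \<in> borel_measurable borel"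
  shows "(\<integral>\<^sup>+x. h x * (ennreal \<bar>w x\<bar> * indicator {l<..<r} x) \<partial>lborel) = (\<integral>\<^sup>+p. h (Y p) * indicator {0<..<b} p \<partial>lborel)"
proof -
  let ?I = "{l<..<r}"
  \<comment> \<open>Extended by 0 outside the intervals, so that these are Borel functions on the
    whole line.\<close>
  define T where "T x = (if x \<in> ?I then \<theta> x else 0)" for x
  define V where "V p = (if p \<in> {0<..<b} then Y p else 0)" for p
  define W where "W x = (if x \<in> ?I then \<bar>w x\<bar> else 0)" for x
  have c\<theta>: "continuous_on ?I \<theta>"
    using der DERIV_isCont by (intro continuous_at_imp_continuous_on) blast
  have [measurable]: "T \<in> borel_measurable borel"
    unfolding T_def[abs_def] by (rule borel_measurable_continuous_on_if) (use c\<theta> in auto)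
  have [measurable]: "V \<in> borel_measurable borel"
    unfolding V_def[abs_def] by (rule borel_measurable_continuous_on_if) (use Y in auto)
  have [measurable]: "W \<in> borel_measurable borel"
    unfolding W_def[abs_def] by (rule borel_measurable_continuous_on_if) (use w in \<open>auto intro: continuous_on_rabs\<close>)
  have [measurable]: "h \<in> borel_measurable borel" by fact
  define M where "M = density lborel (\<lambda>x. ennreal (W x))"
  have Wind: "ennreal \<bar>w x\<bar> * indicator ?I x = ennreal (W x)" for x by (auto simp: W_def)
  have distr: "distr M borel T = density lborel (indicator {0<..<b})"
  proof (rule measure_eqI)
    fix B assume "B \<in> sets (distr M borel T)"
    then have B[measurable]: "B \<in> sets borel" by simp
    define S where "S = {x \<in> ?I. T x \<in> B}"
    have S: "S \<in> sets borel" unfolding S_def by measurable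
    have TS: "\<theta> ` S = B \<inter> {0<..<b}"
    proof (intro equalityI subsetI)
      fix p assume "p \<in> \<theta> ` S"
      then show "p \<in> B \<inter> {0<..<b}" using img by (auto simp: S_def T_def)
    next
      fix p assume p: "p \<in> B \<inter> {0<..<b}"
      then obtain x where "x \<in> ?I" "p = \<theta> x" using img by blast
      then show "p \<in> \<theta> ` S" using p by (auto simp: S_def T_def)
    qed
    have SI: "S \<subseteq> ?I" by (auto simp: S_def)
    have fin: "emeasure lborel (B \<inter> {0<..<b}) < \<infinity>"
    proof -
      have "emeasure lborel (B \<inter> {0<..<b}) \<le> emeasure lborel {0<..<b}" by (rule emeasure_mono) auto
      also have "\<dots> < \<infinity>" using b by simp
      finally show ?thesis .
    qed
    have "((\<lambda>x. 1::real) has_integral measure lborel (B \<inter> {0<..<b})) (\<theta> ` S)"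
      unfolding TS by (rule has_integral_measure_lborel) (use fin in auto)
    then have "(\<lambda>x. 1::real) absolutely_integrable_on \<theta> ` S \<and> integral (\<theta> ` S) (\<lambda>x. 1::real) = measure lborel (B \<inter> {0<..<b})"
      by (auto intro!: nonnegative_absolutely_integrable_1 simp: has_integral_integrable_integral)
    then have "(\<lambda>x. \<bar>w x\<bar> * 1) absolutely_integrable_on S \<and> integral S (\<lambda>x. \<bar>w x\<bar> * 1) = measure lborel (B \<inter> {0<..<b})"
    proof (subst has_absolute_integral_change_of_variables_1'[where g = \<theta>])
      show "S \<in> sets lebesgue" using S by simp
      show "(\<theta> has_field_derivative w x) (at x within S)" if "x \<in> S" for x
        by (rule has_field_derivative_at_within[OF der]) (use that SI in blast)
      show "inj_on \<theta> S" using inj SI by (rule inj_on_subset)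
    qed
    then have "((\<lambda>x. \<bar>w x\<bar>) has_integral measure lborel (B \<inter> {0<..<b})) S"
      by (auto simp: has_integral_integrable_integral absolutely_integrable_on_def)
    then have 1: "(\<integral>\<^sup>+x. ennreal \<bar>w x\<bar> * indicator S x \<partial>lborel) = ennreal (measure lborel (B \<inter> {0<..<b}))"
      by (intro nn_integral_has_integral_lebesgue') auto
    have "emeasure (distr M borel T) B = emeasure M (T -` B)"
      by (subst emeasure_distr) (auto simp: M_def)
    also have "\<dots> = (\<integral>\<^sup>+x. ennreal (W x) * indicator (T -` B) x \<partial>lborel)"
      unfolding M_def using measurable_sets_borel[OF \<open>T \<in> borel_measurable borel\<close> B] by (subst emeasure_density) auto
    also have "\<dots> = (\<integral>\<^sup>+x. ennreal \<bar>w x\<bar> * indicator S x \<partial>lborel)"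
      by (intro nn_integral_cong) (auto simp: indicator_def S_def W_def)
    also have "\<dots> = emeasure lborel (B \<inter> {0<..<b})"
      unfolding 1 using fin by (simp add: measure_def)
    also have "\<dots> = emeasure (density lborel (indicator {0<..<b})) B"
      by (subst emeasure_density) (auto simp: nn_integral_indicator[symmetric] indicator_inter_arith mult.commute simp del: nn_integral_indicator)
    finally show "emeasure (distr M borel T) B = emeasure (density lborel (indicator {0<..<b})) B" .
  qed simp
  have "(\<integral>\<^sup>+x. h x * (ennreal \<bar>w x\<bar> * indicator ?I x) \<partial>lborel) = (\<integral>\<^sup>+x. ennreal (W x) * h (V (T x)) \<partial>lborel)"
  proof (rule nn_integral_cong)
    fix x
    show "h x * (ennreal \<bar>w x\<bar> * indicator ?I x) = ennreal (W x) * h (V (T x))"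
    proof (cases "x \<in> ?I")
      case True
      then have "\<theta> x \<in> {0<..<b}" using img by blast
      then have "V (T x) = x" using True Y(1) by (simp add: V_def T_def)
      then show ?thesis unfolding Wind by (simp add: mult.commute)
    next
      case False
      then have "W x = 0" "indicator ?I x = (0::ennreal)" by (auto simp: W_def)
      then show ?thesis by simp
    qed
  qed
  also have "\<dots> = (\<integral>\<^sup>+x. h (V (T x)) \<partial>M)" unfolding M_def by (rule nn_integral_density[symmetric]) measurable
  also have "\<dots> = (\<integral>\<^sup>+p. h (V p) \<partial>distr M borel T)" by (rule nn_integral_distr[symmetric]) (auto simp: M_def)
  also have "\<dots> = (\<integral>\<^sup>+p. indicator {0<..<b} p * h (V p) \<partial>lborel)" unfolding distr by (rule nn_integral_density) measurable
  also have "\<dots> = (\<integral>\<^sup>+p. h (Y p) * indicator {0<..<b} p \<partial>lborel)"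
    by (intro nn_integral_cong) (auto simp: indicator_def V_def)
  finally show ?thesis .
qed

section \<open>The bands and the coordinate p with discr = 2 cos p\<close>

context periodic_jacobi
begin

definition ddiscr :: "real \<Rightarrow> real" where "ddiscr x = poly (pderiv discr_poly) x"

lemma discr_DERIV: "(discr has_real_derivative ddiscr x) (at x)"
  using poly_DERIV[of "discr_poly :: real poly" x] by (simp add: ddiscr_def poly_discr_poly)

lemma ddiscr_eq:
  "ddiscr x = (\<Sum>i<N. \<psi> x N * (\<phi> x (Suc i))\<^sup>2 + (\<psi> x (Suc N) - \<phi> x N) * \<phi> x (Suc i) * \<psi> x (Suc i) - \<phi> x (Suc N) * (\<psi> x (Suc i))\<^sup>2) / \<alpha> (-1)"
  using DERIV_unique[OF discr_DERIV discr_has_derivative[of x]] by simp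

lemma ddiscr_nonzero: "\<bar>discr x\<bar> < 2 \<Longrightarrow> ddiscr x \<noteq> 0"
  unfolding ddiscr_eq using discr_deriv_nonzero[of x] \<alpha>_pos[of "-1"] by simp

lemma discr_continuous: "continuous_on S (discr :: real \<Rightarrow> real)"
  using discr_DERIV DERIV_isCont by (intro continuous_at_imp_continuous_on) blast

lemma ddiscr_continuous: "continuous_on S ddiscr"
  unfolding ddiscr_def[abs_def] by (intro continuous_intros)

lemma discr_large:
  obtains R where "R > 0" "\<And>x::real. \<bar>x\<bar> \<ge> R \<Longrightarrow> \<bar>discr x\<bar> > 2"
proof -
  obtain c q where cq: "(discr_poly :: real poly) = pCons c q" by (rule pCons_cases)
  have "q \<noteq> 0"
  proof
    assume "q = 0"
    then have "degree (discr_poly :: real poly) = 0" using cq by simp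
    then show False using degree_discr_poly[where 'a=real] N by simp
  qed
  from poly_infinity[OF this, of 3 c] obtain R where R: "\<And>x. R \<le> norm x \<Longrightarrow> 3 \<le> norm (poly (pCons c q) x)" by blast
  have "\<bar>discr x\<bar> > 2" if "\<bar>x\<bar> \<ge> max R 1" for x :: real
    using R[of x] that unfolding cq[symmetric] poly_discr_poly by simp
  then show ?thesis by (intro that[of "max R 1"]) auto
qed

text \<open>The ends are the nearest points on either side of \<xi> where |discr| is at least 2.
  They exist because a nonconstant polynomial is large at infinity, and by continuity the value
  there is exactly 2.\<close>

lemma band_exists:
  fixes \<xi> :: real
  assumes "\<bar>discr \<xi>\<bar> < 2"
  obtains l r where "l < \<xi>" "\<xi> < r" "\<bar>discr l\<bar> = 2" "\<bar>discr r\<bar> = 2" "\<And>x. x \<in> {l<..<r} \<Longrightarrow> \<bar>discr x\<bar> < 2"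
proof -
  obtain R where R: "R > 0" "\<And>x::real. \<bar>x\<bar> \<ge> R \<Longrightarrow> \<bar>discr x\<bar> > 2" using discr_large by blast
  have cl: "closed {x::real. 2 \<le> \<bar>discr x\<bar>}"
    by (intro closed_Collect_le continuous_intros discr_continuous)
  have open': "open {x::real. 2 < \<bar>discr x\<bar>}"
    by (intro open_Collect_less continuous_intros discr_continuous)
  define SL where "SL = {x. 2 \<le> \<bar>discr x\<bar>} \<inter> {..\<xi>}"
  define SR where "SR = {x. 2 \<le> \<bar>discr x\<bar>} \<inter> {\<xi>..}"
  have \<xi>R: "\<bar>\<xi>\<bar> < R" using R(2)[of \<xi>] assms by linarith
  have SL: "SL \<noteq> {}" "bdd_above SL" "closed SL"
  proof -
    have "-R \<in> SL" using R(2)[of "-R"] R(1) \<xi>R by (auto simp: SL_def)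
    then show "SL \<noteq> {}" by blast
    show "bdd_above SL" by (auto simp: SL_def intro!: bdd_aboveI[of _ \<xi>])
    show "closed SL" unfolding SL_def by (intro closed_Int cl) auto
  qed
  have SR: "SR \<noteq> {}" "bdd_below SR" "closed SR"
  proof -
    have "R \<in> SR" using R(2)[of "R"] R(1) \<xi>R by (auto simp: SR_def)
    then show "SR \<noteq> {}" by blast
    show "bdd_below SR" by (auto simp: SR_def intro!: bdd_belowI[of _ \<xi>])
    show "closed SR" unfolding SR_def by (intro closed_Int cl) auto
  qed
  define l where "l = Sup SL"
  define r where "r = Inf SR"
  have l: "l \<in> SL" unfolding l_def using SL by (intro closed_contains_Sup)
  have r: "r \<in> SR" unfolding r_def using SR by (intro closed_contains_Inf)
  have l\<xi>: "l < \<xi>" using l assms by (cases "l = \<xi>") (auto simp: SL_def)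
  have r\<xi>: "\<xi> < r" using r assms by (cases "r = \<xi>") (auto simp: SR_def)
  have inside: "\<bar>discr x\<bar> < 2" if x: "x \<in> {l<..<r}" for x
  proof (rule ccontr)
    assume "\<not> \<bar>discr x\<bar> < 2"
    then have "x \<in> SL \<or> x \<in> SR" by (auto simp: SL_def SR_def)
    then show False
    proof
      assume "x \<in> SL"
      then have "x \<le> l" unfolding l_def using SL by (intro cSup_upper)
      then show False using x by simp
    next
      assume "x \<in> SR"
      then have "r \<le> x" unfolding r_def using SR by (intro cInf_lower)
      then show False using x by simp
    qed
  qed
  have edge: "\<bar>discr y\<bar> \<le> 2" if y: "y \<in> closure {l<..<r}" for y
  proof -
    have "{l<..<r} \<subseteq> {x. \<bar>discr x\<bar> \<le> 2}" using inside by (auto simp: less_imp_le)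
    moreover have "closed {x::real. \<bar>discr x\<bar> \<le> 2}" by (intro closed_Collect_le continuous_intros discr_continuous)
    ultimately have "closure {l<..<r} \<subseteq> {x. \<bar>discr x\<bar> \<le> 2}" by (rule closure_minimal)
    then show ?thesis using y by blast
  qed
  have clos: "closure {l<..<r} = {l..r}" using l\<xi> r\<xi> by (intro closure_greaterThanLessThan) simp
  have "\<bar>discr l\<bar> = 2" using edge[of l] l l\<xi> r\<xi> unfolding clos by (auto simp: SL_def)
  moreover have "\<bar>discr r\<bar> = 2" using edge[of r] r l\<xi> r\<xi> unfolding clos by (auto simp: SR_def)
  ultimately show ?thesis using that l\<xi> r\<xi> inside by blast
qed

text \<open>By Rolle, a repeated value would give a zero of \<open>ddiscr\<close> in the open
  band.\<close>

lemma discr_band_inj: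
  fixes l r :: real
  assumes "\<And>x. x \<in> {l<..<r} \<Longrightarrow> \<bar>discr x\<bar> < 2" shows "inj_on discr {l..r}"
proof -
  have *: "discr x \<noteq> discr y" if xy: "x \<in> {l..r}" "y \<in> {l..r}" "x < y" for x y
  proof
    assume eq: "discr x = discr y"
    have "\<exists>z. x < z \<and> z < y \<and> (\<lambda>v. ddiscr z * v) = (\<lambda>v. 0)"
      by (rule Rolle_deriv[OF xy(3) eq discr_continuous]) (use discr_DERIV in \<open>auto simp: has_field_derivative_def\<close>)
    then obtain z where z: "x < z" "z < y" "(\<lambda>v. ddiscr z * v) = (\<lambda>v. 0)" by blast
    have "ddiscr z = 0" using fun_cong[OF z(3), of 1] by simp
    moreover have "z \<in> {l<..<r}" using z xy by auto
    ultimately show False using ddiscr_nonzero assms by blast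
  qed
  show ?thesis
  proof (rule inj_onI, rule ccontr)
    fix x y assume "x \<in> {l..r}" "y \<in> {l..r}" "discr x = discr y" "x \<noteq> y"
    then show False using *[of x y] *[of y x] by (cases "x < y") auto
  qed
qed

text \<open>The substitution p = arccos (discr x / 2), whose derivative has modulus |ddiscr x| /
  sqrt (4 - discr^2). It maps the open band onto (0, pi), because an injective discr takes the
  values 2 and -2 at the two ends; Y is the inverse map.\<close>

lemma band_integral:
  assumes lr: "l < r" "\<bar>discr l\<bar> = 2" "\<bar>discr r\<bar> = 2" "\<And>x. x \<in> {l<..<r} \<Longrightarrow> \<bar>discr x\<bar> < 2"
  obtains Y where "\<And>p. p \<in> {0<..<pi} \<Longrightarrow> Y p \<in> {l<..<r} \<and> discr (Y p) = 2 * cos p"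
    "continuous_on {0<..<pi} Y"
    "\<And>h. h \<in> borel_measurable borel \<Longrightarrow>
      (\<integral>\<^sup>+x. h x * (ennreal (\<bar>ddiscr x\<bar> / sqrt (4 - (discr x)\<^sup>2)) * indicator {l<..<r} x) \<partial>lborel) = (\<integral>\<^sup>+p. h (Y p) * indicator {0<..<pi} p \<partial>lborel)"
proof -
  have le2: "\<bar>discr x\<bar> \<le> 2" if "x \<in> {l..r}" for x
    using that lr(2,3) lr(4)[of x] by (cases "x = l \<or> x = r") auto
  have inj: "inj_on discr {l..r}" by (rule discr_band_inj[OF lr(4)])
  define \<theta> where "\<theta> x = arccos (discr x / 2)" for x
  have \<theta>c: "continuous_on {l..r} \<theta>"
    unfolding \<theta>_def[abs_def]
  proof (intro continuous_intros discr_continuous ballI)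
    fix x assume "x \<in> {l..r}"
    then show "- 1 \<le> discr x / 2 \<and> discr x / 2 \<le> 1" using le2[of x] by linarith
  qed simp
  have cos\<theta>: "discr x = 2 * cos (\<theta> x)" if "x \<in> {l..r}" for x
    using le2[OF that] by (simp add: \<theta>_def cos_arccos_abs)
  have \<theta>inj: "inj_on \<theta> {l..r}"
    using cos\<theta> inj unfolding inj_on_def by metis
  define Y where "Y = inv_into {l..r} \<theta>"
  have Y\<theta>: "Y (\<theta> x) = x" if "x \<in> {l..r}" for x unfolding Y_def by (rule inv_into_f_f[OF \<theta>inj that])
  have ends: "{discr l, discr r} = {-2, 2}"
  proof -
    have "discr l \<noteq> discr r" using inj lr(1) unfolding inj_on_def by (metis atLeastAtMost_iff less_irrefl less_imp_le order_refl)
    then show ?thesis using lr(2,3) by (auto simp: abs_if split: if_splits)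
  qed
  have surj: "\<exists>x. x \<in> {l<..<r} \<and> discr x = v" if v: "\<bar>v\<bar> < 2" for v
  proof -
    have "discr l \<le> v \<and> v \<le> discr r \<or> discr r \<le> v \<and> v \<le> discr l"
      using ends v by (auto simp: doubleton_eq_iff abs_less_iff)
    then obtain x where x: "l \<le> x" "x \<le> r" "discr x = v"
      using IVT'[of discr l v r] IVT2'[of discr r v l] lr(1) discr_continuous by (metis less_imp_le)
    have "x \<noteq> l" "x \<noteq> r" using x lr v by auto
    then have "x \<in> {l<..<r}" using x by simp
    then show ?thesis using x(3) by blast
  qed
  have \<theta>in: "\<theta> x \<in> {0<..<pi}" if "x \<in> {l<..<r}" for x
    using arccos_lt_bounded[of "discr x / 2"] lr(4)[OF that] by (simp add: \<theta>_def abs_less_iff)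
  have pre: "\<exists>x\<in>{l<..<r}. \<theta> x = p" if p: "p \<in> {0<..<pi}" for p
  proof -
    have "\<bar>2 * cos p\<bar> < 2" using cos_monotone_0_pi[of 0 p] cos_monotone_0_pi[of p pi] p by (simp add: abs_less_iff)
    from surj[OF this] obtain x where x: "x \<in> {l<..<r}" "discr x = 2 * cos p" by blast
    then have "\<theta> x = p" using p by (simp add: \<theta>_def arccos_cos)
    then show ?thesis using x by blast
  qed
  have img: "\<theta> ` {l<..<r} = {0<..<pi}"
    using \<theta>in pre by (auto simp: image_iff) metis+
  have Yp: "Y p \<in> {l<..<r} \<and> discr (Y p) = 2 * cos p" if p: "p \<in> {0<..<pi}" for p
  proof -
    obtain x where x: "x \<in> {l<..<r}" "\<theta> x = p" using pre[OF p] by blast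
    then have "x \<in> {l..r}" by simp
    then have "Y p = x" "discr x = 2 * cos p" using Y\<theta> cos\<theta> x by auto
    then show ?thesis using x by simp
  qed
  have "continuous_on (\<theta> ` {l..r}) Y"
    by (rule continuous_on_inv[OF \<theta>c]) (use Y\<theta> in auto)
  then have Yc: "continuous_on {0<..<pi} Y"
    by (rule continuous_on_subset) (use img in \<open>auto simp: image_iff\<close>, metis greaterThanLessThan_iff image_iff less_imp_le atLeastAtMost_iff)
  show ?thesis
  proof (rule that[OF Yp Yc])
    fix h :: "real \<Rightarrow> ennreal" assume h: "h \<in> borel_measurable borel"
    define w where "w x = inverse (- sqrt (1 - (discr x / 2)\<^sup>2)) * (ddiscr x / 2)" for x
    have sq: "1 - (discr x / 2)\<^sup>2 > 0" if "x \<in> {l<..<r}" for x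
    proof -
      have "(discr x / 2)\<^sup>2 < 1" using lr(4)[OF that] by (simp add: abs_square_less_1)
      then show ?thesis by simp
    qed
    have "(\<integral>\<^sup>+x. h x * (ennreal \<bar>w x\<bar> * indicator {l<..<r} x) \<partial>lborel) = (\<integral>\<^sup>+p. h (Y p) * indicator {0<..<pi} p \<partial>lborel)"
    proof (rule nn_integral_change_of_variables_interval[where \<theta> = \<theta>])
      show "(\<theta> has_real_derivative w x) (at x)" if "x \<in> {l<..<r}" for x
        unfolding \<theta>_def[abs_def] w_def
        by (rule DERIV_chain2[OF DERIV_arccos DERIV_cdivide[OF discr_DERIV]]) (use lr(4)[OF that] in \<open>auto simp: abs_less_iff\<close>)
      show "inj_on \<theta> {l<..<r}" by (rule inj_on_subset[OF \<theta>inj]) auto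
      show "continuous_on {l<..<r} w" unfolding w_def[abs_def]
      proof (intro continuous_intros discr_continuous ddiscr_continuous ballI)
        fix x assume "x \<in> {l<..<r}"
        from sq[OF this] show "- sqrt (1 - (discr x / 2)\<^sup>2) \<noteq> 0" by simp
      qed auto
    qed (use img Yc Y\<theta> h in auto)
    moreover have "ennreal \<bar>w x\<bar> * indicator {l<..<r} x = ennreal (\<bar>ddiscr x\<bar> / sqrt (4 - (discr x)\<^sup>2)) * indicator {l<..<r} x" for x
    proof (cases "x \<in> {l<..<r}")
      case True
      have "4 - (discr x)\<^sup>2 = 4 * (1 - (discr x / 2)\<^sup>2)" by (simp add: power_divide)
      then have "sqrt (4 - (discr x)\<^sup>2) = sqrt (4 * (1 - (discr x / 2)\<^sup>2))" by (simp only:)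
      also have "\<dots> = 2 * sqrt (1 - (discr x / 2)\<^sup>2)" by (simp only: real_sqrt_mult) simp
      finally have "sqrt (4 - (discr x)\<^sup>2) = 2 * sqrt (1 - (discr x / 2)\<^sup>2)" .
      moreover have "\<bar>inverse (- q) * (e / 2)\<bar> = \<bar>e\<bar> / (2 * q)" if "q > 0" for q e :: real
        using that by (simp add: abs_mult field_simps)
      moreover have "sqrt (1 - (discr x / 2)\<^sup>2) > 0" using sq[OF True] by (simp only: real_sqrt_gt_zero)
      ultimately have "\<bar>w x\<bar> = \<bar>ddiscr x\<bar> / sqrt (4 - (discr x)\<^sup>2)" by (simp only: w_def)
      then show ?thesis by simp
    qed simp
    ultimately show "(\<integral>\<^sup>+x. h x * (ennreal (\<bar>ddiscr x\<bar> / sqrt (4 - (discr x)\<^sup>2)) * indicator {l<..<r} x) \<partial>lborel) = (\<integral>\<^sup>+p. h (Y p) * indicator {0<..<pi} p \<partial>lborel)"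
      by simp
  qed
qed

end

text \<open>
  Up to a constant, \<open>arc_pot (p + \<tau>) + arc_pot (p - \<tau>)\<close> is \<open>- ln \<bar>cos \<tau> - cos p\<bar>\<close>. By periodicity its integral over \<open>p\<close>
  does not depend on \<open>\<tau>\<close>.
\<close>

definition arc_pot :: "real \<Rightarrow> real" where "arc_pot u = - ln \<bar>sin (u / 2)\<bar>"

lemma arc_pot_nonneg: "arc_pot u \<ge> 0"
proof (cases "sin (u / 2) = 0")
  case False
  then have "ln \<bar>sin (u / 2)\<bar> \<le> 0" by (simp add: ln_le_zero_iff)
  then show ?thesis by (simp add: arc_pot_def)
\<comment> \<open>Where the sine vanishes, ln 0 = 0 makes the value 0 instead of infinite. This
  concerns a null set only.\<close>
qed (simp add: arc_pot_def)

lemma arc_pot_even: "arc_pot (- u) = arc_pot u"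
  by (simp add: arc_pot_def)

lemma arc_pot_periodic: "arc_pot (u + 2 * pi) = arc_pot u"
  by (simp add: arc_pot_def add_divide_distrib sin_add)

lemma arc_pot_measurable [measurable]: "arc_pot \<in> borel_measurable borel"
  unfolding arc_pot_def[abs_def] by measurable

lemma nn_integral_shift:
  fixes h :: "real \<Rightarrow> ennreal"
  assumes "h \<in> borel_measurable borel"
  shows "(\<integral>\<^sup>+p. h (p + c) * indicator {a<..<b} p \<partial>lborel) = (\<integral>\<^sup>+p. h p * indicator {a + c<..<b + c} p \<partial>lborel)"
proof -
  have "(\<integral>\<^sup>+p. h p * indicator {a + c<..<b + c} p \<partial>lborel) = ennreal \<bar>1\<bar> * (\<integral>\<^sup>+p. h (c + 1 * p) * indicator {a + c<..<b + c} (c + 1 * p) \<partial>lborel)"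
    by (rule nn_integral_real_affine) (use assms in auto)
  also have "\<dots> = (\<integral>\<^sup>+p. h (p + c) * indicator {a<..<b} p \<partial>lborel)"
    by (auto intro!: nn_integral_cong simp: indicator_def add.commute)
  finally show ?thesis by simp
qed

lemma nn_integral_reflect:
  fixes h :: "real \<Rightarrow> ennreal"
  assumes "h \<in> borel_measurable borel"
  shows "(\<integral>\<^sup>+p. h (- p) * indicator {a<..<b} p \<partial>lborel) = (\<integral>\<^sup>+p. h p * indicator {- b<..<- a} p \<partial>lborel)"
proof -
  have "(\<integral>\<^sup>+p. h p * indicator {- b<..<- a} p \<partial>lborel) = ennreal \<bar>-1\<bar> * (\<integral>\<^sup>+p. h (0 + (-1) * p) * indicator {- b<..<- a} (0 + (-1) * p) \<partial>lborel)"
    by (rule nn_integral_real_affine) (use assms in auto)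
  also have "\<dots> = (\<integral>\<^sup>+p. h (- p) * indicator {a<..<b} p \<partial>lborel)"
    by (auto intro!: nn_integral_cong simp: indicator_def)
  finally show ?thesis by simp
qed

lemma nn_integral_split_at:
  fixes h :: "real \<Rightarrow> ennreal"
  assumes "h \<in> borel_measurable borel" "a \<le> c" "c \<le> b"
  shows "(\<integral>\<^sup>+p. h p * indicator {a<..<b} p \<partial>lborel) = (\<integral>\<^sup>+p. h p * indicator {a<..<c} p \<partial>lborel) + (\<integral>\<^sup>+p. h p * indicator {c<..<b} p \<partial>lborel)"
proof -
  have [measurable]: "h \<in> borel_measurable borel" by fact
  have "(\<integral>\<^sup>+p. h p * indicator {a<..<b} p \<partial>lborel) = (\<integral>\<^sup>+p. h p * indicator {a<..<c} p + h p * indicator {c<..<b} p \<partial>lborel)"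
  proof (rule nn_integral_cong_AE)
    have "AE p in lborel. p \<noteq> c" by (rule AE_lborel_singleton)
    then show "AE p in lborel. h p * indicator {a<..<b} p = h p * indicator {a<..<c} p + h p * indicator {c<..<b} p"
      by eventually_elim (use assms in \<open>auto simp: indicator_def\<close>)
  qed
  also have "\<dots> = (\<integral>\<^sup>+p. h p * indicator {a<..<c} p \<partial>lborel) + (\<integral>\<^sup>+p. h p * indicator {c<..<b} p \<partial>lborel)"
    by (rule nn_integral_add) measurable
  finally show ?thesis .
qed

text \<open>The shifted integrals run over (\<tau>, pi + \<tau>) and (-\<tau>, pi - \<tau>). The
  part beyond pi is moved back by a period and the second interval is reflected to (\<tau> - pi,
  \<tau>); the pieces then tile (-pi, pi).\<close>

lemma arc_pot_integral:
  assumes \<tau>: "0 \<le> \<tau>" "\<tau> \<le> pi"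
  shows "(\<integral>\<^sup>+p. (ennreal (arc_pot (p + \<tau>)) + ennreal (arc_pot (p - \<tau>))) * indicator {0<..<pi} p \<partial>lborel)
    = (\<integral>\<^sup>+p. ennreal (arc_pot p) * indicator {- pi<..<pi} p \<partial>lborel)"
proof -
  let ?h = "\<lambda>p. ennreal (arc_pot p)"
  have [measurable]: "?h \<in> borel_measurable borel" by measurable
  have "(\<integral>\<^sup>+p. (?h (p + \<tau>) + ?h (p - \<tau>)) * indicator {0<..<pi} p \<partial>lborel)
     = (\<integral>\<^sup>+p. ?h (p + \<tau>) * indicator {0<..<pi} p \<partial>lborel) + (\<integral>\<^sup>+p. ?h (p - \<tau>) * indicator {0<..<pi} p \<partial>lborel)"
    by (subst nn_integral_add[symmetric]) (auto simp: distrib_right)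
  also have "(\<integral>\<^sup>+p. ?h (p + \<tau>) * indicator {0<..<pi} p \<partial>lborel) = (\<integral>\<^sup>+p. ?h p * indicator {\<tau><..<pi + \<tau>} p \<partial>lborel)"
    using nn_integral_shift[of ?h \<tau> 0 pi] by simp
  also have "\<dots> = (\<integral>\<^sup>+p. ?h p * indicator {\<tau><..<pi} p \<partial>lborel) + (\<integral>\<^sup>+p. ?h p * indicator {pi<..<pi + \<tau>} p \<partial>lborel)"
    by (rule nn_integral_split_at) (use \<tau> in auto)
  also have "(\<integral>\<^sup>+p. ?h p * indicator {pi<..<pi + \<tau>} p \<partial>lborel) = (\<integral>\<^sup>+p. ?h p * indicator {- pi<..<- pi + \<tau>} p \<partial>lborel)"
    using nn_integral_shift[of ?h "2 * pi" "- pi" "- pi + \<tau>"] by (simp add: arc_pot_periodic)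
  also have "(\<integral>\<^sup>+p. ?h (p - \<tau>) * indicator {0<..<pi} p \<partial>lborel) = (\<integral>\<^sup>+p. ?h p * indicator {- \<tau><..<pi - \<tau>} p \<partial>lborel)"
    using nn_integral_shift[of ?h "- \<tau>" 0 pi] by simp
  also have "\<dots> = (\<integral>\<^sup>+p. ?h p * indicator {\<tau> - pi<..<\<tau>} p \<partial>lborel)"
    using nn_integral_reflect[of ?h "\<tau> - pi" \<tau>] by (simp add: arc_pot_even)
  finally have "(\<integral>\<^sup>+p. (?h (p + \<tau>) + ?h (p - \<tau>)) * indicator {0<..<pi} p \<partial>lborel)
     = (\<integral>\<^sup>+p. ?h p * indicator {- pi<..<\<tau> - pi} p \<partial>lborel) + ((\<integral>\<^sup>+p. ?h p * indicator {\<tau> - pi<..<\<tau>} p \<partial>lborel) + (\<integral>\<^sup>+p. ?h p * indicator {\<tau><..<pi} p \<partial>lborel))"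
    by (simp add: add_ac)
  also have "(\<integral>\<^sup>+p. ?h p * indicator {\<tau> - pi<..<\<tau>} p \<partial>lborel) + (\<integral>\<^sup>+p. ?h p * indicator {\<tau><..<pi} p \<partial>lborel) = (\<integral>\<^sup>+p. ?h p * indicator {\<tau> - pi<..<pi} p \<partial>lborel)"
    by (rule nn_integral_split_at[symmetric]) (use \<tau> in auto)
  also have "(\<integral>\<^sup>+p. ?h p * indicator {- pi<..<\<tau> - pi} p \<partial>lborel) + \<dots> = (\<integral>\<^sup>+p. ?h p * indicator {- pi<..<pi} p \<partial>lborel)"
    by (rule nn_integral_split_at[symmetric]) (use \<tau> in auto)
  finally show ?thesis .
qed

text \<open>By concavity sin (p / 2) is at least p / pi on (0, pi), so the integrand is at most ln
  pi - ln p there, which has an explicit primitive. The other half follows by evenness.\<close>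

lemma arc_pot_integral_finite: "(\<integral>\<^sup>+p. ennreal (arc_pot p) * indicator {- pi<..<pi} p \<partial>lborel) < \<infinity>"
proof -
  let ?h = "\<lambda>p. ennreal (arc_pot p)"
  have [measurable]: "?h \<in> borel_measurable borel" by measurable
  have half: "(\<integral>\<^sup>+p. ?h p * indicator {0<..<pi} p \<partial>lborel) < \<infinity>"
  proof -
    have I: "((\<lambda>p. ln pi - ln p) has_integral (ln pi * pi - (pi * ln pi - pi)) - (ln pi * 0 - (0 * ln 0 - 0))) {0..pi}"
    proof (rule fundamental_theorem_of_calculus_interior)
      have c0: "((\<lambda>p::real. p * ln p) \<longlongrightarrow> 0) (at_right 0)" by real_asymp
      show "continuous_on {0..pi} (\<lambda>p. ln pi * p - (p * ln p - p))"
        unfolding continuous_on_eq_continuous_within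
      proof
        fix p assume p: "p \<in> {0..pi}"
        show "continuous (at p within {0..pi}) (\<lambda>p. ln pi * p - (p * ln p - p))"
        proof (cases "p = 0")
          case True
          have "((\<lambda>p::real. ln pi * p - (p * ln p - p)) \<longlongrightarrow> ln pi * 0 - (0 - 0)) (at_right 0)"
            by (intro tendsto_intros c0)
          moreover have "at 0 within {0..pi} = at_right (0::real)" by (rule at_within_Icc_at_right) simp
          ultimately show ?thesis unfolding True continuous_within by simp
        next
          case False
          then have "isCont (\<lambda>p. ln pi * p - (p * ln p - p)) p" by (intro continuous_intros) auto
          then show ?thesis by (rule continuous_at_imp_continuous_within)
        qed
      qed
      show "((\<lambda>p. ln pi * p - (p * ln p - p)) has_vector_derivative ln pi - ln p) (at p)" if "p \<in> {0<..<pi}" for p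
      proof -
        have "((\<lambda>p. ln pi * p - (p * ln p - p)) has_real_derivative ln pi - ln p) (at p)"
          using that by (auto intro!: derivative_eq_intros)
        then show ?thesis by (simp add: has_real_derivative_iff_has_vector_derivative)
      qed
    qed simp
    then have I': "((\<lambda>p. ln pi - ln p) has_integral (ln pi * pi - (pi * ln pi - pi)) - (ln pi * 0 - (0 * ln 0 - 0))) {0<..<pi}"
      by (simp add: has_integral_Icc_iff_Ioo)
    have "(\<integral>\<^sup>+p. ?h p * indicator {0<..<pi} p \<partial>lborel) \<le> (\<integral>\<^sup>+p. ennreal (ln pi - ln p) * indicator {0<..<pi} p \<partial>lborel)"
    proof (rule nn_integral_mono)
      fix p :: real
      show "?h p * indicator {0<..<pi} p \<le> ennreal (ln pi - ln p) * indicator {0<..<pi} p"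
      proof (cases "p \<in> {0<..<pi}")
        case True
        have s: "p / pi \<le> sin (p / 2)"
        proof -
          have "concave_on {0..pi} sin"
            by (rule f''_le0_imp_concave[where f' = cos and f'' = "\<lambda>x. - sin x"])
              (auto intro!: derivative_eq_intros sin_ge_zero)
          from concave_onD[OF this, of "p / pi" 0 "pi / 2"] True show ?thesis
            by (simp add: field_simps)
        qed
        then have pos: "sin (p / 2) > 0" using True by (intro sin_gt_zero) auto
        have "ln (p / pi) \<le> ln (sin (p / 2))" using s True pos by (subst ln_le_cancel_iff) auto
        then have "arc_pot p \<le> ln pi - ln p" using True pos by (simp add: arc_pot_def ln_div)
        then show ?thesis using True by (simp add: ennreal_leI)
      qed simp
    qed
    also have "\<dots> = ennreal ((ln pi * pi - (pi * ln pi - pi)) - (ln pi * 0 - (0 * ln 0 - 0)))"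
      by (rule nn_integral_has_integral_lebesgue'[OF _ I']) auto
    also have "\<dots> < \<infinity>" by simp
    finally show ?thesis .
  qed
  have "(\<integral>\<^sup>+p. ?h p * indicator {- pi<..<pi} p \<partial>lborel) = (\<integral>\<^sup>+p. ?h p * indicator {- pi<..<0} p \<partial>lborel) + (\<integral>\<^sup>+p. ?h p * indicator {0<..<pi} p \<partial>lborel)"
    by (rule nn_integral_split_at) auto
  also have "(\<integral>\<^sup>+p. ?h p * indicator {- pi<..<0} p \<partial>lborel) = (\<integral>\<^sup>+p. ?h p * indicator {0<..<pi} p \<partial>lborel)"
    using nn_integral_reflect[of ?h 0 pi] by (simp add: arc_pot_even)
  finally show ?thesis using half by simp
qed

lemma abs_cos_diff:
  fixes \<tau> p :: real
  shows "\<bar>2 * cos \<tau> - 2 * cos p\<bar> = 4 * \<bar>sin ((p + \<tau>) / 2)\<bar> * \<bar>sin ((p - \<tau>) / 2)\<bar>"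
proof -
  have "2 * cos \<tau> - 2 * cos p = 2 * (2 * sin ((\<tau> + p) / 2) * sin ((p - \<tau>) / 2))"
    using cos_diff_cos[of \<tau> p] by simp
  then show ?thesis by (simp add: abs_mult add.commute)
qed

section \<open>The candidate measure in the coordinates of the bands\<close>

context periodic_jacobi
begin

definition bands :: "real set" where "bands = {x. \<bar>discr x\<bar> \<le> 2}"

text \<open>The modulus of the derivative of arccos (discr / 2) divided by pi N, so that every band
  has mass 1 / N: the density of states of the periodic recurrence.\<close>

definition eqdens :: "real \<Rightarrow> real" where
  "eqdens x = \<bar>ddiscr x\<bar> / (pi * real N * sqrt (4 - (discr x)\<^sup>2))"

definition eqmeas :: "real measure" where
  "eqmeas = density lborel (\<lambda>x. ennreal (eqdens x) * indicator {x. \<bar>discr x\<bar> < 2} x)"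

text \<open>The zeros \<xi> of the discriminant label the bands, and \<open>Y \<xi> p\<close> is the
  point of band \<xi> where discr = 2 cos p. For fixed p these are N distinct roots of a polynomial
  of degree N, which therefore factors over them.\<close>

lemma bands_decomposition:
  obtains Y :: "real \<Rightarrow> real \<Rightarrow> real" and lead where
    "lead \<noteq> 0"
    "\<And>\<xi>. discr \<xi> = 0 \<Longrightarrow> (Y \<xi>) \<in> borel_measurable borel"
    "\<And>\<xi> p. discr \<xi> = 0 \<Longrightarrow> p \<in> {0<..<pi} \<Longrightarrow> \<bar>discr (Y \<xi> p)\<bar> < 2"
    "\<And>x p. p \<in> {0<..<pi} \<Longrightarrow> discr x - 2 * cos p = lead * (\<Prod>\<xi>\<in>{\<xi>. discr \<xi> = 0}. x - Y \<xi> p)"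
    "\<And>h. h \<in> borel_measurable borel \<Longrightarrow>
      (\<integral>\<^sup>+x. h x \<partial>eqmeas) = ennreal (1 / (pi * real N)) * (\<integral>\<^sup>+p. (\<Sum>\<xi>\<in>{\<xi>. discr \<xi> = 0}. h (Y \<xi> p)) * indicator {0<..<pi} p \<partial>lborel)"
proof -
  let ?Z = "{\<xi>::real. discr \<xi> = 0}"
  have finZ: "finite ?Z" using card_discr_zeros N by (metis card.infinite not_one_le_zero)
  have "\<forall>\<xi>\<in>?Z. \<exists>l r. l < \<xi> \<and> \<xi> < r \<and> \<bar>discr l\<bar> = 2 \<and> \<bar>discr r\<bar> = 2 \<and> (\<forall>x\<in>{l<..<r}. \<bar>discr x\<bar> < 2)"
  proof
    fix \<xi> assume "\<xi> \<in> ?Z"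
    then have "\<bar>discr \<xi>\<bar> < 2" by simp
    from band_exists[OF this] show "\<exists>l r. l < \<xi> \<and> \<xi> < r \<and> \<bar>discr l\<bar> = 2 \<and> \<bar>discr r\<bar> = 2 \<and> (\<forall>x\<in>{l<..<r}. \<bar>discr x\<bar> < 2)" by metis
  qed
  then obtain l r where lr: "\<And>\<xi>. \<xi> \<in> ?Z \<Longrightarrow> l \<xi> < \<xi> \<and> \<xi> < r \<xi> \<and> \<bar>discr (l \<xi>)\<bar> = 2 \<and> \<bar>discr (r \<xi>)\<bar> = 2 \<and> (\<forall>x\<in>{l \<xi><..<r \<xi>}. \<bar>discr x\<bar> < 2)"
    by metis
  let ?w = "\<lambda>x. ennreal (\<bar>ddiscr x\<bar> / sqrt (4 - (discr x)\<^sup>2))"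
  have "\<forall>\<xi>\<in>?Z. \<exists>Y. (\<forall>p\<in>{0<..<pi}. Y p \<in> {l \<xi><..<r \<xi>} \<and> discr (Y p) = 2 * cos p) \<and> continuous_on {0<..<pi} Y \<and>
     (\<forall>h. h \<in> borel_measurable borel \<longrightarrow> (\<integral>\<^sup>+x. h x * (?w x * indicator {l \<xi><..<r \<xi>} x) \<partial>lborel) = (\<integral>\<^sup>+p. h (Y p) * indicator {0<..<pi} p \<partial>lborel))"
  proof
    fix \<xi> assume "\<xi> \<in> ?Z"
    from lr[OF this] have *: "l \<xi> < r \<xi>" "\<bar>discr (l \<xi>)\<bar> = 2" "\<bar>discr (r \<xi>)\<bar> = 2" "\<And>x. x \<in> {l \<xi><..<r \<xi>} \<Longrightarrow> \<bar>discr x\<bar> < 2" by auto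
    show "\<exists>Y. (\<forall>p\<in>{0<..<pi}. Y p \<in> {l \<xi><..<r \<xi>} \<and> discr (Y p) = 2 * cos p) \<and> continuous_on {0<..<pi} Y \<and>
     (\<forall>h. h \<in> borel_measurable borel \<longrightarrow> (\<integral>\<^sup>+x. h x * (?w x * indicator {l \<xi><..<r \<xi>} x) \<partial>lborel) = (\<integral>\<^sup>+p. h (Y p) * indicator {0<..<pi} p \<partial>lborel))"
      by (rule band_integral[OF *]) blast+
  qed
  from bchoice[OF this] obtain Y0 where Y0': "\<forall>\<xi>\<in>?Z. (\<forall>p\<in>{0<..<pi}. Y0 \<xi> p \<in> {l \<xi><..<r \<xi>} \<and> discr (Y0 \<xi> p) = 2 * cos p) \<and> continuous_on {0<..<pi} (Y0 \<xi>) \<and>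
     (\<forall>h. h \<in> borel_measurable borel \<longrightarrow> (\<integral>\<^sup>+x. h x * (?w x * indicator {l \<xi><..<r \<xi>} x) \<partial>lborel) = (\<integral>\<^sup>+p. h (Y0 \<xi> p) * indicator {0<..<pi} p \<partial>lborel))"
    by (rule exE)
  note Y0 = Y0'[THEN bspec, THEN conjunct1, THEN bspec]
  note Y0c = Y0'[THEN bspec, THEN conjunct2, THEN conjunct1]
  note Y0i = Y0'[THEN bspec, THEN conjunct2, THEN conjunct2, THEN spec, THEN mp]
  define Y where "Y \<xi> p = (if p \<in> {0<..<pi} then Y0 \<xi> p else 0)" for \<xi> p
  have Ym: "Y \<xi> \<in> borel_measurable borel" if "\<xi> \<in> ?Z" for \<xi>
    unfolding Y_def[abs_def] by (rule borel_measurable_continuous_on_if) (use Y0c[OF that] in auto)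
  have Y: "Y \<xi> p \<in> {l \<xi><..<r \<xi>}" "discr (Y \<xi> p) = 2 * cos p" if "\<xi> \<in> ?Z" "p \<in> {0<..<pi}" for \<xi> p
    using Y0[OF that] that(2) by (auto simp: Y_def)
  \<comment> \<open>The discriminant is injective on a closed band, so the band of \<xi> contains no
    other zero; this separates the bands.\<close>
  have order: "r \<xi> \<le> l \<xi>'" if Z: "\<xi> \<in> ?Z" "\<xi>' \<in> ?Z" and less: "\<xi> < \<xi>'" for \<xi> \<xi>'
  proof -
    have "r \<xi> \<le> \<xi>'"
    proof (rule ccontr)
      assume "\<not> r \<xi> \<le> \<xi>'"
      then have "\<xi>' \<in> {l \<xi>..r \<xi>}" "\<xi> \<in> {l \<xi>..r \<xi>}" using lr[OF Z(1)] less by auto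
      moreover have "inj_on discr {l \<xi>..r \<xi>}" by (rule discr_band_inj) (use lr[OF Z(1)] in blast)
      ultimately show False using Z less unfolding inj_on_def by (metis (mono_tags, lifting) less_irrefl mem_Collect_eq)
    qed
    moreover have "r \<xi> \<notin> {l \<xi>'<..<r \<xi>'}" using lr[OF Z(1)] lr[OF Z(2)] by (metis less_irrefl)
    ultimately show ?thesis using lr[OF Z(2)] by auto
  qed
  have disj: "{l \<xi><..<r \<xi>} \<inter> {l \<xi>'<..<r \<xi>'} = {}" if "\<xi> \<in> ?Z" "\<xi>' \<in> ?Z" "\<xi> \<noteq> \<xi>'" for \<xi> \<xi>'
    using order[of \<xi> \<xi>'] order[of \<xi>' \<xi>] that by (cases "\<xi> < \<xi>'") auto
  define lead where "lead = lead_coeff (discr_poly :: real poly)"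
  have dp0: "(discr_poly :: real poly) \<noteq> 0" using degree_discr_poly[where 'a=real] N by auto
  have fact: "discr x - 2 * cos p = lead * (\<Prod>\<xi>\<in>?Z. x - Y \<xi> p)" if p: "p \<in> {0<..<pi}" for x p
  proof -
    let ?q = "discr_poly - [:2 * cos p:] :: real poly"
    have dq: "degree ?q = N"
      unfolding diff_conv_add_uminus using degree_discr_poly[where 'a=real] N by (subst degree_add_eq_left) auto
    have lq: "lead_coeff ?q = lead"
      unfolding dq using degree_discr_poly[where 'a=real] N by (simp add: lead_def coeff_pCons split: nat.splits)
    have "poly ?q x = lead_coeff ?q * (\<Prod>\<xi>\<in>?Z. x - Y \<xi> p)"
    proof (rule poly_eq_prod_roots[OF finZ])
      show "inj_on (\<lambda>\<xi>. Y \<xi> p) ?Z"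
      proof (rule inj_onI, rule ccontr)
        fix \<xi> \<xi>' assume a: "\<xi> \<in> ?Z" "\<xi>' \<in> ?Z" "Y \<xi> p = Y \<xi>' p" "\<xi> \<noteq> \<xi>'"
        then show False using disj[OF a(1,2,4)] Y(1)[OF a(1) p] Y(1)[OF a(2) p] by auto
      qed
      show "poly ?q (Y \<xi> p) = 0" if "\<xi> \<in> ?Z" for \<xi> using Y(2)[OF that p] by (simp add: poly_discr_poly)
      show "degree ?q = card ?Z" using dq card_discr_zeros by simp
    qed
    then show ?thesis unfolding lq by (simp add: poly_discr_poly)
  qed
  have lead0: "lead \<noteq> 0" unfolding lead_def using dp0 by simp
  \<comment> \<open>By the factorisation every root of discr - 2 cos p is one of the
    \<open>Y \<xi> p\<close>, so no point with |discr| < 2 escapes the labelled bands.\<close>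
  have cover: "\<exists>\<xi>\<in>?Z. x \<in> {l \<xi><..<r \<xi>}" if x: "\<bar>discr x\<bar> < 2" for x
  proof -
    define p where "p = arccos (discr x / 2)"
    have p: "p \<in> {0<..<pi}" using arccos_lt_bounded[of "discr x / 2"] x by (simp add: p_def abs_less_iff)
    have "discr x = 2 * cos p" using x by (simp add: p_def cos_arccos_abs)
    then have "(\<Prod>\<xi>\<in>?Z. x - Y \<xi> p) = 0" using fact[OF p, of x] lead0 by simp
    then obtain \<xi> where "\<xi> \<in> ?Z" "x = Y \<xi> p" using finZ by (auto simp: prod_zero_iff)
    then show ?thesis using Y(1)[OF _ p] by blast
  qed
  have ind: "indicator {x. \<bar>discr x\<bar> < 2} x = (\<Sum>\<xi>\<in>?Z. indicator {l \<xi><..<r \<xi>} x :: ennreal)" for x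
  proof (cases "\<bar>discr x\<bar> < 2")
    case True
    then obtain \<xi> where \<xi>: "\<xi> \<in> ?Z" "x \<in> {l \<xi><..<r \<xi>}" using cover by blast
    have "(\<Sum>\<xi>'\<in>?Z. indicator {l \<xi>'<..<r \<xi>'} x :: ennreal) = (\<Sum>\<xi>'\<in>?Z. if \<xi>' = \<xi> then 1 else 0)"
    proof (rule sum.cong[OF refl])
      fix \<xi>' assume "\<xi>' \<in> ?Z"
      then show "indicator {l \<xi>'<..<r \<xi>'} x = (if \<xi>' = \<xi> then 1 else 0 :: ennreal)"
        using disj[of \<xi> \<xi>'] \<xi> by (auto simp: indicator_def)
    qed
    then show ?thesis using True \<xi>(1) finZ by simp
  next
    case False
    have "indicator {l \<xi><..<r \<xi>} x = (0::ennreal)" if "\<xi> \<in> ?Z" for \<xi> using lr[OF that] False by (auto simp: indicator_def)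
    then show ?thesis using False by simp
  qed
  have wm: "?w \<in> borel_measurable borel"
    using borel_measurable_continuous_onI[OF discr_continuous] borel_measurable_continuous_onI[OF ddiscr_continuous] by measurable
  have int: "(\<integral>\<^sup>+x. h x \<partial>eqmeas) = ennreal (1 / (pi * real N)) * (\<integral>\<^sup>+p. (\<Sum>\<xi>\<in>?Z. h (Y \<xi> p)) * indicator {0<..<pi} p \<partial>lborel)"
    if h: "h \<in> borel_measurable borel" for h
  proof -
    note [measurable] = h wm
    have [measurable]: "(\<lambda>x::real. discr x :: real) \<in> borel_measurable borel" "ddiscr \<in> borel_measurable borel"
      by (rule borel_measurable_continuous_onI[OF discr_continuous], rule borel_measurable_continuous_onI[OF ddiscr_continuous])
    have [measurable]: "eqdens \<in> borel_measurable borel" unfolding eqdens_def[abs_def] by measurable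
    have eqd: "ennreal (eqdens x) = ennreal (1 / (pi * real N)) * ?w x" for x
      by (simp add: eqdens_def ennreal_mult'[symmetric] divide_inverse mult_ac)
    have "(\<integral>\<^sup>+x. h x \<partial>eqmeas) = (\<integral>\<^sup>+x. (ennreal (eqdens x) * indicator {x. \<bar>discr x\<bar> < 2} x) * h x \<partial>lborel)"
      unfolding eqmeas_def by (rule nn_integral_density) measurable
    also have "\<dots> = (\<integral>\<^sup>+x. ennreal (1 / (pi * real N)) * (\<Sum>\<xi>\<in>?Z. h x * (?w x * indicator {l \<xi><..<r \<xi>} x)) \<partial>lborel)"
      unfolding eqd ind by (intro nn_integral_cong) (simp add: sum_distrib_left sum_distrib_right mult_ac)
    also have "\<dots> = ennreal (1 / (pi * real N)) * (\<Sum>\<xi>\<in>?Z. \<integral>\<^sup>+x. h x * (?w x * indicator {l \<xi><..<r \<xi>} x) \<partial>lborel)"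
      by (subst nn_integral_cmult, measurable) (subst nn_integral_sum, measurable)
    also have "(\<Sum>\<xi>\<in>?Z. \<integral>\<^sup>+x. h x * (?w x * indicator {l \<xi><..<r \<xi>} x) \<partial>lborel) = (\<Sum>\<xi>\<in>?Z. \<integral>\<^sup>+p. h (Y \<xi> p) * indicator {0<..<pi} p \<partial>lborel)"
    proof (rule sum.cong[OF refl])
      fix \<xi> assume \<xi>: "\<xi> \<in> ?Z"
      have "(\<integral>\<^sup>+p. h (Y0 \<xi> p) * indicator {0<..<pi} p \<partial>lborel) = (\<integral>\<^sup>+p. h (Y \<xi> p) * indicator {0<..<pi} p \<partial>lborel)"
        by (intro nn_integral_cong) (simp add: Y_def indicator_def)
      then show "(\<integral>\<^sup>+x. h x * (?w x * indicator {l \<xi><..<r \<xi>} x) \<partial>lborel) = (\<integral>\<^sup>+p. h (Y \<xi> p) * indicator {0<..<pi} p \<partial>lborel)"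
        using Y0i[OF \<xi> h] by simp
    qed
    also have "\<dots> = (\<integral>\<^sup>+p. (\<Sum>\<xi>\<in>?Z. h (Y \<xi> p) * indicator {0<..<pi} p) \<partial>lborel)"
    proof (rule nn_integral_sum[symmetric])
      fix \<xi> assume "\<xi> \<in> ?Z"
      note [measurable] = Ym[OF this]
      show "(\<lambda>p. h (Y \<xi> p) * indicator {0<..<pi} p) \<in> borel_measurable lborel" by measurable
    qed
    finally show ?thesis by (simp add: sum_distrib_right)
  qed
  show ?thesis
  proof (rule that[OF lead0 _ _ fact int])
    show "\<bar>discr (Y \<xi> p)\<bar> < 2" if "discr \<xi> = 0" "p \<in> {0<..<pi}" for \<xi> p
      using Y(1)[of \<xi> p] lr[of \<xi>] that by auto
  qed (use Ym in auto)
qed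

end

lemma square_less_four:
  fixes x :: real assumes "\<bar>x\<bar> < 2" shows "x\<^sup>2 < 2\<^sup>2"
  using abs_le_square_iff[of 2 x] assms by linarith

section \<open>The constant potential, the equilibrium measure of the bands and its density\<close>

context periodic_jacobi
begin

lemma discr_zero_exists: obtains \<xi> :: real where "discr \<xi> = 0"
proof -
  have "{x::real. discr x = 0} \<noteq> {}" using card_discr_zeros N by (metis card.empty not_one_le_zero)
  then show ?thesis using that by blast
qed

lemma discr_measurable [measurable]: "(discr :: real \<Rightarrow> real) \<in> borel_measurable borel"
  and ddiscr_measurable [measurable]: "ddiscr \<in> borel_measurable borel"
  by (rule borel_measurable_continuous_onI[OF discr_continuous], rule borel_measurable_continuous_onI[OF ddiscr_continuous])

lemma eqdens_measurable [measurable]: "eqdens \<in> borel_measurable borel"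
  unfolding eqdens_def[abs_def] by measurable

lemma bands_closed: "closed bands"
proof -
  have "closed {x. \<bar>discr x :: real\<bar> \<le> 2}"
    by (rule closed_Collect_le) (intro continuous_intros discr_continuous)+
  then show ?thesis by (simp add: bands_def)
qed

lemma bands_bounded: obtains R where "R > 0" "bands \<subseteq> {- R..R}"
proof -
  obtain R where R: "\<And>x. R \<le> \<bar>x\<bar> \<Longrightarrow> 2 < \<bar>discr x :: real\<bar>" using discr_large by metis
  show ?thesis
  proof (rule that[of "max 1 R"])
    show "bands \<subseteq> {- max 1 R..max 1 R}"
    proof
      fix x assume "x \<in> bands"
      then have "\<not> R \<le> \<bar>x\<bar>" using R[of x] by (auto simp: bands_def)
      then show "x \<in> {- max 1 R..max 1 R}" by (auto simp: abs_if split: if_splits)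
    qed
  qed simp
qed

lemma eqmeas_prob: "prob_measure_on bands eqmeas"
proof (rule bands_decomposition)
  fix Y :: "real \<Rightarrow> real \<Rightarrow> real"
  assume int: "\<And>h. h \<in> borel_measurable borel \<Longrightarrow>
      (\<integral>\<^sup>+x. h x \<partial>eqmeas) = ennreal (1 / (pi * real N)) * (\<integral>\<^sup>+p. (\<Sum>\<xi>\<in>{\<xi>. discr \<xi> = 0}. h (Y \<xi> p)) * indicator {0<..<pi} p \<partial>lborel)"
  have sets: "sets eqmeas = sets borel" by (simp add: eqmeas_def)
  have "emeasure eqmeas (space eqmeas) = (\<integral>\<^sup>+x. 1 \<partial>eqmeas)" by simp
  also have "\<dots> = ennreal (1 / (pi * real N)) * (\<integral>\<^sup>+p. of_nat N * indicator {0<..<pi} p \<partial>lborel)"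
    by (subst int) (simp_all add: card_discr_zeros)
  also have "(\<integral>\<^sup>+p. of_nat N * indicator {0<..<pi} p \<partial>lborel) = ennreal (real N * pi)"
    by (subst nn_integral_cmult_indicator) (simp_all add: ennreal_mult ennreal_of_nat_eq_real_of_nat)
  also have "ennreal (1 / (pi * real N)) * ennreal (real N * pi) = 1"
    using N by (subst ennreal_mult[symmetric]) auto
  finally have 1: "prob_space eqmeas" by (rule prob_spaceI)
  have [measurable]: "bands \<in> sets borel" using bands_closed by simp
  have "emeasure eqmeas (- bands) = (\<integral>\<^sup>+x. (ennreal (eqdens x) * indicator {x. \<bar>discr x\<bar> < 2} x) * indicator (- bands) x \<partial>lborel)"
    unfolding eqmeas_def by (rule emeasure_density) measurable
  also have "\<dots> = (\<integral>\<^sup>+x. 0 \<partial>(lborel :: real measure))"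
    by (intro nn_integral_cong) (auto simp: indicator_def bands_def)
  finally show ?thesis using 1 sets by (simp add: prob_measure_on_def real_prob_measure_def)
qed

text \<open>By the factorisation, the sum over \<xi> of ln |x - Y \<xi> p| is ln |discr x - 2 cos p|
  up to a constant. For x in the bands discr x = 2 cos \<tau> with a real \<tau>, and
  \<open>arc_pot_integral\<close> removes the dependence on \<tau>.\<close>

lemma eqmeas_potential:
  assumes D: "\<And>x y. x \<in> bands \<Longrightarrow> y \<in> bands \<Longrightarrow> \<bar>x - y\<bar> \<le> D" "D \<ge> 1"
  obtains c where "c < \<infinity>" "\<And>x. x \<in> bands \<Longrightarrow> (\<integral>\<^sup>+y. kern D x y \<partial>eqmeas) = c"
proof (rule bands_decomposition)
  let ?Z = "{\<xi>::real. discr \<xi> = 0}"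
  have finZ: "finite ?Z" using card_discr_zeros N by (metis card.infinite not_one_le_zero)
  fix Y :: "real \<Rightarrow> real \<Rightarrow> real" and lead :: real
  assume lead: "lead \<noteq> 0" and
    Ym: "\<And>\<xi>. discr \<xi> = 0 \<Longrightarrow> (Y \<xi>) \<in> borel_measurable borel" and
    Yb: "\<And>\<xi> p. discr \<xi> = 0 \<Longrightarrow> p \<in> {0<..<pi} \<Longrightarrow> \<bar>discr (Y \<xi> p)\<bar> < 2" and
    fact: "\<And>x p. p \<in> {0<..<pi} \<Longrightarrow> discr x - 2 * cos p = lead * (\<Prod>\<xi>\<in>?Z. x - Y \<xi> p)" and
    int: "\<And>h. h \<in> borel_measurable borel \<Longrightarrow>
      (\<integral>\<^sup>+x. h x \<partial>eqmeas) = ennreal (1 / (pi * real N)) * (\<integral>\<^sup>+p. (\<Sum>\<xi>\<in>?Z. h (Y \<xi> p)) * indicator {0<..<pi} p \<partial>lborel)"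
  \<comment> \<open>Collects the constants: N ln D from \<open>kern\<close>, the leading
    coefficient, and the 4 of \<open>abs_cos_diff\<close>. Its sign is unknown, so its positive and
    negative parts stand on opposite sides of the equations in \<open>ennreal\<close>.\<close>
  define c1 where "c1 = real N * ln D + ln \<bar>lead\<bar> - ln 4"
  define H where "H = (\<integral>\<^sup>+p. ennreal (arc_pot p) * indicator {- pi<..<pi} p \<partial>lborel)"
  define c where "c = ennreal (1 / (pi * real N)) * ((ennreal (max 0 c1) * ennreal pi + H) - ennreal (max 0 (- c1)) * ennreal pi)"
  show ?thesis
  proof (rule that)
    have "ennreal (max 0 c1) * ennreal pi + H < \<infinity>"
      using arc_pot_integral_finite by (simp add: H_def ennreal_mult_less_top)
    then show "c < \<infinity>" unfolding c_def
      by (auto simp: ennreal_mult_less_top intro: le_less_trans[OF diff_le_self_ennreal])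
    fix x assume x: "x \<in> bands"
    define \<tau> where "\<tau> = arccos (discr x / 2)"
    have \<tau>: "0 \<le> \<tau>" "\<tau> \<le> pi" and dx: "discr x = 2 * cos \<tau>"
      using x arccos_bounded[of "discr x / 2"] by (auto simp: \<tau>_def bands_def cos_arccos_abs)
    let ?S = "\<lambda>p. \<Sum>\<xi>\<in>?Z. kern D x (Y \<xi> p)"
    let ?u = "\<lambda>p. ennreal (arc_pot (p + \<tau>)) + ennreal (arc_pot (p - \<tau>))"
    \<comment> \<open>At p = \<tau> the left side is infinite, but \<open>arc_pot 0\<close> is 0 by
      the convention ln 0 = 0; this point is excluded.\<close>
    have S: "?S p + ennreal (max 0 (- c1)) = ennreal (max 0 c1) + ?u p" if p: "p \<in> {0<..<pi}" "p \<noteq> \<tau>" for p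
    proof -
      have "cos \<tau> \<noteq> cos p" using p \<tau> cos_inj_pi[of \<tau> p] by auto
      then have ne: "discr x - 2 * cos p \<noteq> 0" using dx by simp
      then have nz: "x - Y \<xi> p \<noteq> 0" if "\<xi> \<in> ?Z" for \<xi> using fact[OF p(1), of x] finZ that by auto
      have le: "ln \<bar>x - Y \<xi> p\<bar> \<le> ln D" if "\<xi> \<in> ?Z" for \<xi>
      proof -
        have "Y \<xi> p \<in> bands" using Yb[of \<xi> p] that p(1) by (simp add: bands_def)
        then have "\<bar>x - Y \<xi> p\<bar> \<le> D" by (rule D(1)[OF x])
        then show ?thesis using nz[OF that] D(2) by (subst ln_le_cancel_iff) auto
      qed
      have "?S p = (\<Sum>\<xi>\<in>?Z. ennreal (ln D - ln \<bar>x - Y \<xi> p\<bar>))"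
        by (rule sum.cong[OF refl]) (use nz in \<open>auto simp: kern_def\<close>)
      also have "\<dots> = ennreal (\<Sum>\<xi>\<in>?Z. ln D - ln \<bar>x - Y \<xi> p\<bar>)"
        by (rule sum_ennreal) (use le in auto)
      finally have S1: "?S p = ennreal (\<Sum>\<xi>\<in>?Z. ln D - ln \<bar>x - Y \<xi> p\<bar>)" .
      have pos: "(\<Sum>\<xi>\<in>?Z. ln D - ln \<bar>x - Y \<xi> p\<bar>) \<ge> 0" by (rule sum_nonneg) (use le in auto)
      have "(\<Sum>\<xi>\<in>?Z. ln \<bar>x - Y \<xi> p\<bar>) = ln (\<Prod>\<xi>\<in>?Z. \<bar>x - Y \<xi> p\<bar>)"
        by (rule ln_prod[symmetric]) (use nz finZ in auto)
      also have "(\<Prod>\<xi>\<in>?Z. \<bar>x - Y \<xi> p\<bar>) = \<bar>discr x - 2 * cos p\<bar> / \<bar>lead\<bar>"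
        using lead by (simp add: fact[OF p(1), of x] abs_mult abs_prod)
      also have "ln \<dots> = ln \<bar>discr x - 2 * cos p\<bar> - ln \<bar>lead\<bar>" using lead ne by (subst ln_div) auto
      finally have 1: "(\<Sum>\<xi>\<in>?Z. ln \<bar>x - Y \<xi> p\<bar>) = ln \<bar>discr x - 2 * cos p\<bar> - ln \<bar>lead\<bar>" .
      have e: "\<bar>discr x - 2 * cos p\<bar> = 4 * \<bar>sin ((p + \<tau>) / 2)\<bar> * \<bar>sin ((p - \<tau>) / 2)\<bar>"
        unfolding dx by (rule abs_cos_diff)
      with ne have "sin ((p + \<tau>) / 2) \<noteq> 0" "sin ((p - \<tau>) / 2) \<noteq> 0" by auto
      then have 2: "ln \<bar>discr x - 2 * cos p\<bar> = ln 4 - arc_pot (p + \<tau>) - arc_pot (p - \<tau>)"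
        unfolding e arc_pot_def by (simp add: ln_mult)
      have "(\<Sum>\<xi>\<in>?Z. ln D - ln \<bar>x - Y \<xi> p\<bar>) = real N * ln D - (\<Sum>\<xi>\<in>?Z. ln \<bar>x - Y \<xi> p\<bar>)"
        by (simp add: sum_subtractf card_discr_zeros)
      also have "\<dots> = c1 + arc_pot (p + \<tau>) + arc_pot (p - \<tau>)" unfolding 1 2 c1_def by simp
      finally have 3: "(\<Sum>\<xi>\<in>?Z. ln D - ln \<bar>x - Y \<xi> p\<bar>) = c1 + arc_pot (p + \<tau>) + arc_pot (p - \<tau>)" .
      have "?S p + ennreal (max 0 (- c1)) = ennreal (c1 + arc_pot (p + \<tau>) + arc_pot (p - \<tau>) + max 0 (- c1))"
        unfolding S1 3[symmetric] by (rule ennreal_plus[symmetric]) (use pos in auto)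
      also have "c1 + arc_pot (p + \<tau>) + arc_pot (p - \<tau>) + max 0 (- c1) = max 0 c1 + (arc_pot (p + \<tau>) + arc_pot (p - \<tau>))"
        by (simp add: max_def)
      also have "ennreal \<dots> = ennreal (max 0 c1) + ?u p"
        by (subst ennreal_plus) (auto simp: arc_pot_nonneg intro: add_nonneg_nonneg)
      finally show ?thesis .
    qed
    have km: "(\<lambda>y. kern D x y) \<in> borel_measurable borel" unfolding kern_def[abs_def] by measurable
    have Sm: "?S \<in> borel_measurable borel"
    proof (rule borel_measurable_sum)
      fix \<xi> assume "\<xi> \<in> ?Z"
      then have "Y \<xi> \<in> borel_measurable borel" using Ym by simp
      from measurable_compose[OF this km] show "(\<lambda>p. kern D x (Y \<xi> p)) \<in> borel_measurable borel" .
    qed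
    note [measurable] = Sm
    let ?I = "\<integral>\<^sup>+p. ?S p * indicator {0<..<pi} p \<partial>lborel"
    have cst: "(\<integral>\<^sup>+p. ennreal k * indicator {0<..<pi} p \<partial>lborel) = ennreal k * ennreal pi" for k
      by (subst nn_integral_cmult_indicator) auto
    have "?I + ennreal (max 0 (- c1)) * ennreal pi = (\<integral>\<^sup>+p. ?S p * indicator {0<..<pi} p + ennreal (max 0 (- c1)) * indicator {0<..<pi} p \<partial>lborel)"
      unfolding cst[symmetric] by (rule nn_integral_add[symmetric]) measurable
    also have "\<dots> = (\<integral>\<^sup>+p. ennreal (max 0 c1) * indicator {0<..<pi} p + ?u p * indicator {0<..<pi} p \<partial>lborel)"
    proof (rule nn_integral_cong_AE)
      have "AE p in lborel. p \<noteq> \<tau>" by (rule AE_lborel_singleton)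
      then show "AE p in lborel. ?S p * indicator {0<..<pi} p + ennreal (max 0 (- c1)) * indicator {0<..<pi} p
        = ennreal (max 0 c1) * indicator {0<..<pi} p + ?u p * indicator {0<..<pi} p"
      proof eventually_elim
        case (elim p)
        show ?case
        proof (cases "p \<in> {0<..<pi}")
          case True
          from S[OF True elim] show ?thesis using True by simp
        qed simp
      qed
    qed
    also have "\<dots> = ennreal (max 0 c1) * ennreal pi + (\<integral>\<^sup>+p. ?u p * indicator {0<..<pi} p \<partial>lborel)"
      unfolding cst[symmetric] by (rule nn_integral_add) measurable
    also have "(\<integral>\<^sup>+p. ?u p * indicator {0<..<pi} p \<partial>lborel) = H" unfolding H_def by (rule arc_pot_integral[OF \<tau>])
    finally have eq: "?I + ennreal (max 0 (- c1)) * ennreal pi = ennreal (max 0 c1) * ennreal pi + H" .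
    have "?I = (ennreal (max 0 c1) * ennreal pi + H) - ennreal (max 0 (- c1)) * ennreal pi"
      unfolding eq[symmetric] by (rule ennreal_add_diff_cancel_right[symmetric]) (simp add: ennreal_mult_eq_top_iff)
    then show "(\<integral>\<^sup>+y. kern D x y \<partial>eqmeas) = c" unfolding int[OF km] c_def by simp
  qed
qed

lemma equilibrium_measure_bands:
  assumes "equilibrium_measure bands \<omega>" shows "\<omega> = eqmeas"
proof -
  obtain R where R: "R > 0" "bands \<subseteq> {- R..R}" by (rule bands_bounded)
  define D where "D = 2 * R + 1"
  have "\<bar>x - y\<bar> \<le> D" if "x \<in> bands" "y \<in> bands" for x y
    using R(1) subsetD[OF R(2) that(1)] subsetD[OF R(2) that(2)] by (auto simp: D_def abs_if)
  moreover have D1: "D \<ge> 1" using R by (simp add: D_def)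
  ultimately show ?thesis
  proof (rule eqmeas_potential)
    fix c assume c: "c < \<infinity>" "\<And>x. x \<in> bands \<Longrightarrow> (\<integral>\<^sup>+y. kern D x y \<partial>eqmeas) = c"
    show ?thesis
    proof (rule energy_minimizer_unique[OF R(2) _ D1 _ _ eqmeas_prob])
      show "R - - R < D" by (simp add: D_def)
      show "prob_measure_on bands \<omega>" "log_energy \<omega> \<le> log_energy eqmeas"
        using assms eqmeas_prob by (auto simp: equilibrium_measure_def)
      show "bands \<in> sets borel" using bands_closed by simp
    qed (use c in auto)
  qed
qed

lemma finite_band_edges: "finite {x::real. \<bar>discr x\<bar> = 2}"
proof -
  let ?p = "[:4:] - discr_poly * discr_poly :: real poly"
  obtain \<xi> :: real where "discr \<xi> = 0" by (rule discr_zero_exists)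
  then have "poly ?p \<xi> \<noteq> 0" by (simp add: poly_discr_poly)
  then have "?p \<noteq> 0" by (metis poly_0)
  then have "finite {x. poly ?p x = 0}" by (rule poly_roots_finite)
  moreover have "{x::real. \<bar>discr x\<bar> = 2} \<subseteq> {x. poly ?p x = 0}"
  proof
    fix x :: real assume "x \<in> {x. \<bar>discr x\<bar> = 2}"
    then have "\<bar>discr x\<bar> * \<bar>discr x\<bar> = 2 * 2" by simp
    then show "x \<in> {x. poly ?p x = 0}" by (simp add: poly_discr_poly)
  qed
  ultimately show ?thesis by (rule finite_subset[rotated])
qed

text \<open>The points of the interior with |discr| = 2 are the closed gaps, and there are finitely
  many of them.\<close>

lemma interior_bands_punctured:
  assumes "x0 \<in> interior bands"
  shows "\<forall>\<^sub>F x in at x0. \<bar>discr x :: real\<bar> < 2"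
proof -
  have "finite ({x::real. \<bar>discr x\<bar> = 2} - {x0})" using finite_band_edges by simp
  then have "open (interior bands - ({x. \<bar>discr x\<bar> = 2} - {x0}))" by (intro open_Diff finite_imp_closed) auto
  then have "\<forall>\<^sub>F x in at x0. x \<in> interior bands - ({x. \<bar>discr x\<bar> = 2} - {x0}) \<and> x \<noteq> x0"
    using assms unfolding eventually_at_topological by blast
  then show ?thesis
  proof eventually_elim
    case (elim x)
    then have "x \<in> bands" using interior_subset by blast
    then show ?case using elim by (auto simp: bands_def)
  qed
qed

text \<open>
  At a closed gap, \<open>4 - (discr x)\<^sup>2\<close> has a zero of order at least two, which the zero of \<open>(ddiscr x)\<^sup>2\<close> compensates.
\<close>

lemma eqdens_tendsto:
  assumes x0: "x0 \<in> interior bands"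
  obtains L where "(eqdens \<longlongrightarrow> L) (at x0)"
proof -
  let ?p = "[:4:] - discr_poly * discr_poly :: real poly"
  have p: "poly ?p x = 4 - (discr x)\<^sup>2" for x by (simp add: poly_discr_poly power2_eq_square)
  obtain \<xi> :: real where "discr \<xi> = 0" by (rule discr_zero_exists)
  then have "poly ?p \<xi> \<noteq> 0" by (simp add: poly_discr_poly)
  then have p0: "?p \<noteq> 0" by (metis poly_0)
  show ?thesis
  proof (cases "\<bar>discr x0\<bar> = 2")
    case False
    moreover have "x0 \<in> bands" using x0 interior_subset by blast
    ultimately have "\<bar>discr x0\<bar> < 2" by (simp add: bands_def)
    then have "(discr x0)\<^sup>2 < 2\<^sup>2" by (rule square_less_four)
    then have "4 - (discr x0)\<^sup>2 \<noteq> 0" by simp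
    then have "isCont eqdens x0" unfolding eqdens_def[abs_def]
      using N discr_continuous[of UNIV] ddiscr_continuous[of UNIV]
      by (intro continuous_intros) (auto simp: continuous_on_eq_continuous_at)
    then show ?thesis using that by (simp add: isCont_def)
  next
    case True
    have disc0: "discr x0 \<noteq> 0" using True by auto
    have r0: "poly ?p x0 = 0"
    proof -
      have "(discr x0)\<^sup>2 = \<bar>discr x0\<bar>\<^sup>2" by simp
      then show ?thesis unfolding p True by simp
    qed
    define e where "e x = - 2 * discr x * ddiscr x" for x
    have De: "((\<lambda>x. poly ?p x) has_real_derivative e x) (at x)" for x
      unfolding p e_def by (auto intro!: derivative_eq_intros discr_DERIV)
    obtain d where d: "d > 0" "ball x0 d \<subseteq> interior bands" using x0 open_interior openE by metis
    \<comment> \<open>In the interior of the bands 4 - discr^2 is nonnegative, so its zero x0 is a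
      local minimum. Hence the derivative vanishes as well and the order of the zero is at least
      2.\<close>
    have e0: "e x0 = 0"
    proof (rule DERIV_local_min[OF De])
      show "\<forall>y. \<bar>x0 - y\<bar> < d \<longrightarrow> poly ?p x0 \<le> poly ?p y"
      proof (intro allI impI)
        fix y assume "\<bar>x0 - y\<bar> < d"
        then have "y \<in> ball x0 d" by (simp add: dist_real_def)
        then have "y \<in> bands" using d(2) interior_subset by blast
        then have "(discr y)\<^sup>2 \<le> 2\<^sup>2" unfolding abs_le_square_iff[symmetric] by (simp add: bands_def)
        then have "0 \<le> poly ?p y" unfolding p by simp
        then show "poly ?p x0 \<le> poly ?p y" unfolding r0 .
      qed
      show "0 < d" by fact
    qed
    obtain q where q: "?p = [:- x0, 1:] ^ order x0 ?p * q" "\<not> [:- x0, 1:] dvd q"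
      using order_decomp[OF p0, of x0] by blast
    define m where "m = order x0 ?p"
    have qx0: "poly q x0 \<noteq> 0" using q(2) by (simp add: poly_eq_0_iff_dvd)
    have pq: "poly ?p x = (x - x0) ^ m * poly q x" for x
    proof -
      have "poly ?p x = poly ([:- x0, 1:] ^ m * q) x" using q(1) unfolding m_def by (rule arg_cong)
      then show ?thesis by (simp add: poly_power)
    qed
    have m0: "m \<noteq> 0" using r0 pq[of x0] qx0 by (metis mult_1 power_0)
    then obtain j where j: "m = Suc j" using not0_implies_Suc by blast
    have eq: "e x = (x - x0) ^ j * (real (Suc j) * poly q x + (x - x0) * poly (pderiv q) x)" for x
    proof -
      have "((\<lambda>x. (x - x0) ^ Suc j * poly q x) has_real_derivative (x - x0) ^ j * (real (Suc j) * poly q x + (x - x0) * poly (pderiv q) x)) (at x)"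
      proof (rule DERIV_cong[OF DERIV_mult[OF _ poly_DERIV]])
        show "((\<lambda>x. (x - x0) ^ Suc j) has_real_derivative real (Suc j) * (x - x0) ^ j) (at x)"
          by (rule DERIV_cong[OF DERIV_power[OF DERIV_diff[OF DERIV_ident DERIV_const]]]) simp
      qed (simp add: algebra_simps)
      then have "((\<lambda>x. poly ?p x) has_real_derivative (x - x0) ^ j * (real (Suc j) * poly q x + (x - x0) * poly (pderiv q) x)) (at x)"
        unfolding pq j .
      from DERIV_unique[OF De this] show ?thesis .
    qed
    have "j \<noteq> 0" using eq[of x0] e0 qx0 by (intro notI) simp
    then obtain i where i: "j = Suc i" using not0_implies_Suc by blast
    define s where "s x = real (Suc j) * poly q x + (x - x0) * poly (pderiv q) x" for x
    \<comment> \<open>With t = x - x0 one has 4 - discr^2 = t^(i+2) q and -2 discr ddiscr = t^(i+1)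
      s. Hence ddiscr^2 / (4 - discr^2) is t^i s^2 / (4 discr^2 q), which is continuous at
      x0.\<close>
    define G where "G x = sqrt ((x - x0) ^ i * (s x)\<^sup>2 / (4 * (discr x)\<^sup>2 * poly q x)) / (pi * real N)" for x
    have Gc: "isCont G x0" unfolding G_def[abs_def] s_def
      using N qx0 disc0 discr_continuous[of UNIV]
      by (intro continuous_intros) (auto simp: continuous_on_eq_continuous_at)
    have ev: "\<forall>\<^sub>F x in at x0. eqdens x = G x"
    proof -
      have "(discr \<longlongrightarrow> discr x0) (at x0)" using discr_continuous[of UNIV] by (simp add: continuous_on_eq_continuous_at isCont_def)
      then have "\<forall>\<^sub>F x in at x0. discr x \<noteq> 0" using disc0 by (rule tendsto_imp_eventually_ne)
      moreover have "\<forall>\<^sub>F x in at x0. x \<noteq> x0" by (simp add: eventually_at_filter)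
      ultimately show ?thesis using interior_bands_punctured[OF x0]
      proof eventually_elim
        case (elim x)
        define t where "t = x - x0"
        have t: "t \<noteq> 0" using elim by (simp add: t_def)
        have "(discr x)\<^sup>2 < 2\<^sup>2" by (rule square_less_four[OF elim(3)])
        then have pos: "4 - (discr x)\<^sup>2 > 0" by simp
        have P: "4 - (discr x)\<^sup>2 = t * (t * t ^ i) * poly q x" using pq[of x] unfolding p j i t_def by simp
        have "(ddiscr x)\<^sup>2 * (4 * (discr x)\<^sup>2) = (e x)\<^sup>2" by (simp add: e_def power2_eq_square)
        also have "e x = t * t ^ i * s x" using eq[of x] unfolding s_def t_def i by simp
        finally have E: "(ddiscr x)\<^sup>2 = (t * t ^ i * s x)\<^sup>2 / (4 * (discr x)\<^sup>2)" using elim by (simp add: field_simps)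
        have "(ddiscr x)\<^sup>2 / (4 - (discr x)\<^sup>2) = t ^ i * (s x)\<^sup>2 / (4 * (discr x)\<^sup>2 * poly q x)"
        proof -
          have "poly q x \<noteq> 0" using pos P by auto
          moreover have "t ^ i \<noteq> 0" using t by simp
          ultimately show ?thesis unfolding E P using t elim by (simp add: divide_simps) (simp add: power2_eq_square)
        qed
        then have "sqrt ((ddiscr x)\<^sup>2 / (4 - (discr x)\<^sup>2)) / (pi * real N) = G x" by (simp only: G_def t_def)
        then show ?case by (simp add: eqdens_def real_sqrt_divide mult_ac)
      qed
    qed
    show ?thesis
    proof (rule that)
      have "(G \<longlongrightarrow> G x0) (at x0)" using Gc by (simp add: isCont_def)
      then show "(eqdens \<longlongrightarrow> G x0) (at x0)" by (subst tendsto_cong[OF ev])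
    qed
  qed
qed

text \<open>\<open>continuous_density\<close> has a meaning only if one continuous density exists on
  the whole interior, closed gaps included. There \<open>eqdens\<close> is 0 through division by
  zero, so \<open>g\<close> takes the limit instead.\<close>

lemma equilibrium_density:
  assumes \<omega>: "equilibrium_measure bands \<omega>" and x: "\<bar>discr x\<bar> < 2"
  shows "continuous_density \<omega> (interior bands) x = eqdens x"
proof -
  define g where "g x = (if \<bar>discr x :: real\<bar> < 2 then eqdens x else Lim (at x) eqdens)" for x
  have nn: "eqdens x \<ge> 0" if "\<bar>discr x\<bar> < 2" for x
  proof -
    have "(discr x)\<^sup>2 \<le> 2\<^sup>2" unfolding abs_le_square_iff[symmetric] using that by simp
    then show ?thesis by (simp add: eqdens_def)
  qed
  have lim: "(eqdens \<longlongrightarrow> g x) (at x)" if x: "x \<in> interior bands" for x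
  proof -
    obtain L where L: "(eqdens \<longlongrightarrow> L) (at x)" using eqdens_tendsto[OF x] .
    show ?thesis
    proof (cases "\<bar>discr x\<bar> < 2")
      case True
      have "(discr x)\<^sup>2 < 2\<^sup>2" using True by (rule square_less_four)
      then have "4 - (discr x)\<^sup>2 \<noteq> 0" by simp
      then have "isCont eqdens x" unfolding eqdens_def[abs_def]
        using N discr_continuous[of UNIV] ddiscr_continuous[of UNIV]
        by (intro continuous_intros) (auto simp: continuous_on_eq_continuous_at)
      then show ?thesis using True by (simp add: isCont_def g_def)
    next
      case False
      have "Lim (at x) eqdens = L" by (rule tendsto_Lim[OF _ L]) simp
      then show ?thesis using False L by (simp add: g_def)
    qed
  qed
  have glim: "(g \<longlongrightarrow> g x) (at x)" if x: "x \<in> interior bands" for x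
  proof -
    have "\<forall>\<^sub>F y in at x. g y = eqdens y" using interior_bands_punctured[OF x]
      by eventually_elim (simp add: g_def)
    then show ?thesis using lim[OF x] by (subst tendsto_cong)
  qed
  have [measurable]: "bands \<in> sets borel" using bands_closed by simp
  have "has_continuous_density eqmeas (interior bands) g"
    unfolding has_continuous_density_def
  proof (intro conjI ballI impI)
    show "continuous_on (interior bands) g"
      using glim by (auto simp: continuous_on_eq_continuous_at isCont_def)
    show "0 \<le> g x" if "x \<in> interior bands" for x
    proof (rule tendsto_lowerbound[OF lim[OF that]])
      show "\<forall>\<^sub>F y in at x. 0 \<le> eqdens y" using interior_bands_punctured[OF that]
        by eventually_elim (rule nn)
    qed simp
    fix A :: "real set" assume A: "A \<in> sets borel" "A \<subseteq> interior bands"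
    note [measurable] = A(1)
    have "emeasure eqmeas A = (\<integral>\<^sup>+x. (ennreal (eqdens x) * indicator {x. \<bar>discr x\<bar> < 2} x) * indicator A x \<partial>lborel)"
      unfolding eqmeas_def
    proof (rule emeasure_density)
      show "A \<in> sets lborel" using A(1) by simp
    qed measurable
    also have "\<dots> = (\<integral>\<^sup>+x. ennreal (g x) * indicator A x \<partial>lborel)"
    proof (rule nn_integral_cong_AE)
      have "{x::real. \<bar>discr x\<bar> = 2} \<in> null_sets lborel"
        by (rule finite_imp_null_set_lborel[OF finite_band_edges])
      then have "AE x in lborel. x \<notin> {x::real. \<bar>discr x\<bar> = 2}" by (rule AE_not_in)
      then show "AE x in lborel. (ennreal (eqdens x) * indicator {x. \<bar>discr x\<bar> < 2} x) * indicator A x = ennreal (g x) * indicator A x"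
      proof eventually_elim
        case (elim x)
        show ?case
        proof (cases "x \<in> A")
          case True
          then have "x \<in> bands" using A(2) interior_subset by blast
          then have "\<bar>discr x\<bar> < 2" using elim by (simp add: bands_def)
          then show ?thesis by (simp add: g_def)
        qed simp
      qed
    qed
    finally show "emeasure eqmeas A = (\<integral>\<^sup>+x\<in>A. ennreal (g x) \<partial>lborel)" .
  qed
  moreover have "x \<in> interior bands"
  proof (rule interiorI)
    show "open {x. \<bar>discr x :: real\<bar> < 2}"
      by (rule open_Collect_less) (intro continuous_intros discr_continuous)+
    show "{x. \<bar>discr x\<bar> < 2} \<subseteq> bands" by (auto simp: bands_def)
  qed (use x in simp)
  ultimately show ?thesis
    using continuous_density_eq[of eqmeas "interior bands" g x] x
    by (simp add: equilibrium_measure_bands[OF \<omega>] g_def)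
qed

end

section \<open>Periodically modulated Jacobi parameters\<close>

lemma sum_lessThan_add:
  fixes f :: "nat \<Rightarrow> 'a::comm_monoid_add"
  shows "(\<Sum>j<m + n. f j) = (\<Sum>j<m. f j) + (\<Sum>i<n. f (m + i))"
  by (induction n) (simp_all add: add.assoc)

text \<open>The first period is split off because the Stolz hypotheses begin with index N.\<close>

lemma sum_blocks:
  fixes f :: "nat \<Rightarrow> 'a::comm_monoid_add"
  shows "(\<Sum>j<Suc M * N. f j) = (\<Sum>j<N. f j) + (\<Sum>i<N. \<Sum>k<M. f (Suc k * N + i))"
proof (induction M)
  case (Suc M)
  have "(\<Sum>j<Suc (Suc M) * N. f j) = (\<Sum>j<Suc M * N + N. f j)" by (simp add: add.commute)
  also have "\<dots> = (\<Sum>j<Suc M * N. f j) + (\<Sum>i<N. f (Suc M * N + i))" by (rule sum_lessThan_add)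
  also have "\<dots> = (\<Sum>j<N. f j) + ((\<Sum>i<N. \<Sum>k<M. f (Suc k * N + i)) + (\<Sum>i<N. f (Suc M * N + i)))"
    by (simp only: Suc.IH add.assoc)
  also have "(\<Sum>i<N. \<Sum>k<M. f (Suc k * N + i)) + (\<Sum>i<N. f (Suc M * N + i)) = (\<Sum>i<N. \<Sum>k<Suc M. f (Suc k * N + i))"
    by (simp only: sum.distrib[symmetric] sum.lessThan_Suc)
  finally show ?case .
qed simp

lemma weighted_cesaro:
  fixes w h :: "nat \<Rightarrow> real"
  assumes "\<And>k. w k > 0" "\<not> summable w" "h \<longlonglongrightarrow> l"
  shows "(\<lambda>n. (\<Sum>k<n. w k * h k) / (\<Sum>k<n. w k)) \<longlonglongrightarrow> l"
proof -
  have "uniform_limit {()} (\<lambda>k x. h k) (\<lambda>x. l) sequentially"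
    unfolding uniform_limit_const_ufilter by (rule tendsto_ufilter_seq) fact
  from uniform_cesaro[OF assms(1,2) this] have "uniform_limit {()} (\<lambda>n x. (\<Sum>k<n. w k * h k) / (\<Sum>k<n. w k)) (\<lambda>x. l) sequentially"
    by simp
  from tendsto_uniform_limitI[OF this, of "()"] show ?thesis by simp
qed

lemma nonsummable_filterlim:
  fixes w :: "nat \<Rightarrow> real"
  assumes w: "\<And>k. w k \<ge> 0" "\<not> summable w"
  shows "filterlim (\<lambda>n. \<Sum>k<n. w k) at_top sequentially"
proof -
  have "\<exists>n. B < (\<Sum>k<n. w k)" for B
  proof (rule ccontr)
    assume "\<not> (\<exists>n. B < (\<Sum>k<n. w k))"
    then have "summable w" by (intro summableI_nonneg_bounded[of w B]) (auto simp: w not_less)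
    then show False using w by simp
  qed
  moreover have "mono (\<lambda>n. \<Sum>k<n. w k)" by (intro monoI sum_mono2) (auto simp: w)
  ultimately show ?thesis
    unfolding filterlim_at_top eventually_sequentially
    by (meson dual_order.trans less_imp_le monoD)
qed

text \<open>The ratio at a general index lies between \<open>S (MN) / T ((M+1)N)\<close> and \<open>S ((M+1)N) / T (MN)\<close>.\<close>

lemma uniform_limit_blocks:
  fixes S :: "nat \<Rightarrow> 'p \<Rightarrow> real" and T :: "nat \<Rightarrow> real"
  assumes S: "\<And>m n x. m \<le> n \<Longrightarrow> S m x \<le> S n x" "\<And>x. S 0 x \<ge> 0" and T: "\<And>m n. m \<le> n \<Longrightarrow> T m \<le> T n" "\<And>n. n > 0 \<Longrightarrow> T n > 0"
    and N: "N \<ge> 1" and ratio: "(\<lambda>M. T (Suc (Suc M) * N) / T (Suc M * N)) \<longlonglongrightarrow> 1"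
    and lim: "uniform_limit K (\<lambda>M x. S (Suc M * N) x / T (Suc M * N)) L sequentially" and L: "bounded (L ` K)"
  shows "uniform_limit K (\<lambda>n x. S n x / T n) L sequentially"
proof -
  have bc: "bounded ((\<lambda>x. 1::real) ` K)" by (rule bounded_subset[of "{1}"]) auto
  have rat: "uniform_limit K (\<lambda>M x. T (Suc (Suc M) * N) / T (Suc M * N)) (\<lambda>x. 1) sequentially"
    unfolding uniform_limit_const_ufilter by (rule tendsto_ufilter_seq) fact
  have Tp: "T (Suc M * N) > 0" for M using T(2) N by simp
  have lim': "uniform_limit K (\<lambda>M x. S (Suc (Suc M) * N) x / T (Suc (Suc M) * N)) L sequentially"
    using lim unfolding uniform_limit_iff by (subst (asm) eventually_sequentially_Suc[symmetric]) simp
  have upper: "uniform_limit K (\<lambda>M x. S (Suc (Suc M) * N) x / T (Suc M * N)) L sequentially"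
  proof -
    from uniform_lim_mult[OF lim' rat L bc]
    have "uniform_limit K (\<lambda>M x. S (Suc (Suc M) * N) x / T (Suc (Suc M) * N) * (T (Suc (Suc M) * N) / T (Suc M * N))) (\<lambda>x. L x * 1) sequentially" .
    moreover have "S (Suc (Suc M) * N) x / T (Suc (Suc M) * N) * (T (Suc (Suc M) * N) / T (Suc M * N)) = S (Suc (Suc M) * N) x / T (Suc M * N)" for M x
      using Tp[of "Suc M"] by simp
    ultimately show ?thesis by (simp only: mult_1_right)
  qed
  have lower: "uniform_limit K (\<lambda>M x. S (Suc M * N) x / T (Suc (Suc M) * N)) L sequentially"
  proof -
    have "uniform_limit K (\<lambda>M x. inverse (T (Suc (Suc M) * N) / T (Suc M * N))) (\<lambda>x. 1) sequentially"
      unfolding uniform_limit_const_ufilter using tendsto_inverse[OF ratio] by (intro tendsto_ufilter_seq) simp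
    from uniform_lim_mult[OF lim this L bc]
    have "uniform_limit K (\<lambda>M x. S (Suc M * N) x / T (Suc M * N) * inverse (T (Suc (Suc M) * N) / T (Suc M * N))) (\<lambda>x. L x * 1) sequentially" .
    moreover have "S (Suc M * N) x / T (Suc M * N) * inverse (T (Suc (Suc M) * N) / T (Suc M * N)) = S (Suc M * N) x / T (Suc (Suc M) * N)" for M x
      using Tp[of M] by (simp add: field_simps)
    ultimately show ?thesis by (simp only: mult_1_right)
  qed
  show ?thesis
    unfolding uniform_limit_sequentially_iff
  proof (intro allI impI)
    fix e :: real assume e: "e > 0"
    obtain M1 where M1: "\<And>M x. M \<ge> M1 \<Longrightarrow> x \<in> K \<Longrightarrow> dist (S (Suc (Suc M) * N) x / T (Suc M * N)) (L x) < e"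
      using upper e unfolding uniform_limit_sequentially_iff by meson
    obtain M2 where M2: "\<And>M x. M \<ge> M2 \<Longrightarrow> x \<in> K \<Longrightarrow> dist (S (Suc M * N) x / T (Suc (Suc M) * N)) (L x) < e"
      using lower e unfolding uniform_limit_sequentially_iff by meson
    show "\<exists>n0. \<forall>n\<ge>n0. \<forall>x\<in>K. dist (S n x / T n) (L x) < e"
    proof (intro exI allI impI ballI)
      fix n x assume n: "n \<ge> Suc (max M1 M2) * N" and x: "x \<in> K"
      have "n div N \<ge> Suc (max M1 M2)" using div_le_mono[OF n, of N] N by simp
      then obtain M where M: "n div N = Suc M" "M \<ge> max M1 M2" by (cases "n div N") auto
      have "n = Suc M * N + n mod N" unfolding M(1)[symmetric] by simp
      moreover have "n mod N < N" using N by simp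
      ultimately have b: "Suc M * N \<le> n" "n \<le> Suc (Suc M) * N" by simp_all
      have Tn: "T n > 0" using Tp[of M] T(1)[OF b(1)] by simp
      have S0: "S m x \<ge> 0" for m using S(1)[of 0 m x] S(2)[of x] by simp
      have "S n x / T n \<le> S (Suc (Suc M) * N) x / T (Suc M * N)"
        by (rule frac_le[OF S0 S(1)[OF b(2)] Tp T(1)[OF b(1)]])
      moreover have "S (Suc M * N) x / T (Suc (Suc M) * N) \<le> S n x / T n"
        by (rule frac_le[OF S0 S(1)[OF b(1)] Tn T(1)[OF b(2)]])
      moreover have "dist (S (Suc (Suc M) * N) x / T (Suc M * N)) (L x) < e" using M(2) x by (intro M1) auto
      moreover have "dist (S (Suc M * N) x / T (Suc (Suc M) * N)) (L x) < e" using M(2) x by (intro M2) auto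
      ultimately show "dist (S n x / T n) (L x) < e" unfolding dist_real_def by linarith
    qed
  qed
qed

locale modulated_jacobi = periodic_jacobi N \<alpha> \<beta> + jacobi a b for N :: nat and \<alpha> \<beta> a b +
  fixes r :: nat
  assumes mod: "periodically_modulated N \<alpha> \<beta> a b" and r: "r \<ge> 1"
    and stolz: "\<And>i. i < N \<Longrightarrow> (\<lambda>k. a (Suc k * N + i - 1) / a (Suc k * N + i)) \<in> stolz_class r \<and>
      (\<lambda>k. b (Suc k * N + i) / a (Suc k * N + i)) \<in> stolz_class r \<and> (\<lambda>k. 1 / a (Suc k * N + i)) \<in> stolz_class r"
    and carleman: "\<not> summable (\<lambda>n. 1 / a n)" and trace: "\<bar>discr (0::real)\<bar> < 2"
begin

text \<open>The last index before a period. The values of \<open>P\<close> at \<open>s k\<close> and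
  \<open>Suc (s k)\<close> play the role of the initial values at positions -1 and 0 of the periodic
  recurrence.\<close>

definition s :: "nat \<Rightarrow> nat" where "s k = Suc k * N - 1"

lemma Suc_s: "Suc (s k) = Suc k * N" and s_Suc: "s (Suc k) = N + s k"
  using N by (auto simp: s_def)

lemma Suc_index: "Suc (i + s k) = Suc k * N + i"
  by (metis Suc_s add.commute add_Suc)

lemma s_filterlim: "filterlim s at_top sequentially"
proof (rule filterlim_at_top_mono[OF filterlim_ident])
  show "\<forall>\<^sub>F k in sequentially. k \<le> s k"
  proof (intro always_eventually allI)
    fix k show "k \<le> s k" using mult_le_mono2[OF N, of "Suc k"] Suc_s[of k] by simp
  qed
qed

text \<open>The coefficients of period k in the indexing of \<open>pc\<close> and \<open>pd\<close>,
  of which they are perturbations; \<open>MA\<close> and \<open>MB\<close> correspond to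
  \<open>\<phi>\<close> and \<open>\<psi>\<close>. Rows N and Suc N form the transfer matrix of the
  period.\<close>

definition tc :: "nat \<Rightarrow> nat \<Rightarrow> real" where "tc k i = jc (i + s k)"
definition td :: "nat \<Rightarrow> real \<Rightarrow> nat \<Rightarrow> real" where "td k x i = jd x (i + s k)"
definition MA :: "nat \<Rightarrow> nat \<Rightarrow> real \<Rightarrow> real" where "MA i k x = sol (tc k) (td k x) 1 0 i"
definition MB :: "nat \<Rightarrow> nat \<Rightarrow> real \<Rightarrow> real" where "MB i k x = sol (tc k) (td k x) 0 1 i"

abbreviation v1 :: "nat \<Rightarrow> real \<Rightarrow> real" where "v1 k x \<equiv> P x (s k)"
abbreviation v2 :: "nat \<Rightarrow> real \<Rightarrow> real" where "v2 k x \<equiv> P x (Suc (s k))"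
abbreviation wt :: "nat \<Rightarrow> real" where "wt k \<equiv> a (s k)"

lemma P_transfer: "P x (i + s k) = MA i k x * v1 k x + MB i k x * v2 k x"
proof -
  have "P x (i + s k) = sol (tc k) (td k x) (v1 k x) (v2 k x) i"
    unfolding P_def jsol_def tc_def[abs_def] td_def[abs_def] by (rule sol_add)
  also have "\<dots> = v1 k x * MA i k x + v2 k x * MB i k x" unfolding MA_def MB_def by (rule sol_linear)
  finally show ?thesis by (simp add: mult.commute)
qed

lemma prod_tc: "(\<Prod>j<i. tc k j) = a (s k) / a (i + s k)"
  by (induction i) (simp_all add: tc_def jc_def)

lemma transfer_det: "MA i k x * MB (Suc i) k x - MB i k x * MA (Suc i) k x = a (s k) / a (i + s k)"
  unfolding prod_tc[symmetric] sol_wronskian[of "tc k" "td k x" i, symmetric] MA_def MB_def by (simp only: mult.commute)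

lemma P_continuous: "continuous_on K (\<lambda>x::real. P x n)"
proof (induction n rule: induct_nat_012)
  case (ge2 n)
  have "(\<lambda>x::real. P x (Suc (Suc n))) = (\<lambda>x. (x - b (Suc n)) / a (Suc n) * P x (Suc n) - jc n * P x n)"
    by (simp add: P_def jsol_def jd_def)
  then show ?case by (simp only:) (intro continuous_intros ge2; simp)
qed (auto simp: P_def jsol_def intro!: continuous_intros)

lemma P_bounded: "compact K \<Longrightarrow> bounded ((\<lambda>x::real. P x n) ` K)"
  by (intro compact_imp_bounded compact_continuous_image P_continuous)

lemma P_nontrivial: "P x n \<noteq> 0 \<or> P x (Suc n) \<noteq> (0::real)"
  using P_Y_wronskian[of n x] by auto

lemma periodic_multiple: "\<alpha> (n + int (k * N)) = \<alpha> n" "\<beta> (n + int (k * N)) = \<beta> n"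
proof -
  have "\<alpha> (n + int (k * N)) = \<alpha> n \<and> \<beta> (n + int (k * N)) = \<beta> n"
  proof (induction k)
    case (Suc k)
    have "n + int (Suc k * N) = (n + int (k * N)) + int N" by (simp add: algebra_simps)
    then show ?case using Suc \<alpha>_shift[of "n + int (k * N)"] \<beta>_shift[of "n + int (k * N)"] by (simp only: simp_thms)
  qed simp
  then show "\<alpha> (n + int (k * N)) = \<alpha> n" "\<beta> (n + int (k * N)) = \<beta> n" by auto
qed

lemma index_filterlim: "filterlim (\<lambda>k. Suc (i + s k)) at_top sequentially"
proof (rule filterlim_at_top_mono[OF s_filterlim])
  show "\<forall>\<^sub>F k in sequentially. s k \<le> Suc (i + s k)" by simp
qed

lemma a_at_top: "filterlim (\<lambda>k. a (Suc (i + s k))) at_top sequentially"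
  using mod filterlim_compose[OF _ index_filterlim] unfolding periodically_modulated_def by blast

lemma wt_at_top: "filterlim wt at_top sequentially"
  using mod filterlim_compose[OF _ s_filterlim] unfolding periodically_modulated_def by blast

lemma \<alpha>_index: "\<alpha> (int (Suc (i + s k)) - 1) = \<alpha> (int i - 1)" "\<alpha> (int (Suc (i + s k))) = \<alpha> (int i)" "\<beta> (int (Suc (i + s k))) = \<beta> (int i)"
proof -
  have 1: "int (Suc (i + s k)) = int i + int (Suc k * N)" unfolding Suc_index by (simp only: of_nat_add add.commute)
  have 2: "int (Suc (i + s k)) - 1 = (int i - 1) + int (Suc k * N)" unfolding 1 by simp
  show "\<alpha> (int (Suc (i + s k)) - 1) = \<alpha> (int i - 1)" unfolding 2 by (rule periodic_multiple)
  show "\<alpha> (int (Suc (i + s k))) = \<alpha> (int i)" "\<beta> (int (Suc (i + s k))) = \<beta> (int i)" unfolding 1 by (rule periodic_multiple)+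
qed

lemma tc_limit: "(\<lambda>k. tc k i) \<longlonglongrightarrow> pc i"
proof -
  have "(\<lambda>n. \<bar>a (n - 1) / a n - \<alpha> (int n - 1) / \<alpha> (int n)\<bar>) \<longlonglongrightarrow> 0"
    using mod unfolding periodically_modulated_def by blast
  then have "(\<lambda>n. a (n - 1) / a n - \<alpha> (int n - 1) / \<alpha> (int n)) \<longlonglongrightarrow> 0" by (rule tendsto_rabs_zero_cancel)
  from filterlim_compose[OF this index_filterlim[of i]]
  have "(\<lambda>k. tc k i - pc i) \<longlonglongrightarrow> 0" unfolding \<alpha>_index tc_def jc_def pc_def by simp
  then show ?thesis by (rule LIM_zero_cancel)
qed

lemma bq_limit: "(\<lambda>k. b (Suc (i + s k)) / a (Suc (i + s k))) \<longlonglongrightarrow> \<beta> (int i) / \<alpha> (int i)"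
proof -
  have "(\<lambda>n. \<bar>b n / a n - \<beta> (int n) / \<alpha> (int n)\<bar>) \<longlonglongrightarrow> 0"
    using mod unfolding periodically_modulated_def by blast
  then have "(\<lambda>n. b n / a n - \<beta> (int n) / \<alpha> (int n)) \<longlonglongrightarrow> 0" by (rule tendsto_rabs_zero_cancel)
  from filterlim_compose[OF this index_filterlim[of i]]
  have "(\<lambda>k. b (Suc (i + s k)) / a (Suc (i + s k)) - \<beta> (int i) / \<alpha> (int i)) \<longlonglongrightarrow> 0" unfolding \<alpha>_index .
  then show ?thesis by (rule LIM_zero_cancel)
qed

text \<open>The energy enters as x divided by a term of \<open>a\<close>, which tends to 0 uniformly
  on bounded sets; hence energy 0 in the limit.\<close>

lemma td_limit:
  assumes "bounded K"
  shows "((\<lambda>p. td (fst p) (snd p) i) \<longlongrightarrow> pd 0 i) (ufilter K)"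
proof -
  obtain B where B: "\<And>x. x \<in> K \<Longrightarrow> \<bar>x\<bar> \<le> B" using assms unfolding bounded_iff real_norm_def by blast
  have "(\<lambda>k. inverse (a (Suc (i + s k)))) \<longlonglongrightarrow> 0" by (rule filterlim_compose[OF tendsto_inverse_0_at_top[OF filterlim_ident] a_at_top])
  then have "((\<lambda>p. inverse (a (Suc (i + s (fst p))))) \<longlongrightarrow> 0) (ufilter K)" by (rule tendsto_ufilter_seq)
  moreover have "\<forall>\<^sub>F p in ufilter K. \<bar>snd p\<bar> \<le> B"
    unfolding eventually_ufilter using B by auto
  ultimately have "((\<lambda>p. inverse (a (Suc (i + s (fst p)))) * snd p) \<longlongrightarrow> 0) (ufilter K)"
    by (rule tendsto_zero_mult_bounded)
  from tendsto_diff[OF this tendsto_ufilter_seq[OF bq_limit[of i], of K]]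
  have "((\<lambda>p. inverse (a (Suc (i + s (fst p)))) * snd p - b (Suc (i + s (fst p))) / a (Suc (i + s (fst p)))) \<longlongrightarrow> 0 - \<beta> (int i) / \<alpha> (int i)) (ufilter K)" .
  moreover have "td k x i = inverse (a (Suc (i + s k))) * x - b (Suc (i + s k)) / a (Suc (i + s k))" for k x
    by (simp add: td_def jd_def field_simps)
  moreover have "pd 0 i = 0 - \<beta> (int i) / \<alpha> (int i)" by (simp add: pd_def)
  ultimately show ?thesis by (simp only:)
qed

lemma sol_limit:
  assumes K: "bounded K"
  shows "((\<lambda>p. sol (tc (fst p)) (td (fst p) (snd p)) u v i) \<longlongrightarrow> sol pc (pd 0) u v i) (ufilter K)"
proof (induction i rule: induct_nat_012)
  case (ge2 n)
  show ?case unfolding sol.simps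
    by (intro tendsto_intros ge2 td_limit[OF K] tendsto_ufilter_seq[OF tc_limit])
qed simp_all

lemma M_limits:
  assumes "bounded K"
  shows "((\<lambda>p. MA i (fst p) (snd p)) \<longlongrightarrow> \<phi> 0 i) (ufilter K)" "((\<lambda>p. MB i (fst p) (snd p)) \<longlongrightarrow> \<psi> 0 i) (ufilter K)"
  unfolding MA_def MB_def by (rule sol_limit[OF assms])+

text \<open>One scale has to serve all coefficients of a period, hence the finite set
  \<open>?S\<close>. The matrix entries arise from the coefficients by products and differences, and
  up to row Suc N no coefficient beyond the period occurs.\<close>

lemma transfer_symb:
  obtains t where "\<And>k. t k \<ge> 0" "\<And>k. t k \<le> 1" "\<And>k. t (Suc k) \<le> 2 * t k" "summable (\<lambda>k. t k ^ r)"
    "\<And>K i. bounded K \<Longrightarrow> i \<le> Suc N \<Longrightarrow> symb K t 0 r (\<lambda>k x. complex_of_real (MA i k x))"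
    "\<And>K i. bounded K \<Longrightarrow> i \<le> Suc N \<Longrightarrow> symb K t 0 r (\<lambda>k x. complex_of_real (MB i k x))"
proof -
  let ?S = "(\<Union>i<N. {\<lambda>k. a (Suc k * N + i - 1) / a (Suc k * N + i), \<lambda>k. b (Suc k * N + i) / a (Suc k * N + i), \<lambda>k. 1 / a (Suc k * N + i)})"
  have fin: "finite ?S" by simp
  have sub: "?S \<subseteq> stolz_class r" using stolz by auto
  show ?thesis
  proof (rule stolz_scale[OF fin sub r])
    fix t :: "nat \<Rightarrow> real" assume t: "\<And>k. t k \<ge> 0" "\<And>k. t k \<le> 1" "\<And>k. t (Suc k) \<le> 2 * t k" "summable (\<lambda>k. t k ^ r)"
      and sy: "\<And>u K. u \<in> ?S \<Longrightarrow> symb (K :: real set) t 0 r (\<lambda>k x. complex_of_real (u k))"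
    have sol_symb: "symb K t 0 r (\<lambda>k x. complex_of_real (sol (tc k) (td k x) u v i))" if K: "bounded K" and i: "i \<le> Suc N" for K u v i
    proof -
      interpret symb_scale K t by unfold_locales (use t in auto)
      have tc: "symb K t 0 r (\<lambda>k x. complex_of_real (tc k j))" if "j < N" for j
      proof -
        have "symb K t 0 r (\<lambda>k x. complex_of_real (a (Suc k * N + j - 1) / a (Suc k * N + j)))"
          by (rule sy) (use that in auto)
        then show ?thesis unfolding tc_def jc_def Suc_index[symmetric] by simp
      qed
      have td: "symb K t 0 r (\<lambda>k x. complex_of_real (td k x j))" if "j < N" for j
      proof -
        have 1: "symb K t 0 r (\<lambda>k x. complex_of_real (1 / a (Suc k * N + j)))" by (rule sy) (use that in auto)
        have 2: "symb K t 0 r (\<lambda>k x. complex_of_real (b (Suc k * N + j) / a (Suc k * N + j)))" by (rule sy) (use that in auto)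
        have "bounded (complex_of_real ` K)" using K unfolding bounded_iff by simp
        then have "symb K t 0 r (\<lambda>k x. complex_of_real x)" by (rule symb_const)
        from symb_diff[OF symb_mult0[OF this 1] 2] show ?thesis
          unfolding td_def jd_def Suc_index[symmetric] by (simp add: diff_divide_distrib)
      qed
      have c: "symb K t 0 r (\<lambda>k x. complex_of_real u)" for u
        by (rule symb_const) (rule bounded_subset[of "{complex_of_real u}"], auto)
      show ?thesis using i
      proof (induction i rule: induct_nat_012)
        case (ge2 n)
        then have n: "n < N" "n \<le> Suc N" "Suc n \<le> Suc N" by auto
        have "symb K t 0 r (\<lambda>k x. complex_of_real (td k x n) * complex_of_real (sol (tc k) (td k x) u v (Suc n)) -
            complex_of_real (tc k n) * complex_of_real (sol (tc k) (td k x) u v n))"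
          by (intro symb_diff symb_mult0 td tc n ge2.IH)
        then show ?case by (simp only: sol.simps of_real_mult of_real_diff)
      qed (simp_all only: sol.simps c)
    qed
    show ?thesis
      by (rule that[OF t]) (simp_all only: MA_def MB_def sol_symb)
  qed
qed

section \<open>The amplitude along whole periods and the density of the orthonormality
  measure\<close>

definition z0 :: complex where "z0 = fixed_point (\<phi> 0 N) (\<psi> 0 N) (\<psi> 0 (Suc N))"

lemma det0: "\<phi> 0 N * \<psi> 0 (Suc N) - \<psi> 0 N * \<phi> 0 (Suc N) = (1::real)"
  using det_monodromy[of "0::real"] by (simp only: mult.commute)

lemma tr0: "\<bar>\<phi> 0 N + \<psi> 0 (Suc N)\<bar> < (2::real)"
  using trace by (simp only: discr_def)

lemma z0_Im: "Im z0 > 0"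
  unfolding z0_def by (rule fixed_point_props(3)[OF det0 tr0]) (rule refl)?

definition amp :: "nat \<Rightarrow> real \<Rightarrow> real" where
  "amp k x = wt k * (norm (complex_of_real (v2 k x) - z0 * of_real (v1 k x)))\<^sup>2 / Im z0"

lemma v_rec: "v1 (Suc k) x = MA N k x * v1 k x + MB N k x * v2 k x"
  "v2 (Suc k) x = MA (Suc N) k x * v1 k x + MB (Suc N) k x * v2 k x"
  using P_transfer[of x N k] P_transfer[of x "Suc N" k] by (simp_all add: s_Suc)

lemma amp_limit_ex:
  assumes K: "compact K"
  obtains g where "uniform_limit K amp g sequentially" "\<And>x. x \<in> K \<Longrightarrow> g x > 0" "bounded (g ` K)"
proof (rule transfer_symb)
  fix t assume t: "\<And>k. t k \<ge> 0" "\<And>k. t k \<le> 1" "\<And>k. t (Suc k) \<le> 2 * t k" "summable (\<lambda>k. t k ^ r)"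
    and sy: "\<And>K i. bounded K \<Longrightarrow> i \<le> Suc N \<Longrightarrow> symb K t 0 r (\<lambda>k x. complex_of_real (MA i k x))"
    "\<And>K i. bounded K \<Longrightarrow> i \<le> Suc N \<Longrightarrow> symb K t 0 r (\<lambda>k x. complex_of_real (MB i k x))"
  have bK: "bounded K" using K by (rule compact_imp_bounded)
  interpret symb_scale K t by unfold_locales (use t in auto)
  show ?thesis
  proof (rule amplitude_limit[OF r t(4) sy(1)[OF bK le_SucI[OF order_refl]] sy(2)[OF bK le_SucI[OF order_refl]] sy(1)[OF bK order_refl] sy(2)[OF bK order_refl]
        M_limits(1)[OF bK, of N] M_limits(2)[OF bK, of N] M_limits(1)[OF bK, of "Suc N"] M_limits(2)[OF bK, of "Suc N"] det0 tr0,
        where wt = wt and ?v1.0 = v1 and ?v2.0 = v2])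
    show "MA N k x * MB (Suc N) k x - MB N k x * MA (Suc N) k x = wt k / wt (Suc k)" for k x
      unfolding s_Suc by (rule transfer_det)
    show "v1 (Suc k) x = MA N k x * v1 k x + MB N k x * v2 k x" "v2 (Suc k) x = MA (Suc N) k x * v1 k x + MB (Suc N) k x * v2 k x" for k x
      by (rule v_rec)+
    show "bounded (v1 k ` K)" "bounded (v2 k ` K)" for k by (rule P_bounded[OF K])+
    fix g assume "uniform_limit K (\<lambda>k x. wt k * (norm (complex_of_real (v2 k x) - fixed_point (\<phi> 0 N) (\<psi> 0 N) (\<psi> 0 (Suc N)) * of_real (v1 k x)))\<^sup>2
      / Im (fixed_point (\<phi> 0 N) (\<psi> 0 N) (\<psi> 0 (Suc N)))) g sequentially" and g: "\<And>x. x \<in> K \<Longrightarrow> g x > 0" "bounded (g ` K)"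
    then have "uniform_limit K amp g sequentially" unfolding amp_def[abs_def] z0_def by blast
    then show ?thesis using g by (rule that)
  qed (use a_pos P_nontrivial in auto)
qed

text \<open>A pointwise limit, so that one function serves all compact sets.\<close>

definition G :: "real \<Rightarrow> real" where "G x = lim (\<lambda>k. amp k x)"

lemma amp_limit:
  assumes K: "compact K"
  shows "uniform_limit K amp G sequentially" "x \<in> K \<Longrightarrow> G x > 0" "bounded (G ` K)"
proof -
  obtain g where g: "uniform_limit K amp g sequentially" "\<And>x. x \<in> K \<Longrightarrow> g x > 0" "bounded (g ` K)"
    using amp_limit_ex[OF K] by metis
  have eq: "G x = g x" if "x \<in> K" for x
    unfolding G_def by (rule limI[OF tendsto_uniform_limitI[OF g(1) that]])
  show "uniform_limit K amp G sequentially"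
    using g(1) eq by (subst uniform_limit_cong'[where g = amp and i = g]) auto
  show "G x > 0" if "x \<in> K" using g(2)[OF that] eq[OF that] by simp
  show "bounded (G ` K)" using g(3) eq by (simp cong: image_cong)
qed

lemma amp_continuous: "continuous_on K (amp k)"
  unfolding amp_def[abs_def] using z0_Im by (intro continuous_intros P_continuous) auto

lemma G_continuous: "compact K \<Longrightarrow> continuous_on K G"
  by (rule uniform_limit_theorem[OF _ amp_limit(1)]) (auto simp: amp_continuous)

lemma G_pos: "G x > 0"
  by (rule amp_limit(2)[of "{x}"]) auto

lemma G_lower:
  assumes K: "compact K" obtains c where "c > 0" "\<And>x. x \<in> K \<Longrightarrow> c \<le> G x"
proof (cases "K = {}")
  case True then show ?thesis using that[of 1] by simp
next
  case False
  then obtain y where "y \<in> K" "\<And>x. x \<in> K \<Longrightarrow> G y \<le> G x"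
    using continuous_attains_inf[OF K False G_continuous[OF K]] by blast
  then show ?thesis using that[of "G y"] G_pos by blast
qed

text \<open>The polynomials are real on the real line, so passing to the conjugate keeps the modulus
  of v2 - z0 v1, while it moves the boundary value to the lower half-plane, where the truncation is
  dissipative.\<close>

lemma approx_eq_amp: "approx (cnj z0) (s k) x = inverse (pi * amp k x)"
proof -
  have "norm (den (cnj z0) (s k) (of_real x)) = norm (cnj (of_real (v2 k x) - z0 * of_real (v1 k x)))"
    unfolding den_def P_of_real by simp
  then have "norm (den (cnj z0) (s k) (of_real x)) = norm (complex_of_real (v2 k x) - z0 * of_real (v1 k x))"
    by (simp only: complex_mod_cnj)
  then show ?thesis by (simp add: approx_def amp_def divide_inverse)
qed

lemma density:
  assumes "orthonormality_measure a b \<mu>"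
  shows "continuous_density \<mu> UNIV x = inverse (pi * G x)"
proof -
  have "has_continuous_density \<mu> UNIV (\<lambda>x. inverse (pi * G x))"
  proof (rule orthonormality_measure_density[OF assms carleman _ s_filterlim])
    show "Im (cnj z0) < 0" using z0_Im by simp
    fix R :: real
    have K: "compact {-R..R}" by simp
    obtain c where c: "c > 0" "\<And>x. x \<in> {-R..R} \<Longrightarrow> c \<le> G x" using G_lower[OF K] by blast
    have "uniform_limit {-R..R} (\<lambda>k x. inverse (amp k x)) (inverse \<circ> G) sequentially"
      by (rule uniform_lim_inverse[OF amp_limit(1)[OF K] _ c(1)]) (use c(2) in force)
    moreover have "uniform_limit {-R..R} (\<lambda>k x. inverse pi) (\<lambda>x. inverse pi) sequentially" by (simp add: uniform_limit_iff)
    ultimately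
    have "uniform_limit {-R..R} (\<lambda>k x. inverse pi * inverse (amp k x)) (\<lambda>x. inverse pi * (inverse \<circ> G) x) sequentially"
    proof (intro uniform_lim_mult)
      show "bounded ((\<lambda>x. inverse pi) ` {-R..R})" by (rule bounded_subset[of "{inverse pi}"]) auto
      have "\<bar>inverse (G x)\<bar> \<le> inverse c" if "x \<in> {-R..R}" for x
        using c(1) c(2)[OF that] G_pos[of x] by (simp add: le_imp_inverse_le)
      then show "bounded ((inverse \<circ> G) ` {-R..R})" unfolding bounded_iff by (intro exI[of _ "inverse c"]) auto
    qed
    then show "uniform_limit {-R..R} (\<lambda>k. approx (cnj z0) (s k)) (\<lambda>x. inverse (pi * G x)) sequentially"
      unfolding approx_eq_amp[abs_def] by (simp add: o_def)
  qed
  from continuous_density_eq[OF this] show ?thesis by simp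
qed

text \<open>Within a period the quotients of \<open>a (s k)\<close> by the other terms converge, so
  they are bounded. Summability along \<open>s\<close> would thus carry over to every residue class
  and contradict \<open>carleman\<close>.\<close>

lemma nonsummable_wt: "\<not> summable (\<lambda>k. 1 / wt k)"
proof
  assume sw: "summable (\<lambda>k. 1 / wt k)"
  have "summable (\<lambda>k. 1 / a (Suc k * N + i))" for i
  proof -
    have "(\<lambda>k. \<Prod>j<Suc i. tc k j) \<longlonglongrightarrow> (\<Prod>j<Suc i. pc j)" by (intro tendsto_prod tc_limit)
    then have "Bseq (\<lambda>k. \<Prod>j<Suc i. tc k j)" by (rule convergent_imp_Bseq[OF convergentI])
    then obtain B where B: "\<And>k. \<bar>\<Prod>j<Suc i. tc k j\<bar> \<le> B" unfolding Bseq_def real_norm_def by blast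
    have "norm (1 / a (Suc k * N + i)) \<le> B * (1 / wt k)" for k
    proof -
      have "a (s k) / a (Suc i + s k) \<le> B" using order_trans[OF abs_ge_self B[of k]] unfolding prod_tc .
      then have "a (s k) / a (Suc k * N + i) \<le> B" by (simp only: add_Suc Suc_index)
      then show ?thesis using a_pos[of "s k"] a_pos[of "Suc k * N + i"] by (simp add: field_simps)
    qed
    then show ?thesis by (intro summable_comparison_test'[OF summable_mult[OF sw, of B], of 0]) auto
  qed
  then have su: "(\<Sum>k<M. 1 / a (Suc k * N + i)) \<le> (\<Sum>k. 1 / a (Suc k * N + i))" for i M
    by (intro sum_le_suminf) (use a_pos in \<open>auto simp: less_imp_le\<close>)
  have "summable (\<lambda>n. 1 / a n)"
  proof (rule summableI_nonneg_bounded)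
    show "0 \<le> 1 / a n" for n using a_pos[of n] by simp
    fix n
    have "n \<le> Suc n * N" using N by (cases N) auto
    then have "(\<Sum>j<n. 1 / a j) \<le> (\<Sum>j<Suc n * N. 1 / a j)"
      by (intro sum_mono2) (use a_pos in \<open>auto simp: less_imp_le\<close>)
    also have "\<dots> = (\<Sum>j<N. 1 / a j) + (\<Sum>i<N. \<Sum>k<n. 1 / a (Suc k * N + i))" by (rule sum_blocks)
    also have "\<dots> \<le> (\<Sum>j<N. 1 / a j) + (\<Sum>i<N. \<Sum>k. 1 / a (Suc k * N + i))"
      by (intro add_left_mono sum_mono su)
    finally show "(\<Sum>j<n. 1 / a j) \<le> (\<Sum>j<N. 1 / a j) + (\<Sum>i<N. \<Sum>k. 1 / a (Suc k * N + i))" .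
  qed
  then show False using carleman by simp
qed

section \<open>Averages over periods and the constant in the limit\<close>

definition W :: "nat \<Rightarrow> real" where "W M = (\<Sum>k<M. 1 / wt k)"

lemma W_at_top: "filterlim W at_top sequentially"
  unfolding W_def[abs_def] by (rule nonsummable_filterlim[OF _ nonsummable_wt]) (use a_pos in \<open>simp add: less_imp_le\<close>)

lemma W_ratio: "(\<lambda>M. W (Suc M) / W M) \<longlonglongrightarrow> 1"
proof -
  have "(\<lambda>k. inverse (wt k)) \<longlonglongrightarrow> 0" by (rule filterlim_compose[OF tendsto_inverse_0_at_top[OF filterlim_ident] wt_at_top])
  moreover have "(\<lambda>M. inverse (W M)) \<longlonglongrightarrow> 0" by (rule filterlim_compose[OF tendsto_inverse_0_at_top[OF filterlim_ident] W_at_top])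
  ultimately have "(\<lambda>M. 1 + inverse (wt M) * inverse (W M)) \<longlonglongrightarrow> 1 + 0 * 0" by (intro tendsto_intros)
  then have "(\<lambda>M. 1 + inverse (wt M) * inverse (W M)) \<longlonglongrightarrow> 1" by simp
  moreover have "\<forall>\<^sub>F M in sequentially. 1 + inverse (wt M) * inverse (W M) = W (Suc M) / W M"
  proof -
    have "\<forall>\<^sub>F M in sequentially. W M > 0" using W_at_top unfolding filterlim_at_top_dense by blast
    then show ?thesis by eventually_elim (simp add: W_def field_simps)
  qed
  ultimately show ?thesis by (rule Lim_transform_eventually)
qed

lemma block_average:
  assumes K: "compact K"
  shows "uniform_limit K (\<lambda>M x. (\<Sum>k<M. (P x (Suc k * N + i))\<^sup>2) / W M)
    (\<lambda>x. ((\<phi> 0 (Suc i))\<^sup>2 + 2 * \<phi> 0 (Suc i) * \<psi> 0 (Suc i) * Re z0 + (\<psi> 0 (Suc i))\<^sup>2 * (norm z0)\<^sup>2) / (2 * Im z0) * G x) sequentially"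
proof -
  have bK: "bounded K" using K by (rule compact_imp_bounded)
  have eq: "MA (Suc i) k x * v1 k x + MB (Suc i) k x * v2 k x = P x (Suc k * N + i)" for k x
    using P_transfer[of x "Suc i" k] by (simp only: add_Suc Suc_index)
  have "uniform_limit K (\<lambda>n x. (\<Sum>k<n. (MA (Suc i) k x * v1 k x + MB (Suc i) k x * v2 k x)\<^sup>2) / (\<Sum>k<n. 1 / wt k))
    (\<lambda>x. ((\<phi> 0 (Suc i))\<^sup>2 + 2 * \<phi> 0 (Suc i) * \<psi> 0 (Suc i) * Re (fixed_point (\<phi> 0 N) (\<psi> 0 N) (\<psi> 0 (Suc N)))
      + (\<psi> 0 (Suc i))\<^sup>2 * (norm (fixed_point (\<phi> 0 N) (\<psi> 0 N) (\<psi> 0 (Suc N))))\<^sup>2) / (2 * Im (fixed_point (\<phi> 0 N) (\<psi> 0 N) (\<psi> 0 (Suc N)))) * G x) sequentially"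
  proof (rule average_limit[OF M_limits(1)[OF bK, of N] M_limits(2)[OF bK, of N] M_limits(1)[OF bK, of "Suc N"] M_limits(2)[OF bK, of "Suc N"]
        M_limits(1)[OF bK, of "Suc i"] M_limits(2)[OF bK, of "Suc i"] det0 tr0 a_pos wt_at_top nonsummable_wt v_rec])
    show "bounded (v1 k ` K)" "bounded (v2 k ` K)" for k by (rule P_bounded[OF K])+
    show "bounded ((\<lambda>x. MA (Suc i) k x * v1 k x + MB (Suc i) k x * v2 k x) ` K)" for k
      unfolding eq by (rule P_bounded[OF K])
    show "uniform_limit K (\<lambda>k x. wt k * (norm (complex_of_real (v2 k x) - fixed_point (\<phi> 0 N) (\<psi> 0 N) (\<psi> 0 (Suc N)) * of_real (v1 k x)))\<^sup>2
      / Im (fixed_point (\<phi> 0 N) (\<psi> 0 N) (\<psi> 0 (Suc N)))) G sequentially"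
      using amp_limit(1)[OF K] unfolding amp_def[abs_def] z0_def .
    show "bounded (G ` K)" by (rule amp_limit(3)[OF K])
  qed
  then show ?thesis unfolding eq W_def z0_def .
qed

end

lemma uniform_limit_sum:
  fixes f :: "'i \<Rightarrow> 'q \<Rightarrow> 'p \<Rightarrow> 'b::real_normed_vector"
  assumes "\<And>i. i \<in> A \<Longrightarrow> uniform_limit K (f i) (l i) F"
  shows "uniform_limit K (\<lambda>n x. \<Sum>i\<in>A. f i n x) (\<lambda>x. \<Sum>i\<in>A. l i x) F"
proof (cases "finite A")
  case True
  then show ?thesis using assms
  proof induction
    case (insert i A)
    have "uniform_limit K (f i) (l i) F" "uniform_limit K (\<lambda>n x. \<Sum>i\<in>A. f i n x) (\<lambda>x. \<Sum>i\<in>A. l i x) F"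
      using insert by simp_all
    from uniform_limit_add[OF this] show ?case using insert by simp
  qed (simp add: uniform_limit_iff)
qed (simp add: uniform_limit_iff)

context modulated_jacobi
begin

text \<open>The sum \<rho> of the theorem with its index shifted: \<open>T (Suc n)\<close> is the
  sum up to n.\<close>

definition T :: "nat \<Rightarrow> real" where "T n = (\<Sum>j<n. \<alpha> (int j) / a j)"

definition \<kappa> :: "nat \<Rightarrow> real" where
  "\<kappa> i = ((\<phi> 0 (Suc i))\<^sup>2 + 2 * \<phi> 0 (Suc i) * \<psi> 0 (Suc i) * Re z0 + (\<psi> 0 (Suc i))\<^sup>2 * (norm z0)\<^sup>2) / (2 * Im z0)"

lemma T_mono: "m \<le> n \<Longrightarrow> T m \<le> T n"
  unfolding T_def by (intro sum_mono2) (use a_pos \<alpha>_pos in \<open>auto simp: less_imp_le\<close>)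

lemma T_pos: "n > 0 \<Longrightarrow> T n > 0"
  unfolding T_def by (intro sum_pos) (use a_pos \<alpha>_pos in auto)

lemma over_W: "(\<lambda>M. c / W M) \<longlonglongrightarrow> 0"
proof -
  have "(\<lambda>M. inverse (W M)) \<longlonglongrightarrow> 0" by (rule filterlim_compose[OF tendsto_inverse_0_at_top[OF filterlim_ident] W_at_top])
  from tendsto_mult_left[OF this, of c] show ?thesis by (simp add: divide_inverse)
qed

text \<open>The product of the \<open>tc\<close> telescopes, and its limit \<alpha> (-1) / \<alpha>
  i is compensated by the weight \<alpha> i. Every residue class thus contributes equally, which is
  the role of \<alpha> in \<rho>.\<close>

lemma weight_block:
  assumes i: "i < N"
  shows "(\<lambda>M. (\<Sum>k<M. \<alpha> (int (Suc k * N + i)) / a (Suc k * N + i)) / W M) \<longlonglongrightarrow> \<alpha> (-1)"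
proof -
  define h where "h k = \<alpha> (int i) * (\<Prod>j<Suc i. tc k j)" for k
  have "h \<longlonglongrightarrow> \<alpha> (int i) * (\<Prod>j<Suc i. pc j)" unfolding h_def[abs_def] by (intro tendsto_mult tendsto_const tendsto_prod tc_limit)
  also have "(\<Prod>j<Suc i. pc j) = \<alpha> (-1) / \<alpha> (int i)" unfolding prod_pc by simp
  also have "\<alpha> (int i) * \<dots> = \<alpha> (-1)" using \<alpha>_pos[of "int i"] by simp
  finally have "h \<longlonglongrightarrow> \<alpha> (-1)" .
  moreover have "0 < 1 / wt k" for k using a_pos[of "s k"] by simp
  ultimately have "(\<lambda>n. (\<Sum>k<n. 1 / wt k * h k) / (\<Sum>k<n. 1 / wt k)) \<longlonglongrightarrow> \<alpha> (-1)"
    using nonsummable_wt by (intro weighted_cesaro)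
  moreover have "1 / wt k * h k = \<alpha> (int (Suc k * N + i)) / a (Suc k * N + i)" for k
  proof -
    have "h k = \<alpha> (int i) * (a (s k) / a (Suc k * N + i))" unfolding h_def prod_tc by (simp only: add_Suc Suc_index)
    moreover have "\<alpha> (int (Suc k * N + i)) = \<alpha> (int i)" using \<alpha>_index(2)[of i k] unfolding Suc_index .
    ultimately show ?thesis using a_pos[of "s k"] by simp
  qed
  ultimately show ?thesis unfolding W_def by (simp only:)
qed

lemma T_block: "(\<lambda>M. T (Suc M * N) / W M) \<longlonglongrightarrow> real N * \<alpha> (-1)"
proof -
  have "(\<lambda>M. T N / W M + (\<Sum>i<N. (\<Sum>k<M. \<alpha> (int (Suc k * N + i)) / a (Suc k * N + i)) / W M)) \<longlonglongrightarrow> 0 + (\<Sum>i<N. \<alpha> (-1))"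
    by (intro tendsto_add over_W tendsto_sum weight_block) simp
  moreover have "T (Suc M * N) / W M = T N / W M + (\<Sum>i<N. (\<Sum>k<M. \<alpha> (int (Suc k * N + i)) / a (Suc k * N + i)) / W M)" for M
    unfolding T_def sum_blocks by (simp only: add_divide_distrib sum_divide_distrib)
  ultimately show ?thesis by simp
qed

lemma T_ratio: "(\<lambda>M. T (Suc (Suc M) * N) / T (Suc M * N)) \<longlonglongrightarrow> 1"
proof -
  let ?c = "real N * \<alpha> (-1)"
  have c: "?c \<noteq> 0" using N \<alpha>_pos[of "-1"] by simp
  have "(\<lambda>M. T (Suc (Suc M) * N) / W (Suc M)) \<longlonglongrightarrow> ?c" using LIMSEQ_Suc[OF T_block] .
  then have "(\<lambda>M. (T (Suc (Suc M) * N) / W (Suc M)) / (T (Suc M * N) / W M) * (W (Suc M) / W M)) \<longlonglongrightarrow> ?c / ?c * 1"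
    by (intro tendsto_mult tendsto_divide T_block W_ratio c)
  then have l: "(\<lambda>M. (T (Suc (Suc M) * N) / W (Suc M)) / (T (Suc M * N) / W M) * (W (Suc M) / W M)) \<longlonglongrightarrow> 1" using c by simp
  have "\<forall>\<^sub>F M in sequentially. W M > 0" using W_at_top unfolding filterlim_at_top_dense by blast
  then have "\<forall>\<^sub>F M in sequentially. (T (Suc (Suc M) * N) / W (Suc M)) / (T (Suc M * N) / W M) * (W (Suc M) / W M) = T (Suc (Suc M) * N) / T (Suc M * N)"
  proof eventually_elim
    case (elim M)
    have "W (Suc M) = W M + 1 / wt M" by (simp add: W_def)
    then have "W (Suc M) > 0" using elim a_pos[of "s M"] by (simp add: add_pos_pos)
    moreover have "(t' / w') / (t / w) * (w' / w) = t' / t" if "w > 0" "w' > 0" for t t' w w' :: real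
      using that by (simp add: field_simps)
    ultimately show ?case using elim by blast
  qed
  with l show ?thesis by (rule Lim_transform_eventually)
qed

lemma S_block:
  assumes K: "compact K"
  shows "uniform_limit K (\<lambda>M x. (\<Sum>j<Suc M * N. (P x j)\<^sup>2) / W M) (\<lambda>x. (\<Sum>i<N. \<kappa> i) * G x) sequentially"
proof -
  obtain B where B: "\<And>x. x \<in> K \<Longrightarrow> \<bar>\<Sum>j<N. (P x j)\<^sup>2\<bar> \<le> B"
  proof -
    have "continuous_on K (\<lambda>x. \<Sum>j<N. (P x j)\<^sup>2)" by (intro continuous_intros P_continuous)
    from compact_imp_bounded[OF compact_continuous_image[OF this K]] show ?thesis
      using that unfolding bounded_iff real_norm_def by blast
  qed
  have 1: "uniform_limit K (\<lambda>M x. (\<Sum>j<N. (P x j)\<^sup>2) / W M) (\<lambda>x. 0) sequentially"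
  proof -
    have "(\<lambda>M. 1 / W M) \<longlonglongrightarrow> 0" by (rule over_W)
    then have "((\<lambda>p. 1 / W (fst p)) \<longlongrightarrow> 0) (ufilter K)" by (rule tendsto_ufilter_seq)
    moreover have "\<forall>\<^sub>F p in ufilter K. \<bar>\<Sum>j<N. (P (snd p) j)\<^sup>2\<bar> \<le> B"
      unfolding eventually_ufilter using B by auto
    ultimately have "((\<lambda>p. 1 / W (fst p) * (\<Sum>j<N. (P (snd p) j)\<^sup>2)) \<longlongrightarrow> 0) (ufilter K)"
      by (rule tendsto_zero_mult_bounded)
    then show ?thesis unfolding uniform_limit_const_ufilter by simp
  qed
  have 2: "uniform_limit K (\<lambda>M x. \<Sum>i<N. (\<Sum>k<M. (P x (Suc k * N + i))\<^sup>2) / W M) (\<lambda>x. \<Sum>i<N. \<kappa> i * G x) sequentially"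
    unfolding \<kappa>_def by (intro uniform_limit_sum block_average[OF K])
  have "(\<Sum>j<Suc M * N. (P x j)\<^sup>2) / W M = (\<Sum>j<N. (P x j)\<^sup>2) / W M + (\<Sum>i<N. (\<Sum>k<M. (P x (Suc k * N + i))\<^sup>2) / W M)" for M x
    unfolding sum_blocks by (simp only: add_divide_distrib sum_divide_distrib)
  then show ?thesis using uniform_limit_add[OF 1 2] by (simp only: sum_distrib_right add_0)
qed

lemma christoffel_limit:
  assumes K: "compact K"
  shows "uniform_limit K (\<lambda>n x. (\<Sum>j<n. (P x j)\<^sup>2) / T n) (\<lambda>x. (\<Sum>i<N. \<kappa> i) / (real N * \<alpha> (-1)) * G x) sequentially"
proof -
  let ?c = "real N * \<alpha> (-1)"
  have c: "?c \<noteq> 0" using N \<alpha>_pos[of "-1"] by simp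
  have bL: "bounded ((\<lambda>x. u * G x) ` K)" for u
  proof -
    have "bounded ((\<lambda>y. u *\<^sub>R y) ` (G ` K))" by (rule bounded_scaling[OF amp_limit(3)[OF K]])
    then show ?thesis by (simp add: image_image)
  qed
  have "(\<lambda>M. inverse (T (Suc M * N) / W M)) \<longlonglongrightarrow> inverse ?c" by (rule tendsto_inverse[OF T_block c])
  then have "uniform_limit K (\<lambda>M x. inverse (T (Suc M * N) / W M)) (\<lambda>x. inverse ?c) sequentially"
    unfolding uniform_limit_const_ufilter by (rule tendsto_ufilter_seq)
  moreover have "bounded ((\<lambda>x. inverse ?c) ` K)" by (rule bounded_subset[of "{inverse ?c}"]) auto
  ultimately have "uniform_limit K (\<lambda>M x. (\<Sum>j<Suc M * N. (P x j)\<^sup>2) / W M * inverse (T (Suc M * N) / W M)) (\<lambda>x. (\<Sum>i<N. \<kappa> i) * G x * inverse ?c) sequentially"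
    by (intro uniform_lim_mult S_block[OF K] bL)
  moreover have "\<forall>\<^sub>F M in sequentially. \<forall>x\<in>K. (\<Sum>j<Suc M * N. (P x j)\<^sup>2) / W M * inverse (T (Suc M * N) / W M) = (\<Sum>j<Suc M * N. (P x j)\<^sup>2) / T (Suc M * N)"
  proof -
    have "\<forall>\<^sub>F M in sequentially. W M > 0" using W_at_top unfolding filterlim_at_top_dense by blast
    then show ?thesis by eventually_elim (simp add: field_simps)
  qed
  moreover have "(\<Sum>i<N. \<kappa> i) * G x * inverse ?c = (\<Sum>i<N. \<kappa> i) / ?c * G x" for x by (simp add: divide_inverse mult_ac)
  ultimately have lim: "uniform_limit K (\<lambda>M x. (\<Sum>j<Suc M * N. (P x j)\<^sup>2) / T (Suc M * N)) (\<lambda>x. (\<Sum>i<N. \<kappa> i) / ?c * G x) sequentially"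
    by (subst (asm) uniform_limit_cong) auto
  show ?thesis
  proof (rule uniform_limit_blocks[OF _ _ T_mono T_pos N T_ratio lim bL])
    show "(\<Sum>j<m. (P x j)\<^sup>2) \<le> (\<Sum>j<n. (P x j)\<^sup>2)" if "m \<le> n" for m n :: nat and x :: real
      by (rule sum_mono2) (use that in auto)
  qed auto
qed

text \<open>The fixed point satisfies 2 Re z0 = (D - A) / B and |z0|^2 = -C / B. So up to a common
  factor \<open>\<kappa> i\<close> is the quadratic form whose sum over the period is \<alpha> (-1)
  times the derivative of the discriminant at 0; here the averages meet the equilibrium
  density.\<close>

lemma \<kappa>_sum: "(\<Sum>i<N. \<kappa> i) / (real N * \<alpha> (-1)) = pi * eqdens 0"
proof -
  define A B C D where "A = \<phi> (0::real) N" and "B = \<psi> (0::real) N" and "C = \<phi> (0::real) (Suc N)" and "D = \<psi> (0::real) (Suc N)"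
  define q where "q = sqrt (4 - (A + D)\<^sup>2)"
  have det: "A * D - B * C = 1" and tr: "\<bar>A + D\<bar> < 2" using det0 tr0 by (simp_all only: A_def B_def C_def D_def)
  note fp = fixed_point_props[OF det tr]
  have B: "B \<noteq> 0" by (rule fp(1))
  have q: "q > 0" using fp(2) by (simp add: q_def)
  have z: "z0 = Complex ((D - A) / (2 * B)) (q / (2 * \<bar>B\<bar>))" by (simp only: z0_def fixed_point_def A_def B_def D_def q_def)
  have nz: "(norm z0)\<^sup>2 = - C / B"
  proof -
    have "q\<^sup>2 = 4 - (A + D)\<^sup>2" using fp(2) by (simp add: q_def)
    moreover have "4 - (A + D)\<^sup>2 + (D - A)\<^sup>2 = - 4 * B * C" using det by (simp add: power2_eq_square algebra_simps)
    ultimately have e: "(D - A)\<^sup>2 + q\<^sup>2 = - 4 * B * C" by simp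
    have "(norm z0)\<^sup>2 = ((D - A)\<^sup>2 + q\<^sup>2) / (4 * B\<^sup>2)"
      unfolding z cmod_power2 by (simp add: power_divide power_mult_distrib add_divide_distrib)
    also have "\<dots> = - C / B" unfolding e using B by (simp add: power2_eq_square)
    finally show ?thesis .
  qed
  have k: "\<kappa> i = \<bar>B\<bar> / (q * B) * (B * (\<phi> 0 (Suc i))\<^sup>2 + (D - A) * \<phi> 0 (Suc i) * \<psi> 0 (Suc i) - C * (\<psi> 0 (Suc i))\<^sup>2)" for i
    unfolding \<kappa>_def nz using B q by (simp add: z field_simps del: sol.simps)
  have "(\<Sum>i<N. \<kappa> i) = \<bar>B\<bar> / (q * B) * (ddiscr 0 * \<alpha> (-1))"
    unfolding k sum_distrib_left[symmetric] ddiscr_eq A_def B_def C_def D_def using \<alpha>_pos[of "-1"] by simp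
  \<comment> \<open>The signs of B and of \<open>ddiscr 0\<close> are not known separately;
    nonnegativity of the sum allows absolute values.\<close>
  moreover have "(\<Sum>i<N. \<kappa> i) \<ge> 0"
  proof (rule sum_nonneg)
    fix i
    have "(l1 + l2 * Re z0)\<^sup>2 + (l2 * Im z0)\<^sup>2 = l1\<^sup>2 + 2 * l1 * l2 * Re z0 + l2\<^sup>2 * (norm z0)\<^sup>2" for l1 l2
      unfolding cmod_power2 by (simp add: power2_eq_square algebra_simps)
    from this[symmetric] show "\<kappa> i \<ge> 0" unfolding \<kappa>_def using z0_Im by simp
  qed
  ultimately have "(\<Sum>i<N. \<kappa> i) = \<bar>\<bar>B\<bar> / (q * B) * (ddiscr 0 * \<alpha> (-1))\<bar>" by (metis abs_of_nonneg)
  also have "\<dots> = \<bar>ddiscr 0\<bar> * \<alpha> (-1) / q" using B q \<alpha>_pos[of "-1"] by (simp add: abs_mult)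
  finally have s: "(\<Sum>i<N. \<kappa> i) = \<bar>ddiscr 0\<bar> * \<alpha> (-1) / q" .
  have "sqrt (4 - (discr (0::real))\<^sup>2) = q" by (simp only: q_def discr_def A_def D_def)
  then show ?thesis unfolding s eqdens_def using q N \<alpha>_pos[of "-1"] by simp
qed

lemma christoffel_darboux_limit:
  assumes \<mu>: "orthonormality_measure a b \<mu>" and \<omega>: "equilibrium_measure bands \<omega>" and K: "compact K"
  shows "uniform_limit K (\<lambda>n x. 1 / (\<Sum>j\<le>n. \<alpha> (int j) / a j) * CD_kernel a b n x x)
    (\<lambda>x. continuous_density \<omega> (interior bands) 0 / continuous_density \<mu> UNIV x) sequentially"
proof -
  have eq: "1 / (\<Sum>j\<le>n. \<alpha> (int j) / a j) * CD_kernel a b n x x = (\<Sum>j<Suc n. (P x j)\<^sup>2) / T (Suc n)" for n x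
    unfolding CD_kernel_def jacobi_poly_eq T_def lessThan_Suc_atMost by (simp add: power2_eq_square)
  have lim: "continuous_density \<omega> (interior bands) 0 / continuous_density \<mu> UNIV x = (\<Sum>i<N. \<kappa> i) / (real N * \<alpha> (-1)) * G x" for x
    unfolding \<kappa>_sum density[OF \<mu>] equilibrium_density[OF \<omega> trace] by (simp add: divide_inverse mult_ac)
  show ?thesis unfolding eq lim
    using christoffel_limit[OF K] filterlim_compose[OF _ filterlim_Suc] by blast
qed

end

theorem theorem1p2:
  fixes N r :: nat
    and a b :: "nat \<Rightarrow> real"
    and \<alpha> \<beta> :: "int \<Rightarrow> real"
    and \<mu> \<omega> :: "real measure"
  assumes "N \<ge> 1"
    and "\<And>n. a n > 0"
    and "periodically_modulated N \<alpha> \<beta> a b"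
    and "r \<ge> 1"
    and "\<And>i. i < N \<Longrightarrow>
           (\<lambda>k. a (Suc k * N + i - 1) / a (Suc k * N + i)) \<in> stolz_class r \<and>
           (\<lambda>k. b (Suc k * N + i) / a (Suc k * N + i)) \<in> stolz_class r \<and>
           (\<lambda>k. 1 / a (Suc k * N + i)) \<in> stolz_class r"
    and "\<not> summable (\<lambda>n. 1 / a n)"
    and "\<bar>trace (transfer_prod \<alpha> \<beta> N 0 0)\<bar> < 2"
    and "orthonormality_measure a b \<mu>"
    and "equilibrium_measure {x. \<bar>trace (transfer_prod \<alpha> \<beta> N 0 x)\<bar> \<le> 2} \<omega>"
  shows "\<exists>E :: nat \<Rightarrow> real \<Rightarrow> real.
           (\<forall>n x. 1 / (\<Sum>j\<le>n. \<alpha> (int j) / a j) * CD_kernel a b n x x =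
              continuous_density \<omega> (interior {y. \<bar>trace (transfer_prod \<alpha> \<beta> N 0 y)\<bar> \<le> 2}) 0
                / continuous_density \<mu> UNIV x + E n x) \<and>
           (\<forall>C. compact C \<longrightarrow> uniform_limit C (\<lambda>n x. \<bar>E n x\<bar>) (\<lambda>x. 0) sequentially)"
proof -
  have per: "periodic_seq N \<alpha>" "periodic_seq N \<beta>" "\<And>n. \<alpha> n > 0"
    using assms(3) unfolding periodically_modulated_def by blast+
  interpret periodic_jacobi N \<alpha> \<beta> by unfold_locales (fact assms per)+
  have tr: "\<bar>discr (0::real)\<bar> < 2" using assms(7) unfolding trace_transfer_prod .
  interpret modulated_jacobi N \<alpha> \<beta> a b r by unfold_locales (fact assms tr)+
  have bands: "{x. \<bar>trace (transfer_prod \<alpha> \<beta> N 0 x)\<bar> \<le> 2} = bands"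
    unfolding trace_transfer_prod bands_def ..
  let ?F = "\<lambda>n x. 1 / (\<Sum>j\<le>n. \<alpha> (int j) / a j) * CD_kernel a b n x x"
  let ?L = "\<lambda>x. continuous_density \<omega> (interior bands) 0 / continuous_density \<mu> UNIV x"
  show ?thesis unfolding bands
  proof (intro exI conjI allI impI)
    show "?F n x = ?L x + (?F n x - ?L x)" for n x by simp
    fix C :: "real set" assume "compact C"
    from christoffel_darboux_limit[OF assms(8) assms(9)[unfolded bands] this]
    have "uniform_limit C ?F ?L sequentially" .
    then show "uniform_limit C (\<lambda>n x. \<bar>?F n x - ?L x\<bar>) (\<lambda>x. 0) sequentially"
      unfolding uniform_limit_iff dist_real_def by simp
  qed
qed

end
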